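(* Let $m\ge 0$, let $\Lambda=(\pmb a;\lambda)$ be an $m$-partition and let $i:R_m\to R_{m+1}$, $f\mapsto f$, be the inclusion. Then $$ i(P_\Lambda)=\sum_{\Omega}\psi_{\Omega/\Lambda}(q,t)\,P_\Omega $$ where the sum is over all $(m+1)$-partitions $\Omega$ whose diagram is obtained from that of $\Lambda$ by adding an $(m+1)$-circle at the end of a symmetric row (a row that does not end with a circle; the row may be of length $0$), i.e. over all $\Omega=(a_1,\dots,a_m,b;\lambda\setminus b)$ where $b$ is either $0$ (with $\lambda\setminus 0=\lambda$) or one of the distinct parts of $\lambda$ ($\lambda\setminus b$ being $\lambda$ with one part $b$ removed). The coefficient is $$ \psi_{\Omega/\Lambda}(q,t)=\prod_{s\in {\rm col}_{\Omega/\Lambda}}\frac{1-q^{a_\Lambda(s)+1}t^{\tilde\ell_\Lambda(s)}}{1-q^{a_\Omega(s)+1}t^{\tilde\ell_\Omega(s)}} $$ where ${\rm col}_{\Omega/\Lambda}$ is the set of squares in the diagram of $\Omega$ that lie in the column of the $(m+1)$-circle and in a symmetric row (a row that does not end with a circle), and where the subscripts on $a$ and $\tilde\ell$ specify with respect to which diagram ($\Lambda$ or $\Omega$) they are computed.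
   Context: $R_m$ is the ring of formal power series of bounded degree in $x_1,x_2,\dots$ over $\mathbb Q(q,t)$ that are symmetric in $x_{m+1},x_{m+2},\dots$, so $R_m\simeq\mathbb Q(q,t)[x_1,\dots,x_m]\otimes\mathbf\Lambda_m$ with $\mathbf\Lambda_m$ the symmetric functions in $x_{m+1},x_{m+2},\dots$; $R_0\subseteq R_1\subseteq\cdots$. $m$-partitions and diagrams. An $m$-partition is a pair $\Lambda=(\pmb a;\lambda)$ with $\pmb a=(a_1,\dots,a_m)\in\mathbb Z_{\ge0}^m$ and $\lambda$ a partition. Its diagram is the Young diagram (English notation) of the partition $\pmb a\cup\lambda$ obtained by sorting all the parts of $\pmb a$ and $\lambda$, with an $i$-circle (a circle filled with $i$) added immediately to the right of a row of length $a_i$ (possibly $0$) for each $i=1,\dots,m$; among rows of equal length the rows with circles lie above those without, and their circles increase from top to bottom. Arms and legs. For a square $s$ of the diagram, $a(s)$ is the number of squares strictly to the right of $s$ in its row, plus one if the row ends with a circle. $\ell(s)$ is the number of squares strictly below $s$ in its column, plus, if the row of $s$ ends with a circle, the number of circles at the bottom of the column of $s$ (i.e. lying in that column, below $s$) with filling smaller than that of the circle ending the row of $s$ (if the row of $s$ has no circle, circles do not contribute to $\ell(s)$). $\tilde\ell(s)=\ell(s)$ if the row of $s$ ends with a circle; otherwise $\tilde\ell(s)$ is $\ell(s)$ plus the number of all circles at the bottom of the column of $s$. Non-symmetric Macdonald polynomials. In $N$ variables let $K_{i,j}$ exchange $x_i$ and $x_j$, let $\tau_i$ replace $x_i$ by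 $qx_i$, and put $T_i=t+\frac{tx_i-x_{i+1}}{x_i-x_{i+1}}(K_{i,i+1}-1)$ for $1\le i\le N-1$, $\omega=K_{N-1,N}\cdots K_{1,2}\tau_1$, $Y_i=t^{-N+i}T_i\cdots T_{N-1}\,\omega\,T_1^{-1}\cdots T_{i-1}^{-1}$. For $\eta\in\mathbb Z_{\ge0}^N$, $E_\eta(x;q,t)$ is the unique polynomial of the form $x^\eta+\sum_{\nu\prec\eta}b_{\eta\nu}(q,t)x^\nu$ with $Y_iE_\eta=q^{\eta_i}t^{1-r_\eta(i)}E_\eta$ for $i=1,\dots,N$, where $r_\eta(i)=\#\{j:\eta_j>\eta_i\}+\#\{j\le i:\eta_j=\eta_i\}$. Here $\nu\prec\eta$ iff $\nu^+<\eta^+$ in dominance order, or $\nu^+=\eta^+$ and $w_\eta<w_\nu$ in Bruhat order, where $\eta^+$ is the decreasing rearrangement of $\eta$ and $w_\eta$ is the minimal length permutation with $\eta=w_\eta\eta^+$. $m$-symmetric Macdonald polynomials. For $N\ge m+\ell(\lambda)$ let $\eta_{\Lambda,N}=(a_1,\dots,a_m,\lambda_{N-m},\dots,\lambda_1)$ (with $\lambda_i=0$ for $i>\ell(\lambda)$) and $$P_\Lambda(x_1,\dots,x_N;q,t)=\frac1{u_{\Lambda,N}(t)}\sum_{\sigma}T_\sigma E_{\eta_{\Lambda,N}}(x_1,\dots,x_N;q,t),$$ the sum being over permutations $\sigma$ of $\{m+1,\dots,N\}$, $T_\sigma=T_{i_1}\cdots T_{i_r}$ for a reduced decomposition $\sigma=s_{i_1}\cdots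 s_{i_r}$, and $u_{\Lambda,N}(t)=\bigl(\prod_{i\ge0}[n_\lambda(i)]_{t^{-1}}!\bigr)t^{(N-m)(N-m-1)/2}$ with $n_\lambda(i)$ the number of entries of $(\lambda_1,\dots,\lambda_{N-m})$ equal to $i$ and $[k]_p!=\prod_{j=1}^k\frac{1-p^j}{1-p}$. For $m\le N<m+\ell(\lambda)$ put $P_\Lambda(x_1,\dots,x_N;q,t)=0$. These are stable (setting $x_N=0$, $N>m$, gives the polynomial in $N-1$ variables), and $P_\Lambda=P_\Lambda(x;q,t)\in R_m$ is the resulting function in infinitely many variables. *)

theory Defs
  imports
    "HOL-Library.Poly_Mapping"
    "HOL-Computational_Algebra.Fraction_Field"
    "HOL-Computational_Algebra.Polynomial"
    "HOL-Combinatorics.Permutations"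
begin

section \<open>The coefficient field and polynomials\<close>

text \<open>The field of rational functions in \<open>q\<close> and \<open>t\<close> over the rationals is the fraction field of
  the polynomial ring in \<open>t\<close> (outer variable) over the polynomials in \<open>q\<close> (inner variable).\<close>

type_synonym qt = "rat poly poly fract"

definition qvar :: qt where
  "qvar = Fraction_Field.Fract [:[:0, 1:]:] 1"

definition tvar :: qt where
  "tvar = Fraction_Field.Fract [:0, 1:] 1"

text \<open>A monomial is a finitely supported exponent function. The variables are numbered
  \<open>x\<^sub>1, x\<^sub>2, \<dots>\<close>; the index \<open>0\<close> is not used.\<close>

type_synonym monom = "nat \<Rightarrow>\<^sub>0 nat"
type_synonym mpoly = "monom \<Rightarrow>\<^sub>0 qt"

definition const :: "qt \<Rightarrow> mpoly" where
  "const c = Poly_Mapping.single 0 c"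

definition xvar :: "nat \<Rightarrow> mpoly" where
  "xvar i = Poly_Mapping.single (Poly_Mapping.single i 1) 1"

definition substitute :: "(nat \<Rightarrow> mpoly) \<Rightarrow> mpoly \<Rightarrow> mpoly" where
  "substitute g p =
     (\<Sum>\<alpha>\<in>Poly_Mapping.keys p. const (Poly_Mapping.lookup p \<alpha>) *
        (\<Prod>i\<in>Poly_Mapping.keys \<alpha>. g i ^ Poly_Mapping.lookup \<alpha> i))"

section \<open>Permutations: length, reduced words, Bruhat order\<close>

definition word_perm :: "nat list \<Rightarrow> nat \<Rightarrow> nat" where
  "word_perm w = foldr (\<lambda>i \<sigma>. transpose i (Suc i) \<circ> \<sigma>) w id"

definition is_word :: "nat \<Rightarrow> (nat \<Rightarrow> nat) \<Rightarrow> nat list \<Rightarrow> bool" where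
  "is_word N \<sigma> w \<longleftrightarrow> set w \<subseteq> {1..<N} \<and> word_perm w = \<sigma>"

definition perm_length :: "nat \<Rightarrow> (nat \<Rightarrow> nat) \<Rightarrow> nat" where
  "perm_length N \<sigma> = (LEAST r. \<exists>w. is_word N \<sigma> w \<and> length w = r)"

definition reduced_word :: "nat \<Rightarrow> (nat \<Rightarrow> nat) \<Rightarrow> nat list \<Rightarrow> bool" where
  "reduced_word N \<sigma> w \<longleftrightarrow> is_word N \<sigma> w \<and> length w = perm_length N \<sigma>"

definition bruhat_step :: "nat \<Rightarrow> (nat \<Rightarrow> nat) \<Rightarrow> (nat \<Rightarrow> nat) \<Rightarrow> bool" where
  "bruhat_step N u v \<longleftrightarrow> u permutes {1..N} \<and>
     (\<exists>i j. 1 \<le> i \<and> i < j \<and> j \<le> N \<and> v = u \<circ> transpose i j) \<and>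
     perm_length N u < perm_length N v"

definition bruhat_less :: "nat \<Rightarrow> (nat \<Rightarrow> nat) \<Rightarrow> (nat \<Rightarrow> nat) \<Rightarrow> bool" where
  "bruhat_less N = (bruhat_step N)\<^sup>+\<^sup>+"

section \<open>Compositions\<close>

text \<open>A composition \<open>\<eta> = (\<eta>\<^sub>1, \<dots>, \<eta>\<^sub>N)\<close> is a list of length \<open>N\<close>, so \<open>\<eta>\<^sub>i\<close> is \<open>\<eta> ! (i - 1)\<close>.\<close>

definition x_pow :: "nat list \<Rightarrow> mpoly" where
  "x_pow \<eta> = (\<Prod>i=1..length \<eta>. xvar i ^ (\<eta> ! (i - 1)))"

definition decr :: "nat list \<Rightarrow> nat list" where
  "decr \<eta> = rev (sort \<eta>)"

definition strictly_dominated :: "nat list \<Rightarrow> nat list \<Rightarrow> bool" where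
  "strictly_dominated \<mu> lam \<longleftrightarrow> \<mu> \<noteq> lam \<and> sum_list \<mu> = sum_list lam \<and>
     (\<forall>k. sum_list (take k \<mu>) \<le> sum_list (take k lam))"

text \<open>The condition \<open>\<eta> = w \<eta>\<^sup>+\<close> reads \<open>\<eta>\<^bsub>w(i)\<^esub> = \<eta>\<^sup>+\<^sub>i\<close>; the minimiser of the length is unique.\<close>

definition min_perm :: "nat list \<Rightarrow> nat \<Rightarrow> nat" where
  "min_perm \<eta> = arg_min (perm_length (length \<eta>))
     (\<lambda>w. w permutes {1..length \<eta>} \<and>
          (\<forall>i\<in>{1..length \<eta>}. \<eta> ! (w i - 1) = decr \<eta> ! (i - 1)))"

definition comp_prec :: "nat list \<Rightarrow> nat list \<Rightarrow> bool" where
  "comp_prec \<nu> \<eta> \<longleftrightarrow> length \<nu> = length \<eta> \<and>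
     (strictly_dominated (decr \<nu>) (decr \<eta>) \<or>
      decr \<nu> = decr \<eta> \<and> bruhat_less (length \<eta>) (min_perm \<eta>) (min_perm \<nu>))"

definition eta_rank :: "nat list \<Rightarrow> nat \<Rightarrow> nat" where
  "eta_rank \<eta> i =
     card {j \<in> {1..length \<eta>}. \<eta> ! (j - 1) > \<eta> ! (i - 1)} +
     card {j \<in> {1..i}. \<eta> ! (j - 1) = \<eta> ! (i - 1)}"

section \<open>Cherednik operators and non-symmetric Macdonald polynomials\<close>

definition K_op :: "nat \<Rightarrow> nat \<Rightarrow> mpoly \<Rightarrow> mpoly" where
  "K_op i j = substitute (\<lambda>k. xvar (transpose i j k))"

definition tau_op :: "nat \<Rightarrow> mpoly \<Rightarrow> mpoly" where
  "tau_op i = substitute (xvar(i := const qvar * xvar i))"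

text \<open>The quotient \<open>(K\<^bsub>i,i+1\<^esub> f - f) / (x\<^sub>i - x\<^bsub>i+1\<^esub>)\<close> is again a polynomial.\<close>

definition T_op :: "nat \<Rightarrow> mpoly \<Rightarrow> mpoly" where
  "T_op i f = const tvar * f + (const tvar * xvar i - xvar (Suc i)) *
     (THE g. (xvar i - xvar (Suc i)) * g = K_op i (Suc i) f - f)"

definition comp_ops :: "(mpoly \<Rightarrow> mpoly) list \<Rightarrow> mpoly \<Rightarrow> mpoly" where
  "comp_ops fs = foldr (\<circ>) fs id"

definition omega_op :: "nat \<Rightarrow> mpoly \<Rightarrow> mpoly" where
  "omega_op N = comp_ops (map (\<lambda>j. K_op j (Suc j)) (rev [1..<N])) \<circ> tau_op 1"

definition Y_op :: "nat \<Rightarrow> nat \<Rightarrow> mpoly \<Rightarrow> mpoly" where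
  "Y_op N i f = const (tvar powi (int i - int N)) *
     (comp_ops (map T_op [i..<N]) \<circ> omega_op N \<circ>
      comp_ops (map (\<lambda>j. inv (T_op j)) [1..<i])) f"

definition E_poly :: "nat list \<Rightarrow> mpoly" where
  "E_poly \<eta> = (THE E.
     (\<exists>b. E = x_pow \<eta> + (\<Sum>\<nu> | comp_prec \<nu> \<eta>. const (b \<nu>) * x_pow \<nu>)) \<and>
     (\<forall>i\<in>{1..length \<eta>}. Y_op (length \<eta>) i E =
        const (qvar ^ (\<eta> ! (i - 1)) * tvar powi (1 - int (eta_rank \<eta> i))) * E))"

section \<open>m-partitions and m-symmetric Macdonald polynomials\<close>

type_synonym mpart = "nat list \<times> nat list"

definition m_partition :: "nat \<Rightarrow> mpart \<Rightarrow> bool" where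
  "m_partition m \<Lambda> \<longleftrightarrow> (case \<Lambda> of (a, lam) \<Rightarrow>
     length a = m \<and> sorted_wrt (\<ge>) lam \<and> 0 \<notin> set lam)"

text \<open>The list \<open>(\<lambda>\<^sub>1, \<dots>, \<lambda>\<^sub>n)\<close>, for \<open>n\<close> at least the length of \<open>\<lambda>\<close>.\<close>

definition pad :: "nat \<Rightarrow> nat list \<Rightarrow> nat list" where
  "pad n lam = lam @ replicate (n - length lam) 0"

definition T_perm :: "nat \<Rightarrow> (nat \<Rightarrow> nat) \<Rightarrow> mpoly \<Rightarrow> mpoly" where
  "T_perm N \<sigma> = comp_ops (map T_op (SOME w. reduced_word N \<sigma> w))"

definition p_fact :: "qt \<Rightarrow> nat \<Rightarrow> qt" where
  "p_fact p k = (\<Prod>j=1..k. (1 - p ^ j) / (1 - p))"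

text \<open>In the product over all \<open>i \<ge> 0\<close> only the entries \<open>i\<close> of the padded partition contribute
  a factor different from \<open>1\<close>.\<close>

definition u_norm :: "nat \<Rightarrow> nat list \<Rightarrow> nat \<Rightarrow> qt" where
  "u_norm m lam N =
     (\<Prod>i\<in>set (pad (N - m) lam). p_fact (inverse tvar) (count_list (pad (N - m) lam) i)) *
     tvar ^ ((N - m) * (N - m - 1) div 2)"

definition P_fin :: "mpart \<Rightarrow> nat \<Rightarrow> mpoly" where
  "P_fin \<Lambda> N = (case \<Lambda> of (a, lam) \<Rightarrow>
     if N < length a + length lam then 0
     else const (1 / u_norm (length a) lam N) *
       (\<Sum>\<sigma> | \<sigma> permutes {length a + 1..N}.
          T_perm N \<sigma> (E_poly (a @ rev (pad (N - length a) lam)))))"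

text \<open>A formal power series in \<open>x\<^sub>1, x\<^sub>2, \<dots>\<close> is its coefficient function on monomials. With this
  encoding the inclusion of \<open>R_ring m\<close> into \<open>R_ring (m + 1)\<close> is the identity on coefficient functions.\<close>

type_synonym pseries = "monom \<Rightarrow> qt"

definition R_ring :: "nat \<Rightarrow> pseries set" where
  "R_ring m = {f.
     (\<forall>\<alpha>. 0 \<in> Poly_Mapping.keys \<alpha> \<longrightarrow> f \<alpha> = 0) \<and>
     (\<exists>d. \<forall>\<alpha>. f \<alpha> \<noteq> 0 \<longrightarrow> (\<Sum>i\<in>Poly_Mapping.keys \<alpha>. Poly_Mapping.lookup \<alpha> i) \<le> d) \<and>
     (\<forall>\<sigma> \<alpha>. \<sigma> permutes {m<..} \<longrightarrow> f (Poly_Mapping.map_key \<sigma> \<alpha>) = f \<alpha>)}"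

text \<open>The element of \<open>R_ring m\<close> that restricts to the given polynomial in \<open>N\<close> variables for every
  \<open>N \<ge> m\<close> (setting \<open>x\<^bsub>N+1\<^esub> = x\<^bsub>N+2\<^esub> = \<dots> = 0\<close> keeps the coefficients of the monomials in
  \<open>x\<^sub>1, \<dots>, x\<^sub>N\<close>).\<close>

definition P_inf :: "mpart \<Rightarrow> pseries" where
  "P_inf \<Lambda> = (THE f. f \<in> R_ring (length (fst \<Lambda>)) \<and>
     (\<forall>N \<ge> length (fst \<Lambda>). \<forall>\<alpha>. Poly_Mapping.keys \<alpha> \<subseteq> {1..N} \<longrightarrow>
        f \<alpha> = Poly_Mapping.lookup (P_fin \<Lambda> N) \<alpha>))"

section \<open>Diagrams, arms and legs\<close>

text \<open>A diagram is the list of its rows from top to bottom, each given by its length and the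
  filling of the circle at its end, if any. Sorting is stable, so rows of equal length stay in
  the order: circled rows with increasing filling, then rows without circle. Rows and columns
  are numbered from \<open>0\<close>: the squares of row \<open>r\<close> are in the columns below its length, its circle
  is in the column equal to its length.\<close>

type_synonym diagram = "(nat \<times> nat option) list"

definition diagram :: "mpart \<Rightarrow> diagram" where
  "diagram \<Lambda> = (case \<Lambda> of (a, lam) \<Rightarrow>
     sort_key (\<lambda>row. - int (fst row))
       (map (\<lambda>i. (a ! (i - 1), Some i)) [1..<Suc (length a)] @ map (\<lambda>b. (b, None)) lam))"

definition row_len :: "diagram \<Rightarrow> nat \<Rightarrow> nat" where
  "row_len D r = fst (D ! r)"

definition row_circle :: "diagram \<Rightarrow> nat \<Rightarrow> nat option" where
  "row_circle D r = snd (D ! r)"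

definition squares :: "diagram \<Rightarrow> (nat \<times> nat) set" where
  "squares D = {(r, c). r < length D \<and> c < row_len D r}"

definition circles_below :: "diagram \<Rightarrow> nat \<times> nat \<Rightarrow> nat set" where
  "circles_below D s = {k. \<exists>r. fst s < r \<and> r < length D \<and>
     row_len D r = snd s \<and> row_circle D r = Some k}"

definition arm :: "diagram \<Rightarrow> nat \<times> nat \<Rightarrow> nat" where
  "arm D s = (row_len D (fst s) - snd s - 1) + (if row_circle D (fst s) \<noteq> None then 1 else 0)"

definition leg :: "diagram \<Rightarrow> nat \<times> nat \<Rightarrow> nat" where
  "leg D s = card {r. fst s < r \<and> (r, snd s) \<in> squares D} +
     (case row_circle D (fst s) of
        None \<Rightarrow> 0
      | Some k \<Rightarrow> card {j \<in> circles_below D s. j < k})"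

definition leg_tilde :: "diagram \<Rightarrow> nat \<times> nat \<Rightarrow> nat" where
  "leg_tilde D s = (if row_circle D (fst s) \<noteq> None then leg D s
     else leg D s + card (circles_below D s))"

section \<open>Adding a circle\<close>

text \<open>For a partition \<open>\<lambda>\<close> (positive parts), \<open>remove1 0 \<lambda> = \<lambda>\<close>.\<close>

definition add_circle :: "mpart \<Rightarrow> mpart set" where
  "add_circle \<Lambda> = (case \<Lambda> of (a, lam) \<Rightarrow>
     {(a @ [b], remove1 b lam) | b. b = 0 \<or> b \<in> set lam})"

text \<open>The added circle has filling \<open>length (fst \<Omega>)\<close>. The diagrams of \<open>\<Omega>\<close> and \<open>\<Lambda>\<close> have the same
  squares, so a square is identified by its coordinates in both.\<close>

definition col_squares :: "mpart \<Rightarrow> (nat \<times> nat) set" where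
  "col_squares \<Omega> = {(r, c) \<in> squares (diagram \<Omega>). row_circle (diagram \<Omega>) r = None \<and>
     (\<exists>r' < length (diagram \<Omega>). row_circle (diagram \<Omega>) r' = Some (length (fst \<Omega>)) \<and>
        row_len (diagram \<Omega>) r' = c)}"

definition psi :: "mpart \<Rightarrow> mpart \<Rightarrow> qt" where
  "psi \<Omega> \<Lambda> = (\<Prod>s\<in>col_squares \<Omega>.
     (1 - qvar ^ (arm (diagram \<Lambda>) s + 1) * tvar ^ leg_tilde (diagram \<Lambda>) s) /
     (1 - qvar ^ (arm (diagram \<Omega>) s + 1) * tvar ^ leg_tilde (diagram \<Omega>) s))"

end

theory Submission
  imports Defs "HOL-Combinatorics.Multiset_Permutations"
begin

text \<open>
  The Cherednik operators are triangular for the order on compositions, with joint eigenvalues that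
  determine the composition. Hence a joint eigenvector is determined up to a scalar by its
  eigenvalues, and a nonzero one for every composition arises from the constant \<open>1\<close> by the raising
  operator \<open>f \<mapsto> x\<^sub>N \<omega> f\<close> and the operators \<open>T\<^sub>i - c\<close>; no commutativity of the Cherednik operators is
  needed. In \<open>N\<close> variables \<open>P\<^sub>\<Lambda>\<close> is, up to a scalar, the only combination of the \<open>E\<close>-polynomials of
  the compositions \<open>(a, \<mu>)\<close>, \<open>\<mu>\<close> a rearrangement of \<open>\<lambda>\<close>, on which \<open>T\<^sub>i\<close> acts by \<open>t\<close> for \<open>i > m\<close>, and the
  scalar is fixed by the coefficient \<open>1\<close> at the decreasing \<open>\<mu>\<close>. Collecting the terms with first
  entry \<open>\<mu>\<^sub>1 = b\<close> gives a combination with the same property for \<open>i > m + 1\<close>, hence a multiple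
  of \<open>P\<^sub>\<Omega>\<close>. The multiple is the coefficient at \<open>(b, \<lambda> - b)\<close>; moving \<open>b\<close> to the front
  past each larger part contributes one factor, which is the factor of a square in the column of
  the new circle. Stability holds because setting \<open>x\<^sub>N = 0\<close> intertwines the Cherednik operators in
  \<open>N\<close> and \<open>N - 1\<close> variables.
\<close>

section \<open>The coefficient field\<close>

text \<open>The single operators \<open>T_op i\<close> are not triangular, since they exchange
  leading exponents. Triangularity of \<open>Y_op\<close> appears once every T is paired with the
  exchange of its two variables; the exchanges then cancel, because \<open>omega_op\<close> supplies
  the opposite ones. The pairs that arise are not adjacent, so T is studied for arbitrary pairs
  (\<open>T_gen\<close>). As T contains a quotient, its relations are checked after multiplication
  by differences of variables.

  In the basis of E-polynomials \<open>T_op i\<close> acts by blocks of size at most two. The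
  diagonal entry is forced by the eigenvalues and the off-diagonal entry at an ascent is
  \<open>tvar\<close>; from these the symmetric combinations are solved. Exchanging neighbours
  \<open>x > b\<close> costs \<open>(1 - z / t) / (1 - z)\<close>, where \<open>z\<close> is the
  ratio of their eigenvalues. Its power of q is \<open>x - b\<close>, the arm plus one. Its power of
  t is a difference of ranks, which counts rows and circles and becomes the modified leg in the
  diagram with the new circle.\<close>

lemma qvar_tvar_monom:
  "qvar ^ a * tvar ^ b = Fraction_Field.Fract (monom (monom 1 a) b) 1"
proof -
  have q: "qvar ^ a = Fraction_Field.Fract (monom (monom 1 a) 0) 1" for a
  proof (induction a)
    case 0 show ?case by (simp add: One_fract_def monom_0 one_pCons)
  next
    case (Suc a)
    have "[:[:0, 1::rat:]:] * monom (monom 1 a) 0 = monom (monom 1 (Suc a)) 0"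
      by (simp add: monom_0 monom_Suc)
    with Suc show ?case by (simp add: qvar_def)
  qed
  have t: "tvar ^ b = Fraction_Field.Fract (monom 1 b) 1" for b
  proof (induction b)
    case 0 show ?case by (simp add: One_fract_def monom_0 one_pCons)
  next
    case (Suc b)
    have "[:0, 1:] * monom 1 b = (monom 1 (Suc b) :: rat poly poly)"
      by (simp add: monom_Suc)
    with Suc show ?case by (simp add: tvar_def)
  qed
  show ?thesis by (simp add: q t mult_monom)
qed

lemma qvar_tvar_pow_eq_iff:
  "qvar ^ a * tvar ^ b = qvar ^ a' * tvar ^ b' \<longleftrightarrow> a = a' \<and> b = b'"
proof
  assume "qvar ^ a * tvar ^ b = qvar ^ a' * tvar ^ b'"
  hence e: "monom (monom (1::rat) a) b = monom (monom 1 a') b'"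
    by (simp add: qvar_tvar_monom eq_fract)
  have "b = b'"
    using arg_cong[OF e, of "\<lambda>p. coeff p b"] by (auto split: if_splits)
  moreover have "a = a'"
    using arg_cong[OF e, of "\<lambda>p. coeff (coeff p b) a"] \<open>b = b'\<close> by (auto split: if_splits)
  ultimately show "a = a' \<and> b = b'" by simp
qed auto

lemma tvar_nonzero [simp]: "tvar \<noteq> 0"
  using qvar_tvar_pow_eq_iff[of 0 1 0 2] by (auto simp: power2_eq_square)

lemma qvar_nonzero [simp]: "qvar \<noteq> 0"
  using qvar_tvar_pow_eq_iff[of 1 0 2 0] by (auto simp: power2_eq_square)

text \<open>Eigenvalues of \<open>Y_op\<close> contain negative powers of t. A common factor
  \<open>tvar ^ n\<close>, with \<open>n\<close> at least both absolute values, turns both sides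
  into monomials with natural exponents.\<close>

lemma qvar_tvar_powi_eq_iff:
  "qvar ^ a * tvar powi b = qvar ^ a' * tvar powi b' \<longleftrightarrow> a = a' \<and> b = b'"
proof
  assume *: "qvar ^ a * tvar powi b = qvar ^ a' * tvar powi b'"
  define n where "n = nat (\<bar>b\<bar> + \<bar>b'\<bar>)"
  have n: "tvar powi b * tvar ^ n = tvar ^ nat (b + int n)"
          "tvar powi b' * tvar ^ n = tvar ^ nat (b' + int n)"
    by (simp_all add: n_def flip: power_int_of_nat power_int_add)
  have "qvar ^ a * tvar ^ nat (b + int n) = qvar ^ a' * tvar ^ nat (b' + int n)"
    using arg_cong[OF *, of "\<lambda>z. z * tvar ^ n"] n by (simp add: mult.assoc)
  thus "a = a' \<and> b = b'"
    unfolding qvar_tvar_pow_eq_iff by (auto simp: n_def)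
qed auto

lemma qvar_tvar_pow_eq_1_iff: "qvar ^ a * tvar ^ b = 1 \<longleftrightarrow> a = 0 \<and> b = 0"
  using qvar_tvar_pow_eq_iff[of a b 0 0] by simp

section \<open>Polynomials and substitutions\<close>

lemma const_0 [simp]: "const 0 = 0"
  and const_1 [simp]: "const 1 = 1"
  by (simp_all add: const_def)

lemma const_add: "const (a + b) = const a + const b"
  and const_diff: "const (a - b) = const a - const b"
  and const_minus: "const (- a) = - const a"
  and const_mult: "const (a * b) = const a * const b"
  by (simp_all add: const_def single_add single_diff single_uminus mult_single)

lemma const_power: "const (a ^ n) = const a ^ n"
  by (induction n) (simp_all add: const_mult)

lemma const_sum: "const (sum f A) = (\<Sum>x\<in>A. const (f x))"
  by (induction A rule: infinite_finite_induct) (simp_all add: const_add)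

lemma lookup_const_mult [simp]:
  "Poly_Mapping.lookup (const c * f) \<alpha> = c * Poly_Mapping.lookup f \<alpha>"
  unfolding const_def mult_map_scale_conv_mult[symmetric]
  by (simp add: map.rep_eq when_def)

lemma const_inverse_mult [simp]: "c \<noteq> 0 \<Longrightarrow> const (inverse c) * (const c * f) = f"
  by (simp add: mult.assoc[symmetric] flip: const_mult)

lemma const_eq_0_iff [simp]: "const c = 0 \<longleftrightarrow> c = 0"
  unfolding const_def by (metis single_zero lookup_single_eq lookup_zero)

lemma mpoly_sum_single: "(f :: mpoly) = (\<Sum>\<alpha>\<in>Poly_Mapping.keys f. Poly_Mapping.single \<alpha> (Poly_Mapping.lookup f \<alpha>))"
  by (rule poly_mapping_eqI)
     (simp add: lookup_sum lookup_single when_def in_keys_iff sum.delta)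

lemma mpoly_induct [case_names zero single add]:
  fixes f :: mpoly
  assumes "P 0" "\<And>\<alpha> c. P (Poly_Mapping.single \<alpha> c)" "\<And>f g. P f \<Longrightarrow> P g \<Longrightarrow> P (f + g)"
  shows "P f"
proof -
  have "P (\<Sum>\<alpha>\<in>A. Poly_Mapping.single \<alpha> (Poly_Mapping.lookup f \<alpha>))" if "finite A" for A
    using that by induction (auto intro: assms)
  thus ?thesis by (subst mpoly_sum_single) simp
qed

definition monom_subst :: "(nat \<Rightarrow> mpoly) \<Rightarrow> monom \<Rightarrow> mpoly" where
  "monom_subst g \<alpha> = (\<Prod>i\<in>Poly_Mapping.keys \<alpha>. g i ^ Poly_Mapping.lookup \<alpha> i)"

text \<open>The support of a sum can be smaller than the union of the supports; a common finite
  index set makes the products comparable.\<close>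

lemma monom_subst_superset:
  assumes "finite A" "Poly_Mapping.keys \<alpha> \<subseteq> A"
  shows "monom_subst g \<alpha> = (\<Prod>i\<in>A. g i ^ Poly_Mapping.lookup \<alpha> i)"
  unfolding monom_subst_def using assms
  by (intro prod.mono_neutral_left) (auto simp: in_keys_iff)

lemma monom_subst_0 [simp]: "monom_subst g 0 = 1"
  by (simp add: monom_subst_def)

lemma monom_subst_add: "monom_subst g (\<alpha> + \<beta>) = monom_subst g \<alpha> * monom_subst g \<beta>"
proof -
  let ?A = "Poly_Mapping.keys \<alpha> \<union> Poly_Mapping.keys \<beta>"
  have "Poly_Mapping.keys (\<alpha> + \<beta>) \<subseteq> ?A" by (rule keys_add)
  thus ?thesis
    by (simp add: monom_subst_superset[of ?A] lookup_add power_add prod.distrib)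
qed

lemma substitute_superset:
  assumes "finite A" "Poly_Mapping.keys p \<subseteq> A"
  shows "substitute g p = (\<Sum>\<alpha>\<in>A. const (Poly_Mapping.lookup p \<alpha>) * monom_subst g \<alpha>)"
  unfolding substitute_def monom_subst_def using assms
  by (intro sum.mono_neutral_left) (auto simp: in_keys_iff)

lemma substitute_single [simp]: "substitute g (Poly_Mapping.single \<alpha> c) = const c * monom_subst g \<alpha>"
  by (subst substitute_superset[of "{\<alpha>}"]) auto

lemma substitute_0 [simp]: "substitute g 0 = 0"
  by (simp add: substitute_def)

lemma substitute_add: "substitute g (p + r) = substitute g p + substitute g r"
proof -
  let ?A = "Poly_Mapping.keys p \<union> Poly_Mapping.keys r"
  have "Poly_Mapping.keys (p + r) \<subseteq> ?A" by (rule keys_add)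
  thus ?thesis
    by (simp add: substitute_superset[of ?A] lookup_add const_add ring_distribs sum.distrib)
qed

lemma substitute_const [simp]: "substitute g (const c) = const c"
  using substitute_single[of g 0 c] by (simp add: const_def)

lemma substitute_xvar [simp]: "substitute g (xvar i) = g i"
  by (simp add: xvar_def monom_subst_def)

lemma substitute_mult: "substitute g (p * r) = substitute g p * substitute g r"
proof (induction p rule: mpoly_induct)
  case (single \<alpha> c)
  show ?case
  proof (induction r rule: mpoly_induct)
    case (single \<beta> d)
    show ?case by (simp add: mult_single const_mult monom_subst_add ac_simps)
  qed (simp_all add: ring_distribs substitute_add)
qed (simp_all add: ring_distribs substitute_add)

lemma substitute_1 [simp]: "substitute g 1 = 1"
  using substitute_const[of g 1] by (simp del: substitute_const)

lemma substitute_minus: "substitute g (- p) = - substitute g p"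
  using substitute_add[of g p "- p"] by (simp add: add_eq_0_iff)

lemma substitute_diff: "substitute g (p - r) = substitute g p - substitute g r"
  using substitute_add[of g p "- r"] by (simp add: substitute_minus)

lemma substitute_power: "substitute g (p ^ n) = substitute g p ^ n"
  by (induction n) (simp_all add: substitute_mult)

lemma substitute_sum: "substitute g (sum f A) = (\<Sum>x\<in>A. substitute g (f x))"
  by (induction A rule: infinite_finite_induct) (simp_all add: substitute_add)

lemma substitute_prod: "substitute g (prod f A) = (\<Prod>x\<in>A. substitute g (f x))"
  by (induction A rule: infinite_finite_induct) (simp_all add: substitute_mult)

lemma substitute_monom_subst:
  "substitute g (monom_subst h \<alpha>) = monom_subst (\<lambda>i. substitute g (h i)) \<alpha>"
  by (simp add: monom_subst_def substitute_prod substitute_power)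

lemma substitute_substitute:
  "substitute g (substitute h p) = substitute (\<lambda>i. substitute g (h i)) p"
proof (induction p rule: mpoly_induct)
  case (single \<alpha> c)
  show ?case by (simp add: substitute_mult substitute_monom_subst)
qed (simp_all add: substitute_add)

lemma monom_subst_xvar: "monom_subst xvar \<alpha> = Poly_Mapping.single \<alpha> 1"
proof (induction \<alpha> rule: update_induct)
  case const thus ?case by (simp)
next
  case (update f a b)
  have e: "Poly_Mapping.update a b f = Poly_Mapping.single a b + f"
    using update by (intro poly_mapping_eqI) (auto simp: lookup_update lookup_add lookup_single in_keys_iff)
  have "xvar a ^ b = Poly_Mapping.single (Poly_Mapping.single a b) 1"
    by (induction b) (simp_all add: xvar_def mult_single flip: single_add)
  hence "monom_subst xvar (Poly_Mapping.single a b) = Poly_Mapping.single (Poly_Mapping.single a b) 1"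
    using update by (simp add: monom_subst_def)
  thus ?case by (simp add: e monom_subst_add update mult_single)
qed

lemma substitute_xvar_id [simp]: "substitute xvar p = p"
proof (induction p rule: mpoly_induct)
  case (single \<alpha> c)
  show ?case by (simp add: monom_subst_xvar const_def mult_single)
qed (simp_all add: substitute_add)

section \<open>Permuting variables and scaling one variable by q\<close>

definition perm_op :: "(nat \<Rightarrow> nat) \<Rightarrow> mpoly \<Rightarrow> mpoly" where
  "perm_op \<sigma> = substitute (\<lambda>k. xvar (\<sigma> k))"

lemma K_op_perm_op: "K_op i j = perm_op (transpose i j)"
  by (simp add: K_op_def perm_op_def)

lemma perm_op_add: "perm_op \<sigma> (f + g) = perm_op \<sigma> f + perm_op \<sigma> g"
  and perm_op_diff: "perm_op \<sigma> (f - g) = perm_op \<sigma> f - perm_op \<sigma> g"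
  and perm_op_minus: "perm_op \<sigma> (- f) = - perm_op \<sigma> f"
  and perm_op_mult: "perm_op \<sigma> (f * g) = perm_op \<sigma> f * perm_op \<sigma> g"
  and perm_op_const [simp]: "perm_op \<sigma> (const c) = const c"
  and perm_op_0 [simp]: "perm_op \<sigma> 0 = 0"
  and perm_op_1 [simp]: "perm_op \<sigma> 1 = 1"
  and perm_op_xvar [simp]: "perm_op \<sigma> (xvar i) = xvar (\<sigma> i)"
  and perm_op_sum: "perm_op \<sigma> (sum h A) = (\<Sum>x\<in>A. perm_op \<sigma> (h x))"
  by (simp_all add: perm_op_def substitute_add substitute_diff substitute_minus substitute_mult
      substitute_sum)

lemmas perm_op_simps = perm_op_add perm_op_diff perm_op_minus perm_op_mult

lemma perm_op_comp: "perm_op \<sigma> (perm_op \<tau> f) = perm_op (\<sigma> \<circ> \<tau>) f"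
  by (simp add: perm_op_def substitute_substitute o_def)

lemma perm_op_id [simp]: "perm_op id f = f" "perm_op (\<lambda>x. x) f = f"
  by (simp_all add: perm_op_def)

text \<open>Renaming pushes exponents forward along \<open>\<sigma>\<close>, while
  \<open>map_key\<close> pulls them back; hence the inverse.\<close>

lemma perm_op_single:
  assumes "bij \<sigma>"
  shows "perm_op \<sigma> (Poly_Mapping.single \<alpha> c) = Poly_Mapping.single (Poly_Mapping.map_key (inv \<sigma>) \<alpha>) c"
proof -
  have inj: "inj (inv \<sigma>)" using assms by (simp add: bij_imp_bij_inv bij_is_inj)
  have "monom_subst (\<lambda>k. xvar (\<sigma> k)) \<alpha> = monom_subst xvar (Poly_Mapping.map_key (inv \<sigma>) \<alpha>)"
    unfolding monom_subst_def keys_map_key[OF inj]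
    by (rule prod.reindex_bij_witness[of _ "inv \<sigma>" \<sigma>])
       (use assms inj in \<open>auto simp: map_key.rep_eq bij_is_inj surj_f_inv_f bij_is_surj\<close>)
  thus ?thesis by (simp add: perm_op_def monom_subst_xvar const_def mult_single)
qed

lemma map_key_inverse:
  assumes "bij \<sigma>"
  shows "Poly_Mapping.map_key \<sigma> (Poly_Mapping.map_key (inv \<sigma>) \<alpha>) = \<alpha>"
    "Poly_Mapping.map_key (inv \<sigma>) (Poly_Mapping.map_key \<sigma> \<alpha>) = \<alpha>"
  using assms bij_imp_bij_inv[OF assms]
  by (auto intro!: poly_mapping_eqI simp: map_key.rep_eq bij_is_inj surj_f_inv_f bij_is_surj inv_f_f)

lemma lookup_perm_op:
  assumes "bij \<sigma>"
  shows "Poly_Mapping.lookup (perm_op \<sigma> f) \<alpha> = Poly_Mapping.lookup f (Poly_Mapping.map_key \<sigma> \<alpha>)"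
proof (induction f rule: mpoly_induct)
  case (single \<beta> c)
  have "Poly_Mapping.map_key (inv \<sigma>) \<beta> = \<alpha> \<longleftrightarrow> \<beta> = Poly_Mapping.map_key \<sigma> \<alpha>"
    using map_key_inverse[OF assms] by metis
  thus ?case by (simp add: perm_op_single[OF assms] lookup_single when_def)
qed (simp_all add: perm_op_simps lookup_add)

lemma tau_op_add: "tau_op i (f + g) = tau_op i f + tau_op i g"
  and tau_op_mult: "tau_op i (f * g) = tau_op i f * tau_op i g"
  and tau_op_const [simp]: "tau_op i (const c) = const c"
  by (simp_all add: tau_op_def substitute_add substitute_mult)

lemma tau_op_single:
  "tau_op i (Poly_Mapping.single \<alpha> c) = Poly_Mapping.single \<alpha> (qvar ^ Poly_Mapping.lookup \<alpha> i * c)"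
proof -
  have "monom_subst (xvar(i := const qvar * xvar i)) \<alpha> =
      (\<Prod>k\<in>insert i (Poly_Mapping.keys \<alpha>). (if k = i then const (qvar ^ Poly_Mapping.lookup \<alpha> i) else 1) * xvar k ^ Poly_Mapping.lookup \<alpha> k)"
    by (subst monom_subst_superset[of "insert i (Poly_Mapping.keys \<alpha>)"])
       (auto intro!: prod.cong simp: power_mult_distrib const_power)
  also have "\<dots> = const (qvar ^ Poly_Mapping.lookup \<alpha> i) * monom_subst xvar \<alpha>"
    by (subst monom_subst_superset[of "insert i (Poly_Mapping.keys \<alpha>)"])
       (auto simp: prod.distrib)
  finally show ?thesis
    by (simp add: tau_op_def monom_subst_xvar const_def mult_single mult.commute)
qed

lemma perm_op_tau_op:
  assumes "bij \<sigma>"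
  shows "perm_op \<sigma> (tau_op i f) = tau_op (\<sigma> i) (perm_op \<sigma> f)"
proof -
  have "inj \<sigma>" using assms by (rule bij_is_inj)
  show ?thesis
    unfolding perm_op_def tau_op_def substitute_substitute
    by (rule arg_cong[where f = "\<lambda>h. substitute h f"])
       (auto simp: fun_eq_iff substitute_mult dest: injD[OF \<open>inj \<sigma>\<close>])
qed

lemma xvar_diff_nonzero: "i \<noteq> j \<Longrightarrow> xvar i - xvar j \<noteq> 0"
proof
  assume "i \<noteq> j" "xvar i - xvar j = 0"
  hence "Poly_Mapping.lookup (xvar i) (Poly_Mapping.single i 1) =
      Poly_Mapping.lookup (xvar j) (Poly_Mapping.single i 1)" by simp
  hence "Poly_Mapping.single i (1::nat) = Poly_Mapping.single j 1"
    by (auto simp: xvar_def lookup_single when_def split: if_splits)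
  hence "Poly_Mapping.lookup (Poly_Mapping.single i (1::nat)) i = Poly_Mapping.lookup (Poly_Mapping.single j 1) i"
    by simp
  thus False using \<open>i \<noteq> j\<close> by (simp add: lookup_single)
qed

lemma const_t_xvar_diff_nonzero: "i \<noteq> j \<Longrightarrow> const tvar * xvar i - xvar j \<noteq> 0"
proof
  assume "i \<noteq> j" "const tvar * xvar i - xvar j = 0"
  hence "Poly_Mapping.lookup (const tvar * xvar i) (Poly_Mapping.single i 1) =
      Poly_Mapping.lookup (xvar j) (Poly_Mapping.single i 1)" by simp
  hence "Poly_Mapping.single i (1::nat) = Poly_Mapping.single j 1"
    by (auto simp: xvar_def lookup_single when_def split: if_splits)
  hence "Poly_Mapping.lookup (Poly_Mapping.single i (1::nat)) i = Poly_Mapping.lookup (Poly_Mapping.single j 1) i"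
    by simp
  thus False using \<open>i \<noteq> j\<close> by (simp add: lookup_single)
qed

section \<open>Demazure-Lusztig operators\<close>

text \<open>The polynomials with this property contain the constants and the variables and are
  closed under sums and, by a twisted Leibniz rule, under products. It makes the quotient in T a
  polynomial.\<close>

lemma xvar_diff_dvd_swap_diff: "xvar i - xvar j dvd perm_op (transpose i j) f - f"
proof -
  define D where "D f \<longleftrightarrow> xvar i - xvar j dvd perm_op (transpose i j) f - f" for f
  have D_const: "D (const c)" for c by (simp add: D_def)
  have D_mult: "D (f * g)" if "D f" "D g" for f g
  proof -
    have "perm_op (transpose i j) (f * g) - f * g =
       perm_op (transpose i j) f * (perm_op (transpose i j) g - g) + (perm_op (transpose i j) f - f) * g"
      by (simp add: perm_op_mult algebra_simps)
    with that show ?thesis by (simp add: D_def)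
  qed
  have D_add: "D (f + g)" if "D f" "D g" for f g
  proof -
    have "perm_op (transpose i j) (f + g) - (f + g) =
       (perm_op (transpose i j) f - f) + (perm_op (transpose i j) g - g)"
      by (simp add: perm_op_add)
    with that show ?thesis unfolding D_def by (metis dvd_add)
  qed
  have D_xvar: "D (xvar k)" for k
  proof -
    have "xvar i - xvar j dvd xvar j - xvar i" by (metis dvd_refl minus_diff_eq dvd_minus_iff)
    thus ?thesis by (auto simp: D_def transpose_def)
  qed
  have D_power: "D (xvar k ^ n)" for k n
    using D_const[of 1] by (induction n) (auto intro: D_mult D_xvar)
  have D_prod: "D (\<Prod>k\<in>A. xvar k ^ h k)" for A h
    using D_const[of 1] by (induction A rule: infinite_finite_induct) (auto intro: D_mult D_power)
  have "D f"
  proof (induction f rule: mpoly_induct)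
    case zero thus ?case using D_const[of 0] by simp
  next
    case (single \<alpha> c)
    have "Poly_Mapping.single \<alpha> c = const c * monom_subst xvar \<alpha>"
      by (simp add: monom_subst_xvar const_def mult_single)
    thus ?case by (simp add: monom_subst_def D_mult D_const D_prod)
  qed (rule D_add)
  thus ?thesis by (simp add: D_def)
qed

text \<open>Conjugation by a renaming leads out of the adjacent pairs, so the braid relation and the
  factorization of \<open>Y_op\<close> are carried out with all ordered pairs. The order matters:
  \<open>T_gen j i\<close> is the conjugate of \<open>T_gen i j\<close> by the exchange.\<close>

definition T_gen :: "nat \<Rightarrow> nat \<Rightarrow> mpoly \<Rightarrow> mpoly" where
  "T_gen i j f = const tvar * f + (const tvar * xvar i - xvar j) *
     (THE g. (xvar i - xvar j) * g = K_op i j f - f)"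

lemma T_op_T_gen: "T_op i = T_gen i (Suc i)"
  by (simp add: T_op_def T_gen_def fun_eq_iff)

text \<open>Clearing the denominator replaces the definite description by an equation. Polynomials
  form an integral domain, so the equation determines T (\<open>T_gen_eqI\<close>), and the basic
  relations below are reduced to it.\<close>

lemma T_gen_eq:
  assumes "i \<noteq> j"
  shows "(xvar i - xvar j) * T_gen i j f =
    (const tvar * xvar i - xvar j) * perm_op (transpose i j) f + (1 - const tvar) * xvar j * f"
proof -
  let ?P = "\<lambda>g. (xvar i - xvar j) * g = K_op i j f - f"
  obtain g where g: "?P g"
    using xvar_diff_dvd_swap_diff[of i j f] unfolding K_op_perm_op dvd_def by metis
  have "h = g" if "?P h" for h
    using that g xvar_diff_nonzero[OF assms] by (metis mult_cancel_left)
  with g have "(THE g. ?P g) = g" by blast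
  hence "T_gen i j f = const tvar * f + (const tvar * xvar i - xvar j) * g"
    unfolding T_gen_def by simp
  hence "(xvar i - xvar j) * T_gen i j f = (xvar i - xvar j) * (const tvar * f) + (const tvar * xvar i - xvar j) * ((xvar i - xvar j) * g)"
    by algebra
  also have "\<dots> = (const tvar * xvar i - xvar j) * perm_op (transpose i j) f + (1 - const tvar) * xvar j * f"
    by (subst g) (simp add: K_op_perm_op algebra_simps)
  finally show ?thesis .
qed

lemma T_gen_eqI:
  assumes "i \<noteq> j"
    "(xvar i - xvar j) * g =
      (const tvar * xvar i - xvar j) * perm_op (transpose i j) f + (1 - const tvar) * xvar j * f"
  shows "T_gen i j f = g"
  using T_gen_eq[OF assms(1), of f] assms xvar_diff_nonzero[OF assms(1)] by (metis mult_cancel_left)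

lemma T_gen_add: "i \<noteq> j \<Longrightarrow> T_gen i j (f + g) = T_gen i j f + T_gen i j g"
  by (rule T_gen_eqI) (simp_all add: distrib_left[of "_ - _"] T_gen_eq perm_op_add, simp add: algebra_simps)

lemma T_gen_mult_invariant:
  assumes "i \<noteq> j" "perm_op (transpose i j) h = h"
  shows "T_gen i j (h * f) = h * T_gen i j f"
  by (rule T_gen_eqI)
     (simp_all add: assms perm_op_mult T_gen_eq mult.left_commute[of "_ - _" h], simp add: algebra_simps)

lemma T_gen_const_mult: "i \<noteq> j \<Longrightarrow> T_gen i j (const c * f) = const c * T_gen i j f"
  by (rule T_gen_mult_invariant) auto

lemma T_gen_minus: "i \<noteq> j \<Longrightarrow> T_gen i j (- f) = - T_gen i j f"
  using T_gen_const_mult[of i j "-1" f] by (simp add: const_minus)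

lemma T_gen_diff: "i \<noteq> j \<Longrightarrow> T_gen i j (f - g) = T_gen i j f - T_gen i j g"
  using T_gen_add[of i j f "- g"] by (simp add: T_gen_minus)

text \<open>The fractions in T are homogeneous of degree zero in the two variables, so a common
  scale \<open>c\<close> cancels. The square of \<open>omega_op\<close> scales by
  \<open>qvar\<close>; renaming, a single \<open>omega_op\<close> and setting a variable to zero
  have \<open>c = 1\<close>.\<close>

lemma substitute_T_gen:
  assumes "i \<noteq> j" "a \<noteq> b" "c \<noteq> 0" "g i = const c * xvar a" "g j = const c * xvar b"
    and comm: "\<And>k. perm_op (transpose a b) (g k) = g (transpose i j k)"
  shows "substitute g (T_gen i j f) = T_gen a b (substitute g f)"
proof -
  have K: "substitute g (perm_op (transpose i j) f) = perm_op (transpose a b) (substitute g f)"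
    unfolding perm_op_def substitute_substitute using comm by (simp add: perm_op_def)
  have "const c * ((xvar a - xvar b) * substitute g (T_gen i j f)) =
      substitute g ((xvar i - xvar j) * T_gen i j f)"
    by (simp add: substitute_mult substitute_diff assms algebra_simps)
  also have "\<dots> = const c * ((const tvar * xvar a - xvar b) * perm_op (transpose a b) (substitute g f)
      + (1 - const tvar) * xvar b * substitute g f)"
    by (subst T_gen_eq[OF assms(1)])
       (simp add: substitute_add substitute_mult substitute_diff assms K algebra_simps)
  finally show ?thesis
    using \<open>c \<noteq> 0\<close> by (intro T_gen_eqI[symmetric]) (auto simp: assms)
qed

lemma perm_op_T_gen:
  assumes "i \<noteq> j" "bij \<sigma>"
  shows "perm_op \<sigma> (T_gen i j f) = T_gen (\<sigma> i) (\<sigma> j) (perm_op \<sigma> f)"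
  unfolding perm_op_def
proof (rule substitute_T_gen[where c = 1])
  show "\<sigma> i \<noteq> \<sigma> j" using assms by (auto dest: bij_is_inj injD)
  fix k
  have "transpose (\<sigma> i) (\<sigma> j) (\<sigma> k) = \<sigma> (transpose i j k)"
    using bij_is_inj[OF assms(2)] by (auto simp: transpose_def inj_eq)
  thus "perm_op (transpose (\<sigma> i) (\<sigma> j)) (xvar (\<sigma> k)) = xvar (\<sigma> (transpose i j k))"
    by simp
qed (use assms in auto)

text \<open>The Hecke relation \<open>(T - t) (T + 1) = 0\<close>. Applying T twice produces the
  conjugate \<open>T_gen j i\<close>, which has a denominator of its own, so two differences have to
  be cleared.\<close>

lemma T_gen_quadratic:
  assumes "i \<noteq> j"
  shows "T_gen i j (T_gen i j f) = const (tvar - 1) * T_gen i j f + const tvar * f"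
proof -
  let ?x = "xvar i" and ?y = "xvar j" and ?t = "const tvar" and ?K = "perm_op (transpose i j)"
  have KT: "?K (T_gen i j f) = T_gen j i (?K f)"
    using assms by (subst perm_op_T_gen) auto
  have 1: "(?y - ?x) * T_gen j i (?K f) = (?t * ?y - ?x) * f + (1 - ?t) * ?x * ?K f"
    using T_gen_eq[of j i "?K f"] assms by (simp add: transpose_commute perm_op_comp)
  have 2: "(?x - ?y) * T_gen i j f = (?t * ?x - ?y) * ?K f + (1 - ?t) * ?y * f"
    using assms by (rule T_gen_eq)
  have 3: "(?x - ?y) * T_gen i j (T_gen i j f) = (?t * ?x - ?y) * T_gen j i (?K f) + (1 - ?t) * ?y * T_gen i j f"
    using T_gen_eq[OF assms, of "T_gen i j f"] KT by simp
  have "(?x - ?y) * ((?x - ?y) * T_gen i j (T_gen i j f)) =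
      (?x - ?y) * ((?x - ?y) * (const (tvar - 1) * T_gen i j f + const tvar * f))"
    unfolding const_diff const_1 using 1 2 3 by algebra
  thus ?thesis using xvar_diff_nonzero[OF assms] by simp
qed

lemma T_gen_commute:
  assumes "distinct [i, j, k, l]"
  shows "T_gen i j (T_gen k l f) = T_gen k l (T_gen i j f)"
proof (rule T_gen_eqI)
  show "i \<noteq> j" using assms by simp
  let ?K = "perm_op (transpose i j)"
  have K: "?K (T_gen k l f) = T_gen k l (?K f)"
    using assms by (subst perm_op_T_gen) (auto simp: transpose_def)
  have inv: "T_gen k l (h * g) = h * T_gen k l g" if "perm_op (transpose k l) h = h" for h g
    using that assms by (intro T_gen_mult_invariant) auto
  have "(xvar i - xvar j) * T_gen k l (T_gen i j f) = T_gen k l ((xvar i - xvar j) * T_gen i j f)"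
    using assms by (subst inv) (auto simp: perm_op_diff transpose_def)
  also have "\<dots> = T_gen k l ((const tvar * xvar i - xvar j) * ?K f + (1 - const tvar) * xvar j * f)"
    using assms by (subst T_gen_eq) auto
  also have "\<dots> = (const tvar * xvar i - xvar j) * T_gen k l (?K f) + (1 - const tvar) * xvar j * T_gen k l f"
    using assms by (subst T_gen_add; (subst inv)?; (subst inv)?) (auto simp: perm_op_simps transpose_def)
  finally show "(xvar i - xvar j) * T_gen k l (T_gen i j f) =
      (const tvar * xvar i - xvar j) * ?K (T_gen k l f) + (1 - const tvar) * xvar j * T_gen k l f"
    by (simp add: K)
qed


text \<open>Both sides of the braid relation, multiplied by a product of differences of variables, become
  the same combination of the six permuted copies of the argument; here \<open>p\<close>, \<open>p1\<close>, \<open>p2\<close>,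
  \<open>p3\<close>, \<open>pa\<close>, \<open>pb\<close> stand for these copies.\<close>

lemma braid_identity:
  fixes x y z t :: "'a :: idom"
  assumes h: "(y - z) * h = (t * y - z) * G + (1 - t) * z * g"
    and G: "(x - z) * G = (t * x - z) * pb + (1 - t) * z * p2"
    and g: "(x - y) * g = (t * x - y) * p1 + (1 - t) * y * p"
    and Kh: "(x - z) * Kh = (t * x - z) * KG + (1 - t) * z * Kg"
    and KG: "(y - z) * KG = (t * y - z) * p3 + (1 - t) * z * pa"
    and Kg: "(y - x) * Kg = (t * y - x) * p + (1 - t) * x * p1"
    and L: "(x - y) * L = (t * x - y) * Kh + (1 - t) * y * h"
    and h': "(x - y) * h' = (t * x - y) * G' + (1 - t) * y * g'"
    and G': "(x - z) * G' = (t * x - z) * pa + (1 - t) * z * p1"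
    and g': "(y - z) * g' = (t * y - z) * p2 + (1 - t) * z * p"
    and Kh': "(x - z) * Kh' = (t * x - z) * KG' + (1 - t) * z * Kg'"
    and KG': "(x - y) * KG' = (t * x - y) * p3 + (1 - t) * y * pb"
    and Kg': "(z - y) * Kg' = (t * z - y) * p + (1 - t) * y * p2"
    and R: "(y - z) * R = (t * y - z) * Kh' + (1 - t) * z * h'"
    and ne: "x \<noteq> y" "x \<noteq> z" "y \<noteq> z"
  shows "L = R"
proof -
  define A B C where "A = x - y" and "B = x - z" and "C = y - z"
  have 1: "A * B * C * h = (t*y - z) * A * ((t * x - z) * pb + (1 - t) * z * p2)
      + (1 - t) * z * B * ((t * x - y) * p1 + (1 - t) * y * p)" (is "_ = ?H")
    using h G g unfolding A_def B_def C_def by algebra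
  have 2: "A * B * C * Kh = (t*x - z) * A * ((t * y - z) * p3 + (1 - t) * z * pa)
      - (1 - t) * z * C * ((t * y - x) * p + (1 - t) * x * p1)" (is "_ = ?KH")
    using Kh KG Kg unfolding A_def B_def C_def by algebra
  have 3: "A * (A * B * C * L) = (t*x - y) * ?KH + (1 - t) * y * ?H"
    using L 1 2 unfolding A_def B_def C_def by algebra
  have 4: "A * B * C * h' = (t*x - y) * C * ((t * x - z) * pa + (1 - t) * z * p1)
      + (1 - t) * y * B * ((t * y - z) * p2 + (1 - t) * z * p)" (is "_ = ?H'")
    using h' G' g' unfolding A_def B_def C_def by algebra
  have 5: "A * B * C * Kh' = (t*x - z) * C * ((t * x - y) * p3 + (1 - t) * y * pb)
      - (1 - t) * z * A * ((t * z - y) * p + (1 - t) * y * p2)" (is "_ = ?KH'")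
    using Kh' KG' Kg' unfolding A_def B_def C_def by algebra
  have 6: "C * (A * B * C * R) = (t*y - z) * ?KH' + (1 - t) * z * ?H'"
    using R 4 5 unfolding A_def B_def C_def by algebra
  have "C * ((t*x - y) * ?KH + (1 - t) * y * ?H) = A * ((t*y - z) * ?KH' + (1 - t) * z * ?H')"
    unfolding A_def B_def C_def by algebra
  hence "C * (A * (A * B * C * L)) = A * (C * (A * B * C * R))"
    unfolding 3 6 .
  moreover have "A \<noteq> 0" "B \<noteq> 0" "C \<noteq> 0" using ne by (auto simp: A_def B_def C_def)
  ultimately show ?thesis by (simp add: ac_simps)
qed

lemma T_gen_braid:
  assumes "distinct [i, j, k]"
  shows "T_gen i j (T_gen j k (T_gen i j f)) = T_gen j k (T_gen i j (T_gen j k f))"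
proof -
  have ne: "i \<noteq> j" "i \<noteq> k" "j \<noteq> k" "j \<noteq> i" "k \<noteq> i" "k \<noteq> j" using assms by auto
  let ?s = "\<lambda>a b. perm_op (transpose a b)"
  have *: "(xvar a - xvar b) * T_gen a b g =
    (const tvar * xvar a - xvar b) * ?s a b g + (1 - const tvar) * xvar b * g" if "a \<noteq> b" for a b g
    using that by (rule T_gen_eq)
  have s: "?s a b (T_gen c d g) = T_gen (transpose a b c) (transpose a b d) (?s a b g)" if "c \<noteq> d" for a b c d g
    using that by (rule perm_op_T_gen) simp
  have c: "?s j k (?s i k (?s i j f)) = ?s i k f" "?s i j (?s i k (?s j k f)) = ?s i k f"
    "?s j k (?s j k f) = f" "?s i j (?s i j f) = f"
  proof -
    have "transpose j k \<circ> (transpose i k \<circ> transpose i j) = transpose i k"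
      "transpose i j \<circ> (transpose i k \<circ> transpose j k) = transpose i k"
      using ne by (auto simp: fun_eq_iff transpose_def)
    thus "?s j k (?s i k (?s i j f)) = ?s i k f" "?s i j (?s i k (?s j k f)) = ?s i k f"
      by (simp_all add: perm_op_comp)
  qed (simp_all add: perm_op_comp)
  show ?thesis
  proof (rule braid_identity[where x = "xvar i" and y = "xvar j" and z = "xvar k" and t = "const tvar"
        and p = f and ?p1.0 = "?s i j f" and ?p2.0 = "?s j k f" and ?p3.0 = "?s i k f"
        and pa = "?s i k (?s i j f)" and pb = "?s i k (?s j k f)"])
    show "xvar i \<noteq> xvar j" "xvar i \<noteq> xvar k" "xvar j \<noteq> xvar k"
      using ne xvar_diff_nonzero by force+
    show "(xvar j - xvar k) * T_gen j k (T_gen i j f) = (const tvar * xvar j - xvar k) * T_gen i k (?s j k f)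
        + (1 - const tvar) * xvar k * T_gen i j f"
      using *[of j k "T_gen i j f"] ne by (simp add: s)
    show "(xvar i - xvar k) * T_gen i k (?s j k f) = (const tvar * xvar i - xvar k) * ?s i k (?s j k f)
        + (1 - const tvar) * xvar k * ?s j k f"
      using ne by (intro *)
    show "(xvar i - xvar j) * T_gen i j f = (const tvar * xvar i - xvar j) * ?s i j f
        + (1 - const tvar) * xvar j * f"
      using ne by (intro *)
    show "(xvar i - xvar k) * T_gen i k (T_gen j i (?s i j f)) = (const tvar * xvar i - xvar k) * T_gen j k (?s i k (?s i j f))
        + (1 - const tvar) * xvar k * T_gen j i (?s i j f)"
      using *[of i k "T_gen j i (?s i j f)"] ne by (simp add: s)
    show "(xvar j - xvar k) * T_gen j k (?s i k (?s i j f)) = (const tvar * xvar j - xvar k) * ?s i k f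
        + (1 - const tvar) * xvar k * ?s i k (?s i j f)"
      using *[of j k "?s i k (?s i j f)"] ne by (simp add: c)
    show "(xvar j - xvar i) * T_gen j i (?s i j f) = (const tvar * xvar j - xvar i) * f
        + (1 - const tvar) * xvar i * ?s i j f"
      using *[of j i "?s i j f"] ne by (simp add: c transpose_commute[of j i])
    show "(xvar i - xvar j) * T_gen i j (T_gen j k (T_gen i j f)) =
        (const tvar * xvar i - xvar j) * T_gen i k (T_gen j i (?s i j f))
        + (1 - const tvar) * xvar j * T_gen j k (T_gen i j f)"
      using *[of i j "T_gen j k (T_gen i j f)"] ne by (simp add: s)
    show "(xvar i - xvar j) * T_gen i j (T_gen j k f) = (const tvar * xvar i - xvar j) * T_gen i k (?s i j f)
        + (1 - const tvar) * xvar j * T_gen j k f"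
      using *[of i j "T_gen j k f"] ne by (simp add: s)
    show "(xvar i - xvar k) * T_gen i k (?s i j f) = (const tvar * xvar i - xvar k) * ?s i k (?s i j f)
        + (1 - const tvar) * xvar k * ?s i j f"
      using ne by (intro *)
    show "(xvar j - xvar k) * T_gen j k f = (const tvar * xvar j - xvar k) * ?s j k f
        + (1 - const tvar) * xvar k * f"
      using ne by (intro *)
    show "(xvar i - xvar k) * T_gen i k (T_gen k j (?s j k f)) = (const tvar * xvar i - xvar k) * T_gen i j (?s i k (?s j k f))
        + (1 - const tvar) * xvar k * T_gen k j (?s j k f)"
      using *[of i k "T_gen k j (?s j k f)"] ne by (simp add: s)
    show "(xvar i - xvar j) * T_gen i j (?s i k (?s j k f)) = (const tvar * xvar i - xvar j) * ?s i k f
        + (1 - const tvar) * xvar j * ?s i k (?s j k f)"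
      using *[of i j "?s i k (?s j k f)"] ne by (simp add: c)
    show "(xvar k - xvar j) * T_gen k j (?s j k f) = (const tvar * xvar k - xvar j) * f
        + (1 - const tvar) * xvar j * ?s j k f"
      using *[of k j "?s j k f"] ne by (simp add: c transpose_commute[of k j])
    show "(xvar j - xvar k) * T_gen j k (T_gen i j (T_gen j k f)) =
        (const tvar * xvar j - xvar k) * T_gen i k (T_gen k j (?s j k f))
        + (1 - const tvar) * xvar k * T_gen i j (T_gen j k f)"
      using *[of j k "T_gen i j (T_gen j k f)"] ne by (simp add: s)
  qed
qed

text \<open>Read off from the quadratic relation in the form
  \<open>T (T - (t - 1)) = t\<close>.\<close>

definition T_gen_inv :: "nat \<Rightarrow> nat \<Rightarrow> mpoly \<Rightarrow> mpoly" where
  "T_gen_inv i j f = const (inverse tvar) * (T_gen i j f - const (tvar - 1) * f)"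

lemma T_gen_T_gen_inv [simp]: "i \<noteq> j \<Longrightarrow> T_gen i j (T_gen_inv i j f) = f"
  by (simp add: T_gen_inv_def T_gen_const_mult T_gen_diff T_gen_quadratic)

lemma T_gen_inv_T_gen [simp]: "i \<noteq> j \<Longrightarrow> T_gen_inv i j (T_gen i j f) = f"
  by (simp add: T_gen_inv_def T_gen_quadratic)

lemma inv_T_op: "inv (T_op i) = T_gen_inv i (Suc i)"
  by (rule inv_equality) (simp_all add: T_op_T_gen)

lemma T_gen_inv_add: "i \<noteq> j \<Longrightarrow> T_gen_inv i j (f + g) = T_gen_inv i j f + T_gen_inv i j g"
  by (simp add: T_gen_inv_def T_gen_add algebra_simps)

lemma T_gen_inv_const_mult: "i \<noteq> j \<Longrightarrow> T_gen_inv i j (const c * f) = const c * T_gen_inv i j f"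
  by (simp add: T_gen_inv_def T_gen_const_mult right_diff_distrib mult.left_commute)

lemma T_gen_eq_T_gen_inv: "T_gen i j f = const tvar * T_gen_inv i j f + const (tvar - 1) * f"
  by (simp add: T_gen_inv_def mult.assoc[symmetric] flip: const_mult)

lemma perm_op_T_gen_inv:
  assumes "i \<noteq> j" "bij \<sigma>"
  shows "perm_op \<sigma> (T_gen_inv i j f) = T_gen_inv (\<sigma> i) (\<sigma> j) (perm_op \<sigma> f)"
  by (simp add: T_gen_inv_def perm_op_simps perm_op_T_gen assms)

text \<open>Cross relation of the affine Hecke algebra: T trades multiplication by one variable of
  the pair for multiplication by the other, at the cost of inverting T. It carries a variable
  through the chains in \<open>Y_op\<close>.\<close>

lemma T_gen_xvar_mult:
  assumes "i \<noteq> j"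
  shows "T_gen i j (xvar i * f) = const tvar * (xvar j * T_gen_inv i j f)"
proof -
  have e: "const tvar * T_gen_inv i j f = T_gen i j f - (const tvar - 1) * f"
    by (simp add: T_gen_eq_T_gen_inv const_diff)
  have "(xvar i - xvar j) * T_gen i j f = (const tvar * xvar i - xvar j) * perm_op (transpose i j) f + (1 - const tvar) * xvar j * f"
    by (rule T_gen_eq[OF assms])
  hence "T_gen i j (xvar i * f) = xvar j * (T_gen i j f - (const tvar - 1) * f)"
    by (intro T_gen_eqI[OF assms]) (simp add: perm_op_mult, algebra)
  thus ?thesis by (simp add: e[symmetric] mult.left_commute)
qed

lemma T_gen_inv_xvar_mult:
  assumes "i \<noteq> j"
  shows "T_gen_inv i j (xvar j * f) = const (inverse tvar) * (xvar i * T_gen i j f)"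
proof -
  have "T_gen i j (xvar i * T_gen i j f) = const tvar * (xvar j * f)"
    using assms by (simp add: T_gen_xvar_mult)
  hence "const (inverse tvar) * T_gen_inv i j (T_gen i j (xvar i * T_gen i j f)) = T_gen_inv i j (xvar j * f)"
    using assms by (simp add: T_gen_inv_const_mult)
  thus ?thesis using assms by simp
qed

lemma T_gen_inv_mult_invariant:
  assumes "i \<noteq> j" "perm_op (transpose i j) h = h"
  shows "T_gen_inv i j (h * f) = h * T_gen_inv i j f"
  by (simp add: T_gen_inv_def T_gen_mult_invariant assms right_diff_distrib mult.left_commute)

text \<open>With eigenvalue t the defining equation collapses to
  \<open>(t x_i - x_j) (K f - f) = 0\<close>. This is how the symmetry demanded by
  \<open>R_ring\<close> comes out of the Hecke symmetrization.\<close>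

lemma T_gen_eq_t_imp_symmetric:
  assumes "i \<noteq> j" "T_gen i j f = const tvar * f"
  shows "perm_op (transpose i j) f = f"
proof -
  have "(xvar i - xvar j) * (const tvar * f) = (const tvar * xvar i - xvar j) * perm_op (transpose i j) f + (1 - const tvar) * xvar j * f"
    using T_gen_eq[OF assms(1), of f] assms(2) by simp
  hence "(const tvar * xvar i - xvar j) * (perm_op (transpose i j) f - f) = 0"
    by algebra
  thus ?thesis using const_t_xvar_diff_nonzero[OF assms(1)] by simp
qed

section \<open>Cherednik operators\<close>

lemma comp_ops_Nil [simp]: "comp_ops [] f = f"
  and comp_ops_Cons [simp]: "comp_ops (F # Fs) f = F (comp_ops Fs f)"
  by (simp_all add: comp_ops_def)

lemma comp_ops_append [simp]: "comp_ops (Fs @ Gs) f = comp_ops Fs (comp_ops Gs f)"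
  by (induction Fs) simp_all

text \<open>Passes one operator through a whole chain, factor by factor; most commutation rules for
  chains below are instances.\<close>

lemma comp_ops_intertwine:
  assumes "\<And>x f. x \<in> set xs \<Longrightarrow> A (F x f) = G x (A f)"
  shows "A (comp_ops (map F xs) f) = comp_ops (map G xs) (A f)"
  using assms by (induction xs) auto

definition linear_op :: "(mpoly \<Rightarrow> mpoly) \<Rightarrow> bool" where
  "linear_op F \<longleftrightarrow> (\<forall>f g. F (f + g) = F f + F g) \<and> (\<forall>c f. F (const c * f) = const c * F f)"

lemma linear_op_add: "linear_op F \<Longrightarrow> F (f + g) = F f + F g"
  and linear_op_const_mult: "linear_op F \<Longrightarrow> F (const c * f) = const c * F f"
  by (auto simp: linear_op_def)

lemma linear_op_0: "linear_op F \<Longrightarrow> F 0 = 0"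
  using linear_op_const_mult[of F 0 0] by simp

lemma linear_op_minus: "linear_op F \<Longrightarrow> F (- f) = - F f"
  using linear_op_const_mult[of F "-1" f] by (simp add: const_minus)

lemma linear_op_diff: "linear_op F \<Longrightarrow> F (f - g) = F f - F g"
  using linear_op_add[of F f "- g"] by (simp add: linear_op_minus)

lemma linear_op_sum: "linear_op F \<Longrightarrow> F (\<Sum>x\<in>A. f x) = (\<Sum>x\<in>A. F (f x))"
  by (induction A rule: infinite_finite_induct) (simp_all add: linear_op_0 linear_op_add)

lemma linear_op_comp: "linear_op F \<Longrightarrow> linear_op G \<Longrightarrow> linear_op (\<lambda>f. F (G f))"
  by (simp add: linear_op_def)

lemma linear_op_comp_ops: "(\<And>x. x \<in> set xs \<Longrightarrow> linear_op (F x)) \<Longrightarrow> linear_op (comp_ops (map F xs))"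
  by (induction xs) (auto simp: linear_op_def)

lemma linear_op_scale: "linear_op F \<Longrightarrow> linear_op (\<lambda>f. const c * F f)"
  by (simp add: linear_op_def algebra_simps)

lemma linear_op_substitute [simp]: "linear_op (substitute g)"
  by (simp add: linear_op_def substitute_add substitute_mult)

lemma linear_op_perm_op [simp]: "linear_op (perm_op \<sigma>)"
  by (simp add: linear_op_def perm_op_simps)

lemma linear_op_tau_op [simp]: "linear_op (tau_op i)"
  by (simp add: linear_op_def tau_op_add tau_op_mult)

lemma linear_op_T_gen: "i \<noteq> j \<Longrightarrow> linear_op (T_gen i j)"
  by (simp add: linear_op_def T_gen_add T_gen_const_mult)

lemma linear_op_T_op [simp]: "linear_op (T_op i)"
  by (simp add: T_op_T_gen linear_op_T_gen)

lemma linear_op_T_gen_inv: "i \<noteq> j \<Longrightarrow> linear_op (T_gen_inv i j)"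
  by (simp add: linear_op_def T_gen_inv_add T_gen_inv_const_mult)

abbreviation Tinv_op :: "nat \<Rightarrow> mpoly \<Rightarrow> mpoly" where
  "Tinv_op i \<equiv> T_gen_inv i (Suc i)"

lemma linear_op_Tinv_op [simp]: "linear_op (Tinv_op i)"
  by (simp add: linear_op_T_gen_inv)

lemmas T_op_const_mult = linear_op_const_mult[OF linear_op_T_op]

lemma Tinv_T_op [simp]: "Tinv_op i (T_op i f) = f" and T_Tinv_op [simp]: "T_op i (Tinv_op i f) = f"
  by (simp_all add: T_op_T_gen)

lemma T_op_quadratic: "T_op i (T_op i f) = const (tvar - 1) * T_op i f + const tvar * f"
  by (simp add: T_op_T_gen T_gen_quadratic)

lemma T_op_braid: "T_op i (T_op (Suc i) (T_op i f)) = T_op (Suc i) (T_op i (T_op (Suc i) f))"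
  unfolding T_op_T_gen by (rule T_gen_braid) auto

lemma T_op_commute: "Suc i < j \<or> Suc j < i \<Longrightarrow> T_op i (T_op j f) = T_op j (T_op i f)"
  unfolding T_op_T_gen by (rule T_gen_commute) auto

lemma Tinv_op_def: "Tinv_op i f = const (inverse tvar) * (T_op i f - const (tvar - 1) * f)"
  by (simp add: T_gen_inv_def T_op_T_gen)

lemma intertwine_inv:
  assumes "\<And>f. A (T_op i f) = T_op j (A f)"
  shows "A (Tinv_op i f) = Tinv_op j (A f)"
  by (metis assms Tinv_T_op T_Tinv_op)

lemma T_op_Tinv_op_commute: "Suc i < j \<or> Suc j < i \<Longrightarrow> T_op i (Tinv_op j f) = Tinv_op j (T_op i f)"
  by (rule intertwine_inv) (rule T_op_commute)

lemma T_op_Tinv_op_braid: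
  "T_op (Suc i) (Tinv_op i (Tinv_op (Suc i) f)) = Tinv_op i (Tinv_op (Suc i) (T_op i f))"
  by (metis T_op_braid Tinv_T_op T_Tinv_op)

section \<open>Chains of Hecke operators in \<open>Y_op\<close> and their passage through
  \<open>omega_op\<close>\<close>

definition TT :: "nat \<Rightarrow> nat \<Rightarrow> mpoly \<Rightarrow> mpoly" where
  "TT i N = comp_ops (map T_op [i..<N])"

definition TI :: "nat \<Rightarrow> mpoly \<Rightarrow> mpoly" where
  "TI i = comp_ops (map Tinv_op [1..<i])"

lemma linear_op_TT [simp]: "linear_op (TT i N)"
  unfolding TT_def by (rule linear_op_comp_ops) simp

lemma linear_op_TI [simp]: "linear_op (TI i)"
  unfolding TI_def by (rule linear_op_comp_ops) simp

lemma TT_empty [simp]: "N \<le> i \<Longrightarrow> TT i N f = f"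
  by (simp add: TT_def)

lemma TT_rec: "i < N \<Longrightarrow> TT i N f = T_op i (TT (Suc i) N f)"
  by (simp add: TT_def upt_conv_Cons)

lemma TT_split: "i \<le> j \<Longrightarrow> j \<le> N \<Longrightarrow> TT i N f = TT i j (TT j N f)"
  using upt_add_eq_append[of i j "N - j"] by (simp add: TT_def)

lemma TT_Suc: "i \<le> N \<Longrightarrow> TT i (Suc N) f = TT i N (T_op N f)"
  using TT_split[of i N "Suc N" f] by (simp add: TT_rec)

lemma TI_1 [simp]: "TI (Suc 0) f = f"
  by (simp add: TI_def)

lemma TI_Suc: "1 \<le> i \<Longrightarrow> TI (Suc i) f = TI i (Tinv_op i f)"
  by (simp add: TI_def)

text \<open>The exchanges and \<open>tau_op 1\<close> as one substitution: the variables move down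
  cyclically, and the one that wraps around picks up q.\<close>

definition omega_var :: "nat \<Rightarrow> nat \<Rightarrow> mpoly" where
  "omega_var N k = (if k = 1 then const qvar * xvar N else if 2 \<le> k \<and> k \<le> N then xvar (k - 1) else xvar k)"

lemma K_ops_rotate:
  "comp_ops (map (\<lambda>j. K_op j (Suc j)) (rev [1..<Suc n])) f =
     perm_op (\<lambda>k. if k = 1 then Suc n else if 2 \<le> k \<and> k \<le> Suc n then k - 1 else k) f"
proof (induction n)
  case 0
  have "(\<lambda>k::nat. if k = 1 then Suc 0 else if 2 \<le> k \<and> k \<le> Suc 0 then k - 1 else k) = id"
    by (auto simp: fun_eq_iff)
  thus ?case by simp
next
  case (Suc n)
  have "(transpose (Suc n) (Suc (Suc n)) \<circ>
     (\<lambda>k. if k = 1 then Suc n else if 2 \<le> k \<and> k \<le> Suc n then k - 1 else k)) =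
    (\<lambda>k. if k = 1 then Suc (Suc n) else if 2 \<le> k \<and> k \<le> Suc (Suc n) then k - 1 else k)"
    by (auto simp: fun_eq_iff transpose_def)
  with Suc show ?case by (simp add: K_op_perm_op perm_op_comp)
qed

lemma omega_op_substitute:
  assumes "N \<ge> 1"
  shows "omega_op N = substitute (omega_var N)"
proof
  fix f
  obtain n where N: "N = Suc n" using assms by (cases N) auto
  have "omega_op N f = perm_op (\<lambda>k. if k = 1 then Suc n else if 2 \<le> k \<and> k \<le> Suc n then k - 1 else k) (tau_op 1 f)"
    using K_ops_rotate[of n "tau_op 1 f"] by (simp add: omega_op_def N)
  also have "\<dots> = substitute (omega_var N) f"
    unfolding perm_op_def tau_op_def substitute_substitute
    by (rule arg_cong[where f = "\<lambda>h. substitute h f"])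
       (auto simp: fun_eq_iff substitute_mult omega_var_def N)
  finally show "omega_op N f = substitute (omega_var N) f" .
qed

lemma linear_op_omega_op [simp]: "N \<ge> 1 \<Longrightarrow> linear_op (omega_op N)"
  by (simp add: omega_op_substitute)

lemma omega_op_xvar_mult:
  assumes "N \<ge> 1"
  shows "omega_op N (xvar 1 * f) = const qvar * (xvar N * omega_op N f)"
    "2 \<le> k \<Longrightarrow> k \<le> N \<Longrightarrow> omega_op N (xvar k * f) = xvar (k - 1) * omega_op N f"
  using assms by (simp_all add: omega_op_substitute substitute_mult omega_var_def mult.assoc)

lemma T_op_omega_op:
  assumes "1 \<le> j" "Suc j < N"
  shows "T_op j (omega_op N f) = omega_op N (T_op (Suc j) f)"
proof -
  have N: "N \<ge> 1" using assms by simp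
  show ?thesis
    unfolding omega_op_substitute[OF N] T_op_T_gen
    by (rule substitute_T_gen[where c = 1, symmetric])
       (use assms in \<open>auto simp: omega_var_def perm_op_mult transpose_def\<close>)
qed

text \<open>One \<open>omega_op\<close> separates \<open>x_1\<close> and \<open>x_2\<close> at the
  wrap-around; the second brings them together again as \<open>q x_(N-1)\<close> and
  \<open>q x_N\<close>, an adjacent pair with common scale q.\<close>

lemma T_op_omega_op_sq:
  assumes "2 \<le> N"
  shows "T_op (N - 1) (omega_op N (omega_op N f)) = omega_op N (omega_op N (T_op 1 f))"
proof -
  have N: "N \<ge> 1" using assms by simp
  show ?thesis
    unfolding omega_op_substitute[OF N] T_op_T_gen substitute_substitute
  proof (rule substitute_T_gen[where c = qvar, symmetric])
    fix k
    have o: "omega_var N 1 = const qvar * xvar N" "\<And>k. 2 \<le> k \<Longrightarrow> k \<le> N \<Longrightarrow> omega_var N k = xvar (k - 1)"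
      "\<And>k. k = 0 \<or> k > N \<Longrightarrow> omega_var N k = xvar k"
      using assms by (auto simp: omega_var_def)
    consider "k = 1" | "k = 2" | "3 \<le> k" "k \<le> N" | "k = 0 \<or> k > N" by linarith
    thus "perm_op (transpose (N - 1) (Suc (N - 1))) (substitute (omega_var N) (omega_var N k)) =
         substitute (omega_var N) (omega_var N (transpose 1 (Suc 1) k))"
    proof cases
      case 1
      have "transpose 1 (Suc 1) k = 2" using 1 by (simp add: transpose_def)
      thus ?thesis using 1 assms by (simp add: o substitute_mult perm_op_mult o(1)[unfolded One_nat_def])
    next
      case 2
      have "transpose 1 (Suc 1) k = 1" using 2 by (simp add: transpose_def)
      thus ?thesis using 2 assms by (simp add: o substitute_mult perm_op_mult o(1)[unfolded One_nat_def])
    next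
      case 3
      have "transpose 1 (Suc 1) k = k" using 3 by (simp add: transpose_def)
      moreover have "transpose (N - 1) (Suc (N - 1)) (k - 1 - 1) = k - 1 - 1"
        using 3 by (intro transpose_apply_other) auto
      ultimately show ?thesis using 3 assms by (simp add: o)
    next
      case 4
      have "transpose 1 (Suc 1) k = k" using 4 assms by (intro transpose_apply_other) auto
      moreover have "transpose (N - 1) (Suc (N - 1)) k = k"
        using 4 assms by (intro transpose_apply_other) auto
      ultimately show ?thesis using 4 by (simp add: o)
    qed
  qed (use assms in \<open>auto simp: omega_var_def substitute_mult\<close>)
qed

lemma Tinv_op_omega_op:
  assumes "1 \<le> j" "Suc j < N"
  shows "Tinv_op j (omega_op N f) = omega_op N (Tinv_op (Suc j) f)"
  using T_op_omega_op[OF assms, of "Tinv_op (Suc j) f"] by (metis Tinv_T_op T_Tinv_op)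

lemma Tinv_op_omega_op_sq:
  assumes "2 \<le> N"
  shows "Tinv_op (N - 1) (omega_op N (omega_op N f)) = omega_op N (omega_op N (Tinv_op 1 f))"
  using T_op_omega_op_sq[OF assms, of "Tinv_op 1 f"] by (metis Tinv_T_op T_Tinv_op)

lemma Y_op_eq: "Y_op N i f = const (tvar powi (int i - int N)) * TT i N (omega_op N (TI i f))"
  by (simp add: Y_op_def TT_def TI_def inv_T_op)

lemma linear_op_Y_op [simp]: "N \<ge> 1 \<Longrightarrow> linear_op (Y_op N i)"
  unfolding Y_op_eq[abs_def]
  by (rule linear_op_scale[OF linear_op_comp[OF linear_op_TT linear_op_comp[OF linear_op_omega_op linear_op_TI]]])

text \<open>Going from \<open>Y_op N i\<close> to \<open>Y_op N (Suc i)\<close> removes the first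
  \<open>T_op i\<close> on the left and adds an inverse one on the right. The remaining t is the
  ratio of the normalizing powers.\<close>

lemma T_Y_T:
  assumes "1 \<le> i" "i < N"
  shows "T_op i (Y_op N (Suc i) (T_op i f)) = const tvar * Y_op N i f"
proof -
  have "tvar powi (int (Suc i) - int N) = tvar * tvar powi (int i - int N)"
    using power_int_add[of tvar 1 "int i - int N"] by (simp add: algebra_simps)
  thus ?thesis using assms
    by (simp add: Y_op_eq TI_Suc TT_rec T_op_const_mult const_mult mult.assoc)
qed

lemma T_op_TT:
  assumes "i < j" "j < N"
  shows "T_op j (TT i N f) = TT i N (T_op (j - 1) f)"
proof -
  obtain k where j: "j = Suc k" using assms by (cases j) auto
  have *: "TT i N g = TT i k (T_op k (T_op (Suc k) (TT (Suc (Suc k)) N g)))" for g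
    using assms j TT_split[of i k N g] by (simp add: TT_rec)
  have 1: "T_op j (TT i k g) = TT i k (T_op j g)" for g
    unfolding TT_def by (rule comp_ops_intertwine) (auto simp: j intro!: T_op_commute)
  have 2: "T_op k (TT (Suc (Suc k)) N g) = TT (Suc (Suc k)) N (T_op k g)" for g
    unfolding TT_def by (rule comp_ops_intertwine) (auto intro!: T_op_commute)
  show ?thesis
    unfolding * 1 unfolding j diff_Suc_1 T_op_braid[symmetric] 2 ..
qed

lemma T_op_TI:
  assumes "1 \<le> j" "Suc j < i"
  shows "T_op (Suc j) (TI i f) = TI i (T_op j f)"
proof -
  have "[1..<i] = [1..<j] @ [j, Suc j] @ [Suc (Suc j)..<i]"
    using assms upt_add_eq_append[of 1 j "i - j"] by (simp add: upt_conv_Cons)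
  hence *: "TI i g = TI j (Tinv_op j (Tinv_op (Suc j) (comp_ops (map Tinv_op [Suc (Suc j)..<i]) g)))" for g
    by (simp add: TI_def)
  have 1: "T_op (Suc j) (TI j g) = TI j (T_op (Suc j) g)" for g
    unfolding TI_def by (rule comp_ops_intertwine) (auto intro!: T_op_Tinv_op_commute)
  have 2: "T_op j (comp_ops (map Tinv_op [Suc (Suc j)..<i]) g) = comp_ops (map Tinv_op [Suc (Suc j)..<i]) (T_op j g)" for g
    by (rule comp_ops_intertwine) (auto intro!: T_op_Tinv_op_commute)
  show ?thesis
    unfolding * 1 T_op_Tinv_op_braid 2 ..
qed

text \<open>The index moves and returns. For \<open>j < i\<close> it is raised by
  \<open>omega_op\<close> and lowered again by a braid relation in \<open>TI\<close>; for
  \<open>j > i\<close> a braid relation in \<open>TT\<close> lowers it and \<open>omega_op\<close>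
  raises it back.\<close>

lemma T_Y_commute:
  assumes "1 \<le> i" "i \<le> N" "1 \<le> j" "j < N" "j \<noteq> i" "Suc j \<noteq> i"
  shows "T_op j (Y_op N i f) = Y_op N i (T_op j f)"
proof (cases "j < i")
  case True
  have "T_op j (TT i N g) = TT i N (T_op j g)" for g
    unfolding TT_def by (rule comp_ops_intertwine) (use True assms in \<open>auto intro!: T_op_commute\<close>)
  thus ?thesis using True assms
    by (simp add: Y_op_eq T_op_const_mult T_op_omega_op T_op_TI)
next
  case False
  have "T_op j (TI i g) = TI i (T_op j g)" for g
    unfolding TI_def by (rule comp_ops_intertwine) (use False assms in \<open>auto intro!: T_op_Tinv_op_commute\<close>)
  moreover obtain k where "j = Suc k" using assms by (cases j) auto
  ultimately show ?thesis using False assms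
    by (simp add: Y_op_eq T_op_const_mult T_op_omega_op T_op_TT)
qed

text \<open>The affine raising operator of Knop and Sahi.\<close>

definition Phi_op :: "nat \<Rightarrow> mpoly \<Rightarrow> mpoly" where
  "Phi_op N f = xvar N * omega_op N f"

lemma linear_op_Phi_op: "N \<ge> 1 \<Longrightarrow> linear_op (Phi_op N)"
  using linear_op_omega_op[of N] by (auto simp: linear_op_def Phi_op_def algebra_simps)

lemma TT_mult_invariant:
  assumes "N < k"
  shows "TT i N (xvar k * f) = xvar k * TT i N f"
  unfolding TT_def
  by (rule comp_ops_intertwine[where A = "\<lambda>f. xvar k * f", symmetric])
     (use assms in \<open>auto simp: T_op_T_gen intro!: T_gen_mult_invariant[symmetric]\<close>)

lemma TI_mult_invariant:
  assumes "i < k"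
  shows "TI i (xvar k * f) = xvar k * TI i f"
  unfolding TI_def
  by (rule comp_ops_intertwine[where A = "\<lambda>f. xvar k * f", symmetric])
     (use assms in \<open>auto intro!: T_gen_inv_mult_invariant[symmetric]\<close>)

text \<open>The factor \<open>x_N\<close> becomes \<open>x_(N-1)\<close> under
  \<open>omega_op\<close>; on passing \<open>T_op (N - 1)\<close> it returns as \<open>x_N\<close>
  and turns that T into its inverse. Moved through both copies of \<open>omega_op\<close>, this
  inverse is the missing first factor of \<open>TI (Suc i)\<close>.\<close>

lemma Y_Phi:
  assumes "1 \<le> i" "i < N"
  shows "Y_op N i (Phi_op N f) = Phi_op N (Y_op N (Suc i) f)"
proof -
  obtain n where N: "N = Suc n" "1 \<le> n" using assms by (cases N) auto
  let ?S = "comp_ops (map (\<lambda>k. Tinv_op (Suc k)) [1..<i])"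
  have S: "TI i (omega_op N g) = omega_op N (?S g)" for g
    unfolding TI_def by (rule comp_ops_intertwine[symmetric]) (use assms in \<open>auto simp: Tinv_op_omega_op\<close>)
  have "map (\<lambda>k. Tinv_op (Suc k)) [1..<i] = map Tinv_op [Suc 1..<Suc i]"
    by (simp add: map_Suc_upt[symmetric] del: upt_Suc)
  hence S': "Tinv_op 1 (?S g) = TI (Suc i) g" for g
  proof -
    have "[1..<Suc i] = 1 # [Suc 1..<Suc i]" by (rule upt_conv_Cons) (use assms in simp)
    thus ?thesis unfolding TI_def \<open>map (\<lambda>k. Tinv_op (Suc k)) [1..<i] = _\<close> by simp
  qed
  have sh: "TT i n (omega_op N g) = omega_op N (TT (Suc i) N g)" for g
  proof -
    have "TT i n (omega_op N g) = omega_op N (comp_ops (map (\<lambda>k. T_op (Suc k)) [i..<n]) g)"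
      unfolding TT_def by (rule comp_ops_intertwine[symmetric]) (use assms N in \<open>auto simp: T_op_omega_op\<close>)
    also have "map (\<lambda>k. T_op (Suc k)) [i..<n] = map T_op [Suc i..<Suc n]"
      by (simp add: map_Suc_upt[symmetric] del: upt_Suc)
    finally show ?thesis by (simp add: TT_def N)
  qed
  have "TI i (Phi_op N f) = xvar N * omega_op N (?S f)"
    using assms by (simp add: Phi_op_def TI_mult_invariant S)
  hence "omega_op N (TI i (Phi_op N f)) = xvar n * omega_op N (omega_op N (?S f))"
    using omega_op_xvar_mult(2)[of N N] N by simp
  hence "T_op n (omega_op N (TI i (Phi_op N f))) = const tvar * (xvar N * Tinv_op n (omega_op N (omega_op N (?S f))))"
    by (simp add: T_op_T_gen T_gen_xvar_mult N)
  also have "\<dots> = const tvar * (xvar N * omega_op N (omega_op N (TI (Suc i) f)))"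
    using Tinv_op_omega_op_sq[of N "?S f"] N S' by simp
  finally have "TT i N (omega_op N (TI i (Phi_op N f))) =
      const tvar * (xvar N * omega_op N (TT (Suc i) N (omega_op N (TI (Suc i) f))))"
    using assms N
    by (simp add: TT_Suc linear_op_const_mult[of "TT i n"] TT_mult_invariant sh[unfolded N])
  moreover have "tvar powi (int (Suc i) - int N) = tvar powi (int i - int N) * tvar"
    using power_int_add[of tvar "int i - int N" 1] by (simp add: algebra_simps)
  ultimately show ?thesis using assms
    by (simp add: Y_op_eq Phi_op_def linear_op_const_mult[of "omega_op N"] const_mult mult.left_commute mult.assoc)
qed

lemma TI_xvar_mult: "TI (Suc n) (xvar (Suc n) * f) = const (inverse tvar ^ n) * (xvar 1 * TT 1 (Suc n) f)"
proof (induction n arbitrary: f)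
  case (Suc n)
  have "TI (Suc (Suc n)) (xvar (Suc (Suc n)) * f) = const (inverse tvar) * TI (Suc n) (xvar (Suc n) * T_op (Suc n) f)"
    by (simp add: TI_Suc T_gen_inv_xvar_mult T_op_T_gen linear_op_const_mult[of "TI (Suc n)"])
  thus ?case by (simp add: Suc TT_Suc const_mult mult.assoc)
qed simp

text \<open>Here the chain \<open>TI N\<close> itself carries \<open>x_N\<close> down to
  \<open>x_1\<close>, converting every inverse into a T, and \<open>omega_op\<close> sends
  \<open>x_1\<close> to \<open>q x_N\<close>. This wrap-around is the source of the extra q that
  raises the moved entry by one.\<close>

lemma Y_Phi_last:
  assumes "1 \<le> N"
  shows "Y_op N N (Phi_op N f) = const qvar * Phi_op N (Y_op N 1 f)"
proof -
  obtain n where N: "N = Suc n" using assms by (cases N) auto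
  have "Y_op N N (Phi_op N f) = omega_op N (TI N (xvar N * omega_op N f))"
    by (simp add: Y_op_eq Phi_op_def)
  also have "\<dots> = const (inverse tvar ^ n) * (const qvar * (xvar N * omega_op N (TT 1 N (omega_op N f))))"
    using TI_xvar_mult[of n "omega_op N f"] omega_op_xvar_mult(1)[of N] N
    by (simp add: linear_op_const_mult[OF linear_op_omega_op])
  also have "inverse tvar ^ n = tvar powi (int 1 - int N)"
    by (simp add: N power_int_minus flip: power_int_of_nat power_int_inverse)
  finally show ?thesis using assms
    by (simp add: Y_op_eq Phi_op_def linear_op_const_mult[of "omega_op N"] mult.left_commute)
qed

section \<open>Length of permutations and the Bruhat order\<close>

definition inversions :: "nat \<Rightarrow> (nat \<Rightarrow> nat) \<Rightarrow> (nat \<times> nat) set" where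
  "inversions N \<sigma> = {(a, b). 1 \<le> a \<and> a < b \<and> b \<le> N \<and> \<sigma> b < \<sigma> a}"

lemma finite_inversions [simp]: "finite (inversions N \<sigma>)"
  by (rule finite_subset[of _ "{1..N} \<times> {1..N}"]) (auto simp: inversions_def)

lemma inversions_id [simp]: "inversions N id = {}"
  by (auto simp: inversions_def)

lemma transpose_Suc_less_iff:
  "x \<noteq> y \<Longrightarrow> \<not> (x = i \<and> y = Suc i) \<Longrightarrow> \<not> (x = Suc i \<and> y = i) \<Longrightarrow>
   transpose i (Suc i) x < transpose i (Suc i) y \<longleftrightarrow> x < y"
  unfolding transpose_def by (simp split: if_splits; linarith)

lemma inversions_transpose_ascent:
  assumes "\<sigma> permutes {1..N}" "1 \<le> i" "i < N" "inv \<sigma> i < inv \<sigma> (Suc i)"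
  shows "inversions N (transpose i (Suc i) \<circ> \<sigma>) = insert (inv \<sigma> i, inv \<sigma> (Suc i)) (inversions N \<sigma>)"
    "(inv \<sigma> i, inv \<sigma> (Suc i)) \<notin> inversions N \<sigma>"
proof -
  have inv: "\<sigma> (inv \<sigma> x) = x" "inv \<sigma> (\<sigma> x) = x" for x
    using permutes_inverses[OF assms(1)] by auto
  have range: "inv \<sigma> i \<in> {1..N}" "inv \<sigma> (Suc i) \<in> {1..N}"
    using permutes_in_image[OF permutes_inv[OF assms(1)], of i]
      permutes_in_image[OF permutes_inv[OF assms(1)], of "Suc i"] assms(2,3) by simp_all
  show "(inv \<sigma> i, inv \<sigma> (Suc i)) \<notin> inversions N \<sigma>"
    by (simp add: inversions_def inv)
  show "inversions N (transpose i (Suc i) \<circ> \<sigma>) = insert (inv \<sigma> i, inv \<sigma> (Suc i)) (inversions N \<sigma>)"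
  proof (intro equalityI subsetI)
    fix p assume p: "p \<in> inversions N (transpose i (Suc i) \<circ> \<sigma>)"
    obtain a b where [simp]: "p = (a, b)" by (cases p)
    have ab: "1 \<le> a" "a < b" "b \<le> N" "transpose i (Suc i) (\<sigma> b) < transpose i (Suc i) (\<sigma> a)"
      using p by (auto simp: inversions_def)
    have "\<sigma> a \<noteq> \<sigma> b" using ab by auto
    have "\<not> (\<sigma> b = i \<and> \<sigma> a = Suc i)" using assms(4) inv(2)[of a] inv(2)[of b] ab by auto
    moreover have "p = (inv \<sigma> i, inv \<sigma> (Suc i))" if "\<sigma> a = i" "\<sigma> b = Suc i"
      using inv(2)[of a] inv(2)[of b] that by auto
    ultimately show "p \<in> insert (inv \<sigma> i, inv \<sigma> (Suc i)) (inversions N \<sigma>)"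
      using transpose_Suc_less_iff[of "\<sigma> b" "\<sigma> a" i] ab \<open>\<sigma> a \<noteq> \<sigma> b\<close> by (auto simp: inversions_def)
  next
    fix p assume p: "p \<in> insert (inv \<sigma> i, inv \<sigma> (Suc i)) (inversions N \<sigma>)"
    show "p \<in> inversions N (transpose i (Suc i) \<circ> \<sigma>)"
    proof (cases "p = (inv \<sigma> i, inv \<sigma> (Suc i))")
      case True
      thus ?thesis using assms range by (auto simp: inversions_def inv)
    next
      case False
      obtain a b where [simp]: "p = (a, b)" by (cases p)
      have ab: "1 \<le> a" "a < b" "b \<le> N" "\<sigma> b < \<sigma> a"
        using p False by (auto simp: inversions_def)
      have "\<not> (\<sigma> b = i \<and> \<sigma> a = Suc i)" using assms(4) inv(2)[of a] inv(2)[of b] ab by auto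
      thus ?thesis
        using transpose_Suc_less_iff[of "\<sigma> b" "\<sigma> a" i] ab by (auto simp: inversions_def)
    qed
  qed
qed

lemma card_inversions_transpose_ascent:
  assumes "\<sigma> permutes {1..N}" "1 \<le> i" "i < N" "inv \<sigma> i < inv \<sigma> (Suc i)"
  shows "card (inversions N (transpose i (Suc i) \<circ> \<sigma>)) = Suc (card (inversions N \<sigma>))"
  using inversions_transpose_ascent[OF assms] by simp

lemma permutes_transpose_comp:
  assumes "\<sigma> permutes S" "i \<in> S" "j \<in> S"
  shows "transpose i j \<circ> \<sigma> permutes S"
  using assms by (simp add: permutes_compose permutes_swap_id)

lemma inv_transpose_comp:
  assumes "\<sigma> permutes S"
  shows "inv (transpose i j \<circ> \<sigma>) x = inv \<sigma> (transpose i j x)"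
  using o_inv_distrib[of "transpose i j" \<sigma>] permutes_bij[OF assms] by simp

lemma card_inversions_transpose_descent:
  assumes "\<sigma> permutes {1..N}" "1 \<le> i" "i < N" "inv \<sigma> (Suc i) < inv \<sigma> i"
  shows "Suc (card (inversions N (transpose i (Suc i) \<circ> \<sigma>))) = card (inversions N \<sigma>)"
proof -
  let ?s = "transpose i (Suc i) \<circ> \<sigma>"
  have "?s permutes {1..N}" using assms by (intro permutes_transpose_comp) auto
  moreover have "inv ?s i < inv ?s (Suc i)"
    using assms by (simp add: inv_transpose_comp[OF assms(1)])
  ultimately have "card (inversions N (transpose i (Suc i) \<circ> ?s)) = Suc (card (inversions N ?s))"
    using assms by (intro card_inversions_transpose_ascent) auto
  thus ?thesis by (simp add: o_assoc)
qed

lemma permutes_increasing_imp_id: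
  assumes "f permutes {1..N::nat}" "\<And>i. 1 \<le> i \<Longrightarrow> i < N \<Longrightarrow> f i \<le> f (Suc i)"
  shows "f = id"
proof -
  have f: "f i \<in> {1..N}" if "i \<in> {1..N}" for i
    using permutes_in_image[OF assms(1)] that by blast
  have strict: "f i < f (Suc i)" if "1 \<le> i" "i < N" for i
    using assms(2)[OF that] permutes_inj[OF assms(1)] by (metis inj_eq le_neq_implies_less n_not_Suc_n)
  have 1: "i \<le> f i" if "1 \<le> i" "i \<le> N" for i
    using that
  proof (induction i rule: dec_induct)
    case base thus ?case using f[of 1] by auto
  next
    case (step i) thus ?case using strict[of i] by auto
  qed
  have 2: "f i \<le> i" if "i \<le> N" "1 \<le> i" for i
    using that
  proof (induction rule: inc_induct)
    case base thus ?case using f[of N] by auto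
  next
    case (step i) thus ?case using strict[of i] by auto
  qed
  show ?thesis
  proof
    fix i show "f i = id i"
      using 1[of i] 2[of i] permutes_not_in[OF assms(1), of i] by (cases "i \<in> {1..N}") auto
  qed
qed

lemma exists_descent:
  assumes "\<sigma> permutes {1..N}" "\<sigma> \<noteq> id"
  shows "\<exists>i. 1 \<le> i \<and> i < N \<and> inv \<sigma> (Suc i) < inv \<sigma> i"
proof (rule ccontr)
  assume "\<not> ?thesis"
  hence "inv \<sigma> = id"
    by (intro permutes_increasing_imp_id[OF permutes_inv[OF assms(1)]]) (meson not_less)
  thus False using assms permutes_inv_inv by fastforce
qed

section \<open>Coxeter length as a number of inversions\<close>

lemma word_perm_Nil [simp]: "word_perm [] = id"
  and word_perm_Cons: "word_perm (i # w) = transpose i (Suc i) \<circ> word_perm w"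
  by (simp_all add: word_perm_def)

lemma is_word_permutes: "is_word N \<sigma> w \<Longrightarrow> \<sigma> permutes {1..N}"
proof (induction w arbitrary: \<sigma>)
  case (Cons i w)
  hence "word_perm w permutes {1..N}" by (auto simp: is_word_def)
  thus ?case using Cons.prems by (auto simp: is_word_def word_perm_Cons intro!: permutes_transpose_comp)
qed (auto simp: is_word_def permutes_id)

lemma card_inversions_le_length: "is_word N \<sigma> w \<Longrightarrow> card (inversions N \<sigma>) \<le> length w"
proof (induction w arbitrary: \<sigma>)
  case (Cons i w)
  let ?s = "word_perm w"
  have w: "is_word N ?s w" and i: "1 \<le> i" "i < N" and \<sigma>: "\<sigma> = transpose i (Suc i) \<circ> ?s"
    using Cons.prems by (auto simp: is_word_def word_perm_Cons)
  have p: "?s permutes {1..N}" using w by (rule is_word_permutes)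
  have "inv ?s i \<noteq> inv ?s (Suc i)"
    using permutes_inj[OF permutes_inv[OF p]] by (auto simp: inj_eq)
  hence "card (inversions N \<sigma>) \<le> Suc (card (inversions N ?s))"
    using card_inversions_transpose_ascent[OF p i] card_inversions_transpose_descent[OF p i]
    unfolding \<sigma> by linarith
  thus ?case using Cons.IH[OF w] by simp
qed (auto simp: is_word_def)

lemma exists_word_card_inversions:
  "\<sigma> permutes {1..N} \<Longrightarrow> \<exists>w. is_word N \<sigma> w \<and> length w = card (inversions N \<sigma>)"
proof (induction "card (inversions N \<sigma>)" arbitrary: \<sigma>)
  case 0
  have "\<sigma> = id"
  proof (rule ccontr)
    assume "\<sigma> \<noteq> id"
    then obtain i where "1 \<le> i" "i < N" "inv \<sigma> (Suc i) < inv \<sigma> i"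
      using exists_descent 0 by blast
    from card_inversions_transpose_descent[OF 0(2) this] 0 show False by simp
  qed
  hence "is_word N \<sigma> []" by (simp add: is_word_def)
  thus ?case using 0(1) by (metis list.size(3))
next
  case (Suc n)
  have "\<sigma> \<noteq> id" using Suc(2) by auto
  then obtain i where i: "1 \<le> i" "i < N" "inv \<sigma> (Suc i) < inv \<sigma> i"
    using exists_descent Suc by blast
  let ?s = "transpose i (Suc i) \<circ> \<sigma>"
  have "n = card (inversions N ?s)" "?s permutes {1..N}"
    using card_inversions_transpose_descent[OF Suc(3) i] Suc(2,3) i
    by (auto intro!: permutes_transpose_comp)
  then obtain w where "is_word N ?s w" "length w = n" using Suc(1) by metis
  hence "is_word N \<sigma> (i # w)" "length (i # w) = Suc n"
    using i by (auto simp: is_word_def word_perm_Cons o_assoc)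
  thus ?case using Suc(2) by metis
qed

text \<open>Each letter of a word changes the number of inversions by exactly one, and removing
  descents one at a time reaches the identity; the two bounds meet.\<close>

lemma perm_length_eq: 
  assumes "\<sigma> permutes {1..N}"
  shows "perm_length N \<sigma> = card (inversions N \<sigma>)"
  unfolding perm_length_def
  using exists_word_card_inversions[OF assms] card_inversions_le_length
  by (intro Least_equality) auto

lemma perm_length_less_comp_transpose:
  assumes u: "u permutes {1..N}" and ab: "1 \<le> a" "a < b" "b \<le> N" "u a < u b"
  shows "perm_length N u < perm_length N (u \<circ> transpose a b)"
proof -
  let ?s = "transpose a b" and ?v = "u \<circ> transpose a b"
  have v: "?v permutes {1..N}" using u ab by (intro permutes_compose permutes_swap_id) auto
  \<comment> \<open>An inversion of \<open>u\<close> is moved along by the exchange if the moved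
    pair is still increasing, and kept otherwise. Either way it is an inversion of
    \<open>?v\<close>, and \<open>(a, b)\<close> is never hit.\<close>
  define \<phi> where "\<phi> = (\<lambda>(c, d). if ?s c < ?s d then (?s c, ?s d) else (c, d))"
  have s: "?s c \<in> {1..N}" if "c \<in> {1..N}" for c
    using that ab by (auto simp: transpose_def)
  have "inj_on \<phi> (inversions N u)"
  proof (rule inj_onI)
    fix p p' assume pp: "p \<in> inversions N u" "p' \<in> inversions N u" "\<phi> p = \<phi> p'"
    obtain c d c' d' where [simp]: "p = (c, d)" "p' = (c', d')" by (cases p, cases p')
    have "c < d" "c' < d'" using pp by (auto simp: inversions_def)
    have "c = c' \<and> d = d'"
      using pp(3) \<open>c < d\<close> \<open>c' < d'\<close>
      by (auto simp: \<phi>_def split: if_splits dest: injD[OF inj_transpose[of a b]])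
    thus "p = p'" by simp
  qed
  moreover have "\<phi> ` inversions N u \<subseteq> inversions N ?v - {(a, b)}"
  proof
    fix p' assume "p' \<in> \<phi> ` inversions N u"
    then obtain c d where cd: "1 \<le> c" "c < d" "d \<le> N" "u d < u c" "p' = \<phi> (c, d)"
      by (auto simp: inversions_def)
    have ne: "(c, d) \<noteq> (a, b)" using cd ab by auto
    show "p' \<in> inversions N ?v - {(a, b)}"
    proof (cases "?s c < ?s d")
      case True
      thus ?thesis using cd s[of c] s[of d] ab by (auto simp: \<phi>_def inversions_def transpose_def)
    next
      case False
      have "c = a \<and> d \<noteq> b \<and> d < b \<or> d = b \<and> c \<noteq> a \<and> a < c"
        using False cd ne ab by (auto simp: transpose_def split: if_splits)
      thus ?thesis using False cd ab by (auto simp: \<phi>_def inversions_def transpose_def)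
    qed
  qed
  moreover have "(a, b) \<in> inversions N ?v" using ab by (auto simp: inversions_def)
  ultimately have "card (inversions N u) < card (inversions N ?v)"
    by (meson card_inj_on_le card_Diff1_less finite_Diff finite_inversions le_less_trans)
  thus ?thesis using perm_length_eq[OF u] perm_length_eq[OF v] by simp
qed

lemma bruhat_less_length: "bruhat_less N u v \<Longrightarrow> perm_length N u < perm_length N v"
  unfolding bruhat_less_def
  by (induction rule: tranclp_induct) (auto simp: bruhat_step_def)

lemma bruhat_less_irrefl: "\<not> bruhat_less N u u"
  using bruhat_less_length by blast

lemma bruhat_less_trans: "bruhat_less N u v \<Longrightarrow> bruhat_less N v w \<Longrightarrow> bruhat_less N u w"
  unfolding bruhat_less_def by (rule tranclp_trans)

section \<open>The order on compositions\<close>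

lemma strictly_dominated_trans:
  assumes "strictly_dominated \<mu> \<nu>" "strictly_dominated \<nu> \<kappa>" "length \<mu> = length \<nu>" "length \<nu> = length \<kappa>"
  shows "strictly_dominated \<mu> \<kappa>"
proof -
  have le: "sum_list (take k \<mu>) \<le> sum_list (take k \<nu>)" "sum_list (take k \<nu>) \<le> sum_list (take k \<kappa>)" for k
    using assms by (auto simp: strictly_dominated_def)
  have "\<mu> \<noteq> \<kappa>"
  proof
    assume "\<mu> = \<kappa>"
    hence e: "sum_list (take k \<mu>) = sum_list (take k \<nu>)" for k
      using le[of k] by simp
    have "\<mu> ! k = \<nu> ! k" if "k < length \<mu>" for k
      using e[of "Suc k"] e[of k] that assms by (simp add: take_Suc_conv_app_nth)
    hence "\<mu> = \<nu>" using assms by (intro nth_equalityI) auto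
    thus False using assms by (auto simp: strictly_dominated_def)
  qed
  thus ?thesis using assms le unfolding strictly_dominated_def by (metis le_trans)
qed

lemma strictly_dominated_irrefl: "\<not> strictly_dominated \<mu> \<mu>"
  by (simp add: strictly_dominated_def)

lemma length_decr [simp]: "length (decr \<eta>) = length \<eta>"
  and mset_decr [simp]: "mset (decr \<eta>) = mset \<eta>"
  and sorted_decr: "sorted_wrt (\<ge>) (decr \<eta>)"
  by (simp_all add: decr_def sorted_wrt_rev)

lemma decr_eq_iff: "decr \<eta> = decr \<nu> \<longleftrightarrow> mset \<eta> = mset \<nu>"
  by (metis decr_def mset_decr mset_sort properties_for_sort sorted_sort)

lemma comp_prec_irrefl: "\<not> comp_prec \<eta> \<eta>"
  by (simp add: comp_prec_def strictly_dominated_irrefl bruhat_less_irrefl)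

lemma comp_prec_trans:
  assumes "comp_prec \<mu> \<nu>" "comp_prec \<nu> \<kappa>"
  shows "comp_prec \<mu> \<kappa>"
  using assms strictly_dominated_trans[of "decr \<mu>" "decr \<nu>" "decr \<kappa>"]
    bruhat_less_trans[of "length \<mu>"]
  by (auto simp: comp_prec_def)

lemma comp_prec_length: "comp_prec \<nu> \<eta> \<Longrightarrow> length \<nu> = length \<eta>"
  by (simp add: comp_prec_def)

lemma comp_prec_sum_list: "comp_prec \<nu> \<eta> \<Longrightarrow> sum_list \<nu> = sum_list \<eta>"
proof -
  assume "comp_prec \<nu> \<eta>"
  hence "sum_list (decr \<nu>) = sum_list (decr \<eta>)"
    by (auto simp: comp_prec_def strictly_dominated_def)
  thus ?thesis by (metis mset_decr sum_mset_sum_list)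
qed

text \<open>With this bound dominance can be checked by exhibiting sub-multisets of equal size,
  without locating changed parts after sorting. In the induction the head is compared with an
  element of \<open>A\<close>, the head itself if it is there.\<close>

lemma sum_mset_le_sum_take:
  fixes xs :: "nat list"
  assumes "sorted_wrt (\<ge>) xs" "A \<subseteq># mset xs"
  shows "sum_mset A \<le> sum_list (take (size A) xs)"
  using assms
proof (induction xs arbitrary: A)
  case (Cons x xs)
  show ?case
  proof (cases "A = {#}")
    case False
    obtain y where y: "y \<in># A" "A - {#y#} \<subseteq># mset xs"
    proof (cases "x \<in># A")
      case True
      hence "A - {#x#} \<subseteq># mset xs" using Cons.prems by (simp add: subset_eq_diff_conv)
      with True that show ?thesis by blast
    next
      case f: False
      hence "A \<subseteq># mset xs" using Cons.prems
        by (metis Diff_eq_empty_iff_mset add_mset_add_single diff_diff_add_mset diff_single_trivial diff_union_swap2 diff_add_mset_swap mset.simps(2) subset_eq_diff_conv)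
      moreover obtain y where "y \<in># A" using False by auto
      moreover have "A - {#y#} \<subseteq># A" by simp
      ultimately show ?thesis using that by (meson subset_mset.order_trans)
    qed
    have "y \<le> x" using y(1) Cons.prems mset_subset_eqD[OF Cons.prems(2)] by auto
    moreover have "sum_mset (A - {#y#}) \<le> sum_list (take (size (A - {#y#})) xs)"
      using Cons.prems y by (intro Cons.IH) auto
    moreover have A: "A = add_mset y (A - {#y#})" using y by simp
    hence "size A = Suc (size (A - {#y#}))" "sum_mset A = y + sum_mset (A - {#y#})"
      by (metis size_add_mset, metis sum_mset.add_mset)
    ultimately show ?thesis by simp
  qed simp
qed simp

lemma mset_take_subset: "mset (take k xs) \<subseteq># mset xs"
  by (metis append_take_drop_id mset_append mset_subset_eq_add_left)

text \<open>The \<open>n\<close> largest parts of \<open>\<nu>\<close> are compared with a choice of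
  \<open>n\<close> parts of \<open>\<eta>\<close>: unchanged parts are kept, one changed part is
  traded for \<open>a\<close>, both together for \<open>a\<close> and \<open>b\<close>. The bound
  \<open>k < a - b\<close> excludes the plain exchange, which gives the same partition.\<close>

lemma strictly_dominated_squeeze:
  fixes a b k :: nat
  assumes \<eta>: "mset \<eta> = M + {#a, b#}" and \<nu>: "mset \<nu> = M + {#a - k, b + k#}"
    and k: "0 < k" "k < a - b"
  shows "strictly_dominated (decr \<nu>) (decr \<eta>)"
proof -
  have "sum_mset (mset (decr \<nu>)) = sum_mset (mset (decr \<eta>))" using k by (simp add: \<eta> \<nu>)
  hence s: "sum_list (decr \<nu>) = sum_list (decr \<eta>)" by (simp only: sum_mset_sum_list)
  have ne: "decr \<nu> \<noteq> decr \<eta>"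
  proof
    assume "decr \<nu> = decr \<eta>"
    hence "mset \<nu> = mset \<eta>" by (simp only: decr_eq_iff)
    hence "{#a - k, b + k#} = {#a, b#}" unfolding \<eta> \<nu> by (rule add_left_imp_eq)
    hence "a \<in># {#a - k, b + k#}" by simp
    thus False using k by auto
  qed
  have "sum_list (take n (decr \<nu>)) \<le> sum_list (take n (decr \<eta>))" for n
  proof (cases "n \<le> length \<nu>")
    case n: True
    define A where "A = mset (take n (decr \<nu>))"
    have A: "A \<subseteq># M + {#a - k, b + k#}"
      unfolding A_def using mset_take_subset[of n "decr \<nu>"] by (simp add: \<nu>)
    have size: "size A = n" using n by (simp add: A_def)
    have "\<exists>B. B \<subseteq># mset \<eta> \<and> size B = size A \<and> sum_mset A \<le> sum_mset B"
    proof -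
      \<comment> \<open>Taking the unchanged parts first leaves in \<open>D\<close> at most the two
        changed ones, even if a changed part equals an unchanged one.\<close>
      define C where "C = A \<inter># M"
      define D where "D = A - C"
      have AC: "A = C + D" by (simp add: C_def D_def multiset_eq_iff min_def)
      have CM: "C \<subseteq># M" by (simp add: C_def)
      have D: "D \<subseteq># {#a - k, b + k#}"
      proof -
        have "D = A - M" by (simp add: D_def C_def multiset_eq_iff)
        thus ?thesis using A by (simp add: subset_eq_diff_conv add.commute)
      qed
      define E where "E = (if D = {#} then {#} else if size D = 1 then {#a#} else {#a, b#})"
      have Dc: "D = {#} \<or> D = {#a - k#} \<or> D = {#b + k#} \<or> D = {#a - k, b + k#}"
      proof -
        have "size D \<le> 2" using size_mset_mono[OF D] by simp
        moreover have "size D = 2 \<Longrightarrow> D = {#a - k, b + k#}"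
          using D by (metis mset_subset_size size_add_mset size_single less_irrefl numeral_2_eq_2 One_nat_def subset_mset.le_imp_less_or_eq)
        moreover have "size D = 1 \<Longrightarrow> D = {#a - k#} \<or> D = {#b + k#}"
        proof -
          assume "size D = 1"
          then obtain d where "D = {#d#}" using size_1_singleton_mset[of D] by auto
          moreover have "d = a - k \<or> d = b + k" using D \<open>D = {#d#}\<close> by (auto dest: mset_subset_eqD)
          ultimately show ?thesis by auto
        qed
        ultimately show ?thesis by (metis One_nat_def le_SucE le_zero_eq numeral_2_eq_2 size_eq_0_iff_empty)
      qed
      have "E \<subseteq># {#a, b#}" "size E = size D" "sum_mset D \<le> sum_mset E"
        using Dc k by (auto simp: E_def)
      moreover from this CM have "C + E \<subseteq># mset \<eta>"
        unfolding \<eta> by (intro subset_mset.add_mono)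
      ultimately have "C + E \<subseteq># mset \<eta>" "size (C + E) = size A" "sum_mset A \<le> sum_mset (C + E)"
        by (simp_all add: AC)
      thus ?thesis by blast
    qed
    then obtain B where B: "B \<subseteq># mset (decr \<eta>)" "size B = n" "sum_mset A \<le> sum_mset B"
      using size by auto
    have "sum_list (take n (decr \<nu>)) = sum_mset A" by (simp add: A_def sum_mset_sum_list)
    also have "\<dots> \<le> sum_mset B" by (rule B)
    also have "\<dots> \<le> sum_list (take n (decr \<eta>))"
      using sum_mset_le_sum_take[OF sorted_decr B(1)] B(2) by simp
    finally show ?thesis .
  next
    case False
    moreover have "length \<nu> = length \<eta>" using arg_cong[OF \<eta>, of size] arg_cong[OF \<nu>, of size] by simp
    ultimately show ?thesis using s by simp
  qed
  thus ?thesis using ne s by (simp add: strictly_dominated_def)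
qed

text \<open>The permutation of minimal length keeps the order of equal entries; this makes it the inverse of
  the rank function.\<close>

definition stable_sorting :: "nat list \<Rightarrow> (nat \<Rightarrow> nat) \<Rightarrow> bool" where
  "stable_sorting \<eta> w \<longleftrightarrow> w permutes {1..length \<eta>} \<and>
     (\<forall>i\<in>{1..length \<eta>}. \<eta> ! (w i - 1) = decr \<eta> ! (i - 1)) \<and>
     (\<forall>a b. 1 \<le> a \<longrightarrow> a < b \<longrightarrow> b \<le> length \<eta> \<longrightarrow> decr \<eta> ! (a - 1) = decr \<eta> ! (b - 1) \<longrightarrow> w a < w b)"

lemma stable_sorting_less_iff:
  assumes w: "stable_sorting \<eta> w" and ab: "a \<in> {1..length \<eta>}" "b \<in> {1..length \<eta>}"
  shows "b \<le> a \<longleftrightarrow> \<eta> ! (w b - 1) > \<eta> ! (w a - 1) \<or> \<eta> ! (w b - 1) = \<eta> ! (w a - 1) \<and> w b \<le> w a"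
proof -
  have e: "\<eta> ! (w a - 1) = decr \<eta> ! (a - 1)" "\<eta> ! (w b - 1) = decr \<eta> ! (b - 1)"
    using w ab by (auto simp: stable_sorting_def)
  have mono: "decr \<eta> ! (y - 1) \<le> decr \<eta> ! (x - 1)" if "1 \<le> x" "x < y" "y \<le> length \<eta>" for x y
    using sorted_wrt_nth_less[OF sorted_decr[of \<eta>], of "x - 1" "y - 1"] that by auto
  have tie: "w x < w y" if "1 \<le> x" "x < y" "y \<le> length \<eta>" "decr \<eta> ! (x - 1) = decr \<eta> ! (y - 1)" for x y
    using w that by (auto simp: stable_sorting_def)
  consider "a = b" | "a < b" | "b < a" by linarith
  thus ?thesis
  proof cases
    case 2
    thus ?thesis using mono[of a b] tie[of a b] ab e by fastforce
  next
    case 3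
    thus ?thesis using mono[of b a] tie[of b a] ab e by fastforce
  qed simp
qed

lemma stable_sorting_rank:
  assumes w: "stable_sorting \<eta> w" and a: "a \<in> {1..length \<eta>}"
  shows "eta_rank \<eta> (w a) = a"
proof -
  let ?N = "length \<eta>"
  let ?A = "{j \<in> {1..?N}. \<eta> ! (j - 1) > \<eta> ! (w a - 1)}"
  let ?B = "{j \<in> {1..w a}. \<eta> ! (j - 1) = \<eta> ! (w a - 1)}"
  have perm: "w permutes {1..?N}" using w by (simp add: stable_sorting_def)
  have wa: "w a \<in> {1..?N}" using permutes_in_image[OF perm] a by blast
  have "w ` {1..a} = ?A \<union> ?B"
  proof (intro equalityI subsetI)
    fix j assume "j \<in> w ` {1..a}"
    then obtain b where b: "j = w b" "1 \<le> b" "b \<le> a" by auto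
    have "w b \<in> {1..?N}" using permutes_in_image[OF perm] a b by auto
    thus "j \<in> ?A \<union> ?B" using stable_sorting_less_iff[OF w a, of b] a b by auto
  next
    fix j assume j: "j \<in> ?A \<union> ?B"
    have jN: "j \<in> {1..?N}" using j wa by auto
    obtain b where b: "j = w b" "b \<in> {1..?N}"
      using permutes_image[OF perm] jN by (metis imageE)
    have "b \<le> a" using stable_sorting_less_iff[OF w a b(2)] j b by auto
    thus "j \<in> w ` {1..a}" using b by auto
  qed
  hence "card (?A \<union> ?B) = a"
    using card_image[of w "{1..a}"] inj_on_subset[OF permutes_inj[OF perm]] by simp
  moreover have "card (?A \<union> ?B) = card ?A + card ?B"
    by (rule card_Un_disjoint) auto
  ultimately show ?thesis by (simp add: eta_rank_def)
qed

lemma stable_sorting_unique: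
  assumes "stable_sorting \<eta> w" "stable_sorting \<eta> w'"
  shows "w = w'"
proof
  fix a
  have perm: "w permutes {1..length \<eta>}" "w' permutes {1..length \<eta>}"
    using assms by (auto simp: stable_sorting_def)
  show "w a = w' a"
  proof (cases "a \<in> {1..length \<eta>}")
    case True
    obtain b where b: "b \<in> {1..length \<eta>}" "w a = w' b"
      using permutes_image[OF perm(2)] permutes_in_image[OF perm(1), of a] True by (metis imageE)
    have "a = b"
      using stable_sorting_rank[OF assms(1) True] stable_sorting_rank[OF assms(2) b(1)] b(2) by simp
    thus ?thesis using b by simp
  next
    case False
    thus ?thesis using perm permutes_not_in by metis
  qed
qed

lemma exists_sorting_perm:
  "\<exists>w. w permutes {1..length \<eta>} \<and> (\<forall>i\<in>{1..length \<eta>}. \<eta> ! (w i - 1) = decr \<eta> ! (i - 1))"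
proof -
  have "mset (decr \<eta>) = mset \<eta>" by simp
  then obtain f where f: "f permutes {..<length \<eta>}" "permute_list f \<eta> = decr \<eta>"
    using mset_eq_permutation[of "decr \<eta>" \<eta>] by auto
  define w where "w i = (if i \<in> {1..length \<eta>} then Suc (f (i - 1)) else i)" for i
  have fN: "f i < length \<eta> \<longleftrightarrow> i < length \<eta>" for i using permutes_in_image[OF f(1), of i] by simp
  have "bij_betw w {1..length \<eta>} {1..length \<eta>}"
  proof -
    have "inj_on w {1..length \<eta>}"
    proof (rule inj_onI)
      fix x y assume xy: "x \<in> {1..length \<eta>}" "y \<in> {1..length \<eta>}" "w x = w y"
      hence "f (x - 1) = f (y - 1)" by (simp add: w_def)
      hence "x - 1 = y - 1" using permutes_inj[OF f(1)] by (metis injD)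
      thus "x = y" using xy by auto
    qed
    moreover have "w ` {1..length \<eta>} \<subseteq> {1..length \<eta>}"
    proof
      fix y assume "y \<in> w ` {1..length \<eta>}"
      then obtain x where "1 \<le> x" "x \<le> length \<eta>" "y = Suc (f (x - 1))" by (auto simp: w_def)
      thus "y \<in> {1..length \<eta>}" using fN[of "x - 1"] by (simp add: Suc_le_eq)
    qed
    ultimately show ?thesis by (simp add: bij_betw_def endo_inj_surj)
  qed
  hence "w permutes {1..length \<eta>}" by (rule bij_imp_permutes) (auto simp: w_def)
  moreover have "\<eta> ! (w i - 1) = decr \<eta> ! (i - 1)" if "i \<in> {1..length \<eta>}" for i
    using that f permute_list_nth[OF f(1), of "i - 1"] by (auto simp: w_def)
  ultimately show ?thesis by blast
qed

text \<open>Two equal entries in the wrong order could be exchanged by composing with a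
  transposition; the result still sorts and is shorter.\<close>

lemma stable_sorting_min_perm: "stable_sorting \<eta> (min_perm \<eta>)"
proof -
  define P where "P w \<longleftrightarrow> w permutes {1..length \<eta>} \<and>
          (\<forall>i\<in>{1..length \<eta>}. \<eta> ! (w i - 1) = decr \<eta> ! (i - 1))" for w
  define w where "w = min_perm \<eta>"
  obtain w0 where "P w0" using exists_sorting_perm by (auto simp: P_def)
  hence "P w \<and> (\<forall>y. P y \<longrightarrow> perm_length (length \<eta>) w \<le> perm_length (length \<eta>) y)"
    unfolding w_def min_perm_def P_def[symmetric] using arg_min_nat_lemma[of P w0 "perm_length (length \<eta>)"]
    by simp
  hence w: "P w" "\<And>y. P y \<Longrightarrow> perm_length (length \<eta>) w \<le> perm_length (length \<eta>) y" by auto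
  have "w a < w b" if ab: "1 \<le> a" "a < b" "b \<le> length \<eta>" "decr \<eta> ! (a - 1) = decr \<eta> ! (b - 1)" for a b
  proof (rule ccontr)
    assume "\<not> w a < w b"
    moreover have "w a \<noteq> w b" using w ab permutes_inj[of w] by (auto simp: P_def inj_eq)
    ultimately have less: "w b < w a" by simp
    let ?y = "w \<circ> transpose a b"
    have y: "?y permutes {1..length \<eta>}" using w ab by (intro permutes_compose permutes_swap_id) (auto simp: P_def)
    have "P ?y" using y w ab by (auto simp: P_def transpose_def)
    moreover have "perm_length (length \<eta>) ?y < perm_length (length \<eta>) (?y \<circ> transpose a b)"
      using y ab less by (intro perm_length_less_comp_transpose) auto
    hence "perm_length (length \<eta>) ?y < perm_length (length \<eta>) w" by (simp add: o_assoc[symmetric])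
    ultimately show False using w(2)[of ?y] by simp
  qed
  thus ?thesis using w(1) by (simp add: stable_sorting_def P_def w_def)
qed

section \<open>Exchanges of two entries and the order on compositions\<close>

definition swap_list :: "nat \<Rightarrow> nat \<Rightarrow> nat list \<Rightarrow> nat list" where
  "swap_list i j \<eta> = \<eta>[i - 1 := \<eta> ! (j - 1), j - 1 := \<eta> ! (i - 1)]"

lemma length_swap_list [simp]: "length (swap_list i j \<eta>) = length \<eta>"
  by (simp add: swap_list_def)

lemma nth_swap_list:
  assumes "i \<in> {1..length \<eta>}" "j \<in> {1..length \<eta>}" "k \<ge> 1"
  shows "swap_list i j \<eta> ! (k - 1) = \<eta> ! (transpose i j k - 1)"
  using assms by (auto simp: swap_list_def transpose_def nth_list_update)

lemma mset_swap_list: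
  assumes "i \<in> {1..length \<eta>}" "j \<in> {1..length \<eta>}"
  shows "mset (swap_list i j \<eta>) = mset \<eta>"
  unfolding swap_list_def using assms by (intro mset_swap) auto

lemma sum_list_swap_list:
  assumes "i \<in> {1..length \<eta>}" "j \<in> {1..length \<eta>}"
  shows "sum_list (swap_list i j \<eta>) = sum_list \<eta>"
  using mset_swap_list[OF assms] by (metis sum_mset_sum_list)

text \<open>If one of the two values occurred between \<open>i\<close> and \<open>j\<close>, the
  exchange would carry an entry past an equal one. Under \<open>between\<close> this cannot happen,
  so the exchanged permutation is again stable, and stable sortings are unique.\<close>

lemma min_perm_swap_eq:
  assumes ij: "1 \<le> i" "i < j" "j \<le> length \<eta>" "\<eta> ! (j - 1) < \<eta> ! (i - 1)"
    and between: "\<And>k. i < k \<Longrightarrow> k < j \<Longrightarrow> \<eta> ! (k - 1) \<noteq> \<eta> ! (i - 1) \<and> \<eta> ! (k - 1) \<noteq> \<eta> ! (j - 1)"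
  shows "min_perm (swap_list i j \<eta>) = transpose i j \<circ> min_perm \<eta>"
proof -
  let ?N = "length \<eta>" and ?w = "min_perm \<eta>" and ?\<eta>' = "swap_list i j \<eta>"
  let ?w' = "transpose i j \<circ> ?w"
  have st: "stable_sorting \<eta> ?w" by (rule stable_sorting_min_perm)
  hence w: "?w permutes {1..?N}"
      and sorted: "\<And>a. a \<in> {1..?N} \<Longrightarrow> \<eta> ! (?w a - 1) = decr \<eta> ! (a - 1)"
      and tie: "\<And>a b. 1 \<le> a \<Longrightarrow> a < b \<Longrightarrow> b \<le> ?N \<Longrightarrow> decr \<eta> ! (a - 1) = decr \<eta> ! (b - 1) \<Longrightarrow> ?w a < ?w b"
    by (auto simp: stable_sorting_def)
  have nth': "?\<eta>' ! (k - 1) = \<eta> ! (transpose i j k - 1)" if "k \<ge> 1" for k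
    using nth_swap_list[of i \<eta> j k] that ij by auto
  have decr': "decr ?\<eta>' = decr \<eta>" using mset_swap_list[of i \<eta> j] ij by (auto simp: decr_eq_iff)
  have w': "?w' permutes {1..?N}" using w ij by (intro permutes_transpose_comp) auto
  have wN: "?w a \<in> {1..?N}" if "a \<in> {1..?N}" for a using permutes_in_image[OF w] that by blast
  have "stable_sorting ?\<eta>' ?w'"
    unfolding stable_sorting_def length_swap_list decr'
  proof (intro conjI ballI allI impI)
    fix a assume a: "a \<in> {1..?N}"
    have "?w' a \<ge> 1" using permutes_in_image[OF w'] a by auto
    thus "?\<eta>' ! (?w' a - 1) = decr \<eta> ! (a - 1)"
      using nth'[of "?w' a"] sorted[OF a] by simp
  next
    fix a b assume ab: "1 \<le> a" "a < b" "b \<le> ?N" "decr \<eta> ! (a - 1) = decr \<eta> ! (b - 1)"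
    have l: "?w a < ?w b" using tie ab by auto
    have e: "\<eta> ! (?w a - 1) = \<eta> ! (?w b - 1)" using sorted ab by auto
    have 1: "\<not> (?w a = i \<and> ?w b = j)" using e ij by auto
    have 2: "?w b > j" if "?w a = i" "?w b \<noteq> j"
    proof (rule ccontr)
      assume "\<not> ?w b > j"
      hence "i < ?w b" "?w b < j" using that l by linarith+
      from between[OF this] show False using that e by simp
    qed
    have 3: "?w a < i" if "?w b = j" "?w a \<noteq> i"
    proof (rule ccontr)
      assume "\<not> ?w a < i"
      hence "i < ?w a" "?w a < j" using that l by linarith+
      from between[OF this] show False using that e by simp
    qed
    show "?w' a < ?w' b"
    proof (cases "?w a = i")
      case True
      thus ?thesis using 1 2 l ij by (simp add: transpose_def)
    next
      case a: False
      show ?thesis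
      proof (cases "?w b = j")
        case True
        thus ?thesis using a 3 l ij by (simp add: transpose_def)
      next
        case False
        thus ?thesis using a l ij by (simp add: transpose_def)
      qed
    qed
  qed (rule w')
  thus "min_perm ?\<eta>' = ?w'" using stable_sorting_min_perm stable_sorting_unique by blast
qed

lemma min_perm_swap_step:
  assumes ij: "1 \<le> i" "i < j" "j \<le> length \<eta>" "\<eta> ! (j - 1) < \<eta> ! (i - 1)"
    and between: "\<And>k. i < k \<Longrightarrow> k < j \<Longrightarrow> \<eta> ! (k - 1) \<noteq> \<eta> ! (i - 1) \<and> \<eta> ! (k - 1) \<noteq> \<eta> ! (j - 1)"
  shows "bruhat_step (length \<eta>) (min_perm \<eta>) (min_perm (swap_list i j \<eta>))"
proof -
  let ?N = "length \<eta>" and ?w = "min_perm \<eta>" and ?\<eta>' = "swap_list i j \<eta>"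
  let ?w' = "transpose i j \<circ> ?w"
  have eq: "min_perm ?\<eta>' = ?w'" using assms by (rule min_perm_swap_eq)
  have st: "stable_sorting \<eta> ?w" by (rule stable_sorting_min_perm)
  hence w: "?w permutes {1..?N}" by (simp add: stable_sorting_def)
  define a b where "a = inv ?w i" and "b = inv ?w j"
  have ab: "?w a = i" "?w b = j" using permutes_inverses[OF w] by (auto simp: a_def b_def)
  have range: "a \<in> {1..?N}" "b \<in> {1..?N}"
    using permutes_in_image[OF permutes_inv[OF w], of i]
      permutes_in_image[OF permutes_inv[OF w], of j] ij by (simp_all add: a_def b_def)
  have "a < b"
    using stable_sorting_less_iff[OF st range] ab ij by auto
  have comp: "?w' = ?w \<circ> transpose a b"
    using ab permutes_inj[OF w] by (auto simp: fun_eq_iff transpose_def inj_eq)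
  have "perm_length ?N ?w < perm_length ?N (?w \<circ> transpose a b)"
    using range \<open>a < b\<close> ab ij w by (intro perm_length_less_comp_transpose) auto
  thus ?thesis
    unfolding bruhat_step_def eq using w range \<open>a < b\<close> comp by auto
qed

text \<open>Induction on the distance. An entry in between that equals one of the two splits the
  exchange into two shorter ones with the same result; if there is none, the exchange is a single
  Bruhat step.\<close>

lemma bruhat_less_swap:
  assumes "1 \<le> i" "i < j" "j \<le> length \<eta>" "\<eta> ! (j - 1) < \<eta> ! (i - 1)"
  shows "bruhat_less (length \<eta>) (min_perm \<eta>) (min_perm (swap_list i j \<eta>))"
  using assms
proof (induction "j - i" arbitrary: i j \<eta> rule: less_induct)
  case less
  show ?case
  proof (cases "\<exists>k. i < k \<and> k < j \<and> (\<eta> ! (k - 1) = \<eta> ! (i - 1) \<or> \<eta> ! (k - 1) = \<eta> ! (j - 1))")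
    case False
    hence "bruhat_step (length \<eta>) (min_perm \<eta>) (min_perm (swap_list i j \<eta>))"
      using less.prems by (intro min_perm_swap_step) auto
    thus ?thesis unfolding bruhat_less_def by blast
  next
    case True
    then obtain k where k: "i < k" "k < j" "\<eta> ! (k - 1) = \<eta> ! (i - 1) \<or> \<eta> ! (k - 1) = \<eta> ! (j - 1)" by auto
    have nth: "swap_list a b \<nu> ! (c - 1) = \<nu> ! (transpose a b c - 1)"
      if "a \<in> {1..length \<eta>}" "b \<in> {1..length \<eta>}" "c \<ge> 1" "length \<nu> = length \<eta>" for a b c \<nu>
      using nth_swap_list[of a \<nu> b c] that by simp
    show ?thesis
    proof (cases "\<eta> ! (k - 1) = \<eta> ! (i - 1)")
      case eq: True
      let ?\<nu> = "swap_list k j \<eta>"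
      have 1: "bruhat_less (length \<eta>) (min_perm \<eta>) (min_perm ?\<nu>)"
        using less.prems k eq by (intro less.hyps) auto
      have 2: "bruhat_less (length ?\<nu>) (min_perm ?\<nu>) (min_perm (swap_list i k ?\<nu>))"
        using less.prems k eq nth[of k j i \<eta>] nth[of k j k \<eta>]
        by (intro less.hyps diff_less_mono) (auto simp: transpose_def)
      have 3: "swap_list i k ?\<nu> = swap_list i j \<eta>"
      proof (rule nth_equalityI)
        fix p assume "p < length (swap_list i k ?\<nu>)"
        have "swap_list i k ?\<nu> ! (Suc p - 1) = swap_list i j \<eta> ! (Suc p - 1)"
          using less.prems k eq by (subst nth; (subst nth)?; (subst nth)?) (auto simp: transpose_def)
        thus "swap_list i k ?\<nu> ! p = swap_list i j \<eta> ! p" by simp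
      qed simp
      show ?thesis using bruhat_less_trans[OF 1, of "min_perm (swap_list i j \<eta>)"] 2 3 by simp
    next
      case False
      hence eq: "\<eta> ! (k - 1) = \<eta> ! (j - 1)" using k by simp
      let ?\<nu> = "swap_list i k \<eta>"
      have 1: "bruhat_less (length \<eta>) (min_perm \<eta>) (min_perm ?\<nu>)"
        using less.prems k eq by (intro less.hyps) auto
      have 2: "bruhat_less (length ?\<nu>) (min_perm ?\<nu>) (min_perm (swap_list k j ?\<nu>))"
        using less.prems k eq nth[of i k j \<eta>] nth[of i k k \<eta>]
        by (intro less.hyps diff_less_mono2) (auto simp: transpose_def)
      have 3: "swap_list k j ?\<nu> = swap_list i j \<eta>"
      proof (rule nth_equalityI)
        fix p assume "p < length (swap_list k j ?\<nu>)"
        have "swap_list k j ?\<nu> ! (Suc p - 1) = swap_list i j \<eta> ! (Suc p - 1)"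
          using less.prems k eq by (subst nth; (subst nth)?; (subst nth)?) (auto simp: transpose_def)
        thus "swap_list k j ?\<nu> ! p = swap_list i j \<eta> ! p" by simp
      qed simp
      show ?thesis using bruhat_less_trans[OF 1, of "min_perm (swap_list i j \<eta>)"] 2 3 by simp
    qed
  qed
qed

lemma swap_list_swap_list:
  assumes "i \<in> {1..length \<eta>}" "j \<in> {1..length \<eta>}"
  shows "swap_list i j (swap_list i j \<eta>) = \<eta>"
proof (rule nth_equalityI)
  fix p assume "p < length (swap_list i j (swap_list i j \<eta>))"
  have "1 \<le> transpose i j (Suc p)"
    using assms by (cases "Suc p = i \<or> Suc p = j") (auto simp: transpose_apply_other)
  hence "swap_list i j \<eta> ! (transpose i j (Suc p) - 1) = \<eta> ! (Suc p - 1)"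
    using nth_swap_list[OF assms, of "transpose i j (Suc p)"] by simp
  moreover have "swap_list i j (swap_list i j \<eta>) ! (Suc p - 1) = swap_list i j \<eta> ! (transpose i j (Suc p) - 1)"
    using assms by (intro nth_swap_list) auto
  ultimately show "swap_list i j (swap_list i j \<eta>) ! p = \<eta> ! p" by simp
qed simp

lemma perm_length_transpose_comp_le:
  assumes "w permutes {1..N}" "1 \<le> i" "i < N"
  shows "perm_length N (transpose i (Suc i) \<circ> w) \<le> Suc (perm_length N w)"
proof -
  have "inv w i \<noteq> inv w (Suc i)"
    using permutes_inj[OF permutes_inv[OF assms(1)]] by (metis injD n_not_Suc_n)
  hence "card (inversions N (transpose i (Suc i) \<circ> w)) \<le> Suc (card (inversions N w))"
    using card_inversions_transpose_ascent[OF assms] card_inversions_transpose_descent[OF assms] by linarith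
  moreover have "transpose i (Suc i) \<circ> w permutes {1..N}"
    using assms by (intro permutes_transpose_comp) auto
  ultimately show ?thesis using perm_length_eq assms(1) by simp
qed

text \<open>An adjacent exchange of different entries multiplies the sorting permutation by a simple
  transposition, in either direction. The bound stands in for triangularity of the exchange in
  \<open>lookup_T_op_swap\<close>.\<close>

lemma perm_length_min_perm_swap_le:
  assumes "1 \<le> i" "i < length \<eta>"
  shows "perm_length (length \<eta>) (min_perm (swap_list i (Suc i) \<eta>)) \<le> Suc (perm_length (length \<eta>) (min_perm \<eta>))"
proof -
  have ii: "i \<in> {1..length \<eta>}" "Suc i \<in> {1..length \<eta>}" using assms by auto
  have perm: "min_perm \<nu> permutes {1..length \<nu>}" for \<nu>
    using stable_sorting_min_perm by (auto simp: stable_sorting_def)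
  consider "\<eta> ! (i - 1) = \<eta> ! i" | "\<eta> ! i < \<eta> ! (i - 1)" | "\<eta> ! (i - 1) < \<eta> ! i" by linarith
  thus ?thesis
  proof cases
    case 1
    have "swap_list i (Suc i) \<eta> = \<eta>[i - 1 := \<eta> ! (i - 1), i := \<eta> ! i]"
      by (simp only: swap_list_def diff_Suc_1 1[symmetric])
    hence "swap_list i (Suc i) \<eta> = \<eta>" by (simp only: list_update_id)
    thus ?thesis by simp
  next
    case 2
    hence "min_perm (swap_list i (Suc i) \<eta>) = transpose i (Suc i) \<circ> min_perm \<eta>"
      using assms by (intro min_perm_swap_eq) auto
    thus ?thesis using perm_length_transpose_comp_le[OF perm[of \<eta>] assms] by simp
  next
    case 3
    let ?\<nu> = "swap_list i (Suc i) \<eta>"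
    have "?\<nu> ! (Suc i - 1) < ?\<nu> ! (i - 1)"
      using 3 nth_swap_list[OF ii, of i] nth_swap_list[OF ii, of "Suc i"] assms by simp
    hence "min_perm (swap_list i (Suc i) ?\<nu>) = transpose i (Suc i) \<circ> min_perm ?\<nu>"
      using assms by (intro min_perm_swap_eq) auto
    hence "min_perm ?\<nu> = transpose i (Suc i) \<circ> min_perm \<eta>"
      unfolding swap_list_swap_list[OF ii] by (simp add: o_assoc)
    thus ?thesis using perm_length_transpose_comp_le[OF perm[of \<eta>] assms] by simp
  qed
qed

lemma comp_prec_swap:
  assumes "1 \<le> i" "i < j" "j \<le> length \<eta>" "\<eta> ! (j - 1) < \<eta> ! (i - 1)"
  shows "comp_prec (swap_list i j \<eta>) \<eta>"
  using bruhat_less_swap[OF assms] mset_swap_list[of i \<eta> j] assms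
  by (auto simp: comp_prec_def decr_eq_iff)

section \<open>Triangularity of the Cherednik operators\<close>

text \<open>Trailing zeros leave no trace in the monomial, so the map is injective only among lists
  of equal length. The same effect identifies monomials in different numbers of variables
  (\<open>mon_append_0\<close>).\<close>

lift_definition mon :: "nat list \<Rightarrow> monom" is
  "\<lambda>\<eta> k. if 1 \<le> k \<and> k \<le> length \<eta> then \<eta> ! (k - 1) else 0"
  by (rule finite_subset[of _ "{1..length _}"]) (auto split: if_splits)

lemma lookup_mon: "Poly_Mapping.lookup (mon \<eta>) k = (if 1 \<le> k \<and> k \<le> length \<eta> then \<eta> ! (k - 1) else 0)"
  by (simp add: mon.rep_eq)

lemma mon_inject: "length \<eta> = length \<nu> \<Longrightarrow> mon \<eta> = mon \<nu> \<longleftrightarrow> \<eta> = \<nu>"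
proof
  assume "length \<eta> = length \<nu>" "mon \<eta> = mon \<nu>"
  show "\<eta> = \<nu>"
  proof (rule nth_equalityI)
    fix k assume "k < length \<eta>"
    thus "\<eta> ! k = \<nu> ! k"
      using arg_cong[OF \<open>mon \<eta> = mon \<nu>\<close>, of "\<lambda>\<alpha>. Poly_Mapping.lookup \<alpha> (Suc k)"] \<open>length \<eta> = length \<nu>\<close>
      by (simp add: lookup_mon)
  qed fact
qed simp

lemma xvar_power: "xvar i ^ n = Poly_Mapping.single (Poly_Mapping.single i n) 1"
  by (induction n) (simp_all add: xvar_def mult_single flip: single_add)

lemma x_pow_mon: "x_pow \<eta> = Poly_Mapping.single (mon \<eta>) 1"
proof -
  have "(\<Prod>i\<in>A. xvar i ^ h i) = Poly_Mapping.single (\<Sum>i\<in>A. Poly_Mapping.single i (h i)) 1" for A h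
    by (induction A rule: infinite_finite_induct) (simp_all add: xvar_power mult_single)
  moreover have "(\<Sum>i=1..length \<eta>. Poly_Mapping.single i (\<eta> ! (i - 1))) = mon \<eta>"
    by (rule poly_mapping_eqI) (auto simp: lookup_sum lookup_single lookup_mon when_def sum.delta)
  ultimately show ?thesis by (simp add: x_pow_def)
qed

lemma lookup_x_pow: "Poly_Mapping.lookup (x_pow \<eta>) \<alpha> = (if \<alpha> = mon \<eta> then 1 else 0)"
  by (auto simp: x_pow_mon lookup_single)

lemma x_pow_update2:
  assumes "i \<in> {1..length \<eta>}" "j \<in> {1..length \<eta>}" "i \<noteq> j"
  shows "x_pow (\<eta>[i - 1 := c, j - 1 := d]) =
     (\<Prod>k\<in>{1..length \<eta>} - {i, j}. xvar k ^ (\<eta> ! (k - 1))) * (xvar i ^ c * xvar j ^ d)"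
proof -
  let ?\<eta> = "\<eta>[i - 1 := c, j - 1 := d]"
  have "x_pow ?\<eta> = (\<Prod>k\<in>insert i (insert j ({1..length \<eta>} - {i, j})). xvar k ^ (?\<eta> ! (k - 1)))"
    unfolding x_pow_def using assms by (intro prod.cong) auto
  also have "\<dots> = xvar i ^ c * (xvar j ^ d * (\<Prod>k\<in>{1..length \<eta>} - {i, j}. xvar k ^ (?\<eta> ! (k - 1))))"
  proof -
    have "?\<eta> ! (i - 1) = c" "?\<eta> ! (j - 1) = d" using assms by (auto simp: nth_list_update)
    thus ?thesis using assms by simp
  qed
  also have "(\<Prod>k\<in>{1..length \<eta>} - {i, j}. xvar k ^ (?\<eta> ! (k - 1))) = (\<Prod>k\<in>{1..length \<eta>} - {i, j}. xvar k ^ (\<eta> ! (k - 1)))"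
  proof (rule prod.cong[OF refl])
    fix k assume "k \<in> {1..length \<eta>} - {i, j}"
    hence "?\<eta> ! (k - 1) = \<eta> ! (k - 1)" using assms by (auto simp: nth_list_update)
    thus "xvar k ^ (?\<eta> ! (k - 1)) = xvar k ^ (\<eta> ! (k - 1))" by simp
  qed
  finally show ?thesis by (simp add: ac_simps)
qed

text \<open>T exchanges the two leading exponents; applying the exchange beforehand puts the leading
  monomial back. This product, not T, is triangular.\<close>

definition R_gen :: "nat \<Rightarrow> nat \<Rightarrow> mpoly \<Rightarrow> mpoly" where
  "R_gen i j f = T_gen i j (perm_op (transpose i j) f)"

definition R_gen_inv :: "nat \<Rightarrow> nat \<Rightarrow> mpoly \<Rightarrow> mpoly" where
  "R_gen_inv i j f = perm_op (transpose i j) (T_gen_inv i j f)"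

lemma linear_op_R_gen: "i \<noteq> j \<Longrightarrow> linear_op (R_gen i j)"
  unfolding R_gen_def[abs_def] by (rule linear_op_comp[OF linear_op_T_gen]) auto

lemma linear_op_R_gen_inv: "i \<noteq> j \<Longrightarrow> linear_op (R_gen_inv i j)"
  unfolding R_gen_inv_def[abs_def] by (rule linear_op_comp[OF _ linear_op_T_gen_inv]) auto

text \<open>Conjugation by the exchange turns \<open>T_gen i j\<close> into
  \<open>T_gen j i\<close>, so the expansion of \<open>R_gen\<close> with reversed indices serves
  the inverse as well.\<close>

lemma R_gen_inv_eq:
  assumes "i \<noteq> j"
  shows "R_gen_inv i j f = const (inverse tvar) * (R_gen j i f - const (tvar - 1) * perm_op (transpose i j) f)"
  using assms
  by (simp add: R_gen_inv_def R_gen_def T_gen_inv_def perm_op_simps perm_op_T_gen transpose_commute[of j i])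

lemma two_variables_identity_greater:
  fixes x :: "'a :: comm_ring_1"
  assumes "u - v = (x - y) * S"
  shows "(x - y) * (t * (X * u * Y) + (t - 1) * (X * Y * y * S)) =
    (t * x - y) * (Y * (X * u)) + (1 - t) * y * (X * (Y * v))"
proof -
  have "(x - y) * (t * (X * u * Y) + (t - 1) * (X * Y * y * S)) =
      (x - y) * (t * (X * u * Y)) + (t - 1) * (X * Y * y) * ((x - y) * S)"
    by (simp add: algebra_simps)
  thus ?thesis unfolding assms[symmetric] by (simp add: algebra_simps)
qed

lemma two_variables_identity_less:
  fixes x :: "'a :: comm_ring_1"
  assumes "u - v = (x - y) * S"
  shows "(x - y) * (X * (Y * (y * v)) + (1 - t) * (X * Y * x * y * S)) =
    (t * x - y) * (Y * (y * v) * X) + (1 - t) * y * (X * (x * u) * Y)"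
proof -
  have "(x - y) * (X * (Y * (y * v)) + (1 - t) * (X * Y * x * y * S)) =
      (x - y) * (X * (Y * (y * v))) + (1 - t) * (X * Y * x * y) * ((x - y) * S)"
    by (simp add: algebra_simps)
  thus ?thesis unfolding assms[symmetric] by (simp add: algebra_simps)
qed

text \<open>The divided difference of a two-variable monomial is a geometric sum, which runs along
  the string between the two exponents.\<close>

lemma T_gen_two_variables_greater:
  assumes "i \<noteq> j"
  shows "T_gen i j (xvar i ^ b * xvar j ^ (b + n)) =
    const tvar * (xvar i ^ (b + n) * xvar j ^ b)
      + (\<Sum>k=1..n. const (tvar - 1) * (xvar i ^ (b + n - k) * xvar j ^ (b + k)))"
proof (rule T_gen_eqI[OF assms])
  let ?x = "xvar i" and ?y = "xvar j" and ?t = "const tvar"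
  have s: "?x ^ n - ?y ^ n = (?x - ?y) * (\<Sum>k<n. ?y ^ (n - Suc k) * ?x ^ k)"
    by (rule power_diff_sumr2)
  have "(\<Sum>k=1..n. const (tvar - 1) * (?x ^ (b + n - k) * ?y ^ (b + k))) =
      (\<Sum>k<n. const (tvar - 1) * (?x ^ (b + k) * ?y ^ (b + (n - k))))"
    by (rule sum.reindex_bij_witness[of _ "\<lambda>k. n - k" "\<lambda>k. n - k"]) auto
  also have "\<dots> = const (tvar - 1) * (?x ^ b * ?y ^ b * ?y * (\<Sum>k<n. ?y ^ (n - Suc k) * ?x ^ k))"
    unfolding sum_distrib_left
  proof (intro sum.cong refl)
    fix k assume "k \<in> {..<n}"
    hence "n - k = Suc (n - Suc k)" by simp
    hence "?y ^ (b + (n - k)) = ?y ^ b * ?y * ?y ^ (n - Suc k)" by (simp only: power_add power_Suc mult.assoc)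
    thus "const (tvar - 1) * (?x ^ (b + k) * ?y ^ (b + (n - k))) =
        const (tvar - 1) * (?x ^ b * ?y ^ b * ?y * (?y ^ (n - Suc k) * ?x ^ k))"
      by (simp add: power_add ac_simps)
  qed
  finally have e: "(\<Sum>k=1..n. const (tvar - 1) * (?x ^ (b + n - k) * ?y ^ (b + k))) =
      const (tvar - 1) * (?x ^ b * ?y ^ b * ?y * (\<Sum>k<n. ?y ^ (n - Suc k) * ?x ^ k))" .
  have p: "perm_op (transpose i j) (?x ^ b * ?y ^ (b + n)) = ?y ^ b * ?x ^ (b + n)"
    unfolding perm_op_def by (simp add: substitute_mult substitute_power)
  show "(?x - ?y) * (?t * (?x ^ (b + n) * ?y ^ b) + (\<Sum>k=1..n. const (tvar - 1) * (?x ^ (b + n - k) * ?y ^ (b + k)))) =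
     (?t * ?x - ?y) * perm_op (transpose i j) (?x ^ b * ?y ^ (b + n)) + (1 - ?t) * ?y * (?x ^ b * ?y ^ (b + n))"
    unfolding e p unfolding const_diff const_1 power_add
    by (rule two_variables_identity_greater[OF s])
qed

lemma T_gen_two_variables_less:
  assumes "i \<noteq> j" "0 < n"
  shows "T_gen i j (xvar i ^ (a + n) * xvar j ^ a) =
    xvar i ^ a * xvar j ^ (a + n)
      + (\<Sum>k=1..<n. const (1 - tvar) * (xvar i ^ (a + k) * xvar j ^ (a + n - k)))"
proof (rule T_gen_eqI[OF assms(1)])
  let ?x = "xvar i" and ?y = "xvar j" and ?t = "const tvar"
  obtain l where n: "n = Suc l" using assms by (cases n) auto
  have s: "?x ^ l - ?y ^ l = (?x - ?y) * (\<Sum>k<l. ?y ^ (l - Suc k) * ?x ^ k)"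
    by (rule power_diff_sumr2)
  have "(\<Sum>k=1..<n. const (1 - tvar) * (?x ^ (a + k) * ?y ^ (a + n - k))) =
      (\<Sum>k<l. const (1 - tvar) * (?x ^ (a + Suc k) * ?y ^ (a + (l - k))))"
    by (rule sum.reindex_bij_witness[of _ Suc "\<lambda>k. k - 1"]) (auto simp: n)
  also have "\<dots> = const (1 - tvar) * (?x ^ a * ?y ^ a * ?x * ?y * (\<Sum>k<l. ?y ^ (l - Suc k) * ?x ^ k))"
    unfolding sum_distrib_left
  proof (intro sum.cong refl)
    fix k assume "k \<in> {..<l}"
    hence "l - k = Suc (l - Suc k)" by simp
    hence "?y ^ (a + (l - k)) = ?y ^ a * ?y * ?y ^ (l - Suc k)" by (simp only: power_add power_Suc mult.assoc)
    thus "const (1 - tvar) * (?x ^ (a + Suc k) * ?y ^ (a + (l - k))) =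
        const (1 - tvar) * (?x ^ a * ?y ^ a * ?x * ?y * (?y ^ (l - Suc k) * ?x ^ k))"
      by (simp add: power_add ac_simps)
  qed
  finally have e: "(\<Sum>k=1..<n. const (1 - tvar) * (?x ^ (a + k) * ?y ^ (a + n - k))) =
      const (1 - tvar) * (?x ^ a * ?y ^ a * ?x * ?y * (\<Sum>k<l. ?y ^ (l - Suc k) * ?x ^ k))" .
  have p: "perm_op (transpose i j) (?x ^ (a + n) * ?y ^ a) = ?y ^ (a + n) * ?x ^ a"
    unfolding perm_op_def by (simp add: substitute_mult substitute_power)
  show "(?x - ?y) * (?x ^ a * ?y ^ (a + n) + (\<Sum>k=1..<n. const (1 - tvar) * (?x ^ (a + k) * ?y ^ (a + n - k)))) =
     (?t * ?x - ?y) * perm_op (transpose i j) (?x ^ (a + n) * ?y ^ a) + (1 - ?t) * ?y * (?x ^ (a + n) * ?y ^ a)"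
    unfolding e p unfolding const_diff const_1 power_add n power_Suc
    by (rule two_variables_identity_less[OF s])
qed

lemma perm_op_x_pow:
  assumes "i \<in> {1..length \<eta>}" "j \<in> {1..length \<eta>}"
  shows "perm_op (transpose i j) (x_pow \<eta>) = x_pow (swap_list i j \<eta>)"
proof -
  have "Poly_Mapping.map_key (transpose i j) (mon \<eta>) = mon (swap_list i j \<eta>)"
  proof (rule poly_mapping_eqI)
    fix k
    have "transpose i j k \<in> {1..length \<eta>} \<longleftrightarrow> k \<in> {1..length \<eta>}"
      using assms by (auto simp: transpose_def)
    thus "Poly_Mapping.lookup (Poly_Mapping.map_key (transpose i j) (mon \<eta>)) k =
        Poly_Mapping.lookup (mon (swap_list i j \<eta>)) k"
      using nth_swap_list[OF assms, of k] by (auto simp: map_key.rep_eq lookup_mon)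
  qed
  thus ?thesis by (simp add: x_pow_mon perm_op_single)
qed

lemma swap_list_update2:
  assumes "i \<in> {1..length \<eta>}" "j \<in> {1..length \<eta>}" "i \<noteq> j"
  shows "swap_list i j \<eta> = \<eta>[i - 1 := \<eta> ! (j - 1), j - 1 := \<eta> ! (i - 1)]"
    "\<eta> = \<eta>[i - 1 := \<eta> ! (i - 1), j - 1 := \<eta> ! (j - 1)]"
  by (simp_all add: swap_list_def)

text \<open>The other variables form a factor symmetric in \<open>x_i\<close> and
  \<open>x_j\<close>, which leaves the two-variable computation. The ranges matter: for different
  entries the first sum ends with the exchanged composition, while the second stops before it. For
  \<open>i < j\<close> that exchange is lower exactly in the first situation.\<close>

lemma R_gen_x_pow:
  assumes "i \<in> {1..length \<eta>}" "j \<in> {1..length \<eta>}" "i \<noteq> j"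
  shows "\<eta> ! (j - 1) \<le> \<eta> ! (i - 1) \<Longrightarrow>
      R_gen i j (x_pow \<eta>) = const tvar * x_pow \<eta> +
        (\<Sum>k=1..\<eta> ! (i - 1) - \<eta> ! (j - 1).
          const (tvar - 1) * x_pow (\<eta>[i - 1 := \<eta> ! (i - 1) - k, j - 1 := \<eta> ! (j - 1) + k]))"
    "\<eta> ! (i - 1) < \<eta> ! (j - 1) \<Longrightarrow>
      R_gen i j (x_pow \<eta>) = x_pow \<eta> +
        (\<Sum>k=1..<\<eta> ! (j - 1) - \<eta> ! (i - 1).
          const (1 - tvar) * x_pow (\<eta>[i - 1 := \<eta> ! (i - 1) + k, j - 1 := \<eta> ! (j - 1) - k]))"
proof -
  define M where "M = (\<Prod>k\<in>{1..length \<eta>} - {i, j}. xvar k ^ (\<eta> ! (k - 1)))"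
  define a b where "a = \<eta> ! (i - 1)" and "b = \<eta> ! (j - 1)"
  have M: "perm_op (transpose i j) M = M"
    unfolding M_def perm_op_def
    by (auto simp: substitute_prod substitute_power transpose_def intro!: prod.cong)
  have x: "x_pow (\<eta>[i - 1 := c, j - 1 := d]) = M * (xvar i ^ c * xvar j ^ d)" for c d
    unfolding M_def using assms by (rule x_pow_update2)
  have x\<eta>: "x_pow \<eta> = M * (xvar i ^ a * xvar j ^ b)"
    using x[of a b] by (simp add: a_def b_def)
  have R: "R_gen i j (x_pow \<eta>) = M * T_gen i j (xvar i ^ b * xvar j ^ a)"
    unfolding R_gen_def perm_op_x_pow[OF assms(1,2)] swap_list_update2(1)[OF assms]
      x T_gen_mult_invariant[OF assms(3) M] a_def b_def ..
  show "R_gen i j (x_pow \<eta>) = const tvar * x_pow \<eta> +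
        (\<Sum>k=1..\<eta> ! (i - 1) - \<eta> ! (j - 1).
          const (tvar - 1) * x_pow (\<eta>[i - 1 := \<eta> ! (i - 1) - k, j - 1 := \<eta> ! (j - 1) + k]))"
    if "\<eta> ! (j - 1) \<le> \<eta> ! (i - 1)"
  proof -
    define n where "n = a - b"
    have n: "a = b + n" using that by (simp add: n_def a_def b_def)
    show ?thesis
      unfolding R unfolding x\<eta> x unfolding a_def[symmetric] b_def[symmetric] n T_gen_two_variables_greater[OF assms(3)]
      by (simp add: distrib_left sum_distrib_left mult.left_commute)
  qed
  show "R_gen i j (x_pow \<eta>) = x_pow \<eta> +
        (\<Sum>k=1..<\<eta> ! (j - 1) - \<eta> ! (i - 1).
          const (1 - tvar) * x_pow (\<eta>[i - 1 := \<eta> ! (i - 1) + k, j - 1 := \<eta> ! (j - 1) - k]))"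
    if "\<eta> ! (i - 1) < \<eta> ! (j - 1)"
  proof -
    define n where "n = b - a"
    have n: "b = a + n" using that by (simp add: n_def a_def b_def)
    have "n > 0" using n that by (simp add: a_def b_def)
    show ?thesis
      unfolding R unfolding x\<eta> x unfolding a_def[symmetric] b_def[symmetric] n T_gen_two_variables_less[OF assms(3) \<open>n > 0\<close>]
      by (simp add: distrib_left sum_distrib_left mult.left_commute)
  qed
qed

section \<open>Operators triangular for the order on compositions\<close>

definition lower_span :: "nat list \<Rightarrow> mpoly set" where
  "lower_span \<eta> = {g. Poly_Mapping.keys g \<subseteq> mon ` {\<nu>. comp_prec \<nu> \<eta>}}"

lemma lower_span_0 [simp]: "0 \<in> lower_span \<eta>"
  by (simp add: lower_span_def)

lemma lower_span_add: "f \<in> lower_span \<eta> \<Longrightarrow> g \<in> lower_span \<eta> \<Longrightarrow> f + g \<in> lower_span \<eta>"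
  unfolding lower_span_def using keys_add[of f g] by blast

lemma keys_const_mult_subset: "Poly_Mapping.keys (const c * f) \<subseteq> Poly_Mapping.keys f"
  by (auto simp: in_keys_iff)

lemma lower_span_const_mult: "f \<in> lower_span \<eta> \<Longrightarrow> const c * f \<in> lower_span \<eta>"
  unfolding lower_span_def using keys_const_mult_subset[of c f] by blast

lemma lower_span_diff: "f \<in> lower_span \<eta> \<Longrightarrow> g \<in> lower_span \<eta> \<Longrightarrow> f - g \<in> lower_span \<eta>"
  using lower_span_add[of f \<eta> "const (-1) * g"] lower_span_const_mult[of g \<eta> "-1"] by (simp add: const_minus)

lemma lower_span_sum: "(\<And>x. x \<in> A \<Longrightarrow> f x \<in> lower_span \<eta>) \<Longrightarrow> sum f A \<in> lower_span \<eta>"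
  by (induction A rule: infinite_finite_induct) (auto intro: lower_span_add)

lemma lower_span_x_pow: "comp_prec \<nu> \<eta> \<Longrightarrow> x_pow \<nu> \<in> lower_span \<eta>"
  by (auto simp: lower_span_def x_pow_mon)

lemma lower_span_trans: "comp_prec \<nu> \<eta> \<Longrightarrow> f \<in> lower_span \<nu> \<Longrightarrow> f \<in> lower_span \<eta>"
  unfolding lower_span_def using comp_prec_trans by blast

lemma comp_prec_squeeze:
  assumes "i \<in> {1..length \<eta>}" "j \<in> {1..length \<eta>}" "i \<noteq> j"
    and "0 < k" "k < \<eta> ! (i - 1) - \<eta> ! (j - 1)"
  shows "comp_prec (\<eta>[i - 1 := \<eta> ! (i - 1) - k, j - 1 := \<eta> ! (j - 1) + k]) \<eta>"
proof -
  let ?a = "\<eta> ! (i - 1)" and ?b = "\<eta> ! (j - 1)"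
  have ij: "i - 1 < length \<eta>" "j - 1 < length \<eta>" "i - 1 \<noteq> j - 1" using assms by auto
  define M where "M = mset \<eta> - {#?a, ?b#}"
  have upd: "mset (\<eta>[i - 1 := c, j - 1 := d]) = M + {#c, d#}" for c d
  proof -
    have "\<eta>[i - 1 := Suc ?b] ! (j - 1) = ?b" using ij by simp
    hence "?b \<in># mset (\<eta>[i - 1 := Suc ?b])"
      using ij by (metis length_list_update nth_mem_mset)
    hence "?b \<in># mset \<eta> - {#?a#}" using ij by (simp add: mset_update)
    thus ?thesis using ij
      by (simp add: mset_update M_def add_mset_commute)
  qed
  have "mset \<eta> = M + {#?a, ?b#}" using upd[of ?a ?b] by simp
  moreover have "mset (\<eta>[i - 1 := ?a - k, j - 1 := ?b + k]) = M + {#?a - k, ?b + k#}" by (rule upd)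
  ultimately show ?thesis
    using strictly_dominated_squeeze[OF _ _ assms(4,5)] by (simp add: comp_prec_def)
qed

definition triangular :: "nat \<Rightarrow> (mpoly \<Rightarrow> mpoly) \<Rightarrow> (nat list \<Rightarrow> qt) \<Rightarrow> bool" where
  "triangular N F d \<longleftrightarrow> linear_op F \<and>
     (\<forall>\<eta>. length \<eta> = N \<longrightarrow> F (x_pow \<eta>) - const (d \<eta>) * x_pow \<eta> \<in> lower_span \<eta>)"

lemma triangularI:
  assumes "linear_op F" "\<And>\<eta>. length \<eta> = N \<Longrightarrow> \<exists>g\<in>lower_span \<eta>. F (x_pow \<eta>) = const (d \<eta>) * x_pow \<eta> + g"
  shows "triangular N F d"
  unfolding triangular_def using assms by fastforce

lemma triangularE:
  assumes "triangular N F d" "length \<eta> = N"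
  obtains g where "g \<in> lower_span \<eta>" "F (x_pow \<eta>) = const (d \<eta>) * x_pow \<eta> + g"
  using assms unfolding triangular_def by (metis add.commute diff_add_cancel)

lemma mpoly_sum_x_pow:
  assumes "Poly_Mapping.keys f \<subseteq> mon ` S" "inj_on mon S" "finite S"
  shows "f = (\<Sum>\<nu>\<in>S. const (Poly_Mapping.lookup f (mon \<nu>)) * x_pow \<nu>)"
proof -
  have "f = (\<Sum>\<alpha>\<in>Poly_Mapping.keys f. Poly_Mapping.single \<alpha> (Poly_Mapping.lookup f \<alpha>))"
    by (rule mpoly_sum_single)
  also have "\<dots> = (\<Sum>\<alpha>\<in>mon ` S. Poly_Mapping.single \<alpha> (Poly_Mapping.lookup f \<alpha>))"
    using assms by (intro sum.mono_neutral_left) (auto simp: in_keys_iff)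
  also have "\<dots> = (\<Sum>\<nu>\<in>S. const (Poly_Mapping.lookup f (mon \<nu>)) * x_pow \<nu>)"
    using assms by (simp add: sum.reindex x_pow_mon const_def mult_single)
  finally show ?thesis .
qed

lemma finite_compositions: "finite {\<nu> :: nat list. length \<nu> = N \<and> sum_list \<nu> = d}"
proof (rule finite_subset)
  show "{\<nu> :: nat list. length \<nu> = N \<and> sum_list \<nu> = d} \<subseteq> {\<nu>. set \<nu> \<subseteq> {..d} \<and> length \<nu> = N}"
    using member_le_sum_list by fastforce
  show "finite {\<nu>. set \<nu> \<subseteq> {..d} \<and> length \<nu> = N}" by (rule finite_lists_length_eq) simp
qed

lemma inj_on_mon: "(\<And>\<nu>. \<nu> \<in> S \<Longrightarrow> length \<nu> = N) \<Longrightarrow> inj_on mon S"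
  by (rule inj_onI) (metis mon_inject)

lemma comp_prec_finite [simp]: "finite {\<nu>. comp_prec \<nu> \<eta>}"
  by (rule finite_subset[OF _ finite_compositions[of "length \<eta>" "sum_list \<eta>"]])
     (auto simp: comp_prec_length comp_prec_sum_list)

lemma comp_prec_inj_on_mon: "inj_on mon {\<nu>. comp_prec \<nu> \<eta>}"
  by (rule inj_on_mon[of _ "length \<eta>"]) (auto simp: comp_prec_length)

lemma triangular_lower_span:
  assumes "triangular N F d" "length \<eta> = N" "g \<in> lower_span \<eta>"
  shows "F g \<in> lower_span \<eta>"
proof -
  let ?S = "{\<nu>. comp_prec \<nu> \<eta>}"
  have lin: "linear_op F" using assms by (simp add: triangular_def)
  have g: "g = (\<Sum>\<nu>\<in>?S. const (Poly_Mapping.lookup g (mon \<nu>)) * x_pow \<nu>)"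
    using assms comp_prec_inj_on_mon by (intro mpoly_sum_x_pow) (auto simp: lower_span_def)
  have "F (x_pow \<nu>) \<in> lower_span \<eta>" if "comp_prec \<nu> \<eta>" for \<nu>
  proof -
    have "length \<nu> = N" using comp_prec_length[OF that] assms by simp
    then obtain h where "h \<in> lower_span \<nu>" "F (x_pow \<nu>) = const (d \<nu>) * x_pow \<nu> + h"
      using assms triangularE by blast
    thus ?thesis using that
      by (auto intro: lower_span_add lower_span_const_mult lower_span_x_pow lower_span_trans)
  qed
  hence "(\<Sum>\<nu>\<in>?S. const (Poly_Mapping.lookup g (mon \<nu>)) * F (x_pow \<nu>)) \<in> lower_span \<eta>"
    by (auto intro!: lower_span_sum lower_span_const_mult)
  also have "(\<Sum>\<nu>\<in>?S. const (Poly_Mapping.lookup g (mon \<nu>)) * F (x_pow \<nu>)) = F g"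
    by (subst (2) g) (simp add: linear_op_sum[OF lin] linear_op_const_mult[OF lin])
  finally show ?thesis .
qed

lemma triangular_comp:
  assumes F: "triangular N F d" and G: "triangular N G e"
  shows "triangular N (\<lambda>f. F (G f)) (\<lambda>\<eta>. d \<eta> * e \<eta>)"
proof (rule triangularI)
  have lin: "linear_op F" "linear_op G" using assms by (auto simp: triangular_def)
  show "linear_op (\<lambda>f. F (G f))" using lin by (rule linear_op_comp)
  fix \<eta> :: "nat list" assume N: "length \<eta> = N"
  obtain g where g: "g \<in> lower_span \<eta>" "G (x_pow \<eta>) = const (e \<eta>) * x_pow \<eta> + g"
    using G N by (rule triangularE)
  obtain h where h: "h \<in> lower_span \<eta>" "F (x_pow \<eta>) = const (d \<eta>) * x_pow \<eta> + h"
    using F N by (rule triangularE)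
  have "F (G (x_pow \<eta>)) = const (e \<eta>) * (const (d \<eta>) * x_pow \<eta> + h) + F g"
    by (simp add: g h linear_op_add[OF lin(1)] linear_op_const_mult[OF lin(1)])
  also have "\<dots> = const (d \<eta> * e \<eta>) * x_pow \<eta> + (const (e \<eta>) * h + F g)"
    by (simp add: const_mult algebra_simps)
  finally have "F (G (x_pow \<eta>)) = const (d \<eta> * e \<eta>) * x_pow \<eta> + (const (e \<eta>) * h + F g)" .
  moreover have "const (e \<eta>) * h + F g \<in> lower_span \<eta>"
    using g h triangular_lower_span[OF F N] by (auto intro: lower_span_add lower_span_const_mult)
  ultimately show "\<exists>g\<in>lower_span \<eta>. F (G (x_pow \<eta>)) = const (d \<eta> * e \<eta>) * x_pow \<eta> + g" by blast
qed

lemma triangular_id: "triangular N (\<lambda>f. f) (\<lambda>_. 1)"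
  by (rule triangularI) (auto simp: linear_op_def intro!: bexI[of _ 0])

lemma triangular_comp_ops:
  assumes "\<And>x. x \<in> set xs \<Longrightarrow> triangular N (F x) (d x)"
  shows "triangular N (comp_ops (map F xs)) (\<lambda>\<eta>. \<Prod>x\<leftarrow>xs. d x \<eta>)"
  using assms
proof (induction xs)
  case Nil
  have "comp_ops [] = (\<lambda>f. f)" by (simp add: fun_eq_iff)
  thus ?case using triangular_id by simp
next
  case (Cons x xs)
  have "comp_ops (map F (x # xs)) = (\<lambda>f. F x (comp_ops (map F xs) f))" by (simp add: fun_eq_iff)
  thus ?case using triangular_comp[of N "F x" "d x" "comp_ops (map F xs)"] Cons by simp
qed

lemma triangular_scale:
  assumes "triangular N F d"
  shows "triangular N (\<lambda>f. const c * F f) (\<lambda>\<eta>. c * d \<eta>)"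
proof (rule triangularI)
  show "linear_op (\<lambda>f. const c * F f)" using assms by (simp add: triangular_def linear_op_scale)
  fix \<eta> :: "nat list" assume N: "length \<eta> = N"
  obtain h where h: "h \<in> lower_span \<eta>" "F (x_pow \<eta>) = const (d \<eta>) * x_pow \<eta> + h"
    using assms N by (rule triangularE)
  thus "\<exists>g\<in>lower_span \<eta>. const c * F (x_pow \<eta>) = const (c * d \<eta>) * x_pow \<eta> + g"
    by (intro bexI[of _ "const c * h"]) (auto simp: const_mult distrib_left mult.assoc intro: lower_span_const_mult)
qed

lemma triangular_tau_op:
  assumes "i \<in> {1..N}"
  shows "triangular N (tau_op i) (\<lambda>\<eta>. qvar ^ (\<eta> ! (i - 1)))"
proof (rule triangularI)
  fix \<eta> :: "nat list" assume "length \<eta> = N"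
  hence "tau_op i (x_pow \<eta>) = const (qvar ^ (\<eta> ! (i - 1))) * x_pow \<eta>"
    using assms by (simp add: x_pow_mon tau_op_single const_def mult_single lookup_mon)
  thus "\<exists>g\<in>lower_span \<eta>. tau_op i (x_pow \<eta>) = const (qvar ^ (\<eta> ! (i - 1))) * x_pow \<eta> + g"
    by (intro bexI[of _ 0]) auto
qed simp

lemma triangular_R_gen:
  assumes "1 \<le> i" "i < j" "j \<le> N"
  shows "triangular N (R_gen i j) (\<lambda>\<eta>. if \<eta> ! (j - 1) \<le> \<eta> ! (i - 1) then tvar else 1)"
proof (rule triangularI)
  show "linear_op (R_gen i j)" using assms by (intro linear_op_R_gen) simp
  fix \<eta> :: "nat list" assume N: "length \<eta> = N"
  let ?a = "\<eta> ! (i - 1)" and ?b = "\<eta> ! (j - 1)"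
  have ij: "i \<in> {1..length \<eta>}" "j \<in> {1..length \<eta>}" "i \<noteq> j" using assms N by auto
  show "\<exists>g\<in>lower_span \<eta>. R_gen i j (x_pow \<eta>) = const (if ?b \<le> ?a then tvar else 1) * x_pow \<eta> + g"
  proof (cases "?b \<le> ?a")
    case True
    have "x_pow (\<eta>[i - 1 := ?a - k, j - 1 := ?b + k]) \<in> lower_span \<eta>" if k: "k \<in> {1..?a - ?b}" for k
    proof (cases "k = ?a - ?b")
      case True
      hence "\<eta>[i - 1 := ?a - k, j - 1 := ?b + k] = swap_list i j \<eta>"
        using swap_list_update2(1)[OF ij] k by simp
      moreover have "comp_prec (swap_list i j \<eta>) \<eta>"
        using assms N k True by (intro comp_prec_swap) auto
      ultimately show ?thesis by (simp add: lower_span_x_pow)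
    next
      case False
      thus ?thesis using k by (intro lower_span_x_pow comp_prec_squeeze ij) auto
    qed
    thus ?thesis
      using True unfolding R_gen_x_pow(1)[OF ij True]
      by (intro bexI[of _ "\<Sum>k=1..?a - ?b. const (tvar - 1) * x_pow (\<eta>[i - 1 := ?a - k, j - 1 := ?b + k])"]
          lower_span_sum lower_span_const_mult) auto
  next
    case False
    have "x_pow (\<eta>[i - 1 := ?a + k, j - 1 := ?b - k]) \<in> lower_span \<eta>" if k: "k \<in> {1..<?b - ?a}" for k
    proof -
      have "\<eta>[i - 1 := ?a + k, j - 1 := ?b - k] = \<eta>[j - 1 := ?b - k, i - 1 := ?a + k]"
        using ij by (intro list_update_swap) auto
      thus ?thesis
        using k comp_prec_squeeze[OF ij(2,1) ij(3)[symmetric], of k] by (simp add: lower_span_x_pow)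
    qed
    thus ?thesis
      using False R_gen_x_pow(2)[OF ij]
      by (intro bexI[of _ "\<Sum>k=1..<?b - ?a. const (1 - tvar) * x_pow (\<eta>[i - 1 := ?a + k, j - 1 := ?b - k])"]
          lower_span_sum lower_span_const_mult) auto
  qed
qed

lemma triangular_R_gen_inv:
  assumes "1 \<le> i" "i < j" "j \<le> N"
  shows "triangular N (R_gen_inv i j) (\<lambda>\<eta>. if \<eta> ! (j - 1) \<le> \<eta> ! (i - 1) then inverse tvar else 1)"
proof (rule triangularI)
  show "linear_op (R_gen_inv i j)" using assms by (intro linear_op_R_gen_inv) simp
  fix \<eta> :: "nat list" assume N: "length \<eta> = N"
  let ?a = "\<eta> ! (i - 1)" and ?b = "\<eta> ! (j - 1)"
  have ij: "i \<in> {1..length \<eta>}" "j \<in> {1..length \<eta>}" "i \<noteq> j" and ji: "j \<noteq> i" using assms N by auto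
  have Rinv: "R_gen_inv i j (x_pow \<eta>) =
      const (inverse tvar) * (R_gen j i (x_pow \<eta>) - const (tvar - 1) * x_pow (swap_list i j \<eta>))"
    by (simp add: R_gen_inv_eq ij(3) perm_op_x_pow[OF ij(1,2)])
  show "\<exists>g\<in>lower_span \<eta>. R_gen_inv i j (x_pow \<eta>) = const (if ?b \<le> ?a then inverse tvar else 1) * x_pow \<eta> + g"
  proof -
    consider "?b = ?a" | "?b < ?a" | "?a < ?b" by linarith
    thus ?thesis
    proof cases
      case 1
      hence "swap_list i j \<eta> = \<eta>" using swap_list_update2[OF ij] by simp
      moreover have "R_gen j i (x_pow \<eta>) = const tvar * x_pow \<eta>"
        using R_gen_x_pow(1)[OF ij(2,1) ji] 1 by simp
      ultimately have "R_gen_inv i j (x_pow \<eta>) = const (inverse tvar) * x_pow \<eta> + 0"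
        unfolding Rinv by (simp add: const_diff algebra_simps)
      thus ?thesis using 1 by (intro bexI[of _ 0]) auto
    next
      case 2
      define S where "S = (\<Sum>k=1..<?a - ?b. const (1 - tvar) * x_pow (\<eta>[j - 1 := ?b + k, i - 1 := ?a - k]))"
      have S: "S \<in> lower_span \<eta>"
        unfolding S_def
      proof (intro lower_span_sum lower_span_const_mult lower_span_x_pow)
        fix k assume k: "k \<in> {1..<?a - ?b}"
        have "\<eta>[j - 1 := ?b + k, i - 1 := ?a - k] = \<eta>[i - 1 := ?a - k, j - 1 := ?b + k]"
          using ij by (intro list_update_swap) auto
        thus "comp_prec (\<eta>[j - 1 := ?b + k, i - 1 := ?a - k]) \<eta>"
          using k comp_prec_squeeze[OF ij, of k] by simp
      qed
      have sw: "x_pow (swap_list i j \<eta>) \<in> lower_span \<eta>"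
        using assms N 2 by (intro lower_span_x_pow comp_prec_swap) auto
      have "R_gen j i (x_pow \<eta>) = x_pow \<eta> + S"
        using R_gen_x_pow(2)[OF ij(2,1) ji] 2 by (simp add: S_def)
      hence "R_gen_inv i j (x_pow \<eta>) = const (inverse tvar) * x_pow \<eta> +
          const (inverse tvar) * (S - const (tvar - 1) * x_pow (swap_list i j \<eta>))"
        unfolding Rinv by (simp add: algebra_simps)
      thus ?thesis using 2 S sw
        by (intro bexI[of _ "const (inverse tvar) * (S - const (tvar - 1) * x_pow (swap_list i j \<eta>))"])
           (auto intro: lower_span_const_mult lower_span_diff)
    next
      \<comment> \<open>Now the exchanged composition is the higher one. It occurs in
        \<open>R_gen j i\<close> with coefficient \<open>tvar - 1\<close> and cancels against the
        second term of \<open>Rinv\<close>.\<close>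
      case 3
      define S where "S = (\<Sum>k=1..<?b - ?a. const (tvar - 1) * x_pow (\<eta>[j - 1 := ?b - k, i - 1 := ?a + k]))"
      have S: "S \<in> lower_span \<eta>"
        unfolding S_def using comp_prec_squeeze[OF ij(2,1) ji]
        by (intro lower_span_sum lower_span_const_mult lower_span_x_pow) auto
      have "\<eta>[j - 1 := ?a, i - 1 := ?b] = swap_list i j \<eta>"
        unfolding swap_list_update2(1)[OF ij] using ij by (intro list_update_swap) auto
      moreover have "{1..?b - ?a} = insert (?b - ?a) {1..<?b - ?a}" using 3 by auto
      ultimately have "R_gen j i (x_pow \<eta>) = const tvar * x_pow \<eta> + (S + const (tvar - 1) * x_pow (swap_list i j \<eta>))"
        using R_gen_x_pow(1)[OF ij(2,1) ji] 3 by (simp add: S_def)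
      hence "R_gen_inv i j (x_pow \<eta>) = x_pow \<eta> + const (inverse tvar) * S"
        unfolding Rinv by (simp add: distrib_left)
      thus ?thesis using 3 S
        by (intro bexI[of _ "const (inverse tvar) * S"]) (auto intro: lower_span_const_mult)
    qed
  qed
qed

text \<open>Each T is written as R times an exchange, and the exchanges are collected on the right;
  on the way they turn the pairs \<open>(k, Suc k)\<close> into \<open>(i, Suc k)\<close>.\<close>

lemma TT_R_gen:
  assumes "i \<le> N"
  shows "TT i N f = comp_ops (map (R_gen i) [Suc i..<Suc N])
      (comp_ops (map (\<lambda>k. perm_op (transpose k (Suc k))) [i..<N]) f)"
  using assms
proof (induction arbitrary: f rule: dec_induct)
  case (step n)
  define c where "c = word_perm [i..<n]"
  have c_op: "comp_ops (map (\<lambda>k. perm_op (transpose k (Suc k))) xs) g = perm_op (word_perm xs) g" for xs g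
    by (induction xs) (simp_all add: perm_op_comp word_perm_Cons o_def)
  have bij: "bij (word_perm xs)" for xs
  proof (induction xs)
    case Nil thus ?case unfolding word_perm_Nil by (rule bij_id)
  next
    case (Cons k xs)
    show ?case unfolding word_perm_Cons by (rule bij_comp[OF Cons bij_transpose])
  qed
  have cn: "word_perm [j..<n] n = j" if "j \<le> n" for j
    using that by (induction rule: inc_induct) (simp_all add: upt_conv_Cons word_perm_Cons)
  have cn': "word_perm [j..<n] (Suc n) = Suc n" if "j \<le> n" for j
    using that by (induction rule: inc_induct) (simp_all add: upt_conv_Cons transpose_def word_perm_Cons)
  have c: "c n = i" "c (Suc n) = Suc n" "bij c"
    using cn[of i] cn'[of i] step bij by (simp_all add: c_def)
  have "c x = Suc n \<longleftrightarrow> x = Suc n" "c x = i \<longleftrightarrow> x = n" for x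
    using c bij_is_inj[OF c(3)] by (metis injD)+
  hence "transpose i (Suc n) \<circ> c = c \<circ> transpose n (Suc n)"
    by (auto simp: fun_eq_iff transpose_def c(1,2))
  hence p: "perm_op (transpose i (Suc n)) (perm_op (transpose i (Suc n)) (perm_op c f)) =
      perm_op (transpose i (Suc n)) (perm_op c (perm_op (transpose n (Suc n)) f))"
    by (simp only: perm_op_comp)
  have "perm_op c (T_op n f) = T_gen i (Suc n) (perm_op c f)"
    unfolding T_op_T_gen using c by (subst perm_op_T_gen) auto
  also have "\<dots> = R_gen i (Suc n) (perm_op c (perm_op (transpose n (Suc n)) f))"
    unfolding R_gen_def p[symmetric] by (simp add: perm_op_comp[of "transpose i (Suc n)" "transpose i (Suc n)"])
  finally have "comp_ops (map (\<lambda>k. perm_op (transpose k (Suc k))) [i..<n]) (T_op n f) =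
      R_gen i (Suc n) (comp_ops (map (\<lambda>k. perm_op (transpose k (Suc k))) [i..<n]) (perm_op (transpose n (Suc n)) f))"
    by (simp add: c_op c_def)
  thus ?case using step by (simp add: TT_Suc)
qed simp

definition K_down :: "nat \<Rightarrow> mpoly \<Rightarrow> mpoly" where
  "K_down i = comp_ops (map (\<lambda>k. perm_op (transpose k (Suc k))) (rev [1..<i]))"

lemma K_down_1 [simp]: "K_down (Suc 0) f = f"
  by (simp add: K_down_def)

lemma K_down_Suc: "1 \<le> i \<Longrightarrow> K_down (Suc i) f = perm_op (transpose i (Suc i)) (K_down i f)"
  by (simp add: K_down_def)

lemma K_up_K_down:
  assumes "1 \<le> i" "i \<le> N"
  shows "comp_ops (map (\<lambda>k. perm_op (transpose k (Suc k))) [i..<N]) (K_down N f) = K_down i f"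
  using assms(2,1) by (induction rule: dec_induct) (simp_all add: K_down_Suc perm_op_comp)

lemma omega_op_K_down: "omega_op N f = K_down N (tau_op 1 f)"
  by (simp add: omega_op_def K_down_def K_op_perm_op)

lemma K_down_tau_op: 
  assumes "1 \<le> i"
  shows "K_down i (tau_op 1 f) = tau_op i (K_down i f)"
  using assms by (induction rule: dec_induct) (simp_all add: K_down_Suc perm_op_tau_op)

lemma K_down_TI:
  assumes "1 \<le> i"
  shows "K_down i (TI i f) = comp_ops (map (\<lambda>j. R_gen_inv j i) [1..<i]) f"
  using assms
proof (induction arbitrary: f rule: dec_induct)
  case (step n)
  have "K_down (Suc n) (TI (Suc n) f) =
      perm_op (transpose n (Suc n)) (comp_ops (map (\<lambda>j. R_gen_inv j n) [1..<n]) (Tinv_op n f))"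
    using step by (simp add: K_down_Suc TI_Suc)
  also have "\<dots> = comp_ops (map (\<lambda>j. R_gen_inv j (Suc n)) [1..<n]) (perm_op (transpose n (Suc n)) (Tinv_op n f))"
  proof (rule comp_ops_intertwine)
    fix j g assume "j \<in> set [1..<n]"
    hence j: "j < n" by simp
    have "transpose n (Suc n) \<circ> transpose j n = transpose j (Suc n) \<circ> transpose n (Suc n)"
      using j by (auto simp: fun_eq_iff transpose_def)
    hence "perm_op (transpose n (Suc n)) (R_gen_inv j n g) =
        perm_op (transpose j (Suc n)) (perm_op (transpose n (Suc n)) (T_gen_inv j n g))"
      by (simp add: R_gen_inv_def perm_op_comp)
    also have "perm_op (transpose n (Suc n)) (T_gen_inv j n g) = T_gen_inv j (Suc n) (perm_op (transpose n (Suc n)) g)"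
      using j by (subst perm_op_T_gen_inv) auto
    finally show "perm_op (transpose n (Suc n)) (R_gen_inv j n g) = R_gen_inv j (Suc n) (perm_op (transpose n (Suc n)) g)"
      by (simp add: R_gen_inv_def)
  qed
  finally show ?case using step by (simp add: R_gen_inv_def[of n])
qed simp

text \<open>The exchanges from \<open>TT\<close> cancel part of those in \<open>omega_op\<close>,
  the ones paired with the inverses in \<open>TI\<close> use up the rest, and
  \<open>tau_op 1\<close> has become \<open>tau_op i\<close>. Every remaining factor is
  triangular.\<close>

lemma Y_op_R_gen:
  assumes "1 \<le> i" "i \<le> N"
  shows "Y_op N i f = const (tvar powi (int i - int N)) *
     comp_ops (map (R_gen i) [Suc i..<Suc N]) (tau_op i (comp_ops (map (\<lambda>j. R_gen_inv j i) [1..<i]) f))"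
  unfolding Y_op_eq TT_R_gen[OF assms(2)] omega_op_K_down K_up_K_down[OF assms]
    K_down_tau_op[OF assms(1)] K_down_TI[OF assms(1)] ..

definition y_eigenvalue :: "nat list \<Rightarrow> nat \<Rightarrow> qt" where
  "y_eigenvalue \<eta> i = qvar ^ (\<eta> ! (i - 1)) * tvar powi (1 - int (eta_rank \<eta> i))"

lemma prod_list_if_upt:
  fixes c :: "'a :: comm_monoid_mult"
  shows "(\<Prod>x\<leftarrow>[a..<b]. if P x then c else 1) = c ^ card {x \<in> {a..<b}. P x}"
  by (subst prod.distinct_set_conv_list[symmetric]) (auto simp: prod.If_cases Int_def)

lemma triangular_Y_op:
  assumes "1 \<le> i" "i \<le> N"
  shows "triangular N (Y_op N i) (\<lambda>\<eta>. y_eigenvalue \<eta> i)"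
proof -
  define d where "d \<eta> = tvar powi (int i - int N) *
     ((\<Prod>j\<leftarrow>[Suc i..<Suc N]. if \<eta> ! (j - 1) \<le> \<eta> ! (i - 1) then tvar else 1) * (qvar ^ (\<eta> ! (i - 1)) *
     (\<Prod>j\<leftarrow>[1..<i]. if \<eta> ! (i - 1) \<le> \<eta> ! (j - 1) then inverse tvar else 1)))" for \<eta>
  have "triangular N (Y_op N i) d"
    unfolding Y_op_R_gen[OF assms, abs_def] d_def
    using assms
    by (intro triangular_scale triangular_comp[of N _ _ "\<lambda>f. tau_op i (_ f)"]
        triangular_comp[of N "tau_op i"] triangular_comp_ops triangular_tau_op triangular_R_gen triangular_R_gen_inv)
       auto
  moreover have "d \<eta> = y_eigenvalue \<eta> i" if N: "length \<eta> = N" for \<eta>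
  proof -
    let ?a = "\<eta> ! (i - 1)"
    \<comment> \<open>\<open>A\<close> counts the larger entries to the right of \<open>i\<close>,
      \<open>B\<close> the entries at least as large to the left, so the rank is
      \<open>A + B + 1\<close>. The factors R give t the exponent \<open>N - i - A\<close>, the
      inverse ones \<open>- B\<close>; with the prefactor this is \<open>1\<close> minus the
      rank.\<close>
    define A where "A = card {j \<in> {Suc i..<Suc N}. \<not> \<eta> ! (j - 1) \<le> ?a}"
    define B where "B = card {j \<in> {1..<i}. ?a \<le> \<eta> ! (j - 1)}"
    have 1: "card {j \<in> {Suc i..<Suc N}. \<eta> ! (j - 1) \<le> ?a} + A = N - i"
    proof -
      have "card ({j \<in> {Suc i..<Suc N}. \<eta> ! (j - 1) \<le> ?a} \<union> {j \<in> {Suc i..<Suc N}. \<not> \<eta> ! (j - 1) \<le> ?a}) =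
          card {j \<in> {Suc i..<Suc N}. \<eta> ! (j - 1) \<le> ?a} + A"
        unfolding A_def by (rule card_Un_disjoint) auto
      also have "{j \<in> {Suc i..<Suc N}. \<eta> ! (j - 1) \<le> ?a} \<union> {j \<in> {Suc i..<Suc N}. \<not> \<eta> ! (j - 1) \<le> ?a} = {Suc i..<Suc N}"
        by auto
      finally show ?thesis by simp
    qed
    have 2: "eta_rank \<eta> i = A + B + 1"
    proof -
      have A': "{j \<in> {1..length \<eta>}. \<eta> ! (j - 1) > ?a} =
          {j \<in> {Suc i..<Suc N}. \<not> \<eta> ! (j - 1) \<le> ?a} \<union> {j \<in> {1..<i}. ?a < \<eta> ! (j - 1)}"
      proof (rule set_eqI)
        fix j
        show "j \<in> {j \<in> {1..length \<eta>}. \<eta> ! (j - 1) > ?a} \<longleftrightarrow>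
            j \<in> {j \<in> {Suc i..<Suc N}. \<not> \<eta> ! (j - 1) \<le> ?a} \<union> {j \<in> {1..<i}. ?a < \<eta> ! (j - 1)}"
          using N assms by (cases j i rule: linorder_cases) auto
      qed
      have a: "card {j \<in> {1..length \<eta>}. \<eta> ! (j - 1) > ?a} = A + card {j \<in> {1..<i}. ?a < \<eta> ! (j - 1)}"
        unfolding A' A_def by (rule card_Un_disjoint) auto
      have "{j \<in> {1..i}. \<eta> ! (j - 1) = ?a} = insert i {j \<in> {1..<i}. \<eta> ! (j - 1) = ?a}"
        using assms by auto
      hence b: "card {j \<in> {1..i}. \<eta> ! (j - 1) = ?a} = Suc (card {j \<in> {1..<i}. \<eta> ! (j - 1) = ?a})"
        by simp
      have B': "{j \<in> {1..<i}. ?a \<le> \<eta> ! (j - 1)} = {j \<in> {1..<i}. ?a < \<eta> ! (j - 1)} \<union> {j \<in> {1..<i}. \<eta> ! (j - 1) = ?a}"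
        by auto
      have "B = card {j \<in> {1..<i}. ?a < \<eta> ! (j - 1)} + card {j \<in> {1..<i}. \<eta> ! (j - 1) = ?a}"
        unfolding B_def B' by (rule card_Un_disjoint) auto
      with a b show ?thesis by (simp add: eta_rank_def)
    qed
    have "d \<eta> = qvar ^ ?a * (tvar powi (int i - int N) * tvar ^ card {j \<in> {Suc i..<Suc N}. \<eta> ! (j - 1) \<le> ?a} * inverse tvar ^ B)"
      unfolding d_def prod_list_if_upt B_def by simp
    also have "tvar powi (int i - int N) * tvar ^ card {j \<in> {Suc i..<Suc N}. \<eta> ! (j - 1) \<le> ?a} * inverse tvar ^ B
      = tvar powi (int i - int N + int (card {j \<in> {Suc i..<Suc N}. \<eta> ! (j - 1) \<le> ?a}) + (- int B))"
      by (simp add: power_int_add power_int_diff power_inverse divide_inverse)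
    also have "int i - int N + int (card {j \<in> {Suc i..<Suc N}. \<eta> ! (j - 1) \<le> ?a}) + (- int B) = 1 - int (eta_rank \<eta> i)"
      using 1 2 assms by linarith
    finally show ?thesis by (simp add: y_eigenvalue_def)
  qed
  ultimately show ?thesis unfolding triangular_def by auto
qed

section \<open>Non-symmetric Macdonald polynomials\<close>

definition hom_polys :: "nat \<Rightarrow> nat \<Rightarrow> mpoly set" where
  "hom_polys N d = {f. Poly_Mapping.keys f \<subseteq> mon ` {\<nu>. length \<nu> = N \<and> sum_list \<nu> = d}}"

lemma hom_polys_add: "f \<in> hom_polys N d \<Longrightarrow> g \<in> hom_polys N d \<Longrightarrow> f + g \<in> hom_polys N d"
  unfolding hom_polys_def using keys_add[of f g] by blast

lemma hom_polys_0 [simp]: "0 \<in> hom_polys N d"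
  by (simp add: hom_polys_def)

lemma hom_polys_const_mult: "f \<in> hom_polys N d \<Longrightarrow> const c * f \<in> hom_polys N d"
  unfolding hom_polys_def using keys_const_mult_subset[of c f] by blast

lemma hom_polys_diff: "f \<in> hom_polys N d \<Longrightarrow> g \<in> hom_polys N d \<Longrightarrow> f - g \<in> hom_polys N d"
  using hom_polys_add[of f N d "const (-1) * g"] hom_polys_const_mult[of g N d "-1"] by (simp add: const_minus)

lemma hom_polys_sum: "(\<And>x. x \<in> A \<Longrightarrow> f x \<in> hom_polys N d) \<Longrightarrow> sum f A \<in> hom_polys N d"
  by (induction A rule: infinite_finite_induct) (auto intro: hom_polys_add)

lemma hom_polys_x_pow: "x_pow \<nu> \<in> hom_polys (length \<nu>) (sum_list \<nu>)"
  by (auto simp: hom_polys_def x_pow_mon)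

lemma lower_span_hom_polys: "g \<in> lower_span \<eta> \<Longrightarrow> g \<in> hom_polys (length \<eta>) (sum_list \<eta>)"
  unfolding lower_span_def hom_polys_def using comp_prec_length comp_prec_sum_list by blast

lemma hom_polys_expand:
  assumes "f \<in> hom_polys N d"
  shows "f = (\<Sum>\<nu> | length \<nu> = N \<and> sum_list \<nu> = d. const (Poly_Mapping.lookup f (mon \<nu>)) * x_pow \<nu>)"
  using assms by (intro mpoly_sum_x_pow inj_on_mon[of _ N] finite_compositions) (auto simp: hom_polys_def)

lemma hom_polys_nonzero:
  assumes "f \<in> hom_polys N d" "f \<noteq> 0"
  obtains \<nu> where "length \<nu> = N" "sum_list \<nu> = d" "Poly_Mapping.lookup f (mon \<nu>) \<noteq> 0"
proof -
  from assms(2) have "Poly_Mapping.keys f \<noteq> {}" by auto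
  then obtain \<alpha> where "\<alpha> \<in> Poly_Mapping.keys f" by blast
  with assms(1) that show ?thesis by (auto simp: hom_polys_def in_keys_iff)
qed

lemma hom_polys_lookup_sum:
  assumes "f \<in> hom_polys N d" "length \<nu> = N" "Poly_Mapping.lookup f (mon \<nu>) \<noteq> 0"
  shows "sum_list \<nu> = d"
proof -
  obtain \<mu> where "mon \<nu> = mon \<mu>" "length \<mu> = N" "sum_list \<mu> = d"
    using assms unfolding hom_polys_def in_keys_iff[symmetric] by blast
  thus ?thesis using mon_inject[of \<nu> \<mu>] assms(2) by simp
qed

lemma triangular_hom_polys:
  assumes "triangular N F dd" "f \<in> hom_polys N d"
  shows "F f \<in> hom_polys N d"
proof -
  have lin: "linear_op F" using assms by (simp add: triangular_def)
  have x: "F (x_pow \<nu>) \<in> hom_polys N d" if \<nu>: "length \<nu> = N" "sum_list \<nu> = d" for \<nu>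
  proof -
    obtain g where "g \<in> lower_span \<nu>" "F (x_pow \<nu>) = const (dd \<nu>) * x_pow \<nu> + g"
      using assms(1) \<nu>(1) by (rule triangularE)
    thus ?thesis using \<nu> lower_span_hom_polys[of g \<nu>] hom_polys_x_pow[of \<nu>]
      by (auto intro: hom_polys_add hom_polys_const_mult)
  qed
  have "F f = (\<Sum>\<nu> | length \<nu> = N \<and> sum_list \<nu> = d. const (Poly_Mapping.lookup f (mon \<nu>)) * F (x_pow \<nu>))"
    by (subst hom_polys_expand[OF assms(2)]) (simp add: linear_op_sum[OF lin] linear_op_const_mult[OF lin])
  thus ?thesis using x by (auto intro!: hom_polys_sum hom_polys_const_mult)
qed

text \<open>Besides \<open>\<nu>\<close> itself, only compositions above \<open>\<nu>\<close> could
  contribute to its coefficient, and these are absent from \<open>f\<close>.\<close>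

lemma triangular_lookup:
  assumes F: "triangular N F dd" and f: "f \<in> hom_polys N d" and \<nu>: "length \<nu> = N"
    and max: "\<And>\<mu>. comp_prec \<nu> \<mu> \<Longrightarrow> Poly_Mapping.lookup f (mon \<mu>) = 0"
  shows "Poly_Mapping.lookup (F f) (mon \<nu>) = dd \<nu> * Poly_Mapping.lookup f (mon \<nu>)"
proof -
  let ?S = "{\<mu>. length \<mu> = N \<and> sum_list \<mu> = d}"
  let ?l = "Poly_Mapping.lookup"
  have lin: "linear_op F" using F by (simp add: triangular_def)
  have x: "?l f (mon \<mu>) * ?l (F (x_pow \<mu>)) (mon \<nu>) = (if \<mu> = \<nu> then dd \<nu> * ?l f (mon \<nu>) else 0)"
    if \<mu>: "\<mu> \<in> ?S" for \<mu>
  proof -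
    obtain g where g: "g \<in> lower_span \<mu>" "F (x_pow \<mu>) = const (dd \<mu>) * x_pow \<mu> + g"
      using F \<mu> by (auto elim: triangularE)
    have gl: "comp_prec \<nu> \<mu>" if "?l g (mon \<nu>) \<noteq> 0"
    proof -
      from that g obtain \<kappa> where \<kappa>: "comp_prec \<kappa> \<mu>" "mon \<nu> = mon \<kappa>"
        unfolding lower_span_def in_keys_iff[symmetric] by blast
      hence "\<nu> = \<kappa>" using mon_inject[of \<nu> \<kappa>] comp_prec_length[of \<kappa> \<mu>] \<nu> \<mu> by simp
      thus ?thesis using \<kappa> by simp
    qed
    show ?thesis
    proof (cases "\<mu> = \<nu>")
      case True
      hence "?l g (mon \<nu>) = 0" using gl comp_prec_irrefl by auto
      thus ?thesis using g(2) unfolding True by (simp add: lookup_add lookup_x_pow)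
    next
      case False
      hence "mon \<nu> \<noteq> mon \<mu>" using mon_inject[of \<nu> \<mu>] \<nu> \<mu> by auto
      moreover have "?l f (mon \<mu>) * ?l g (mon \<nu>) = 0" using gl max by auto
      ultimately show ?thesis using False by (simp add: g lookup_add lookup_x_pow distrib_left)
    qed
  qed
  have "F f = (\<Sum>\<mu>\<in>?S. const (?l f (mon \<mu>)) * F (x_pow \<mu>))"
    by (subst hom_polys_expand[OF f]) (simp add: linear_op_sum[OF lin] linear_op_const_mult[OF lin])
  hence "?l (F f) (mon \<nu>) = (\<Sum>\<mu>\<in>?S. ?l f (mon \<mu>) * ?l (F (x_pow \<mu>)) (mon \<nu>))"
    by (simp add: lookup_sum)
  also have "\<dots> = (\<Sum>\<mu>\<in>?S. if \<mu> = \<nu> then dd \<nu> * ?l f (mon \<nu>) else 0)"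
    by (rule sum.cong[OF refl x])
  also have "\<dots> = (if \<nu> \<in> ?S then dd \<nu> * ?l f (mon \<nu>) else 0)"
    using finite_compositions[of N d] by (simp add: sum.delta)
  also have "\<dots> = dd \<nu> * ?l f (mon \<nu>)"
    using hom_polys_lookup_sum[OF f \<nu>] \<nu> by auto
  finally show ?thesis .
qed

lemma comp_prec_maximal_above:
  assumes "finite S" "\<nu> \<in> S"
  shows "\<exists>\<eta>\<in>S. (\<nu> = \<eta> \<or> comp_prec \<nu> \<eta>) \<and> (\<forall>\<mu>\<in>S. \<not> comp_prec \<eta> \<mu>)"
  using assms(2)
proof (induction "card {\<mu> \<in> S. comp_prec \<nu> \<mu>}" arbitrary: \<nu> rule: less_induct)
  case less
  show ?case
  proof (cases "\<exists>\<mu>\<in>S. comp_prec \<nu> \<mu>")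
    case True
    then obtain \<mu> where \<mu>: "\<mu> \<in> S" "comp_prec \<nu> \<mu>" by blast
    have "{\<kappa> \<in> S. comp_prec \<mu> \<kappa>} \<subset> {\<kappa> \<in> S. comp_prec \<nu> \<kappa>}"
      using \<mu> comp_prec_trans comp_prec_irrefl by blast
    hence "card {\<kappa> \<in> S. comp_prec \<mu> \<kappa>} < card {\<kappa> \<in> S. comp_prec \<nu> \<kappa>}"
      using assms(1) by (intro psubset_card_mono) auto
    from less.hyps[OF this \<mu>(1)] show ?thesis using \<mu>(2) comp_prec_trans by blast
  next
    case False
    thus ?thesis using less.prems by blast
  qed
qed

lemma y_eigenvalue_eq_iff:
  "y_eigenvalue \<eta> i = y_eigenvalue \<nu> j \<longleftrightarrow> \<eta> ! (i - 1) = \<nu> ! (j - 1) \<and> eta_rank \<eta> i = eta_rank \<nu> j"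
  by (auto simp: y_eigenvalue_def qvar_tvar_powi_eq_iff)

lemma y_eigenvalue_inject:
  assumes "length \<eta> = length \<nu>" "\<And>i. i \<in> {1..length \<eta>} \<Longrightarrow> y_eigenvalue \<eta> i = y_eigenvalue \<nu> i"
  shows "\<eta> = \<nu>"
proof (rule nth_equalityI)
  fix i assume "i < length \<eta>"
  hence "y_eigenvalue \<eta> (Suc i) = y_eigenvalue \<nu> (Suc i)" by (intro assms) auto
  thus "\<eta> ! i = \<nu> ! i" by (simp add: y_eigenvalue_eq_iff)
qed fact

lemma y_eigenvalue_nonzero [simp]: "y_eigenvalue \<eta> i \<noteq> 0"
  by (simp add: y_eigenvalue_def)

text \<open>At every maximal composition of the support, triangularity reads off the given
  eigenvalues. Since eigenvalues determine the composition, there is just one maximal composition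
  although the order is partial, and the rest of the support lies below it.\<close>

lemma joint_eigenvector_leading:
  assumes f: "f \<in> hom_polys N d" "f \<noteq> 0"
    and eig: "\<And>i. i \<in> {1..N} \<Longrightarrow> Y_op N i f = const (e i) * f"
  obtains \<eta> where "length \<eta> = N" "sum_list \<eta> = d" "Poly_Mapping.lookup f (mon \<eta>) \<noteq> 0"
    "\<And>i. i \<in> {1..N} \<Longrightarrow> e i = y_eigenvalue \<eta> i"
    "\<And>\<nu>. length \<nu> = N \<Longrightarrow> Poly_Mapping.lookup f (mon \<nu>) \<noteq> 0 \<Longrightarrow> \<nu> = \<eta> \<or> comp_prec \<nu> \<eta>"
proof -
  define S where "S = {\<nu>. length \<nu> = N \<and> sum_list \<nu> = d \<and> Poly_Mapping.lookup f (mon \<nu>) \<noteq> 0}"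
  have fin: "finite S" by (rule finite_subset[OF _ finite_compositions[of N d]]) (auto simp: S_def)
  have max: "e i = y_eigenvalue \<eta> i" if \<eta>: "\<eta> \<in> S" "\<forall>\<mu>\<in>S. \<not> comp_prec \<eta> \<mu>" and i: "i \<in> {1..N}" for \<eta> i
  proof -
    have "Poly_Mapping.lookup (Y_op N i f) (mon \<eta>) = y_eigenvalue \<eta> i * Poly_Mapping.lookup f (mon \<eta>)"
    proof (rule triangular_lookup)
      show "triangular N (Y_op N i) (\<lambda>\<eta>. y_eigenvalue \<eta> i)" using i by (intro triangular_Y_op) auto
      fix \<mu> assume "comp_prec \<eta> \<mu>"
      thus "Poly_Mapping.lookup f (mon \<mu>) = 0"
        using \<eta> comp_prec_length[of \<eta> \<mu>] comp_prec_sum_list[of \<eta> \<mu>] by (auto simp: S_def)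
    qed (use f \<eta> in \<open>auto simp: S_def\<close>)
    thus ?thesis using eig[OF i] \<eta> by (simp add: S_def)
  qed
  obtain \<nu>0 where "\<nu>0 \<in> S" using hom_polys_nonzero[OF f] by (auto simp: S_def)
  then obtain \<eta> where \<eta>: "\<eta> \<in> S" "\<forall>\<mu>\<in>S. \<not> comp_prec \<eta> \<mu>"
    using comp_prec_maximal_above[OF fin] by blast
  show ?thesis
  proof (rule that[of \<eta>])
    fix \<nu> assume \<nu>: "length \<nu> = N" "Poly_Mapping.lookup f (mon \<nu>) \<noteq> 0"
    hence "\<nu> \<in> S" using hom_polys_lookup_sum[OF f(1)] by (simp add: S_def)
    then obtain \<kappa> where \<kappa>: "\<kappa> \<in> S" "\<nu> = \<kappa> \<or> comp_prec \<nu> \<kappa>" "\<forall>\<mu>\<in>S. \<not> comp_prec \<kappa> \<mu>"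
      using comp_prec_maximal_above[OF fin] by blast
    have "\<kappa> = \<eta>"
      using max[OF \<eta>] max[OF \<kappa>(1,3)] \<eta>(1) \<kappa>(1) by (intro y_eigenvalue_inject) (auto simp: S_def)
    thus "\<nu> = \<eta> \<or> comp_prec \<nu> \<eta>" using \<kappa> by simp
  qed (use \<eta> max in \<open>auto simp: S_def\<close>)
qed

text \<open>A nonzero multiple of the non-symmetric Macdonald polynomial, described by degree and
  eigenvalues alone. The triangular shape follows (\<open>eigenpoly_leading\<close>), which spares
  tracking it through the constructions.\<close>

definition eigenpoly :: "nat list \<Rightarrow> mpoly \<Rightarrow> bool" where
  "eigenpoly \<eta> f \<longleftrightarrow> f \<in> hom_polys (length \<eta>) (sum_list \<eta>) \<and> f \<noteq> 0 \<and>
     (\<forall>i\<in>{1..length \<eta>}. Y_op (length \<eta>) i f = const (y_eigenvalue \<eta> i) * f)"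

lemma eigenpoly_leading:
  assumes "eigenpoly \<eta> f"
  shows "Poly_Mapping.lookup f (mon \<eta>) \<noteq> 0"
    "\<And>\<nu>. length \<nu> = length \<eta> \<Longrightarrow> Poly_Mapping.lookup f (mon \<nu>) \<noteq> 0 \<Longrightarrow> \<nu> = \<eta> \<or> comp_prec \<nu> \<eta>"
proof -
  have a: "f \<in> hom_polys (length \<eta>) (sum_list \<eta>)" "f \<noteq> 0"
    "\<And>i. i \<in> {1..length \<eta>} \<Longrightarrow> Y_op (length \<eta>) i f = const (y_eigenvalue \<eta> i) * f"
    using assms by (auto simp: eigenpoly_def)
  from joint_eigenvector_leading[OF a] obtain \<kappa> where \<kappa>: "length \<kappa> = length \<eta>"
    "Poly_Mapping.lookup f (mon \<kappa>) \<noteq> 0"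
    "\<And>i. i \<in> {1..length \<eta>} \<Longrightarrow> y_eigenvalue \<eta> i = y_eigenvalue \<kappa> i"
    "\<And>\<nu>. length \<nu> = length \<eta> \<Longrightarrow> Poly_Mapping.lookup f (mon \<nu>) \<noteq> 0 \<Longrightarrow> \<nu> = \<kappa> \<or> comp_prec \<nu> \<kappa>"
    by metis
  have eq: "\<eta> = \<kappa>"
  proof (rule y_eigenvalue_inject)
    show "length \<eta> = length \<kappa>" using \<kappa>(1) by simp
  qed (rule \<kappa>(3))
  show "Poly_Mapping.lookup f (mon \<eta>) \<noteq> 0" using \<kappa>(2) unfolding eq .
  show "\<And>\<nu>. length \<nu> = length \<eta> \<Longrightarrow> Poly_Mapping.lookup f (mon \<nu>) \<noteq> 0 \<Longrightarrow> \<nu> = \<eta> \<or> comp_prec \<nu> \<eta>"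
    using \<kappa>(4) unfolding eq by blast
qed

lemma eigenpoly_unique:
  assumes "f \<in> hom_polys (length \<eta>) (sum_list \<eta>)"
    and "\<And>i. i \<in> {1..length \<eta>} \<Longrightarrow> Y_op (length \<eta>) i f = const (y_eigenvalue \<eta> i) * f"
    and "Poly_Mapping.lookup f (mon \<eta>) = 0"
  shows "f = 0"
  using assms eigenpoly_leading(1)[of \<eta> f] by (auto simp: eigenpoly_def)

lemma eigenpoly_scale:
  assumes "eigenpoly \<eta> f" "c \<noteq> 0"
  shows "eigenpoly \<eta> (const c * f)"
  unfolding eigenpoly_def
proof (intro conjI ballI)
  fix i assume i: "i \<in> {1..length \<eta>}"
  hence "Y_op (length \<eta>) i (const c * f) = const c * Y_op (length \<eta>) i f"
    by (intro linear_op_const_mult) auto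
  thus "Y_op (length \<eta>) i (const c * f) = const (y_eigenvalue \<eta> i) * (const c * f)"
    using assms i by (simp add: eigenpoly_def mult.left_commute)
qed (use assms in \<open>auto simp: eigenpoly_def intro: hom_polys_const_mult\<close>)

text \<open>Two candidates differ by a polynomial with the same eigenvalues and no coefficient at
  \<open>\<eta>\<close>, and \<open>eigenpoly_unique\<close> makes it zero.\<close>

lemma E_poly_eqI:
  assumes f: "eigenpoly \<eta> f" "Poly_Mapping.lookup f (mon \<eta>) = 1"
  shows "E_poly \<eta> = f"
  unfolding E_poly_def y_eigenvalue_def[symmetric]
proof (rule the_equality)
  let ?P = "\<lambda>E. \<exists>b. E = x_pow \<eta> + (\<Sum>\<nu> | comp_prec \<nu> \<eta>. const (b \<nu>) * x_pow \<nu>)"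
  let ?l = "Poly_Mapping.lookup"
  have "?P f"
  proof -
    have "f = (\<Sum>\<nu>\<in>insert \<eta> {\<nu>. comp_prec \<nu> \<eta>}. const (?l f (mon \<nu>)) * x_pow \<nu>)"
    proof (rule mpoly_sum_x_pow)
      show "Poly_Mapping.keys f \<subseteq> mon ` insert \<eta> {\<nu>. comp_prec \<nu> \<eta>}"
      proof
        fix \<alpha> assume \<alpha>: "\<alpha> \<in> Poly_Mapping.keys f"
        then obtain \<nu> where "\<alpha> = mon \<nu>" "length \<nu> = length \<eta>"
          using f by (auto simp: eigenpoly_def hom_polys_def)
        thus "\<alpha> \<in> mon ` insert \<eta> {\<nu>. comp_prec \<nu> \<eta>}"
          using eigenpoly_leading(2)[OF f(1), of \<nu>] \<alpha> by (auto simp: in_keys_iff)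
      qed
      show "inj_on mon (insert \<eta> {\<nu>. comp_prec \<nu> \<eta>})"
        by (rule inj_on_mon[of _ "length \<eta>"]) (auto simp: comp_prec_length)
    qed simp
    also have "\<dots> = x_pow \<eta> + (\<Sum>\<nu> | comp_prec \<nu> \<eta>. const (?l f (mon \<nu>)) * x_pow \<nu>)"
      using comp_prec_irrefl f(2) by simp
    finally show ?thesis by (intro exI[of _ "\<lambda>\<nu>. ?l f (mon \<nu>)"])
  qed
  thus "?P f \<and> (\<forall>i\<in>{1..length \<eta>}. Y_op (length \<eta>) i f = const (y_eigenvalue \<eta> i) * f)"
    using f by (auto simp: eigenpoly_def)
  fix E assume E: "?P E \<and> (\<forall>i\<in>{1..length \<eta>}. Y_op (length \<eta>) i E = const (y_eigenvalue \<eta> i) * E)"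
  then obtain b where b: "E = x_pow \<eta> + (\<Sum>\<nu> | comp_prec \<nu> \<eta>. const (b \<nu>) * x_pow \<nu>)" by blast
  have ls: "(\<Sum>\<nu> | comp_prec \<nu> \<eta>. const (b \<nu>) * x_pow \<nu>) \<in> lower_span \<eta>"
    by (intro lower_span_sum lower_span_const_mult lower_span_x_pow) auto
  have hE: "E \<in> hom_polys (length \<eta>) (sum_list \<eta>)"
    unfolding b using hom_polys_x_pow[of \<eta>] lower_span_hom_polys[OF ls] by (rule hom_polys_add)
  have "?l (x_pow \<nu>) (mon \<eta>) = 0" if "comp_prec \<nu> \<eta>" for \<nu>
    using mon_inject[of \<eta> \<nu>] comp_prec_length[OF that] that comp_prec_irrefl by (auto simp: lookup_x_pow)
  hence "?l E (mon \<eta>) = 1"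
    by (simp add: b lookup_add lookup_sum lookup_x_pow[of \<eta>])
  hence "E - f = 0"
    using E f hE
    by (intro eigenpoly_unique)
       (auto simp: lookup_minus eigenpoly_def right_diff_distrib linear_op_diff intro: hom_polys_diff)
  thus "E = f" by simp
qed

subsection \<open>Existence\<close>

lemma x_pow_append_last: "x_pow (\<eta> @ [a]) = x_pow \<eta> * xvar (Suc (length \<eta>)) ^ a"
proof -
  let ?n = "length \<eta>"
  have "x_pow (\<eta> @ [a]) = (\<Prod>i=1..Suc ?n. xvar i ^ ((\<eta> @ [a]) ! (i - 1)))"
    by (simp add: x_pow_def del: prod.cl_ivl_Suc)
  also have "\<dots> = (\<Prod>i=1..?n. xvar i ^ ((\<eta> @ [a]) ! (i - 1))) * xvar (Suc ?n) ^ ((\<eta> @ [a]) ! ?n)"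
    by simp
  also have "(\<Prod>i=1..?n. xvar i ^ ((\<eta> @ [a]) ! (i - 1))) = x_pow \<eta>"
    unfolding x_pow_def by (intro prod.cong) (auto simp: nth_append)
  finally show ?thesis by simp
qed

lemma omega_op_x_pow:
  "omega_op (Suc (length \<eta>)) (x_pow (a # \<eta>)) = const (qvar ^ a) * x_pow (\<eta> @ [a])"
proof -
  let ?n = "length \<eta>"
  have "omega_op (Suc ?n) (x_pow (a # \<eta>)) = (\<Prod>i=1..Suc ?n. omega_var (Suc ?n) i ^ ((a # \<eta>) ! (i - 1)))"
    by (simp add: omega_op_substitute x_pow_def substitute_prod substitute_power del: prod.cl_ivl_Suc)
  also have "\<dots> = (const qvar * xvar (Suc ?n)) ^ a * (\<Prod>i=Suc 1..Suc ?n. omega_var (Suc ?n) i ^ ((a # \<eta>) ! (i - 1)))"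
    by (simp add: prod.atLeast_Suc_atMost omega_var_def del: prod.cl_ivl_Suc)
  also have "(\<Prod>i=Suc 1..Suc ?n. omega_var (Suc ?n) i ^ ((a # \<eta>) ! (i - 1))) = (\<Prod>i=1..?n. xvar i ^ (\<eta> ! (i - 1)))"
    unfolding prod.shift_bounds_cl_Suc_ivl by (intro prod.cong refl) (auto simp: omega_var_def)
  also have "(const qvar * xvar (Suc ?n)) ^ a * \<dots> = const (qvar ^ a) * x_pow (\<eta> @ [a])"
    unfolding x_pow_append_last unfolding x_pow_def by (simp add: power_mult_distrib const_power ac_simps)
  finally show ?thesis .
qed

lemma Phi_op_x_pow:
  "Phi_op (Suc (length \<eta>)) (x_pow (a # \<eta>)) = const (qvar ^ a) * x_pow (\<eta> @ [Suc a])"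
  unfolding Phi_op_def omega_op_x_pow x_pow_append_last by (simp add: ac_simps)

lemma xvar_nonzero: "xvar k \<noteq> 0"
proof
  assume "xvar k = 0"
  hence "Poly_Mapping.lookup (xvar k) (Poly_Mapping.single k 1) = 0" by simp
  thus False by (simp add: xvar_def)
qed

lemma Phi_op_hom_polys:
  assumes "f \<in> hom_polys (Suc n) d"
  shows "Phi_op (Suc n) f \<in> hom_polys (Suc n) (Suc d)"
proof -
  have lin: "linear_op (Phi_op (Suc n))" by (rule linear_op_Phi_op) simp
  have "Phi_op (Suc n) (x_pow \<nu>) \<in> hom_polys (Suc n) (Suc d)" if "length \<nu> = Suc n" "sum_list \<nu> = d" for \<nu>
  proof -
    obtain a \<kappa> where \<nu>: "\<nu> = a # \<kappa>" "length \<kappa> = n" using \<open>length \<nu> = Suc n\<close> by (cases \<nu>) auto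
    show ?thesis
      using Phi_op_x_pow[of \<kappa> a] hom_polys_x_pow[of "\<kappa> @ [Suc a]"] that \<nu>
      by (auto intro: hom_polys_const_mult simp: add.commute)
  qed
  moreover have "Phi_op (Suc n) f = (\<Sum>\<nu> | length \<nu> = Suc n \<and> sum_list \<nu> = d.
      const (Poly_Mapping.lookup f (mon \<nu>)) * Phi_op (Suc n) (x_pow \<nu>))"
    by (subst hom_polys_expand[OF assms]) (simp add: linear_op_sum[OF lin] linear_op_const_mult[OF lin])
  ultimately show ?thesis by (auto intro!: hom_polys_sum hom_polys_const_mult)
qed

lemma omega_op_eq_0:
  assumes "N \<ge> 1" "omega_op N f = 0"
  shows "f = 0"
proof -
  \<comment> \<open>The inverse substitution: the variables move up cyclically, and the last one, on
    returning to the first place, loses its q.\<close>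
  let ?h = "\<lambda>k. if k = N then const (inverse qvar) * xvar 1 else if 1 \<le> k \<and> k < N then xvar (Suc k) else xvar k"
  have "substitute ?h (omega_op N f) = f"
  proof -
    have "(\<lambda>k. substitute ?h (omega_var N k)) = xvar"
    proof
      fix k
      show "substitute ?h (omega_var N k) = xvar k"
        using assms(1) by (cases "k = 1") (auto simp: omega_var_def substitute_mult mult.assoc[symmetric] simp flip: const_mult)
    qed
    thus ?thesis by (simp add: omega_op_substitute[OF assms(1)] substitute_substitute)
  qed
  thus ?thesis using assms(2) by simp
qed

text \<open>Only the eigenvalues of the image are computed. By
  \<open>joint_eigenvector_leading\<close> they belong to some composition, and their powers of q
  identify it, so the ranks of the rotated composition come for free.\<close>

lemma eigenpoly_Phi:
  assumes "eigenpoly (a # \<eta>) f"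
  shows "eigenpoly (\<eta> @ [Suc a]) (Phi_op (Suc (length \<eta>)) f)"
proof -
  let ?N = "Suc (length \<eta>)" and ?g = "Phi_op (Suc (length \<eta>)) f"
  have f: "f \<in> hom_polys ?N (a + sum_list \<eta>)" "f \<noteq> 0"
    "\<And>i. i \<in> {1..?N} \<Longrightarrow> Y_op ?N i f = const (y_eigenvalue (a # \<eta>) i) * f"
    using assms by (auto simp: eigenpoly_def)
  define e where "e i = (if i = ?N then qvar * y_eigenvalue (a # \<eta>) 1 else y_eigenvalue (a # \<eta>) (Suc i))" for i
  have lin: "linear_op (Phi_op ?N)" by (rule linear_op_Phi_op) simp
  have eig: "Y_op ?N i ?g = const (e i) * ?g" if i: "i \<in> {1..?N}" for i
  proof (cases "i = ?N")
    case True
    thus ?thesis using Y_Phi_last[of ?N f] f(3)[of 1]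
      by (simp add: e_def linear_op_const_mult[OF lin] const_mult mult.assoc)
  next
    case False
    thus ?thesis using Y_Phi[of i ?N f] f(3)[of "Suc i"] i
      by (simp add: e_def linear_op_const_mult[OF lin])
  qed
  have g: "?g \<in> hom_polys ?N (Suc (a + sum_list \<eta>))" using f(1) by (rule Phi_op_hom_polys)
  have "?g \<noteq> 0" using omega_op_eq_0[of ?N f] f(2) xvar_nonzero by (auto simp: Phi_op_def)
  from joint_eigenvector_leading[OF g \<open>?g \<noteq> 0\<close> eig] obtain \<kappa> where \<kappa>: "length \<kappa> = ?N"
    "\<And>i. i \<in> {1..?N} \<Longrightarrow> e i = y_eigenvalue \<kappa> i"
    by metis
  have "\<kappa> = \<eta> @ [Suc a]"
  proof (rule nth_equalityI)
    fix i assume i: "i < length \<kappa>"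
    show "\<kappa> ! i = (\<eta> @ [Suc a]) ! i"
    proof (cases "i = length \<eta>")
      case True
      have "qvar * y_eigenvalue (a # \<eta>) 1 = y_eigenvalue \<kappa> ?N" using \<kappa>(2)[of ?N] by (simp add: e_def)
      hence "qvar ^ Suc a * tvar powi (1 - int (eta_rank (a # \<eta>) 1)) = qvar ^ (\<kappa> ! length \<eta>) * tvar powi (1 - int (eta_rank \<kappa> ?N))"
        by (simp add: y_eigenvalue_def mult.assoc)
      thus ?thesis using True unfolding qvar_tvar_powi_eq_iff by simp
    next
      case False
      have "y_eigenvalue (a # \<eta>) (Suc (Suc i)) = y_eigenvalue \<kappa> (Suc i)"
        using \<kappa>(2)[of "Suc i"] False i \<kappa>(1) by (simp add: e_def)
      thus ?thesis using False i \<kappa>(1) by (simp add: y_eigenvalue_eq_iff nth_append)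
    qed
  qed (use \<kappa> in simp)
  thus ?thesis using \<kappa>(2) eig g \<open>?g \<noteq> 0\<close> by (auto simp: eigenpoly_def add.commute add.left_commute)
qed

section \<open>The action of T on eigenpolynomials\<close>

lemma T_op_R_gen: "T_op i f = R_gen i (Suc i) (perm_op (transpose i (Suc i)) f)"
  by (simp add: T_op_T_gen R_gen_def perm_op_comp)

lemma perm_op_hom_polys:
  assumes "f \<in> hom_polys N d" "i \<in> {1..N}" "j \<in> {1..N}"
  shows "perm_op (transpose i j) f \<in> hom_polys N d"
proof -
  have "perm_op (transpose i j) (x_pow \<nu>) \<in> hom_polys N d" if "length \<nu> = N" "sum_list \<nu> = d" for \<nu>
    using that assms hom_polys_x_pow[of "swap_list i j \<nu>"] by (simp add: perm_op_x_pow sum_list_swap_list)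
  moreover have "perm_op (transpose i j) f = (\<Sum>\<nu> | length \<nu> = N \<and> sum_list \<nu> = d.
      const (Poly_Mapping.lookup f (mon \<nu>)) * perm_op (transpose i j) (x_pow \<nu>))"
    by (subst hom_polys_expand[OF assms(1)]) (simp add: perm_op_sum perm_op_mult)
  ultimately show ?thesis by (auto intro!: hom_polys_sum hom_polys_const_mult)
qed

lemma T_op_hom_polys:
  assumes "f \<in> hom_polys N d" "1 \<le> i" "i < N"
  shows "T_op i f \<in> hom_polys N d"
  unfolding T_op_R_gen using assms
  by (intro triangular_hom_polys[OF triangular_R_gen] perm_op_hom_polys) auto

lemma lookup_perm_op_mon:
  assumes "i \<in> {1..length \<nu>}" "j \<in> {1..length \<nu>}"
  shows "Poly_Mapping.lookup (perm_op (transpose i j) f) (mon \<nu>) = Poly_Mapping.lookup f (mon (swap_list i j \<nu>))"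
proof -
  have "Poly_Mapping.single (mon (swap_list i j \<nu>)) 1 = perm_op (transpose i j) (Poly_Mapping.single (mon \<nu>) 1)"
    using perm_op_x_pow[OF assms] by (simp add: x_pow_mon)
  also have "\<dots> = Poly_Mapping.single (Poly_Mapping.map_key (transpose i j) (mon \<nu>)) 1"
    by (simp add: perm_op_single)
  finally have "Poly_Mapping.map_key (transpose i j) (mon \<nu>) = mon (swap_list i j \<nu>)"
    by (metis keys_single one_neq_zero singleton_inject)
  thus ?thesis by (simp add: lookup_perm_op)
qed

text \<open>T is R after the exchange \<open>s\<close>, and \<open>s\<close> is not triangular, so
  it has to be shown that \<open>s f\<close> contains nothing above \<open>s \<eta>\<close>. For
  such a \<open>\<mu>\<close>, dominance in both directions forces equal parts. Apart from the
  trivial case \<open>s \<mu> = \<eta>\<close>, the lengths of the sorting permutations then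
  increase strictly along \<open>\<mu>\<close>, \<open>s \<eta>\<close>, \<open>\<eta>\<close>,
  \<open>s \<mu>\<close>, while \<open>s\<close> raises a length by at most one.\<close>

lemma lookup_T_op_swap:
  assumes f: "eigenpoly \<eta> f" and i: "1 \<le> i" "i < length \<eta>" and less: "\<eta> ! (i - 1) < \<eta> ! i"
  shows "Poly_Mapping.lookup (T_op i f) (mon (swap_list i (Suc i) \<eta>)) = tvar * Poly_Mapping.lookup f (mon \<eta>)"
proof -
  let ?N = "length \<eta>" and ?s = "swap_list i (Suc i)" and ?p = "perm_op (transpose i (Suc i))"
  let ?l = "\<lambda>\<nu>. perm_length (length \<eta>) (min_perm \<nu>)"
  have ii: "i \<in> {1..?N}" "Suc i \<in> {1..?N}" using i by auto
  have nth: "?s \<eta> ! (i - 1) = \<eta> ! i" "?s \<eta> ! i = \<eta> ! (i - 1)"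
    using nth_swap_list[OF ii, of i] nth_swap_list[OF ii, of "Suc i"] i by auto
  have ss: "?s (?s \<nu>) = \<nu>" if "length \<nu> = ?N" for \<nu>
    using ii that by (intro swap_list_swap_list) auto
  have f': "f \<in> hom_polys ?N (sum_list \<eta>)" using f by (simp add: eigenpoly_def)
  have "Poly_Mapping.lookup (R_gen i (Suc i) (?p f)) (mon (?s \<eta>)) =
      (if ?s \<eta> ! (Suc i - 1) \<le> ?s \<eta> ! (i - 1) then tvar else 1) * Poly_Mapping.lookup (?p f) (mon (?s \<eta>))"
  proof (rule triangular_lookup)
    show "triangular ?N (R_gen i (Suc i)) (\<lambda>\<eta>. if \<eta> ! (Suc i - 1) \<le> \<eta> ! (i - 1) then tvar else 1)"
      using i by (intro triangular_R_gen) auto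
    show "?p f \<in> hom_polys ?N (sum_list \<eta>)" using f' ii by (rule perm_op_hom_polys)
    fix \<mu> assume \<mu>: "comp_prec (?s \<eta>) \<mu>"
    have len: "length \<mu> = ?N" using comp_prec_length[OF \<mu>] by simp
    have decr: "decr (?s \<kappa>) = decr \<kappa>" if "length \<kappa> = ?N" for \<kappa>
      using mset_swap_list[of i \<kappa> "Suc i"] ii that by (simp add: decr_eq_iff)
    have "Poly_Mapping.lookup f (mon (?s \<mu>)) = 0"
    proof (rule ccontr)
      assume "Poly_Mapping.lookup f (mon (?s \<mu>)) \<noteq> 0"
      hence "?s \<mu> = \<eta> \<or> comp_prec (?s \<mu>) \<eta>" using eigenpoly_leading(2)[OF f, of "?s \<mu>"] len by simp
      hence le: "?s \<mu> = \<eta> \<or> strictly_dominated (decr \<mu>) (decr \<eta>) \<or> decr \<mu> = decr \<eta> \<and> ?l \<eta> < ?l (?s \<mu>)"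
        using len by (auto simp: comp_prec_def decr dest: bruhat_less_length)
      have ge: "strictly_dominated (decr \<eta>) (decr \<mu>) \<or> decr \<eta> = decr \<mu> \<and> ?l \<mu> < ?l (?s \<eta>)"
        using \<mu> len by (auto simp: comp_prec_def decr dest: bruhat_less_length)
      have l1: "?l (?s \<eta>) < ?l \<eta>"
        using bruhat_less_length[OF bruhat_less_swap[of i "Suc i" "?s \<eta>"]] i less nth ss[of \<eta>] by simp
      have l2: "?l (?s \<mu>) \<le> Suc (?l \<mu>)"
        using perm_length_min_perm_swap_le[of i \<mu>] i len by simp
      have asym: "\<not> (strictly_dominated (decr \<eta>) (decr \<mu>) \<and> strictly_dominated (decr \<mu>) (decr \<eta>))"
        using strictly_dominated_trans[of "decr \<eta>" "decr \<mu>" "decr \<eta>"] strictly_dominated_irrefl len by force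
      from le consider "?s \<mu> = \<eta>" | "strictly_dominated (decr \<mu>) (decr \<eta>)"
        | "decr \<mu> = decr \<eta>" "?l \<eta> < ?l (?s \<mu>)" by blast
      thus False
      proof cases
        case 1
        hence "decr \<mu> = decr \<eta>" "?s \<eta> = \<mu>" using decr[OF len] ss[OF len] by simp_all
        thus ?thesis using ge strictly_dominated_irrefl by simp
      next
        case 2
        thus ?thesis using ge asym strictly_dominated_irrefl by metis
      next
        case 3
        hence "?l \<mu> < ?l (?s \<eta>)" using ge strictly_dominated_irrefl by metis
        thus ?thesis using 3 l1 l2 by linarith
      qed
    qed
    thus "Poly_Mapping.lookup (?p f) (mon \<mu>) = 0"
      using ii len by (simp add: lookup_perm_op_mon)
  qed simp
  also have "Poly_Mapping.lookup (?p f) (mon (?s \<eta>)) = Poly_Mapping.lookup f (mon \<eta>)"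
    using ii ss[of \<eta>] by (simp add: lookup_perm_op_mon)
  finally show ?thesis using less nth by (simp add: T_op_R_gen)
qed

lemma eta_rank_Suc:
  assumes "1 \<le> i" "i < length \<eta>" "\<eta> ! i = \<eta> ! (i - 1)"
  shows "eta_rank \<eta> (Suc i) = Suc (eta_rank \<eta> i)"
proof -
  have "{j \<in> {1..Suc i}. \<eta> ! (j - 1) = \<eta> ! i} = insert (Suc i) {j \<in> {1..i}. \<eta> ! (j - 1) = \<eta> ! i}"
    by auto
  thus ?thesis using assms by (simp add: eta_rank_def)
qed

lemma y_eigenvalue_Suc_neq:
  assumes "1 \<le> i" "i < length \<eta>"
  shows "y_eigenvalue \<eta> i \<noteq> y_eigenvalue \<eta> (Suc i)"
  using eta_rank_Suc[OF assms] by (auto simp: y_eigenvalue_eq_iff)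

text \<open>The constant \<open>c\<close> for which \<open>T_op i f - c f\<close> is, unless it
  vanishes, again a joint eigenvector, with the eigenvalues at \<open>i\<close> and
  \<open>Suc i\<close> exchanged.\<close>

definition T_diag :: "nat list \<Rightarrow> nat \<Rightarrow> qt" where
  "T_diag \<eta> i = (tvar - 1) * y_eigenvalue \<eta> i / (y_eigenvalue \<eta> i - y_eigenvalue \<eta> (Suc i))"

lemma T_diag_eq:
  assumes "1 \<le> i" "i < length \<eta>"
  shows "(tvar - 1) * y_eigenvalue \<eta> i = T_diag \<eta> i * (y_eigenvalue \<eta> i - y_eigenvalue \<eta> (Suc i))"
  using y_eigenvalue_Suc_neq[OF assms] by (simp add: T_diag_def)

lemma T_op_eigen:
  assumes f: "eigenpoly \<eta> f" and i: "1 \<le> i" "i < length \<eta>" and j: "j \<in> {1..length \<eta>}"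
  shows "Y_op (length \<eta>) j (T_op i f - const (T_diag \<eta> i) * f) =
    const (y_eigenvalue \<eta> (transpose i (Suc i) j)) * (T_op i f - const (T_diag \<eta> i) * f)"
proof -
  let ?N = "length \<eta>" and ?y = "y_eigenvalue \<eta>" and ?c = "T_diag \<eta> i"
  have lin: "linear_op (Y_op ?N j)" for j using i by (intro linear_op_Y_op) auto
  have Y: "Y_op ?N j f = const (?y j) * f" if "j \<in> {1..?N}" for j
    using f that by (auto simp: eigenpoly_def)
  have c: "const (tvar - 1) * const (?y i) = const ?c * (const (?y i) - const (?y (Suc i)))"
    by (simp add: T_diag_eq[OF i] flip: const_mult const_diff)
  have d: "Y_op ?N j (T_op i f - const ?c * f) = Y_op ?N j (T_op i f) - const ?c * (const (?y j) * f)" 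
    using j by (simp add: linear_op_diff[OF lin] linear_op_const_mult[OF lin] Y)
  consider "j = i" | "j = Suc i" | "j \<noteq> i" "j \<noteq> Suc i" by blast
  thus ?thesis
  proof cases
    case 1
    \<comment> \<open>\<open>T_Y_T\<close> is applied to \<open>Tinv_op i f\<close>, so that the
      inner T disappears and \<open>Y_op\<close> meets the eigenvector \<open>f\<close>.\<close>
    have "T_op i (Y_op ?N (Suc i) (T_op i (Tinv_op i f))) = const tvar * Y_op ?N i (Tinv_op i f)"
      using i by (intro T_Y_T) auto
    hence "const (?y (Suc i)) * T_op i f = Y_op ?N i (const tvar * Tinv_op i f)"
      using i by (simp add: Y T_op_const_mult linear_op_const_mult[OF lin])
    also have "const tvar * Tinv_op i f = T_op i f - const (tvar - 1) * f"
      by (simp add: Tinv_op_def mult.assoc[symmetric] flip: const_mult)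
    finally have "Y_op ?N i (T_op i f) = const (?y (Suc i)) * T_op i f + const (tvar - 1) * const (?y i) * f"
      using i by (simp add: linear_op_diff[OF lin] linear_op_const_mult[OF lin] Y mult.assoc)
    thus ?thesis unfolding d using 1 by (simp add: c algebra_simps)
  next
    case 2
    have "T_op i (Y_op ?N (Suc i) (T_op i f)) = const tvar * Y_op ?N i f"
      using i by (intro T_Y_T) auto
    hence "T_op i (Y_op ?N (Suc i) (T_op i f)) = const (tvar * ?y i) * f"
      using i by (simp add: Y const_mult mult.assoc)
    hence "Y_op ?N (Suc i) (T_op i f) = Tinv_op i (const (tvar * ?y i) * f)"
      using Tinv_T_op[of i "Y_op ?N (Suc i) (T_op i f)"] by simp
    also have "\<dots> = const (inverse tvar * (tvar * ?y i)) * (T_op i f - const (tvar - 1) * f)"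
      unfolding linear_op_const_mult[OF linear_op_Tinv_op] unfolding Tinv_op_def
      by (simp add: const_mult mult.assoc mult.left_commute)
    also have "\<dots> = const (?y i) * T_op i f - const (tvar - 1) * const (?y i) * f"
    proof -
      have e: "inverse tvar * (tvar * ?y i) = ?y i" by (simp add: mult.assoc[symmetric])
      show ?thesis unfolding e by (simp add: algebra_simps)
    qed
    finally show ?thesis unfolding d using 2 by (simp add: c algebra_simps)
  next
    case 3
    have "Y_op ?N j (T_op i f) = T_op i (Y_op ?N j f)"
      using i j 3 by (intro T_Y_commute[symmetric]) auto
    also have "\<dots> = const (?y j) * T_op i f" using j by (simp add: Y T_op_const_mult)
    finally show ?thesis unfolding d using 3 by (simp add: transpose_apply_other algebra_simps)
  qed
qed

text \<open>Again the eigenvalues identify the composition. For equal neighbours the exchange would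
  fix the composition but permute two different eigenvalues; so the difference vanishes there, and
  \<open>T_op i\<close> acts by a scalar.\<close>

lemma eigenpoly_T_op:
  assumes f: "eigenpoly \<eta> f" and i: "1 \<le> i" "i < length \<eta>"
  defines "h \<equiv> T_op i f - const (T_diag \<eta> i) * f"
  assumes h: "h \<noteq> 0"
  shows "eigenpoly (swap_list i (Suc i) \<eta>) h" "\<eta> ! (i - 1) \<noteq> \<eta> ! i"
proof -
  let ?N = "length \<eta>" and ?\<nu> = "swap_list i (Suc i) \<eta>"
  have ii: "i \<in> {1..?N}" "Suc i \<in> {1..?N}" using i by auto
  have f': "f \<in> hom_polys ?N (sum_list \<eta>)" using f by (simp add: eigenpoly_def)
  have hh: "h \<in> hom_polys ?N (sum_list \<eta>)"
    unfolding h_def using f' i by (intro hom_polys_diff hom_polys_const_mult T_op_hom_polys) auto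
  from joint_eigenvector_leading[OF hh h T_op_eigen[OF f i, folded h_def]]
  obtain \<kappa> where \<kappa>: "length \<kappa> = ?N"
    "\<And>j. j \<in> {1..?N} \<Longrightarrow> y_eigenvalue \<eta> (transpose i (Suc i) j) = y_eigenvalue \<kappa> j"
    by metis
  have \<kappa>\<nu>: "\<kappa> = ?\<nu>"
  proof (rule nth_equalityI)
    fix j assume j: "j < length \<kappa>"
    hence "\<kappa> ! (Suc j - 1) = \<eta> ! (transpose i (Suc i) (Suc j) - 1)"
      using \<kappa>(2)[of "Suc j"] \<kappa>(1) by (simp add: y_eigenvalue_eq_iff)
    also have "\<dots> = ?\<nu> ! (Suc j - 1)" using nth_swap_list[OF ii, of "Suc j"] by simp
    finally show "\<kappa> ! j = ?\<nu> ! j" by simp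
  qed (use \<kappa> in simp)
  show "eigenpoly ?\<nu> h"
    unfolding eigenpoly_def using hh h \<kappa> \<kappa>\<nu> T_op_eigen[OF f i, folded h_def] sum_list_swap_list[OF ii]
    by simp
  show "\<eta> ! (i - 1) \<noteq> \<eta> ! i"
  proof
    assume eq: "\<eta> ! (i - 1) = \<eta> ! i"
    have "?\<nu> = \<eta>[i - 1 := \<eta> ! (i - 1), i := \<eta> ! i]"
      by (simp only: swap_list_def diff_Suc_1 eq[symmetric])
    hence "\<kappa> = \<eta>" using \<kappa>\<nu> by (simp only: list_update_id)
    hence "y_eigenvalue \<eta> (Suc i) = y_eigenvalue \<eta> i" using \<kappa>(2)[of i] i by simp
    thus False using y_eigenvalue_Suc_neq[OF i] by simp
  qed
qed

lemma eigenpoly_T_op_less: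
  assumes f: "eigenpoly \<eta> f" and i: "1 \<le> i" "i < length \<eta>" and less: "\<eta> ! (i - 1) < \<eta> ! i"
  defines "h \<equiv> T_op i f - const (T_diag \<eta> i) * f"
  shows "eigenpoly (swap_list i (Suc i) \<eta>) h"
    "Poly_Mapping.lookup h (mon (swap_list i (Suc i) \<eta>)) = tvar * Poly_Mapping.lookup f (mon \<eta>)"
proof -
  let ?\<nu> = "swap_list i (Suc i) \<eta>"
  have ii: "i \<in> {1..length \<eta>}" "Suc i \<in> {1..length \<eta>}" using i by auto
  have nth: "?\<nu> ! (i - 1) = \<eta> ! i" "?\<nu> ! i = \<eta> ! (i - 1)"
    using nth_swap_list[OF ii, of i] nth_swap_list[OF ii, of "Suc i"] i by auto
  have "comp_prec \<eta> ?\<nu>"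
    using comp_prec_swap[of i "Suc i" ?\<nu>] i less nth swap_list_swap_list[OF ii] by simp
  hence "\<not> (?\<nu> = \<eta> \<or> comp_prec ?\<nu> \<eta>)"
    using comp_prec_trans comp_prec_irrefl by metis
  hence "Poly_Mapping.lookup f (mon ?\<nu>) = 0" using eigenpoly_leading(2)[OF f, of ?\<nu>] by auto
  thus l: "Poly_Mapping.lookup h (mon ?\<nu>) = tvar * Poly_Mapping.lookup f (mon \<eta>)"
    using lookup_T_op_swap[OF f i less] by (simp add: h_def lookup_minus)
  hence "h \<noteq> 0" using eigenpoly_leading(1)[OF f] by auto
  thus "eigenpoly ?\<nu> h" unfolding h_def by (rule eigenpoly_T_op(1)[OF f i])
qed

text \<open>No composition lies below the zero composition, so triangularity already makes
  \<open>1\<close> an eigenvector.\<close>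

lemma eigenpoly_replicate_0: "eigenpoly (replicate N 0) 1"
proof -
  let ?\<eta> = "replicate N (0::nat)"
  have "mon ?\<eta> = 0" by (rule poly_mapping_eqI) (auto simp: lookup_mon)
  hence x: "x_pow ?\<eta> = 1" by (simp add: x_pow_mon)
  have "g = 0" if "g \<in> lower_span ?\<eta>" for g
  proof -
    have "\<not> comp_prec \<nu> ?\<eta>" for \<nu>
    proof
      assume *: "comp_prec \<nu> ?\<eta>"
      have "\<nu> = ?\<eta>"
        using comp_prec_sum_list[OF *] comp_prec_length[OF *] by (intro replicate_eqI) (auto simp: sum_list_replicate)
      thus False using * comp_prec_irrefl by simp
    qed
    thus ?thesis using that by (auto simp: lower_span_def)
  qed
  hence "Y_op N i 1 = const (y_eigenvalue ?\<eta> i) * 1" if "i \<in> {1..N}" for i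
    using triangular_Y_op[of i N] that x unfolding triangular_def by force
  moreover have "1 \<in> hom_polys N 0" using hom_polys_x_pow[of ?\<eta>] x by (simp add: sum_list_replicate)
  ultimately show ?thesis by (simp add: eigenpoly_def sum_list_replicate)
qed

text \<open>Induction on the degree. The last nonzero entry \<open>Suc a\<close> is followed by
  zeros only. It is brought to its place from the very end by exchanges with zeros, all at ascents;
  standing at the end, it comes from a raising step applied to a composition of degree one
  less.\<close>

lemma exists_eigenpoly: "\<exists>f. eigenpoly \<eta> f"
proof (induction "sum_list \<eta>" arbitrary: \<eta> rule: less_induct)
  case less
  have *: "\<exists>f. eigenpoly (xs @ [Suc a] @ replicate n 0) f" if "sum_list \<eta> = sum_list xs + Suc a" for xs a n
    using that
  proof (induction n arbitrary: xs)
    case 0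
    have "\<exists>f. eigenpoly (a # xs) f" using 0 by (intro less.hyps) simp
    thus ?case using eigenpoly_Phi by fastforce
  next
    case (Suc n)
    let ?\<kappa> = "xs @ 0 # Suc a # replicate n 0"
    have "\<exists>f. eigenpoly ((xs @ [0]) @ [Suc a] @ replicate n 0) f" using Suc.prems by (intro Suc.IH) simp
    then obtain f where "eigenpoly ?\<kappa> f" by auto
    from eigenpoly_T_op_less(1)[OF this, of "Suc (length xs)"]
    have "\<exists>f. eigenpoly (swap_list (Suc (length xs)) (Suc (Suc (length xs))) ?\<kappa>) f"
      by (auto simp: nth_append)
    also have "swap_list (Suc (length xs)) (Suc (Suc (length xs))) ?\<kappa> = xs @ Suc a # 0 # replicate n 0"
      by (simp add: swap_list_def nth_append list_update_append)
    finally show ?case by simp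
  qed
  show ?case
  proof (cases "\<forall>x\<in>set \<eta>. x = 0")
    case True
    hence "\<eta> = replicate (length \<eta>) 0" by (intro replicate_eqI) auto
    thus ?thesis using eigenpoly_replicate_0 by metis
  next
    case False
    then obtain xs y ys where \<eta>: "\<eta> = xs @ y # ys" "y \<noteq> 0" "\<forall>z\<in>set ys. \<not> z \<noteq> 0"
      using split_list_last_prop[of \<eta> "\<lambda>x. x \<noteq> 0"] by metis
    have "ys = replicate (length ys) 0" using \<eta>(3) by (intro replicate_eqI) auto
    then obtain n where ys: "ys = replicate n 0" by blast
    obtain a where y: "y = Suc a" using \<eta>(2) by (cases y) auto
    show ?thesis using *[of xs a n] by (simp add: \<eta>(1) ys y sum_list_replicate)
  qed
qed

lemma eigenpoly_E_poly: "eigenpoly \<eta> (E_poly \<eta>)"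
  and lookup_E_poly [simp]: "Poly_Mapping.lookup (E_poly \<eta>) (mon \<eta>) = 1"
proof -
  obtain f where f: "eigenpoly \<eta> f" using exists_eigenpoly by blast
  define g where "g = const (inverse (Poly_Mapping.lookup f (mon \<eta>))) * f"
  have l: "Poly_Mapping.lookup f (mon \<eta>) \<noteq> 0" using eigenpoly_leading(1)[OF f] .
  have g: "eigenpoly \<eta> g" unfolding g_def using l by (intro eigenpoly_scale f) auto
  have g1: "Poly_Mapping.lookup g (mon \<eta>) = 1" using l by (simp add: g_def)
  have "E_poly \<eta> = g" using g g1 by (rule E_poly_eqI)
  thus "eigenpoly \<eta> (E_poly \<eta>)" "Poly_Mapping.lookup (E_poly \<eta>) (mon \<eta>) = 1" using g g1 by auto
qed

lemma eigenpoly_eq_E_poly: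
  assumes "eigenpoly \<eta> f"
  shows "f = const (Poly_Mapping.lookup f (mon \<eta>)) * E_poly \<eta>"
proof -
  let ?l = "Poly_Mapping.lookup f (mon \<eta>)"
  have "?l \<noteq> 0" using eigenpoly_leading(1)[OF assms] .
  hence "E_poly \<eta> = const (inverse ?l) * f"
    by (intro E_poly_eqI eigenpoly_scale assms) auto
  thus ?thesis using \<open>?l \<noteq> 0\<close> by (simp add: mult.assoc[symmetric] flip: const_mult)
qed

lemma T_op_E_poly_less:
  assumes "1 \<le> i" "i < length \<eta>" "\<eta> ! (i - 1) < \<eta> ! i"
  shows "T_op i (E_poly \<eta>) = const (T_diag \<eta> i) * E_poly \<eta> + const tvar * E_poly (swap_list i (Suc i) \<eta>)"
  using eigenpoly_eq_E_poly[OF eigenpoly_T_op_less(1)[OF eigenpoly_E_poly assms]]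
    eigenpoly_T_op_less(2)[OF eigenpoly_E_poly assms]
  by (simp add: algebra_simps)

lemma T_op_E_poly:
  assumes "1 \<le> i" "i < length \<eta>"
  obtains d where
    "T_op i (E_poly \<eta>) = const (T_diag \<eta> i) * E_poly \<eta> + const d * E_poly (swap_list i (Suc i) \<eta>)"
proof -
  define h where "h = T_op i (E_poly \<eta>) - const (T_diag \<eta> i) * E_poly \<eta>"
  have "\<exists>d. h = const d * E_poly (swap_list i (Suc i) \<eta>)"
  proof (cases "h = 0")
    case True
    thus ?thesis by (intro exI[of _ 0]) simp
  next
    case False
    thus ?thesis
      using eigenpoly_eq_E_poly[OF eigenpoly_T_op(1)[OF eigenpoly_E_poly assms]] unfolding h_def by blast
  qed
  thus ?thesis using that by (auto simp: h_def algebra_simps)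
qed

text \<open>The ranks of equal neighbours differ by one, so the first eigenvalue is t times the
  second.\<close>

lemma T_diag_equal:
  assumes "1 \<le> i" "i < length \<eta>" "\<eta> ! (i - 1) = \<eta> ! i"
  shows "T_diag \<eta> i = tvar"
proof -
  have "1 - int (eta_rank \<eta> i) = 1 - int (eta_rank \<eta> (Suc i)) + 1"
    using eta_rank_Suc[of i \<eta>] assms by simp
  hence "tvar powi (1 - int (eta_rank \<eta> i)) = tvar powi (1 - int (eta_rank \<eta> (Suc i))) * tvar"
    by (simp only: power_int_add[OF disjI1[OF tvar_nonzero]] power_int_1_right)
  hence y: "y_eigenvalue \<eta> i = y_eigenvalue \<eta> (Suc i) * tvar"
    using assms(3) by (simp add: y_eigenvalue_def)
  have "y_eigenvalue \<eta> i - y_eigenvalue \<eta> (Suc i) \<noteq> 0" using y_eigenvalue_Suc_neq[OF assms(1,2)] by simp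
  thus ?thesis unfolding T_diag_def by (simp add: y field_simps)
qed

lemma T_op_E_poly_eq:
  assumes "1 \<le> i" "i < length \<eta>" "\<eta> ! (i - 1) = \<eta> ! i"
  shows "T_op i (E_poly \<eta>) = const tvar * E_poly \<eta>"
  using eigenpoly_T_op(2)[OF eigenpoly_E_poly assms(1,2)] assms(3) T_diag_equal[OF assms] by auto

lemma E_poly_hom_polys: "E_poly \<eta> \<in> hom_polys (length \<eta>) (sum_list \<eta>)"
  using eigenpoly_E_poly by (simp add: eigenpoly_def)

text \<open>At a composition that is maximal among those with nonzero coefficient, only its own term
  contributes.\<close>

lemma E_poly_independent:
  assumes "finite S" "\<And>\<eta>. \<eta> \<in> S \<Longrightarrow> length \<eta> = N" "(\<Sum>\<eta>\<in>S. const (c \<eta>) * E_poly \<eta>) = 0" "\<eta> \<in> S"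
  shows "c \<eta> = 0"
proof (rule ccontr)
  assume "c \<eta> \<noteq> 0"
  let ?S = "{\<nu> \<in> S. c \<nu> \<noteq> 0}"
  have "finite ?S" "\<eta> \<in> ?S" using assms \<open>c \<eta> \<noteq> 0\<close> by auto
  then obtain \<kappa> where \<kappa>: "\<kappa> \<in> S" "c \<kappa> \<noteq> 0" "\<forall>\<mu>\<in>?S. \<not> comp_prec \<kappa> \<mu>"
    using comp_prec_maximal_above[of ?S \<eta>] by blast
  have "c \<nu> * Poly_Mapping.lookup (E_poly \<nu>) (mon \<kappa>) = (if \<nu> = \<kappa> then c \<kappa> else 0)" if \<nu>: "\<nu> \<in> S" for \<nu>
  proof (cases "\<nu> = \<kappa>")
    case False
    have "c \<nu> = 0 \<or> Poly_Mapping.lookup (E_poly \<nu>) (mon \<kappa>) = 0"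
      using eigenpoly_leading(2)[OF eigenpoly_E_poly, of \<kappa> \<nu>] \<kappa> \<nu> assms(2) False by auto
    thus ?thesis using False by auto
  qed simp
  hence "(\<Sum>\<nu>\<in>S. c \<nu> * Poly_Mapping.lookup (E_poly \<nu>) (mon \<kappa>)) = c \<kappa>"
    using assms(1) \<kappa>(1) by (simp add: sum.delta)
  moreover have "(\<Sum>\<nu>\<in>S. c \<nu> * Poly_Mapping.lookup (E_poly \<nu>) (mon \<kappa>)) = 0"
    using arg_cong[OF assms(3), of "\<lambda>f. Poly_Mapping.lookup f (mon \<kappa>)"] by (simp add: lookup_sum)
  ultimately show False using \<kappa> by simp
qed

section \<open>Hecke symmetrization\<close>

definition TD :: "nat \<Rightarrow> nat \<Rightarrow> mpoly \<Rightarrow> mpoly" where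
  "TD k j = comp_ops (map T_op (rev [k..<j]))"

lemma linear_op_TD [simp]: "linear_op (TD k j)"
  unfolding TD_def by (rule linear_op_comp_ops) simp

lemma TD_empty [simp]: "j \<le> k \<Longrightarrow> TD k j f = f"
  by (simp add: TD_def)

lemma TD_Suc: "k \<le> j \<Longrightarrow> TD k (Suc j) f = T_op j (TD k j f)"
  by (simp add: TD_def)

lemma TD_split: "k \<le> i \<Longrightarrow> i \<le> j \<Longrightarrow> TD k j f = TD i j (TD k i f)"
  using upt_add_eq_append[of k i "j - i"] by (simp add: TD_def)

lemma T_op_TD_far:
  assumes "j < i"
  shows "T_op i (TD k j f) = TD k j (T_op i f)"
  unfolding TD_def by (rule comp_ops_intertwine) (use assms in \<open>auto intro!: T_op_commute\<close>)

lemma T_op_TD_braid: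
  assumes "k \<le> i" "Suc i < j"
  shows "T_op i (TD k j f) = TD k j (T_op (Suc i) f)"
proof -
  have *: "TD k j g = TD (Suc (Suc i)) j (T_op (Suc i) (T_op i (TD k i g)))" for g
    using TD_split[of k "Suc (Suc i)" j g] assms by (simp add: TD_Suc)
  have 1: "T_op i (TD (Suc (Suc i)) j g) = TD (Suc (Suc i)) j (T_op i g)" for g
    unfolding TD_def by (rule comp_ops_intertwine) (auto intro!: T_op_commute)
  have 2: "T_op (Suc i) (TD k i g) = TD k i (T_op (Suc i) g)" for g
    by (rule T_op_TD_far) simp
  show ?thesis unfolding * 1 T_op_braid 2 ..
qed

abbreviation cyc :: "nat \<Rightarrow> nat \<Rightarrow> nat \<Rightarrow> nat" where
  "cyc k j \<equiv> word_perm [k..<j]"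

lemma cyc_apply: "k \<le> j \<Longrightarrow> cyc k j x = (if x = j then k else if k \<le> x \<and> x < j then Suc x else x)"
proof (induction arbitrary: x rule: inc_induct)
  case (step n)
  have "cyc n j x = transpose n (Suc n) (cyc (Suc n) j x)"
    using step.hyps by (simp add: upt_conv_Cons word_perm_Cons)
  thus ?case using step by (auto simp: transpose_def)
qed simp

lemma cyc_permutes:
  assumes "k \<le> j" "{k..j} \<subseteq> S"
  shows "cyc k j permutes S"
proof -
  have "word_perm w permutes S" if "\<And>i. i \<in> set w \<Longrightarrow> i \<in> S \<and> Suc i \<in> S" for w
    using that
  proof (induction w)
    case Nil show ?case unfolding word_perm_Nil by (rule permutes_id)
  next
    case (Cons i w)
    thus ?case unfolding word_perm_Cons by (intro permutes_transpose_comp) auto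
  qed
  note this[of "[k..<j]"]
  moreover have "i \<in> S \<and> Suc i \<in> S" if "i \<in> set [k..<j]" for i
    using that assms by auto
  ultimately show ?thesis by blast
qed

text \<open>The operator of a permutation of \<open>{k..<k + n}\<close>, computed from its normal form as a
  product of descending chains; it is shown to be the product along any reduced word, so no
  appeal to Matsumoto's theorem is needed.\<close>

primrec nf_op :: "nat \<Rightarrow> nat \<Rightarrow> (nat \<Rightarrow> nat) \<Rightarrow> mpoly \<Rightarrow> mpoly" where
  "nf_op 0 k \<sigma> f = f"
| "nf_op (Suc n) k \<sigma> f = TD k (\<sigma> k) (nf_op n (Suc k) (cyc k (\<sigma> k) \<circ> \<sigma>) f)"

lemma permutes_cyc_comp:
  assumes "\<sigma> permutes {k..<k + Suc n}"
  shows "k \<le> \<sigma> k" "\<sigma> k < k + Suc n" "cyc k (\<sigma> k) \<circ> \<sigma> permutes {Suc k..<Suc k + n}"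
proof -
  have "\<sigma> k \<in> {k..<k + Suc n}" using permutes_in_image[OF assms, of k] by simp
  thus k: "k \<le> \<sigma> k" "\<sigma> k < k + Suc n" by auto
  have "cyc k (\<sigma> k) \<circ> \<sigma> permutes {k..<k + Suc n}"
    using k by (intro permutes_compose[OF assms] cyc_permutes) auto
  moreover have "(cyc k (\<sigma> k) \<circ> \<sigma>) x = x" if "x \<in> {k..<k + Suc n} - {Suc k..<Suc k + n}" for x
  proof -
    have "x = k" using that by auto
    thus ?thesis using k by (simp add: cyc_apply)
  qed
  ultimately show "cyc k (\<sigma> k) \<circ> \<sigma> permutes {Suc k..<Suc k + n}"
    by (rule permutes_superset)
qed

text \<open>The condition \<open>a < b\<close> says that the simple transposition lengthens
  \<open>\<sigma>\<close>. Compare \<open>i\<close> with the end \<open>\<sigma> k\<close> of the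
  first chain: if \<open>\<sigma> k\<close> is below \<open>i\<close>, the operator commutes with
  the chain; if it equals \<open>i\<close>, the operator prolongs the chain; if it is above
  \<open>Suc i\<close>, the braid relation hands \<open>Suc i\<close> to the inner
  permutation.\<close>

lemma T_op_nf_op:
  assumes "\<sigma> permutes {k..<k + n}" "k \<le> i" "Suc i < k + n" "\<sigma> a = i" "\<sigma> b = Suc i" "a < b"
  shows "T_op i (nf_op n k \<sigma> f) = nf_op n k (transpose i (Suc i) \<circ> \<sigma>) f"
  using assms
proof (induction n arbitrary: k \<sigma> i)
  case (Suc n)
  define j where "j = \<sigma> k"
  let ?s = "transpose i (Suc i)"
  have j: "k \<le> j" "j < k + Suc n" and \<sigma>': "cyc k j \<circ> \<sigma> permutes {Suc k..<Suc k + n}"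
    using permutes_cyc_comp[OF Suc.prems(1)] by (auto simp: j_def)
  have inj: "inj \<sigma>" using Suc.prems(1) by (rule permutes_inj)
  \<comment> \<open>Otherwise \<open>b\<close> is the first point \<open>k\<close>, and the earlier
    point \<open>a\<close> lies outside the permuted range and is fixed, against
    \<open>\<sigma> a = i\<close>.\<close>
  have "Suc i \<noteq> j"
  proof
    assume "Suc i = j"
    hence "b = k" using Suc.prems(5) injD[OF inj, of b k] by (simp add: j_def)
    hence "\<sigma> a = a" using Suc.prems(6) permutes_not_in[OF Suc.prems(1), of a] by simp
    thus False using Suc.prems \<open>b = k\<close> by simp
  qed
  then consider "j < i" | "j = i" | "Suc i < j" by linarith
  thus ?case
  proof cases
    case 1
    have s: "(?s \<circ> \<sigma>) k = j" using 1 by (simp add: j_def transpose_def)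
    have c: "cyc k j \<circ> (?s \<circ> \<sigma>) = ?s \<circ> (cyc k j \<circ> \<sigma>)"
      using 1 j by (auto simp: fun_eq_iff cyc_apply transpose_def)
    have "T_op i (nf_op n (Suc k) (cyc k j \<circ> \<sigma>) f) = nf_op n (Suc k) (?s \<circ> (cyc k j \<circ> \<sigma>)) f"
      using 1 j Suc.prems by (intro Suc.IH \<sigma>') (auto simp: cyc_apply)
    thus ?thesis
      unfolding nf_op.simps s c using 1 by (simp add: T_op_TD_far flip: j_def)
  next
    case 2
    have s: "(?s \<circ> \<sigma>) k = Suc j" using 2 by (simp add: j_def transpose_def)
    have c: "cyc k (Suc j) \<circ> (?s \<circ> \<sigma>) = cyc k j \<circ> \<sigma>"
      unfolding fun_eq_iff o_apply using 2 j by (auto simp: cyc_apply transpose_def simp del: upt_Suc)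
    show ?thesis
      unfolding nf_op.simps s c using 2 j by (simp add: TD_Suc flip: j_def)
  next
    case 3
    have s: "(?s \<circ> \<sigma>) k = j" using 3 by (simp add: j_def transpose_def)
    have c: "cyc k j \<circ> (?s \<circ> \<sigma>) = transpose (Suc i) (Suc (Suc i)) \<circ> (cyc k j \<circ> \<sigma>)"
      unfolding fun_eq_iff o_apply using 3 j Suc.prems(2) by (auto simp: cyc_apply transpose_def)
    have "T_op (Suc i) (nf_op n (Suc k) (cyc k j \<circ> \<sigma>) f) =
        nf_op n (Suc k) (transpose (Suc i) (Suc (Suc i)) \<circ> (cyc k j \<circ> \<sigma>)) f"
      using 3 j Suc.prems by (intro Suc.IH \<sigma>') (auto simp: cyc_apply)
    thus ?thesis
      unfolding nf_op.simps s c using 3 Suc.prems(2) by (simp add: T_op_TD_braid flip: j_def)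
  qed
qed simp

lemma nf_op_id: "nf_op n k id f = f"
  by (induction n arbitrary: k) simp_all

lemma nf_op_skip: "\<sigma> k = k \<Longrightarrow> nf_op (Suc n) k \<sigma> f = nf_op n (Suc k) \<sigma> f"
  by simp

text \<open>No word is shorter than the number of inversions, so in a reduced word every letter adds
  an inversion, which is the situation of \<open>T_op_nf_op\<close>. Hence the choice by
  \<open>SOME\<close> in \<open>T_perm\<close> does not influence the operator.\<close>

lemma reduced_word_nf_op:
  assumes "is_word N \<sigma> w" "length w = card (inversions N \<sigma>)"
  shows "comp_ops (map T_op w) f = nf_op N 1 \<sigma> f"
  using assms
proof (induction w arbitrary: \<sigma>)
  case Nil
  hence "\<sigma> = id" unfolding is_word_def word_perm_Nil by simp
  thus ?case by (simp only: nf_op_id list.map comp_ops_Nil)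
next
  case (Cons i w)
  define \<tau> where "\<tau> = word_perm w"
  have w: "is_word N \<tau> w" and i: "1 \<le> i" "i < N" and \<sigma>: "\<sigma> = transpose i (Suc i) \<circ> \<tau>"
    using Cons.prems by (auto simp: is_word_def word_perm_Cons \<tau>_def)
  have p: "\<tau> permutes {1..N}" using w by (rule is_word_permutes)
  have le: "card (inversions N \<tau>) \<le> length w" using w by (rule card_inversions_le_length)
  have "inv \<tau> i \<noteq> inv \<tau> (Suc i)"
    using permutes_inj[OF permutes_inv[OF p]] by (metis injD n_not_Suc_n)
  moreover have "\<not> inv \<tau> (Suc i) < inv \<tau> i"
    using card_inversions_transpose_descent[OF p i] Cons.prems(2) le unfolding \<sigma> length_Cons by linarith
  ultimately have asc: "inv \<tau> i < inv \<tau> (Suc i)" by linarith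
  have "length w = card (inversions N \<tau>)"
    using card_inversions_transpose_ascent[OF p i asc] Cons.prems(2) unfolding \<sigma> length_Cons by linarith
  hence "comp_ops (map T_op w) f = nf_op N 1 \<tau> f" using Cons.IH w by blast
  moreover have "T_op i (nf_op N 1 \<tau> f) = nf_op N 1 (transpose i (Suc i) \<circ> \<tau>) f"
  proof (rule T_op_nf_op)
    have "{1..N} = {1..<1 + N}" by auto
    thus "\<tau> permutes {1..<1 + N}" using p by simp
    show "\<tau> (inv \<tau> i) = i" "\<tau> (inv \<tau> (Suc i)) = Suc i" using permutes_inverses[OF p] by auto
  qed (use i asc in auto)
  ultimately show ?case unfolding \<sigma> by (simp only: list.map comp_ops_Cons)
qed

lemma T_perm_nf_op:
  assumes "\<sigma> permutes {Suc m..N}" "m \<le> N"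
  shows "T_perm N \<sigma> f = nf_op (N - m) (Suc m) \<sigma> f"
proof -
  have p: "\<sigma> permutes {1..N}" using assms(1) by (rule permutes_subset) auto
  obtain w where "reduced_word N \<sigma> w"
    using exists_word_card_inversions[OF p] perm_length_eq[OF p] by (auto simp: reduced_word_def)
  hence rw: "reduced_word N \<sigma> (SOME w. reduced_word N \<sigma> w)" by (rule someI)
  have "T_perm N \<sigma> f = nf_op N 1 \<sigma> f"
    unfolding T_perm_def
    by (rule reduced_word_nf_op) (use rw perm_length_eq[OF p] in \<open>unfold reduced_word_def, auto\<close>)
  also have "nf_op N 1 \<sigma> f = nf_op (N - l) (Suc l) \<sigma> f" if "l \<le> m" for l
    using that
  proof (induction l)
    case (Suc l)
    have "N - l = Suc (N - Suc l)" using Suc.prems assms(2) by simp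
    moreover have "\<sigma> (Suc l) = Suc l" using permutes_not_in[OF assms(1), of "Suc l"] Suc.prems by simp
    ultimately show ?case using Suc nf_op_skip[of \<sigma> "Suc l" "N - Suc l" f] by simp
  qed simp
  finally show ?thesis by simp
qed

definition U_op :: "nat \<Rightarrow> nat \<Rightarrow> mpoly \<Rightarrow> mpoly" where
  "U_op n k f = (\<Sum>\<sigma> | \<sigma> permutes {k..<k + n}. nf_op n k \<sigma> f)"

lemma U_op_0 [simp]: "U_op 0 k f = f"
proof -
  have "{\<sigma>. \<sigma> permutes {k..<k + 0}} = {id}" by auto
  thus ?thesis unfolding U_op_def by simp
qed

text \<open>Permutations are grouped by the image of \<open>k\<close>; the chains
  \<open>TD k j\<close> belong to the minimal coset representatives.\<close>

lemma U_op_Suc: "U_op (Suc n) k f = (\<Sum>j=k..<k + Suc n. TD k j (U_op n (Suc k) f))"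
proof -
  let ?P = "{\<sigma>. \<sigma> permutes {k..<k + Suc n}}" and ?P' = "{\<sigma>. \<sigma> permutes {Suc k..<Suc k + n}}"
  have "U_op (Suc n) k f = (\<Sum>p\<in>{k..<k + Suc n} \<times> ?P'. TD k (fst p) (nf_op n (Suc k) (snd p) f))"
    unfolding U_op_def
  proof (rule sum.reindex_bij_witness[of _ "\<lambda>p. inv (cyc k (fst p)) \<circ> snd p" "\<lambda>\<sigma>. (\<sigma> k, cyc k (\<sigma> k) \<circ> \<sigma>)"])
    fix \<sigma> assume "\<sigma> \<in> ?P"
    hence \<sigma>: "\<sigma> permutes {k..<k + Suc n}" by simp
    note * = permutes_cyc_comp[OF \<sigma>]
    have c: "cyc k (\<sigma> k) permutes {k..<k + Suc n}" using * by (intro cyc_permutes) auto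
    show "inv (cyc k (fst (\<sigma> k, cyc k (\<sigma> k) \<circ> \<sigma>))) \<circ> snd (\<sigma> k, cyc k (\<sigma> k) \<circ> \<sigma>) = \<sigma>"
      using permutes_inv_o(2)[OF c] by (simp add: o_assoc)
    show "(\<sigma> k, cyc k (\<sigma> k) \<circ> \<sigma>) \<in> {k..<k + Suc n} \<times> ?P'" using * by auto
  next
    fix p assume p: "p \<in> {k..<k + Suc n} \<times> ?P'"
    obtain j \<tau> where [simp]: "p = (j, \<tau>)" by (cases p)
    have j: "k \<le> j" "j < k + Suc n" and \<tau>: "\<tau> permutes {Suc k..<Suc k + n}" using p by auto
    have c: "cyc k j permutes {k..<k + Suc n}" using j by (intro cyc_permutes) auto
    have "\<tau> permutes {k..<k + Suc n}" using \<tau> by (rule permutes_subset) auto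
    thus "inv (cyc k (fst p)) \<circ> snd p \<in> ?P" using c by (auto intro: permutes_compose permutes_inv)
    have "\<tau> k = k" using permutes_not_in[OF \<tau>, of k] by simp
    moreover have "inv (cyc k j) k = j"
      using permutes_inverses(2)[OF c, of j] j by (simp add: cyc_apply)
    ultimately show "((inv (cyc k (fst p)) \<circ> snd p) k,
        cyc k ((inv (cyc k (fst p)) \<circ> snd p) k) \<circ> (inv (cyc k (fst p)) \<circ> snd p)) = p"
      using permutes_inv_o(1)[OF c] by (simp add: o_assoc)
  qed simp
  also have "\<dots> = (\<Sum>j=k..<k + Suc n. \<Sum>\<tau>\<in>?P'. TD k j (nf_op n (Suc k) \<tau> f))"
    unfolding sum.cartesian_product by (intro sum.cong) auto
  also have "\<dots> = (\<Sum>j=k..<k + Suc n. TD k j (U_op n (Suc k) f))"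
    unfolding U_op_def by (simp add: linear_op_sum[OF linear_op_TD])
  finally show ?thesis .
qed

text \<open>Left multiplication by the transposition pairs each ascent with a descent, and the
  quadratic relation gives \<open>T (F + T F) = t (F + T F)\<close> for every pair.\<close>

lemma T_op_U_op:
  assumes "k \<le> i" "Suc i < k + n"
  shows "T_op i (U_op n k f) = const tvar * U_op n k f"
proof -
  let ?P = "{\<sigma>. \<sigma> permutes {k..<k + n}}" and ?s = "\<lambda>\<sigma>. transpose i (Suc i) \<circ> \<sigma>"
  let ?asc = "\<lambda>\<sigma>. inv \<sigma> i < inv \<sigma> (Suc i)"
  define A where "A = {\<sigma> \<in> ?P. ?asc \<sigma>}"
  define D where "D = {\<sigma> \<in> ?P. \<not> ?asc \<sigma>}"
  define F where "F \<sigma> = nf_op n k \<sigma> f" for \<sigma>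
  have finP: "finite ?P" by (rule finite_permutations) simp
  have fin: "finite A" "finite D" using finP by (auto simp: A_def D_def)
  have ss: "?s (?s \<sigma>) = \<sigma>" for \<sigma> by (simp add: o_assoc)
  have inv_s: "inv (?s \<sigma>) i = inv \<sigma> (Suc i)" "inv (?s \<sigma>) (Suc i) = inv \<sigma> i" if "\<sigma> \<in> ?P" for \<sigma>
    using inv_transpose_comp[of \<sigma> "{k..<k + n}" i "Suc i"] that by auto
  have sP: "?s \<sigma> \<in> ?P" if "\<sigma> \<in> ?P" for \<sigma>
    using that assms by (auto intro!: permutes_transpose_comp)
  have ne: "inv \<sigma> i \<noteq> inv \<sigma> (Suc i)" if "\<sigma> \<in> ?P" for \<sigma>
    using permutes_inj[OF permutes_inv[of \<sigma>]] that by (metis injD mem_Collect_eq n_not_Suc_n)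
  have AD: "?s \<sigma> \<in> D" if "\<sigma> \<in> A" for \<sigma>
    using that sP[of \<sigma>] inv_s[of \<sigma>] by (auto simp: A_def D_def)
  have DA: "?s \<sigma> \<in> A" if "\<sigma> \<in> D" for \<sigma>
  proof -
    have "\<sigma> \<in> ?P" "\<not> ?asc \<sigma>" using that by (auto simp: D_def)
    thus ?thesis using sP[of \<sigma>] inv_s[of \<sigma>] ne[of \<sigma>] unfolding A_def by auto
  qed
  have TA: "T_op i (F \<sigma>) = F (?s \<sigma>)" if "\<sigma> \<in> A" for \<sigma>
    unfolding F_def
  proof (rule T_op_nf_op)
    show "\<sigma> permutes {k..<k + n}" using that by (simp add: A_def)
    thus "\<sigma> (inv \<sigma> i) = i" "\<sigma> (inv \<sigma> (Suc i)) = Suc i" by (auto simp: permutes_inverses)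
  qed (use assms that in \<open>auto simp: A_def\<close>)
  have TD: "T_op i (F \<sigma>) = const (tvar - 1) * F \<sigma> + const tvar * F (?s \<sigma>)" if "\<sigma> \<in> D" for \<sigma>
  proof -
    have "F \<sigma> = T_op i (F (?s \<sigma>))" using TA[OF DA[OF that]] ss[of \<sigma>] by simp
    thus ?thesis using T_op_quadratic[of i "F (?s \<sigma>)"] by simp
  qed
  have swap1: "(\<Sum>\<sigma>\<in>A. F (?s \<sigma>)) = sum F D"
    by (rule sum.reindex_bij_witness[of _ ?s ?s]) (auto simp: ss AD DA)
  have swap2: "(\<Sum>\<sigma>\<in>D. F (?s \<sigma>)) = sum F A"
    by (rule sum.reindex_bij_witness[of _ ?s ?s]) (auto simp: ss AD DA)
  have U: "U_op n k f = sum F A + sum F D"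
  proof -
    have "?P = A \<union> D" "A \<inter> D = {}" by (auto simp: A_def D_def)
    thus ?thesis unfolding U_op_def F_def[symmetric] using fin by (metis sum.union_disjoint)
  qed
  have "T_op i (U_op n k f) = (\<Sum>\<sigma>\<in>A. T_op i (F \<sigma>)) + (\<Sum>\<sigma>\<in>D. T_op i (F \<sigma>))"
    by (simp add: U linear_op_add[OF linear_op_T_op] linear_op_sum[OF linear_op_T_op])
  also have "(\<Sum>\<sigma>\<in>A. T_op i (F \<sigma>)) = sum F D"
    using TA swap1 by (simp cong: sum.cong)
  also have "(\<Sum>\<sigma>\<in>D. T_op i (F \<sigma>)) = const (tvar - 1) * sum F D + const tvar * sum F A"
  proof -
    have "(\<Sum>\<sigma>\<in>D. T_op i (F \<sigma>)) = (\<Sum>\<sigma>\<in>D. const (tvar - 1) * F \<sigma> + const tvar * F (?s \<sigma>))"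
      by (rule sum.cong[OF refl TD])
    also have "\<dots> = const (tvar - 1) * sum F D + const tvar * (\<Sum>\<sigma>\<in>D. F (?s \<sigma>))"
      by (simp add: sum.distrib sum_distrib_left)
    finally show ?thesis unfolding swap2 .
  qed
  finally show ?thesis unfolding U by (simp add: const_diff algebra_simps)
qed

section \<open>Symmetric combinations of non-symmetric Macdonald polynomials\<close>

text \<open>At an ascent the value is \<open>tvar\<close> (\<open>T_off_less\<close>); at a descent
  it stays abstract. For equal neighbours the exchange changes nothing and both terms are multiples
  of one polynomial; the default \<open>0\<close> fixes the splitting there.\<close>

definition T_off :: "nat list \<Rightarrow> nat \<Rightarrow> qt" where
  "T_off \<eta> i = (if \<eta> ! (i - 1) = \<eta> ! i then 0 else
     (SOME d. T_op i (E_poly \<eta>) = const (T_diag \<eta> i) * E_poly \<eta> + const d * E_poly (swap_list i (Suc i) \<eta>)))"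

lemma T_op_E_poly_off:
  assumes "1 \<le> i" "i < length \<eta>"
  shows "T_op i (E_poly \<eta>) = const (T_diag \<eta> i) * E_poly \<eta> + const (T_off \<eta> i) * E_poly (swap_list i (Suc i) \<eta>)"
proof (cases "\<eta> ! (i - 1) = \<eta> ! i")
  case True
  thus ?thesis using T_op_E_poly_eq[OF assms True] T_diag_equal[OF assms True] by (simp add: T_off_def)
next
  case False
  let ?P = "\<lambda>d. T_op i (E_poly \<eta>) = const (T_diag \<eta> i) * E_poly \<eta> + const d * E_poly (swap_list i (Suc i) \<eta>)"
  obtain d where "?P d" using T_op_E_poly[OF assms] .
  hence "?P (SOME d. ?P d)" by (rule someI)
  thus ?thesis using False by (simp add: T_off_def)
qed

lemma T_off_less:
  assumes "1 \<le> i" "i < length \<eta>" "\<eta> ! (i - 1) < \<eta> ! i"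
  shows "T_off \<eta> i = tvar"
proof -
  have "const (T_off \<eta> i) * E_poly (swap_list i (Suc i) \<eta>) = const tvar * E_poly (swap_list i (Suc i) \<eta>)"
    using T_op_E_poly_off[OF assms(1,2)] T_op_E_poly_less[OF assms] by (metis add_left_cancel)
  from arg_cong[OF this, of "\<lambda>f. Poly_Mapping.lookup f (mon (swap_list i (Suc i) \<eta>))"]
  show ?thesis by simp
qed

lemma T_off_equal: "\<eta> ! (i - 1) = \<eta> ! i \<Longrightarrow> T_off \<eta> i = 0"
  by (simp add: T_off_def)

definition comb :: "nat list \<Rightarrow> nat multiset \<Rightarrow> (nat list \<Rightarrow> qt) \<Rightarrow> mpoly" where
  "comb a M c = (\<Sum>\<mu>\<in>permutations_of_multiset M. const (c \<mu>) * E_poly (a @ \<mu>))"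

text \<open>Coefficients transform by the transposed matrix: the second contribution at
  \<open>\<mu>\<close> arrives from the exchanged list, hence \<open>T_off\<close> is taken
  there.\<close>

definition T_coeff :: "nat list \<Rightarrow> nat \<Rightarrow> (nat list \<Rightarrow> qt) \<Rightarrow> nat list \<Rightarrow> qt" where
  "T_coeff a p c \<mu> = T_diag (a @ \<mu>) (length a + p) * c \<mu> +
     T_off (a @ swap_list p (Suc p) \<mu>) (length a + p) * c (swap_list p (Suc p) \<mu>)"

lemma nth_append_shift: "1 \<le> p \<Longrightarrow> (a @ \<mu>) ! (length a + p - 1) = \<mu> ! (p - 1)"
  by (simp add: nth_append) auto

lemma swap_list_append:
  assumes "1 \<le> p" "p < length \<mu>"
  shows "swap_list (length a + p) (Suc (length a + p)) (a @ \<mu>) = a @ swap_list p (Suc p) \<mu>"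
proof -
  obtain r where "p = Suc r" using assms by (cases p) auto
  thus ?thesis by (simp add: swap_list_def nth_append list_update_append)
qed

lemma length_permutations_of_multiset: "\<mu> \<in> permutations_of_multiset M \<Longrightarrow> length \<mu> = size M"
  by (auto simp: permutations_of_multiset_def)

lemma swap_list_permutations:
  assumes "\<mu> \<in> permutations_of_multiset M" "1 \<le> p" "p < size M"
  shows "swap_list p (Suc p) \<mu> \<in> permutations_of_multiset M" "swap_list p (Suc p) (swap_list p (Suc p) \<mu>) = \<mu>"
  using assms length_permutations_of_multiset[OF assms(1)]
  by (auto simp: permutations_of_multiset_def mset_swap_list swap_list_swap_list)

lemma T_op_comb:
  assumes "1 \<le> p" "p < size M"
  shows "T_op (length a + p) (comb a M c) = comb a M (T_coeff a p c)"
proof -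
  let ?P = "permutations_of_multiset M" and ?i = "length a + p" and ?s = "swap_list p (Suc p)"
  have "T_op ?i (comb a M c) = (\<Sum>\<mu>\<in>?P. const (c \<mu>) * T_op ?i (E_poly (a @ \<mu>)))"
    unfolding comb_def by (simp add: linear_op_sum[OF linear_op_T_op] T_op_const_mult)
  also have "\<dots> = (\<Sum>\<mu>\<in>?P. const (T_diag (a @ \<mu>) ?i * c \<mu>) * E_poly (a @ \<mu>) +
      const (T_off (a @ \<mu>) ?i * c \<mu>) * E_poly (a @ ?s \<mu>))"
  proof (rule sum.cong[OF refl])
    fix \<mu> assume "\<mu> \<in> ?P"
    hence "length \<mu> = size M" by (rule length_permutations_of_multiset)
    thus "const (c \<mu>) * T_op ?i (E_poly (a @ \<mu>)) = const (T_diag (a @ \<mu>) ?i * c \<mu>) * E_poly (a @ \<mu>) +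
      const (T_off (a @ \<mu>) ?i * c \<mu>) * E_poly (a @ ?s \<mu>)"
      using assms by (subst T_op_E_poly_off) (auto simp: swap_list_append const_mult distrib_left mult.assoc mult.left_commute)
  qed
  also have "\<dots> = (\<Sum>\<mu>\<in>?P. const (T_diag (a @ \<mu>) ?i * c \<mu>) * E_poly (a @ \<mu>)) +
      (\<Sum>\<mu>\<in>?P. const (T_off (a @ \<mu>) ?i * c \<mu>) * E_poly (a @ ?s \<mu>))"
    by (rule sum.distrib)
  also have "(\<Sum>\<mu>\<in>?P. const (T_off (a @ \<mu>) ?i * c \<mu>) * E_poly (a @ ?s \<mu>)) =
      (\<Sum>\<mu>\<in>?P. const (T_off (a @ ?s \<mu>) ?i * c (?s \<mu>)) * E_poly (a @ \<mu>))"
    by (rule sum.reindex_bij_witness[of _ ?s ?s]) (use assms swap_list_permutations in auto)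
  finally show ?thesis by (simp add: comb_def T_coeff_def const_add distrib_right sum.distrib)
qed

lemma comb_scale_diff: "comb a M (\<lambda>\<mu>. c \<mu> - k * d \<mu>) = comb a M c - const k * comb a M d"
  by (simp add: comb_def const_diff const_mult left_diff_distrib sum_subtractf sum_distrib_left mult.assoc)

lemma comb_scale: "comb a M (\<lambda>\<mu>. k * c \<mu>) = const k * comb a M c"
  by (simp add: comb_def const_mult sum_distrib_left mult.assoc)

lemma comb_cong: "(\<And>\<mu>. \<mu> \<in> permutations_of_multiset M \<Longrightarrow> c \<mu> = d \<mu>) \<Longrightarrow> comb a M c = comb a M d"
  unfolding comb_def by (rule sum.cong) auto

lemma comb_sum: "comb a M (\<lambda>\<mu>. \<Sum>x\<in>A. c x \<mu>) = (\<Sum>x\<in>A. comb a M (c x))"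
  unfolding comb_def by (subst sum.swap) (simp add: const_sum sum_distrib_right)

lemma comb_eq_0:
  assumes "comb a M c = 0" "\<mu> \<in> permutations_of_multiset M"
  shows "c \<mu> = 0"
proof -
  let ?S = "(@) a ` permutations_of_multiset M" and ?c = "\<lambda>\<kappa>. c (drop (length a) \<kappa>)"
  have "(\<Sum>\<kappa>\<in>?S. const (?c \<kappa>) * E_poly \<kappa>) = comb a M c"
    unfolding comb_def by (subst sum.reindex) (auto simp: inj_on_def)
  hence "?c (a @ \<mu>) = 0"
    using assms length_permutations_of_multiset
    by (intro E_poly_independent[of ?S "length a + size M"]) auto
  thus ?thesis by simp
qed

definition sym_coeff :: "nat list \<Rightarrow> nat multiset \<Rightarrow> (nat list \<Rightarrow> qt) \<Rightarrow> bool" where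
  "sym_coeff a M c \<longleftrightarrow> (\<forall>p \<mu>. 1 \<le> p \<longrightarrow> p < size M \<longrightarrow> \<mu> \<in> permutations_of_multiset M \<longrightarrow>
     T_coeff a p c \<mu> = tvar * c \<mu>)"

lemma sym_coeffD:
  "sym_coeff a M c \<Longrightarrow> 1 \<le> p \<Longrightarrow> p < size M \<Longrightarrow> \<mu> \<in> permutations_of_multiset M \<Longrightarrow>
     T_coeff a p c \<mu> = tvar * c \<mu>"
  by (auto simp: sym_coeff_def)

lemma sym_coeffI:
  assumes "\<And>p. 1 \<le> p \<Longrightarrow> p < size M \<Longrightarrow> T_op (length a + p) (comb a M c) = const tvar * comb a M c"
  shows "sym_coeff a M c"
  unfolding sym_coeff_def
proof (intro allI impI)
  fix p \<mu> assume p: "1 \<le> p" "p < size M" and \<mu>: "\<mu> \<in> permutations_of_multiset M"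
  have "comb a M (\<lambda>\<mu>. T_coeff a p c \<mu> - tvar * c \<mu>) = 0"
    using assms[OF p] unfolding T_op_comb[OF p] comb_scale_diff by simp
  from comb_eq_0[OF this \<mu>] show "T_coeff a p c \<mu> = tvar * c \<mu>" by simp
qed

lemma T_op_comb_sym:
  assumes "sym_coeff a M c" "1 \<le> p" "p < size M"
  shows "T_op (length a + p) (comb a M c) = const tvar * comb a M c"
  unfolding T_op_comb[OF assms(2,3)] comb_scale[symmetric]
  by (rule comb_cong) (use assms sym_coeffD in blast)

text \<open>The eigenvalue equation is read at the arrangement with the descent. Its off-diagonal
  coefficient belongs to the exchanged arrangement, which has an ascent, and so is
  \<open>tvar\<close>.\<close>

lemma sym_coeff_swap:
  assumes "sym_coeff a M c" "\<mu> \<in> permutations_of_multiset M" "1 \<le> p" "p < size M" "\<mu> ! p < \<mu> ! (p - 1)"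
  shows "c (swap_list p (Suc p) \<mu>) = c \<mu> * ((tvar - T_diag (a @ \<mu>) (length a + p)) / tvar)"
proof -
  let ?\<nu> = "swap_list p (Suc p) \<mu>" and ?i = "length a + p"
  have len: "length \<mu> = size M" using assms(2) by (rule length_permutations_of_multiset)
  have "?\<nu> ! (p - 1) = \<mu> ! p" "?\<nu> ! p = \<mu> ! (p - 1)"
    using nth_swap_list[of p \<mu> "Suc p" p] nth_swap_list[of p \<mu> "Suc p" "Suc p"] assms len by auto
  hence "T_off (a @ ?\<nu>) ?i = tvar"
    using assms len by (intro T_off_less) (auto simp: nth_append)
  hence "T_diag (a @ \<mu>) ?i * c \<mu> + tvar * c ?\<nu> = tvar * c \<mu>"
    using sym_coeffD[OF assms(1,3,4,2)] by (simp add: T_coeff_def)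
  hence "tvar * c ?\<nu> = (tvar - T_diag (a @ \<mu>) ?i) * c \<mu>" by (simp add: algebra_simps)
  thus ?thesis by (simp add: field_simps)
qed

text \<open>A maximal arrangement in the support has no ascent: exchanging it would give a higher
  arrangement, and the coefficient is a multiple of the one there. So it is the decreasing list
  \<open>L\<close>, where \<open>c\<close> vanishes.\<close>

lemma sym_coeff_eq_0:
  assumes sym: "sym_coeff a M c" and L: "sorted_wrt (\<ge>) L" "mset L = M" "c L = 0"
    and \<mu>: "\<mu> \<in> permutations_of_multiset M"
  shows "c \<mu> = 0"
proof (rule ccontr)
  assume "c \<mu> \<noteq> 0"
  let ?S = "(@) a ` {\<nu> \<in> permutations_of_multiset M. c \<nu> \<noteq> 0}"
  have "finite ?S" "a @ \<mu> \<in> ?S" using \<mu> \<open>c \<mu> \<noteq> 0\<close> by auto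
  then obtain \<nu> where \<nu>: "\<nu> \<in> permutations_of_multiset M" "c \<nu> \<noteq> 0" "\<forall>\<kappa>\<in>?S. \<not> comp_prec (a @ \<nu>) \<kappa>"
    using comp_prec_maximal_above[of ?S "a @ \<mu>"] by auto
  have len: "length \<nu> = size M" using \<nu>(1) by (rule length_permutations_of_multiset)
  have "\<nu> ! p \<le> \<nu> ! (p - 1)" if p: "1 \<le> p" "p < length \<nu>" for p
  proof (rule ccontr)
    assume less: "\<not> \<nu> ! p \<le> \<nu> ! (p - 1)"
    let ?\<kappa> = "swap_list p (Suc p) \<nu>"
    have p': "p < size M" using p len by simp
    have \<kappa>: "?\<kappa> \<in> permutations_of_multiset M" "swap_list p (Suc p) ?\<kappa> = \<nu>"
      using swap_list_permutations[OF \<nu>(1) p(1) p'] by auto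
    have nth: "?\<kappa> ! (p - 1) = \<nu> ! p" "?\<kappa> ! p = \<nu> ! (p - 1)"
      using nth_swap_list[of p \<nu> "Suc p" p] nth_swap_list[of p \<nu> "Suc p" "Suc p"] p by auto
    have "c ?\<kappa> \<noteq> 0"
      using sym_coeff_swap[OF sym \<kappa>(1) p(1) p'] nth less \<kappa>(2) \<nu>(2) by auto
    moreover have "comp_prec (a @ \<nu>) (a @ ?\<kappa>)"
      using comp_prec_swap[of "length a + p" "Suc (length a + p)" "a @ ?\<kappa>"] p nth less
        swap_list_append[of p ?\<kappa> a] \<kappa>(2) nth_append_shift[of p a ?\<kappa>] nth_append_shift[of "Suc p" a ?\<kappa>]
      by simp
    ultimately show False using \<nu>(3) \<kappa>(1) by blast
  qed
  from this[of "Suc i" for i] have "sorted_wrt (\<ge>) \<nu>"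
    by (subst sorted_wrt_iff_nth_Suc_transp) (auto simp: transp_def)
  hence "sorted (rev \<nu>)" "sorted (rev L)" using L by (auto simp: sorted_wrt_rev)
  moreover have "mset (rev \<nu>) = mset (rev L)" using \<nu>(1) L by (auto simp: permutations_of_multiset_def)
  ultimately have "rev \<nu> = rev L" by (metis properties_for_sort)
  thus False using \<nu> L by simp
qed

section \<open>Normalization\<close>

text \<open>The coefficient that symmetrizing an increasing list gives to the decreasing one,
  collected one chain at a time. In the decreasing list the copies of the smallest entry
  \<open>x\<close> occupy the last places, numbered from \<open>0\<close>; the chain that can bring
  \<open>x\<close> to place \<open>r\<close> contributes \<open>tvar ^ r\<close>.\<close>

fun u_coeff :: "nat list \<Rightarrow> qt" where
  "u_coeff [] = 1"
| "u_coeff (x # xs) = (\<Sum>r = length (x # xs) - count_list (x # xs) x..<length (x # xs). tvar ^ r) * u_coeff xs"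

primrec TD_coeff :: "nat list \<Rightarrow> nat \<Rightarrow> (nat list \<Rightarrow> qt) \<Rightarrow> nat list \<Rightarrow> qt" where
  "TD_coeff a 0 c = c"
| "TD_coeff a (Suc r) c = T_coeff a (Suc r) (TD_coeff a r c)"

lemma TD_comb:
  "r < size M \<Longrightarrow> TD (Suc (length a)) (Suc (length a) + r) (comb a M c) = comb a M (TD_coeff a r c)"
proof (induction r)
  case (Suc r)
  thus ?case using T_op_comb[of "Suc r" M a "TD_coeff a r c"] by (simp add: TD_Suc)
qed simp

text \<open>Extension by zero from the arrangements with first entry \<open>x\<close> to all
  arrangements.\<close>

definition first_coeff :: "nat \<Rightarrow> (nat list \<Rightarrow> qt) \<Rightarrow> nat list \<Rightarrow> qt" where
  "first_coeff x c \<mu> = (case \<mu> of [] \<Rightarrow> 0 | y # \<nu> \<Rightarrow> if y = x then c \<nu> else 0)"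

lemma comb_first_coeff: "comb (a @ [x]) M c = comb a (add_mset x M) (first_coeff x c)"
proof -
  let ?S = "(#) x ` permutations_of_multiset M"
  have "comb a (add_mset x M) (first_coeff x c) = (\<Sum>\<mu>\<in>?S. const (first_coeff x c \<mu>) * E_poly (a @ \<mu>))"
    unfolding comb_def
  proof (rule sum.mono_neutral_right)
    show "?S \<subseteq> permutations_of_multiset (add_mset x M)" by (auto simp: permutations_of_multiset_def)
    show "\<forall>\<mu>\<in>permutations_of_multiset (add_mset x M) - ?S. const (first_coeff x c \<mu>) * E_poly (a @ \<mu>) = 0"
    proof
      fix \<mu> assume \<mu>: "\<mu> \<in> permutations_of_multiset (add_mset x M) - ?S"
      show "const (first_coeff x c \<mu>) * E_poly (a @ \<mu>) = 0"
      proof (cases \<mu>)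
        case (Cons y \<nu>)
        have "y \<noteq> x" using \<mu> Cons by (auto simp: permutations_of_multiset_def)
        thus ?thesis using Cons by (simp add: first_coeff_def)
      qed (simp add: first_coeff_def)
    qed
  qed simp
  also have "\<dots> = comb (a @ [x]) M c"
    unfolding comb_def by (subst sum.reindex) (auto simp: first_coeff_def inj_on_def)
  finally show ?thesis by simp
qed

text \<open>Each further operator of the chain moves an entry by at most one place.\<close>

lemma TD_coeff_support:
  assumes "\<And>\<nu>. c \<nu> \<noteq> 0 \<Longrightarrow> x \<in> set (take 1 \<nu>)" "TD_coeff a r c \<mu> \<noteq> 0" "r < length \<mu>"
  shows "x \<in> set (take (Suc r) \<mu>)"
  using assms(2,3)
proof (induction r arbitrary: \<mu>)
  case 0
  thus ?case using assms(1)[of \<mu>] by simp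
next
  case (Suc r)
  let ?s = "swap_list (Suc r) (Suc (Suc r)) \<mu>"
  have "TD_coeff a r c \<mu> \<noteq> 0 \<or> TD_coeff a r c ?s \<noteq> 0"
    using Suc.prems by (auto simp: T_coeff_def)
  hence "x \<in> set (take (Suc r) \<mu>) \<or> x \<in> set (take (Suc r) ?s)"
    using Suc by auto
  moreover have "set (take (Suc r) \<mu>) \<subseteq> set (take (Suc (Suc r)) \<mu>)"
    by (rule set_take_subset_set_take) simp
  moreover have "set (take (Suc r) ?s) \<subseteq> set (take (Suc (Suc r)) \<mu>)"
  proof
    fix z assume "z \<in> set (take (Suc r) ?s)"
    then obtain j where j: "j < Suc r" "z = ?s ! j" using Suc.prems by (auto simp: in_set_conv_nth)
    have "z = \<mu> ! (transpose (Suc r) (Suc (Suc r)) (Suc j) - 1)"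
      using nth_swap_list[of "Suc r" \<mu> "Suc (Suc r)" "Suc j"] j Suc.prems by simp
    moreover have "transpose (Suc r) (Suc (Suc r)) (Suc j) - 1 < Suc (Suc r)"
      using j by (auto simp: transpose_def)
    ultimately show "z \<in> set (take (Suc (Suc r)) \<mu>)"
      using Suc.prems by (auto simp: in_set_conv_nth intro!: exI[of _ "transpose (Suc r) (Suc (Suc r)) (Suc j) - 1"])
  qed
  ultimately show ?case by blast
qed

text \<open>While \<open>x\<close> passes larger entries, every exchange starts from an ascent and
  contributes \<open>tvar\<close>; the diagonal terms vanish because \<open>x\<close> cannot yet
  have come so far.\<close>

lemma TD_coeff_move:
  assumes supp: "\<And>\<nu>. c \<nu> \<noteq> 0 \<Longrightarrow> x \<in> set (take 1 \<nu>)" and "\<forall>y\<in>set \<kappa>. x < y"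
  shows "TD_coeff a (length \<kappa>) c (\<kappa> @ x # \<rho>) = tvar ^ length \<kappa> * c (x # \<kappa> @ \<rho>)"
  using assms(2)
proof (induction \<kappa> arbitrary: \<rho> rule: rev_induct)
  case (snoc y \<kappa>)
  let ?\<mu> = "\<kappa> @ y # x # \<rho>" and ?r = "Suc (length \<kappa>)"
  have s: "swap_list ?r (Suc ?r) ?\<mu> = \<kappa> @ x # y # \<rho>"
    by (simp add: swap_list_def nth_append list_update_append)
  have "x \<notin> set (take (Suc (length \<kappa>)) ?\<mu>)" using snoc.prems by auto
  hence 0: "TD_coeff a (length \<kappa>) c ?\<mu> = 0"
    using TD_coeff_support[where c = c and x = x and a = a and r = "length \<kappa>" and \<mu> = ?\<mu>] supp by auto
  have "T_off (a @ \<kappa> @ x # y # \<rho>) (length a + ?r) = tvar"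
    using snoc.prems by (intro T_off_less) (auto simp: nth_append)
  hence "TD_coeff a ?r c ?\<mu> = tvar * TD_coeff a (length \<kappa>) c (\<kappa> @ x # y # \<rho>)"
    by (simp add: T_coeff_def s 0)
  also have "\<dots> = tvar * (tvar ^ length \<kappa> * c (x # \<kappa> @ y # \<rho>))"
    using snoc by simp
  finally show ?case by simp
qed simp

text \<open>Past the first of the equal places, longer chains act on equal neighbours, where the
  diagonal entry is \<open>tvar\<close> and the off-diagonal one \<open>0\<close>.\<close>

lemma TD_coeff_equal:
  assumes "length \<kappa> \<le> r" "r < length \<kappa> + p"
  shows "TD_coeff a r c (\<kappa> @ replicate p x) = tvar ^ (r - length \<kappa>) * TD_coeff a (length \<kappa>) c (\<kappa> @ replicate p x)"
  using assms
proof (induction r rule: dec_induct)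
  case (step r)
  let ?\<mu> = "\<kappa> @ replicate p x"
  have nth: "?\<mu> ! r = x" "?\<mu> ! Suc r = x" using step by (auto simp: nth_append)
  have s: "swap_list (Suc r) (Suc (Suc r)) ?\<mu> = ?\<mu>"
  proof -
    have "swap_list (Suc r) (Suc (Suc r)) ?\<mu> = ?\<mu>[r := ?\<mu> ! r, Suc r := ?\<mu> ! Suc r]"
      by (simp only: swap_list_def diff_Suc_1 nth)
    thus ?thesis by (simp only: list_update_id)
  qed
  have n: "(a @ ?\<mu>) ! (length a + Suc r - 1) = (a @ ?\<mu>) ! (length a + Suc r)"
    using nth by (simp add: nth_append_right)
  have "TD_coeff a (Suc r) c ?\<mu> = tvar * TD_coeff a r c ?\<mu>"
    using T_diag_equal[OF _ _ n] T_off_equal[OF n] step by (simp add: T_coeff_def s)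
  thus ?case using step by (simp add: Suc_diff_le)
qed simp

lemma sorted_Cons_rev_eq:
  fixes x :: nat
  assumes "sorted (x # xs)"
  obtains \<kappa> p where "rev xs = \<kappa> @ replicate p x" "\<forall>y\<in>set \<kappa>. x < y" "count_list (x # xs) x = Suc p"
proof -
  define ys where "ys = dropWhile (\<lambda>y. y = x) xs"
  define p where "p = length (takeWhile (\<lambda>y. y = x) xs)"
  have "takeWhile (\<lambda>y. y = x) xs = replicate p x"
    by (rule replicate_eqI) (auto simp: p_def dest: set_takeWhileD)
  hence xs: "xs = replicate p x @ ys"
    using takeWhile_dropWhile_id[of "\<lambda>y. y = x" xs] by (simp add: ys_def)
  have ys: "\<forall>y\<in>set ys. x < y"
  proof (cases ys)
    case (Cons z zs)
    have "z \<noteq> x" using Cons hd_dropWhile[of "\<lambda>y. y = x" xs] by (auto simp: ys_def)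
    moreover have "sorted (x # ys)" using assms xs by (auto simp: sorted_append)
    ultimately show ?thesis using Cons by (auto simp: less_le dest: order_trans)
  qed simp
  have "count_list (replicate p x) x = p" by (induction p) auto
  moreover have "count_list ys x = 0" using ys by (auto simp: count_list_0_iff)
  ultimately have "count_list (x # xs) x = Suc p" by (simp add: xs)
  moreover have "rev xs = rev ys @ replicate p x" by (simp add: xs)
  ultimately show ?thesis using that[of "rev ys" p] ys by auto
qed

text \<open>Recursion on the first entry, the smallest one. At the decreasing list, chains too short
  to bring \<open>x\<close> behind all larger entries contribute nothing, and each of the others
  contributes a power of t.\<close>

lemma U_op_E_poly:
  assumes "sorted xs"
  shows "\<exists>c. U_op (length xs) (Suc (length a)) (E_poly (a @ xs)) = comb a (mset xs) c \<and> c (rev xs) = u_coeff xs"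
  using assms
proof (induction xs arbitrary: a)
  case Nil
  show ?case by (intro exI[of _ "\<lambda>_. 1"]) (simp add: comb_def)
next
  case (Cons x xs)
  have "\<exists>c. U_op (length xs) (Suc (length (a @ [x]))) (E_poly ((a @ [x]) @ xs)) = comb (a @ [x]) (mset xs) c \<and> c (rev xs) = u_coeff xs"
    using Cons.prems by (intro Cons.IH) simp
  then obtain c where c: "U_op (length xs) (Suc (Suc (length a))) (E_poly (a @ x # xs)) = comb (a @ [x]) (mset xs) c"
    "c (rev xs) = u_coeff xs" by auto
  define d where "d = first_coeff x c"
  let ?M = "mset (x # xs)" and ?n = "length (x # xs)" and ?k = "Suc (length a)"
  have "U_op ?n ?k (E_poly (a @ x # xs)) = (\<Sum>j=?k..<?k + ?n. TD ?k j (comb a ?M d))"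
    using c(1) comb_first_coeff[of a x "mset xs" c] by (simp add: U_op_Suc d_def del: sum.op_ivl_Suc)
  also have "\<dots> = (\<Sum>r<?n. TD ?k (?k + r) (comb a ?M d))"
    by (rule sum.reindex_bij_witness[of _ "\<lambda>r. ?k + r" "\<lambda>j. j - ?k"]) auto
  also have "\<dots> = (\<Sum>r<?n. comb a ?M (TD_coeff a r d))"
    by (intro sum.cong refl TD_comb) auto
  also have "\<dots> = comb a ?M (\<lambda>\<mu>. \<Sum>r<?n. TD_coeff a r d \<mu>)"
    by (rule comb_sum[symmetric])
  finally have U: "U_op ?n ?k (E_poly (a @ x # xs)) = comb a ?M (\<lambda>\<mu>. \<Sum>r<?n. TD_coeff a r d \<mu>)" .
  obtain \<kappa> p where \<kappa>: "rev xs = \<kappa> @ replicate p x" "\<forall>y\<in>set \<kappa>. x < y" "count_list (x # xs) x = Suc p"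
    using sorted_Cons_rev_eq[OF Cons.prems] .
  let ?\<mu> = "\<kappa> @ replicate (Suc p) x"
  have rev: "rev (x # xs) = ?\<mu>" using \<kappa>(1) by (simp flip: replicate_append_same)
  have n: "?n = length \<kappa> + Suc p" using arg_cong[OF rev, of length] by simp
  have supp: "x \<in> set (take 1 \<nu>)" if "d \<nu> \<noteq> 0" for \<nu>
    using that by (cases \<nu>) (auto simp: d_def first_coeff_def split: if_splits)
  have low: "TD_coeff a r d ?\<mu> = 0" if "r < length \<kappa>" for r
  proof -
    have "x \<notin> set (take (Suc r) ?\<mu>)" using that \<kappa>(2) by (auto dest!: in_set_takeD)
    thus ?thesis using TD_coeff_support[where c = d and x = x and a = a and r = r and \<mu> = ?\<mu>] supp that by auto
  qed
  have high: "TD_coeff a r d ?\<mu> = tvar ^ r * u_coeff xs" if "length \<kappa> \<le> r" "r < ?n" for r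
  proof -
    have "TD_coeff a r d ?\<mu> = tvar ^ (r - length \<kappa>) * TD_coeff a (length \<kappa>) d ?\<mu>"
      using that n by (intro TD_coeff_equal) auto
    also have "TD_coeff a (length \<kappa>) d ?\<mu> = tvar ^ length \<kappa> * d (x # \<kappa> @ replicate p x)"
      using TD_coeff_move[of d x \<kappa> a "replicate p x"] supp \<kappa>(2) by simp
    also have "d (x # \<kappa> @ replicate p x) = u_coeff xs"
      using c(2) \<kappa>(1) by (simp add: d_def first_coeff_def)
    finally show ?thesis using that by (simp add: mult.assoc[symmetric] flip: power_add)
  qed
  have "(\<Sum>r<?n. TD_coeff a r d ?\<mu>) = (\<Sum>r=length \<kappa>..<?n. TD_coeff a r d ?\<mu>)"
    by (rule sum.mono_neutral_right) (use low in auto)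
  also have "\<dots> = (\<Sum>r=length \<kappa>..<?n. tvar ^ r * u_coeff xs)"
    by (rule sum.cong[OF refl]) (use high in auto)
  also have "\<dots> = u_coeff (x # xs)"
    using n \<kappa>(3) by (simp add: sum_distrib_right del: sum.op_ivl_Suc)
  finally show ?case unfolding rev using U by blast
qed

lemma tvar_power_neq_1: "j > 0 \<Longrightarrow> tvar ^ j \<noteq> 1"
  using qvar_tvar_pow_eq_1_iff[of 0 j] by auto

lemma p_fact_nonzero: "p_fact (inverse tvar) k \<noteq> 0"
proof -
  have "inverse tvar ^ j \<noteq> 1" if "j > 0" for j
    using tvar_power_neq_1[OF that] by (simp add: power_inverse inverse_eq_1_iff)
  from this[of 1] this show ?thesis by (auto simp: p_fact_def)
qed

lemma sum_tvar_power:
  assumes "p \<le> n"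
  shows "(\<Sum>r = n - p..<n. tvar ^ r) = tvar ^ (n - 1) * ((1 - inverse tvar ^ p) / (1 - inverse tvar))"
proof -
  have ne: "tvar \<noteq> 1" using tvar_power_neq_1[of 1] by simp
  have "(\<Sum>r = n - p..<n. tvar ^ r) = (\<Sum>r<p. tvar ^ (n - p) * tvar ^ r)"
    by (rule sum.reindex_bij_witness[of _ "\<lambda>r. n - p + r" "\<lambda>r. r - (n - p)"])
       (use assms in \<open>auto simp flip: power_add\<close>)
  also have "\<dots> = tvar ^ (n - p) * ((tvar ^ p - 1) / (tvar - 1))"
    unfolding sum_distrib_left[symmetric] geometric_sum[OF ne] ..
  also have "\<dots> = tvar ^ (n - 1) * ((1 - inverse tvar ^ p) / (1 - inverse tvar))"
  proof (cases "p = 0")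
    case False
    then obtain m where m: "n = p + m" "p > 0" using assms le_Suc_ex by blast
    have "n = Suc (n - 1)" using m by simp
    hence "tvar ^ n = tvar * tvar ^ (n - 1)" by (metis power_Suc)
    moreover have "tvar ^ n = tvar ^ (n - p) * tvar ^ p" using m by (simp add: power_add mult.commute)
    ultimately show ?thesis using ne by (simp add: field_simps)
  qed simp
  finally show ?thesis .
qed

text \<open>Adding an entry to a list of length \<open>l\<close> multiplies by a block of
  consecutive powers of t, which is \<open>tvar ^ l\<close> times the next factor of a factorial in
  \<open>inverse tvar\<close>. The exponents \<open>l\<close> add up to the triangular
  number.\<close>

lemma u_coeff_eq:
  "u_coeff xs = (\<Prod>i\<in>set xs. p_fact (inverse tvar) (count_list xs i)) * tvar ^ (length xs * (length xs - 1) div 2)"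
proof (induction xs)
  case (Cons x xs)
  let ?f = "\<lambda>ys i. p_fact (inverse tvar) (count_list ys i)" and ?p = "count_list xs x"
  have step: "p_fact (inverse tvar) (Suc ?p) = p_fact (inverse tvar) ?p * ((1 - inverse tvar ^ Suc ?p) / (1 - inverse tvar))"
    by (simp add: p_fact_def)
  have ext: "(\<Prod>i\<in>set xs. ?f xs i) = (\<Prod>i\<in>insert x (set xs). ?f xs i)"
    by (rule prod.mono_neutral_left) (auto simp: p_fact_def count_list_0_iff)
  have "(\<Prod>i\<in>insert x (set xs). ?f (x # xs) i) = ?f (x # xs) x * (\<Prod>i\<in>set xs - {x}. ?f (x # xs) i)"
    by (rule prod.insert_remove) simp
  also have "(\<Prod>i\<in>set xs - {x}. ?f (x # xs) i) = (\<Prod>i\<in>set xs - {x}. ?f xs i)"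
    by (rule prod.cong) auto
  also have "?f (x # xs) x * \<dots> = ((1 - inverse tvar ^ Suc ?p) / (1 - inverse tvar)) * (?f xs x * (\<Prod>i\<in>set xs - {x}. ?f xs i))"
    using step by (simp add: ac_simps)
  also have "?f xs x * (\<Prod>i\<in>set xs - {x}. ?f xs i) = (\<Prod>i\<in>insert x (set xs). ?f xs i)"
    by (rule prod.insert_remove[symmetric]) simp
  finally have prod: "(\<Prod>i\<in>set (x # xs). ?f (x # xs) i) =
      ((1 - inverse tvar ^ Suc ?p) / (1 - inverse tvar)) * (\<Prod>i\<in>set xs. ?f xs i)"
    by (simp add: ext)
  have "?p \<le> length xs" by (rule count_le_length)
  hence "(\<Sum>r = length (x # xs) - count_list (x # xs) x..<length (x # xs). tvar ^ r) =
      tvar ^ length xs * ((1 - inverse tvar ^ Suc ?p) / (1 - inverse tvar))"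
    using sum_tvar_power[of "Suc ?p" "Suc (length xs)"] by (simp del: sum.op_ivl_Suc)
  moreover have "length (x # xs) * (length (x # xs) - 1) div 2 = length xs + length xs * (length xs - 1) div 2"
    by (cases "length xs") auto
  ultimately show ?case
    unfolding u_coeff.simps Cons.IH prod by (simp add: power_add ac_simps del: sum.op_ivl_Suc)
qed simp

lemma length_pad: "length lam \<le> n \<Longrightarrow> length (pad n lam) = n"
  by (simp add: pad_def)

lemma sorted_pad: "sorted_wrt (\<ge>) lam \<Longrightarrow> sorted_wrt (\<ge>) (pad n lam)"
proof -
  have "sorted_wrt (\<ge>) (replicate k (0::nat))" for k by (induction k) auto
  thus "sorted_wrt (\<ge>) lam \<Longrightarrow> ?thesis" by (auto simp: pad_def sorted_wrt_append)
qed

lemma P_fin_comb: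
  assumes lam: "sorted_wrt (\<ge>) lam" and N: "length a + length lam \<le> N"
  defines "L \<equiv> pad (N - length a) lam"
  obtains c where "P_fin (a, lam) N = comb a (mset L) c" "sym_coeff a (mset L) c" "c L = 1"
proof -
  let ?m = "length a" and ?n = "N - length a"
  define u where "u = u_norm ?m lam N"
  have len: "length L = ?n" using N by (simp add: L_def length_pad)
  have "sorted (rev L)" using sorted_pad[OF lam] by (simp add: L_def sorted_wrt_rev)
  then obtain c where c: "U_op ?n (Suc ?m) (E_poly (a @ rev L)) = comb a (mset L) c" "c L = u_coeff (rev L)"
    using U_op_E_poly[of "rev L" a] len by auto
  have u: "u_coeff (rev L) = u"
    unfolding u_coeff_eq u_def u_norm_def using len by (simp add: L_def)
  have "u \<noteq> 0" unfolding u_def u_norm_def using p_fact_nonzero by simp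
  have "{\<sigma>. \<sigma> permutes {?m + 1..N}} = {\<sigma>. \<sigma> permutes {Suc ?m..<Suc ?m + ?n}}"
  proof -
    have "{?m + 1..N} = {Suc ?m..<Suc ?m + ?n}" using N by auto
    thus ?thesis by simp
  qed
  hence "P_fin (a, lam) N = const (1 / u) * (\<Sum>\<sigma> | \<sigma> permutes {Suc ?m..<Suc ?m + ?n}. T_perm N \<sigma> (E_poly (a @ rev L)))"
    using N by (simp add: P_fin_def u_def L_def)
  also have "(\<Sum>\<sigma> | \<sigma> permutes {Suc ?m..<Suc ?m + ?n}. T_perm N \<sigma> (E_poly (a @ rev L))) =
      U_op ?n (Suc ?m) (E_poly (a @ rev L))"
    unfolding U_op_def
  proof (rule sum.cong[OF refl])
    fix \<sigma> assume "\<sigma> \<in> {\<sigma>. \<sigma> permutes {Suc ?m..<Suc ?m + ?n}}"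
    moreover have "{Suc ?m..N} = {Suc ?m..<Suc ?m + ?n}" using N by auto
    ultimately show "T_perm N \<sigma> (E_poly (a @ rev L)) = nf_op ?n (Suc ?m) \<sigma> (E_poly (a @ rev L))"
      using N by (intro T_perm_nf_op) auto
  qed
  finally have P: "P_fin (a, lam) N = comb a (mset L) (\<lambda>\<mu>. 1 / u * c \<mu>)"
    unfolding comb_scale c .
  have PU: "P_fin (a, lam) N = const (1 / u) * U_op ?n (Suc ?m) (E_poly (a @ rev L))"
    unfolding P comb_scale c ..
  have "sym_coeff a (mset L) (\<lambda>\<mu>. 1 / u * c \<mu>)"
  proof (rule sym_coeffI)
    fix p assume p: "1 \<le> p" "p < size (mset L)"
    have "T_op (?m + p) (U_op ?n (Suc ?m) (E_poly (a @ rev L))) = const tvar * U_op ?n (Suc ?m) (E_poly (a @ rev L))"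
      using p len by (intro T_op_U_op) auto
    thus "T_op (?m + p) (comb a (mset L) (\<lambda>\<mu>. 1 / u * c \<mu>)) = const tvar * comb a (mset L) (\<lambda>\<mu>. 1 / u * c \<mu>)"
      unfolding P[symmetric] PU by (simp add: T_op_const_mult mult.left_commute)
  qed
  thus ?thesis using that[OF P] c(2) u \<open>u \<noteq> 0\<close> by simp
qed

text \<open>After subtracting the multiple of \<open>P_fin\<close> the combination is still
  symmetric and has no coefficient at \<open>L\<close>, so it vanishes by
  \<open>sym_coeff_eq_0\<close>.\<close>

lemma comb_eq_P_fin:
  assumes lam: "sorted_wrt (\<ge>) lam" and N: "length a + length lam \<le> N"
  defines "L \<equiv> pad (N - length a) lam"
  assumes sym: "sym_coeff a (mset L) c"
  shows "comb a (mset L) c = const (c L) * P_fin (a, lam) N"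
proof -
  obtain d where d: "P_fin (a, lam) N = comb a (mset L) d" "sym_coeff a (mset L) d" "d L = 1"
    using P_fin_comb[OF lam N] unfolding L_def by blast
  let ?e = "\<lambda>\<mu>. c \<mu> - c L * d \<mu>"
  have "sym_coeff a (mset L) ?e"
  proof (rule sym_coeffI)
    fix p assume p: "1 \<le> p" "p < size (mset L)"
    show "T_op (length a + p) (comb a (mset L) ?e) = const tvar * comb a (mset L) ?e"
      unfolding comb_scale_diff linear_op_diff[OF linear_op_T_op] T_op_const_mult
        T_op_comb_sym[OF sym p] T_op_comb_sym[OF d(2) p]
      by (simp only: right_diff_distrib mult.left_commute[of "const tvar" "const (c L)"])
  qed
  hence "?e \<mu> = 0" if "\<mu> \<in> permutations_of_multiset (mset L)" for \<mu>
    by (rule sym_coeff_eq_0[where L = L]) (use sorted_pad[OF lam] d(3) that in \<open>auto simp: L_def\<close>)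
  hence "comb a (mset L) ?e = 0" by (simp add: comb_def)
  thus ?thesis unfolding comb_scale_diff d(1) by simp
qed

section \<open>Splitting off the first entry\<close>

lemma swap_list_Cons:
  "1 \<le> p \<Longrightarrow> swap_list (Suc p) (Suc (Suc p)) (b # \<nu>) = b # swap_list p (Suc p) \<nu>"
  by (cases p) (simp_all add: swap_list_def)

lemma T_coeff_Cons:
  assumes "1 \<le> p"
  shows "T_coeff (a @ [b]) p (\<lambda>\<nu>. c (b # \<nu>)) \<nu> = T_coeff a (Suc p) c (b # \<nu>)"
  by (simp add: T_coeff_def swap_list_Cons[OF assms])

text \<open>The operators beyond the first place leave the first entry alone, so the equations
  decouple according to that entry.\<close>

lemma sym_coeff_Cons:
  assumes "sym_coeff a (add_mset b M) c"
  shows "sym_coeff (a @ [b]) M (\<lambda>\<nu>. c (b # \<nu>))"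
  unfolding sym_coeff_def
proof (intro allI impI)
  fix p \<nu> assume p: "1 \<le> p" "p < size M" "\<nu> \<in> permutations_of_multiset M"
  have "b # \<nu> \<in> permutations_of_multiset (add_mset b M)"
    using p(3) by (simp add: permutations_of_multiset_def)
  thus "T_coeff (a @ [b]) p (\<lambda>\<nu>. c (b # \<nu>)) \<nu> = tvar * c (b # \<nu>)"
    unfolding T_coeff_Cons[OF p(1)] using p by (intro sym_coeffD[OF assms]) auto
qed

lemma comb_split_first:
  assumes "M \<noteq> {#}"
  shows "comb a M c = (\<Sum>b\<in>set_mset M. comb (a @ [b]) (M - {#b#}) (\<lambda>\<nu>. c (b # \<nu>)))"
proof -
  have "comb a M c = comb a M (\<lambda>\<mu>. \<Sum>b\<in>set_mset M. first_coeff b (\<lambda>\<nu>. c (b # \<nu>)) \<mu>)"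
  proof (rule comb_cong)
    fix \<mu> assume \<mu>: "\<mu> \<in> permutations_of_multiset M"
    then obtain y \<nu> where y: "\<mu> = y # \<nu>"
      using assms by (cases \<mu>) (auto simp: permutations_of_multiset_def)
    hence "y \<in># M" using \<mu> by (auto simp: permutations_of_multiset_def)
    thus "c \<mu> = (\<Sum>b\<in>set_mset M. first_coeff b (\<lambda>\<nu>. c (b # \<nu>)) \<mu>)"
      by (simp add: y first_coeff_def sum.delta)
  qed
  also have "\<dots> = (\<Sum>b\<in>set_mset M. comb a M (first_coeff b (\<lambda>\<nu>. c (b # \<nu>))))"
    by (rule comb_sum)
  also have "\<dots> = (\<Sum>b\<in>set_mset M. comb (a @ [b]) (M - {#b#}) (\<lambda>\<nu>. c (b # \<nu>)))"
    by (rule sum.cong[OF refl]) (simp add: comb_first_coeff)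
  finally show ?thesis .
qed

lemma sorted_wrt_remove1: "sorted_wrt R xs \<Longrightarrow> sorted_wrt R (remove1 x xs)"
proof (induction xs)
  case (Cons y xs)
  have "set (remove1 x xs) \<subseteq> set xs" by (rule set_remove1_subset)
  thus ?case using Cons by auto
qed simp

text \<open>For \<open>b = 0\<close> the partition itself is unchanged, and the removed entry is one
  of the padding zeros; the strict bound on the length guarantees that there is one.\<close>

lemma pad_remove1:
  assumes "0 \<notin> set lam" "length lam < n" "b \<in> insert 0 (set lam)"
  shows "pad (n - 1) (remove1 b lam) = remove1 b (pad n lam)"
proof (cases "b \<in> set lam")
  case True
  hence "length (remove1 b lam) = length lam - 1" "length lam > 0" by (auto simp: length_remove1)
  thus ?thesis using True assms by (simp add: pad_def remove1_append Suc_diff_Suc)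
next
  case False
  hence b: "b = 0" using assms by simp
  obtain k where "n - length lam = Suc k" using assms(2) by (cases "n - length lam") auto
  thus ?thesis using False assms by (simp add: b pad_def remove1_append remove1_idem)
qed

section \<open>Ranks, and the factor of one adjacent exchange\<close>

lemma Collect_shift_Suc: "{j \<in> {1..n}. P (j - 1)} = Suc ` {j. j < n \<and> P j}"
proof (intro equalityI subsetI)
  fix j assume "j \<in> {j \<in> {1..n}. P (j - 1)}"
  hence "j = Suc (j - 1)" "j - 1 < n" "P (j - 1)" by auto
  thus "j \<in> Suc ` {j. j < n \<and> P j}" by blast
qed auto

lemma eta_rank_append:
  "eta_rank (xs @ x # ys) (Suc (length xs)) =
     length (filter (\<lambda>y. x < y) (xs @ ys)) + length (filter (\<lambda>y. y = x) xs) + 1"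
proof -
  let ?\<eta> = "xs @ x # ys"
  have x: "?\<eta> ! (Suc (length xs) - 1) = x" by simp
  have "card {j \<in> {1..length ?\<eta>}. x < ?\<eta> ! (j - 1)} = length (filter (\<lambda>y. x < y) ?\<eta>)"
    unfolding Collect_shift_Suc[where P = "\<lambda>j. x < ?\<eta> ! j"]
    by (simp add: card_image length_filter_conv_card del: length_append filter_append)
  moreover have "{j \<in> {1..Suc (length xs)}. ?\<eta> ! (j - 1) = x} = {j \<in> {1..length (xs @ [x])}. (xs @ [x]) ! (j - 1) = x}"
    by (auto simp: nth_append)
  hence "card {j \<in> {1..Suc (length xs)}. ?\<eta> ! (j - 1) = x} = length (filter (\<lambda>y. y = x) (xs @ [x]))"
    unfolding Collect_shift_Suc[where P = "\<lambda>j. (xs @ [x]) ! j = x"]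
    by (simp add: card_image length_filter_conv_card del: length_append filter_append)
  ultimately show ?thesis unfolding eta_rank_def x by simp
qed

text \<open>Entries of \<open>a\<close> equal to \<open>b\<close> are included: they stand to the
  left of \<open>b\<close> and so precede it in the rank. In the diagram they are the circles at the
  bottom of column \<open>b\<close>.\<close>

definition between :: "nat list \<Rightarrow> nat \<Rightarrow> nat \<Rightarrow> nat" where
  "between a b x = length (filter (\<lambda>y. b \<le> y \<and> y < x) a)"

text \<open>The rank difference of the neighbours \<open>x\<close> and \<open>b\<close> counts what
  lies between them in the sorted order: the entries of \<open>a\<close> from \<open>b\<close> up to
  below \<open>x\<close>, the parts in \<open>\<kappa>2\<close>, and one more for the step itself.
  With \<open>z\<close> the ratio of the eigenvalues the factor is
  \<open>(1 - z / t) / (1 - z)\<close>.\<close>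

lemma T_diag_factor:
  assumes \<kappa>: "\<forall>y\<in>set \<kappa>1. x \<le> y" "\<forall>y\<in>set \<kappa>2. b < y \<and> y \<le> x" "\<forall>y\<in>set \<rho>. y \<le> b" and x: "b < x"
  shows "(tvar - T_diag (a @ \<kappa>1 @ x # b # \<kappa>2 @ \<rho>) (Suc (length a + length \<kappa>1))) / tvar =
    (1 - qvar ^ (x - b) * tvar ^ (between a b x + length \<kappa>2)) /
    (1 - qvar ^ (x - b) * tvar ^ (between a b x + length \<kappa>2 + 1))"
proof -
  let ?\<eta> = "a @ \<kappa>1 @ x # b # \<kappa>2 @ \<rho>" and ?i = "Suc (length a + length \<kappa>1)"
  let ?R = "between a b x + length \<kappa>2 + 1"
  define z where "z = qvar ^ (x - b) * tvar ^ ?R"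
  have f: "length (filter P xs) = length xs" if "\<forall>y\<in>set xs. P y" for P and xs :: "nat list"
    using that by (metis filter_True)
  have f0: "length (filter P xs) = 0" if "\<forall>y\<in>set xs. \<not> P y" for P and xs :: "nat list"
    using that by (simp add: filter_empty_conv)
  have split: "length (filter (\<lambda>y. x < y) xs) + length (filter (\<lambda>y. y = x) xs) = length (filter (\<lambda>y. x \<le> y) xs)" for x and xs :: "nat list"
    by (induction xs) auto
  have split2: "length (filter (\<lambda>y. b \<le> y) xs) = length (filter (\<lambda>y. x \<le> y) xs) + between xs b x" for xs
    using x by (induction xs) (auto simp: between_def)
  have "eta_rank ?\<eta> ?i = length (filter (\<lambda>y. x < y) ((a @ \<kappa>1) @ b # \<kappa>2 @ \<rho>)) + length (filter (\<lambda>y. y = x) (a @ \<kappa>1)) + 1"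
    using eta_rank_append[of "a @ \<kappa>1" x "b # \<kappa>2 @ \<rho>"] by simp
  also have "\<dots> = length (filter (\<lambda>y. x \<le> y) a) + length \<kappa>1 + 1"
    using split[of x a] split[of x \<kappa>1] f[of \<kappa>1 "\<lambda>y. x \<le> y"] f0[of \<kappa>2 "\<lambda>y. x < y"] f0[of \<rho> "\<lambda>y. x < y"] assms
    by fastforce
  finally have r: "eta_rank ?\<eta> ?i = length (filter (\<lambda>y. x \<le> y) a) + length \<kappa>1 + 1" .
  have "eta_rank ?\<eta> (Suc ?i) = length (filter (\<lambda>y. b < y) ((a @ \<kappa>1 @ [x]) @ \<kappa>2 @ \<rho>)) + length (filter (\<lambda>y. y = b) (a @ \<kappa>1 @ [x])) + 1"
    using eta_rank_append[of "a @ \<kappa>1 @ [x]" b "\<kappa>2 @ \<rho>"] by simp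
  also have "\<dots> = length (filter (\<lambda>y. b \<le> y) a) + length \<kappa>1 + 1 + length \<kappa>2 + 1"
    using split[of b a] f[of \<kappa>1 "\<lambda>y. b < y"] f0[of \<kappa>1 "\<lambda>y. y = b"] f[of \<kappa>2 "\<lambda>y. b < y"] f0[of \<rho> "\<lambda>y. b < y"] assms
    by fastforce
  finally have "eta_rank ?\<eta> (Suc ?i) = eta_rank ?\<eta> ?i + ?R"
    using r split2[of a] by simp
  hence p: "1 - int (eta_rank ?\<eta> ?i) = 1 - int (eta_rank ?\<eta> (Suc ?i)) + int ?R" by simp
  have nth: "?\<eta> ! (?i - 1) = x" "?\<eta> ! (Suc ?i - 1) = b" by (simp_all add: nth_append)
  have "y_eigenvalue ?\<eta> ?i = qvar ^ x * (tvar powi (1 - int (eta_rank ?\<eta> (Suc ?i))) * tvar ^ ?R)"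
    unfolding y_eigenvalue_def nth p
    by (simp only: power_int_add[OF disjI1[OF tvar_nonzero]] power_int_of_nat)
  also have "qvar ^ x = qvar ^ (x - b) * qvar ^ b" using x by (simp flip: power_add)
  finally have y: "y_eigenvalue ?\<eta> ?i = z * y_eigenvalue ?\<eta> (Suc ?i)"
    unfolding y_eigenvalue_def nth z_def by (simp only: ac_simps)
  have z1: "z \<noteq> 1" unfolding z_def qvar_tvar_pow_eq_1_iff using x by simp
  have "T_diag ?\<eta> ?i = (tvar - 1) * z / (z - 1)"
  proof -
    let ?y = "y_eigenvalue ?\<eta> (Suc ?i)"
    have "T_diag ?\<eta> ?i = ((tvar - 1) * z * ?y) / ((z - 1) * ?y)"
      unfolding T_diag_def y by (simp add: algebra_simps)
    thus ?thesis by simp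
  qed
  hence "(tvar - T_diag ?\<eta> ?i) / tvar = (tvar - (tvar - 1) * z / (z - 1)) / tvar" by simp
  also have "\<dots> = (1 - z / tvar) / (1 - z)"
  proof -
    have "z - 1 \<noteq> 0" "1 - z \<noteq> 0" using z1 by simp_all
    thus ?thesis by (simp add: divide_simps) (simp add: algebra_simps)
  qed
  also have "z / tvar = qvar ^ (x - b) * tvar ^ (between a b x + length \<kappa>2)"
    by (simp add: z_def)
  finally show ?thesis by (simp add: z_def add.assoc)
qed

definition branch_factor :: "nat list \<Rightarrow> nat \<Rightarrow> nat \<Rightarrow> nat \<Rightarrow> qt" where
  "branch_factor a b x l = (1 - qvar ^ (x - b) * tvar ^ (between a b x + l)) /
     (1 - qvar ^ (x - b) * tvar ^ (between a b x + l + 1))"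

text \<open>The part \<open>b\<close> passes the larger parts from right to left.
  \<open>\<kappa>'\<close> holds the larger parts already to the right of \<open>b\<close>; they
  enter the rank difference and give the last argument of \<open>branch_factor\<close>.\<close>

lemma sym_coeff_move_to_front:
  assumes sym: "sym_coeff a M c" and M: "mset (\<kappa> @ b # \<rho>) = M"
    and sorted: "sorted_wrt (\<ge>) (\<kappa> @ \<kappa>')" and gt: "\<forall>y\<in>set (\<kappa> @ \<kappa>'). b < y"
    and \<rho>: "\<rho> = \<kappa>' @ \<rho>'" "\<forall>y\<in>set \<rho>'. y \<le> b"
  shows "c (b # \<kappa> @ \<rho>) = c (\<kappa> @ b # \<rho>) *
    (\<Prod>k<length \<kappa>. branch_factor a b (\<kappa> ! k) (length \<kappa> + length \<kappa>' - Suc k))"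
  using M sorted gt \<rho>(1)
proof (induction \<kappa> arbitrary: \<rho> \<kappa>' rule: rev_induct)
  case (snoc x \<kappa>)
  let ?\<mu> = "\<kappa> @ x # b # \<rho>" and ?p = "Suc (length \<kappa>)"
  have s: "swap_list ?p (Suc ?p) ?\<mu> = \<kappa> @ b # x # \<rho>"
    by (simp add: swap_list_def nth_append list_update_append)
  have \<mu>: "?\<mu> \<in> permutations_of_multiset M"
    using snoc.prems(1) by (auto simp: permutations_of_multiset_def)
  have size: "size M = length \<kappa> + length \<rho> + 2" using arg_cong[OF snoc.prems(1), of size] by simp
  have "c (\<kappa> @ b # x # \<rho>) = c ?\<mu> * ((tvar - T_diag (a @ ?\<mu>) (length a + ?p)) / tvar)"
    using sym_coeff_swap[OF sym \<mu>, of ?p, unfolded s] size snoc.prems(3) by (simp add: nth_append)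
  also have "(tvar - T_diag (a @ ?\<mu>) (length a + ?p)) / tvar = branch_factor a b x (length \<kappa>')"
    using T_diag_factor[of \<kappa> x \<kappa>' b \<rho>' a] snoc.prems \<rho>(2)
    by (auto simp: branch_factor_def sorted_wrt_append)
  finally have 1: "c (\<kappa> @ b # x # \<rho>) = c ?\<mu> * branch_factor a b x (length \<kappa>')" .
  have 2: "c (b # \<kappa> @ (x # \<rho>)) = c (\<kappa> @ b # (x # \<rho>)) *
    (\<Prod>k<length \<kappa>. branch_factor a b (\<kappa> ! k) (length \<kappa> + length (x # \<kappa>') - Suc k))"
    using snoc.prems by (intro snoc.IH) auto
  have 3: "(\<Prod>k<length \<kappa>. branch_factor a b ((\<kappa> @ [x]) ! k) (length (\<kappa> @ [x]) + length \<kappa>' - Suc k)) =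
     (\<Prod>k<length \<kappa>. branch_factor a b (\<kappa> ! k) (length \<kappa> + length (x # \<kappa>') - Suc k))"
    by (rule prod.cong) (auto simp: nth_append)
  have 4: "(\<Prod>k<length (\<kappa> @ [x]). branch_factor a b ((\<kappa> @ [x]) ! k) (length (\<kappa> @ [x]) + length \<kappa>' - Suc k)) =
     (\<Prod>k<length \<kappa>. branch_factor a b (\<kappa> ! k) (length \<kappa> + length (x # \<kappa>') - Suc k)) * branch_factor a b x (length \<kappa>')"
    unfolding 3[symmetric] by (simp add: nth_append)
  show ?case unfolding 4 using 1 2 by (simp add: ac_simps)
qed simp

definition branch_coeff :: "nat list \<Rightarrow> nat list \<Rightarrow> nat \<Rightarrow> qt" where
  "branch_coeff a lam b = (let \<kappa> = filter (\<lambda>y. b < y) lam in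
     \<Prod>k<length \<kappa>. branch_factor a b (\<kappa> ! k) (length \<kappa> - Suc k))"

text \<open>The strict bound on \<open>N\<close> leaves at least one zero in the padded partition,
  so that \<open>0\<close> occurs as a first entry.\<close>

lemma P_fin_branch:
  assumes lam: "sorted_wrt (\<ge>) lam" "0 \<notin> set lam" and N: "length a + length lam < N"
  shows "P_fin (a, lam) N =
    (\<Sum>b\<in>insert 0 (set lam). const (branch_coeff a lam b) * P_fin (a @ [b], remove1 b lam) N)"
proof -
  let ?n = "N - length a"
  define L where "L = pad ?n lam"
  obtain c where c: "P_fin (a, lam) N = comb a (mset L) c" "sym_coeff a (mset L) c" "c L = 1"
    using P_fin_comb[of lam a N] lam N by (auto simp: L_def)
  have n: "length lam < ?n" using N by simp
  have set_L: "set L = insert 0 (set lam)" using n by (auto simp: L_def pad_def)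
  have sorted_L: "sorted_wrt (\<ge>) L" unfolding L_def using lam(1) by (rule sorted_pad)
  have "P_fin (a, lam) N = (\<Sum>b\<in>set L. comb (a @ [b]) (mset L - {#b#}) (\<lambda>\<nu>. c (b # \<nu>)))"
    unfolding c(1) using set_L by (subst comb_split_first) auto
  also have "\<dots> = (\<Sum>b\<in>insert 0 (set lam). const (branch_coeff a lam b) * P_fin (a @ [b], remove1 b lam) N)"
    unfolding set_L
  proof (rule sum.cong[OF refl])
    fix b assume b: "b \<in> insert 0 (set lam)"
    define L' where "L' = pad (N - length (a @ [b])) (remove1 b lam)"
    have L': "L' = remove1 b L"
      using pad_remove1[OF lam(2) n b] by (simp add: L'_def L_def)
    have bL: "b \<in> set L" using b set_L by simp
    have M: "mset L = add_mset b (mset L')" using bL by (simp add: L')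
    have sym: "sym_coeff (a @ [b]) (mset L') (\<lambda>\<nu>. c (b # \<nu>))"
      using c(2) unfolding M by (rule sym_coeff_Cons)
    have len: "length (a @ [b]) + length (remove1 b lam) \<le> N"
    proof -
      have "length (remove1 b lam) \<le> length lam" by (simp add: length_remove1)
      thus ?thesis using N by simp
    qed
    have "comb (a @ [b]) (mset L - {#b#}) (\<lambda>\<nu>. c (b # \<nu>)) = comb (a @ [b]) (mset L') (\<lambda>\<nu>. c (b # \<nu>))"
      by (simp add: M)
    also have "\<dots> = const (c (b # L')) * P_fin (a @ [b], remove1 b lam) N"
      unfolding L'_def using sym[unfolded L'_def]
      by (rule comb_eq_P_fin[OF sorted_wrt_remove1[OF lam(1)] len])
    also have "c (b # L') = branch_coeff a lam b"
    proof -
      define \<kappa> where "\<kappa> = filter (\<lambda>y. b < y) lam"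
      \<comment> \<open>Splitting at the first occurrence puts all larger parts, and only these,
        before \<open>b\<close>.\<close>
      obtain ys zs where yz: "L = ys @ b # zs" "b \<notin> set ys" using bL split_list_first by metis
      have ys: "\<forall>y\<in>set ys. b < y"
        using sorted_L yz by (auto simp: sorted_wrt_append le_less)
      have zs: "\<forall>y\<in>set zs. y \<le> b" using sorted_L yz by (auto simp: sorted_wrt_append)
      have "filter (\<lambda>y. b < y) L = ys" using ys zs by (auto simp: yz filter_empty_conv)
      moreover have "filter (\<lambda>y. b < y) L = \<kappa>" by (simp add: L_def pad_def \<kappa>_def)
      ultimately have \<kappa>: "\<kappa> = ys" by simp
      have L'': "L' = ys @ zs" using yz by (simp add: L' remove1_append)
      have "c (b # ys @ zs) = c (ys @ b # zs) *
          (\<Prod>k<length ys. branch_factor a b (ys ! k) (length ys + length ([] :: nat list) - Suc k))"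
        by (rule sym_coeff_move_to_front[OF c(2), where \<rho>' = zs])
           (use sorted_L yz ys zs in \<open>auto simp: sorted_wrt_append\<close>)
      thus ?thesis using c(3) \<kappa> by (simp add: L'' yz branch_coeff_def Let_def \<kappa>_def)
    qed
    finally show "comb (a @ [b]) (mset L - {#b#}) (\<lambda>\<nu>. c (b # \<nu>)) =
        const (branch_coeff a lam b) * P_fin (a @ [b], remove1 b lam) N" .
  qed
  finally show ?thesis .
qed

section \<open>Stability\<close>

definition restrict_var :: "nat \<Rightarrow> mpoly \<Rightarrow> mpoly" where
  "restrict_var N = substitute (xvar(N := 0))"

lemma linear_op_restrict_var: "linear_op (restrict_var N)"
  by (simp add: restrict_var_def)

lemma lookup_restrict_var:
  "Poly_Mapping.lookup (restrict_var N f) \<alpha> = (if N \<in> Poly_Mapping.keys \<alpha> then 0 else Poly_Mapping.lookup f \<alpha>)"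
proof (induction f rule: mpoly_induct)
  case (single \<beta> c)
  have "monom_subst (xvar(N := 0)) \<beta> = (if N \<in> Poly_Mapping.keys \<beta> then 0 else monom_subst xvar \<beta>)"
    by (auto simp: monom_subst_def in_keys_iff intro!: prod.cong)
  hence "restrict_var N (Poly_Mapping.single \<beta> c) = (if N \<in> Poly_Mapping.keys \<beta> then 0 else Poly_Mapping.single \<beta> c)"
    by (simp add: restrict_var_def monom_subst_xvar const_def mult_single)
  thus ?case by (auto simp: lookup_single when_def)
qed (simp_all add: restrict_var_def substitute_add lookup_add)

lemma restrict_var_T_op:
  assumes "Suc j < N"
  shows "restrict_var N (T_op j f) = T_op j (restrict_var N f)"
  unfolding restrict_var_def T_op_T_gen
proof (rule substitute_T_gen[where c = 1])
  fix k
  show "perm_op (transpose j (Suc j)) ((xvar(N := 0)) k) = (xvar(N := 0)) (transpose j (Suc j) k)"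
    using assms by (auto simp: transpose_def)
qed (use assms in auto)

lemma restrict_var_Tinv_op:
  assumes "Suc j < N"
  shows "restrict_var N (Tinv_op j f) = Tinv_op j (restrict_var N f)"
  by (rule intertwine_inv) (rule restrict_var_T_op[OF assms])

text \<open>When the last variable is zero, the defining equation of T loses its second term and
  leaves t times the exchange, which turns the rotation of all variables into that of one variable
  fewer. The t compensates the change of the normalizing power in \<open>Y_op\<close>.\<close>

lemma restrict_var_T_omega:
  assumes "1 \<le> n"
  shows "restrict_var (Suc n) (T_op n (omega_op (Suc n) f)) = const tvar * omega_op n (restrict_var (Suc n) f)"
proof -
  let ?r = "restrict_var (Suc n)" and ?h = "omega_op (Suc n) f"
  have r: "?r (u * v) = ?r u * ?r v" "?r (u - v) = ?r u - ?r v" "?r (u + v) = ?r u + ?r v" for u v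
    by (simp_all add: restrict_var_def substitute_mult substitute_diff substitute_add)
  have r': "?r (xvar n) = xvar n" "?r (xvar (Suc n)) = 0" "?r (const c) = const c" for c
    by (simp_all add: restrict_var_def)
  have "?r ((xvar n - xvar (Suc n)) * T_gen n (Suc n) ?h) =
      ?r ((const tvar * xvar n - xvar (Suc n)) * perm_op (transpose n (Suc n)) ?h + (1 - const tvar) * xvar (Suc n) * ?h)"
    by (subst T_gen_eq) simp_all
  hence "xvar n * ?r (T_gen n (Suc n) ?h) = xvar n * (const tvar * ?r (perm_op (transpose n (Suc n)) ?h))"
    by (simp add: r r' ac_simps)
  hence 1: "?r (T_gen n (Suc n) ?h) = const tvar * ?r (perm_op (transpose n (Suc n)) ?h)"
    using xvar_nonzero by simp
  have "?r (perm_op (transpose n (Suc n)) ?h) = omega_op n (?r f)"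
  proof -
    have "(\<lambda>k. substitute (xvar(Suc n := 0)) (substitute (\<lambda>k. xvar (transpose n (Suc n) k)) (omega_var (Suc n) k))) =
        (\<lambda>k. substitute (omega_var n) ((xvar(Suc n := 0)) k))"
    proof
      fix k
      consider "k = 1" | "2 \<le> k" "k \<le> n" | "k = Suc n" "2 \<le> k" | "k = 0 \<or> Suc n < k" using assms by linarith
      thus "substitute (xvar(Suc n := 0)) (substitute (\<lambda>k. xvar (transpose n (Suc n) k)) (omega_var (Suc n) k)) =
          substitute (omega_var n) ((xvar(Suc n := 0)) k)"
      proof cases
        case 2
        hence "transpose n (Suc n) (k - 1) = k - 1" by (intro transpose_apply_other) auto
        thus ?thesis using 2 by (simp add: omega_var_def)
      next
        case 4
        hence "transpose n (Suc n) k = k" using assms by (intro transpose_apply_other) auto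
        thus ?thesis using 4 by (auto simp: omega_var_def)
      qed (use assms in \<open>auto simp: omega_var_def substitute_mult\<close>)
    qed
    hence "substitute (\<lambda>k. substitute (xvar(Suc n := 0)) (substitute (\<lambda>k. xvar (transpose n (Suc n) k)) (omega_var (Suc n) k))) f =
        substitute (\<lambda>k. substitute (omega_var n) ((xvar(Suc n := 0)) k)) f"
      by (rule arg_cong)
    moreover have "omega_op (Suc n) f = substitute (omega_var (Suc n)) f" by (simp add: omega_op_substitute)
    ultimately show ?thesis
      unfolding restrict_var_def perm_op_def omega_op_substitute[OF assms]
      by (simp only: substitute_substitute)
  qed
  with 1 show ?thesis by (simp add: T_op_T_gen)
qed

lemma restrict_var_Y_op:
  assumes "1 \<le> i" "i \<le> n"
  shows "restrict_var (Suc n) (Y_op (Suc n) i f) = Y_op n i (restrict_var (Suc n) f)"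
proof -
  let ?r = "restrict_var (Suc n)"
  have c: "?r (const c * g) = const c * ?r g" for c g
    by (rule linear_op_const_mult[OF linear_op_restrict_var])
  have "?r (TT i (Suc n) (omega_op (Suc n) (TI i f))) = TT i n (?r (T_op n (omega_op (Suc n) (TI i f))))"
    unfolding TT_Suc[OF assms(2)] unfolding TT_def by (rule comp_ops_intertwine) (auto intro: restrict_var_T_op)
  also have "\<dots> = const tvar * TT i n (omega_op n (?r (TI i f)))"
    using assms by (simp add: restrict_var_T_omega linear_op_const_mult[OF linear_op_TT])
  also have "?r (TI i f) = TI i (?r f)"
    unfolding TI_def by (rule comp_ops_intertwine) (use assms in \<open>auto intro: restrict_var_Tinv_op\<close>)
  finally have "?r (TT i (Suc n) (omega_op (Suc n) (TI i f))) = const tvar * TT i n (omega_op n (TI i (?r f)))" .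
  moreover have "tvar powi (int i - int n) = tvar powi (int i - int (Suc n)) * tvar"
    using power_int_add[of tvar "int i - int (Suc n)" 1] by simp
  ultimately show ?thesis unfolding Y_op_eq c by (simp add: const_mult mult.assoc)
qed

lemma mon_append_0: "mon (\<eta> @ [0]) = mon \<eta>"
  by (rule poly_mapping_eqI) (auto simp: lookup_mon nth_append)

lemma restrict_var_hom_polys:
  assumes "f \<in> hom_polys (Suc n) d"
  shows "restrict_var (Suc n) f \<in> hom_polys n d"
  unfolding hom_polys_def
proof (intro CollectI subsetI)
  fix \<alpha> assume "\<alpha> \<in> Poly_Mapping.keys (restrict_var (Suc n) f)"
  hence \<alpha>: "Suc n \<notin> Poly_Mapping.keys \<alpha>" "\<alpha> \<in> Poly_Mapping.keys f"
    by (auto simp: in_keys_iff[of \<alpha>] lookup_restrict_var split: if_splits)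
  then obtain \<nu> where \<nu>: "\<alpha> = mon \<nu>" "length \<nu> = Suc n" "sum_list \<nu> = d"
    using assms by (auto simp: hom_polys_def)
  obtain \<kappa> z where \<kappa>: "\<nu> = \<kappa> @ [z]" using \<nu>(2) by (cases \<nu> rule: rev_cases) auto
  have "z = 0" using \<alpha>(1) \<nu>(2) by (auto simp: \<nu>(1) \<kappa> in_keys_iff lookup_mon)
  hence "\<alpha> = mon \<kappa>" "length \<kappa> = n" "sum_list \<kappa> = d" using \<nu> by (simp_all add: \<kappa> mon_append_0)
  thus "\<alpha> \<in> mon ` {\<nu>. length \<nu> = n \<and> sum_list \<nu> = d}" by blast
qed

text \<open>Restriction keeps the eigenvalues at the remaining places, and their powers of q force
  the composition \<open>\<eta>\<close>. For \<open>z \<noteq> 0\<close> this has the wrong degree,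
  so nothing survives.\<close>

lemma restrict_var_E_poly:
  "restrict_var (Suc (length \<eta>)) (E_poly (\<eta> @ [z])) = (if z = 0 then E_poly \<eta> else 0)"
proof -
  let ?n = "length \<eta>" and ?\<kappa> = "\<eta> @ [z]"
  let ?f = "restrict_var (Suc ?n) (E_poly ?\<kappa>)"
  have hom: "?f \<in> hom_polys ?n (sum_list ?\<kappa>)"
    using E_poly_hom_polys[of ?\<kappa>] by (intro restrict_var_hom_polys) simp
  have eig: "Y_op ?n i ?f = const (y_eigenvalue ?\<kappa> i) * ?f" if "i \<in> {1..?n}" for i
  proof -
    have "Y_op (Suc ?n) i (E_poly ?\<kappa>) = const (y_eigenvalue ?\<kappa> i) * E_poly ?\<kappa>"
      using eigenpoly_E_poly[of ?\<kappa>] that by (simp add: eigenpoly_def)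
    thus ?thesis using that
      by (simp add: linear_op_const_mult[OF linear_op_restrict_var] flip: restrict_var_Y_op)
  qed
  show ?thesis
  proof (cases "z = 0")
    case True
    have y: "y_eigenvalue ?\<kappa> i = y_eigenvalue \<eta> i" if i: "i \<in> {1..?n}" for i
    proof -
      have "{j \<in> {1..length ?\<kappa>}. ?\<kappa> ! (j - 1) > ?\<kappa> ! (i - 1)} = {j \<in> {1..?n}. \<eta> ! (j - 1) > \<eta> ! (i - 1)}"
        using i True by (auto simp: nth_append split: if_splits)
      moreover have "{j \<in> {1..i}. ?\<kappa> ! (j - 1) = ?\<kappa> ! (i - 1)} = {j \<in> {1..i}. \<eta> ! (j - 1) = \<eta> ! (i - 1)}"
        using i by (auto simp: nth_append)
      ultimately have "eta_rank ?\<kappa> i = eta_rank \<eta> i" by (simp add: eta_rank_def)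
      moreover have "?\<kappa> ! (i - 1) = \<eta> ! (i - 1)" using i by (auto simp: nth_append)
      ultimately show ?thesis by (simp only: y_eigenvalue_def)
    qed
    have "Suc ?n \<notin> Poly_Mapping.keys (mon \<eta>)" by (simp add: in_keys_iff lookup_mon)
    hence l: "Poly_Mapping.lookup ?f (mon \<eta>) = 1"
      using lookup_E_poly[of ?\<kappa>] True by (simp add: lookup_restrict_var mon_append_0)
    hence "?f \<noteq> 0" by auto
    hence "eigenpoly \<eta> ?f" using hom eig y True by (simp add: eigenpoly_def)
    hence "E_poly \<eta> = ?f" using l by (rule E_poly_eqI)
    thus ?thesis using True by simp
  next
    case False
    have "?f = 0"
    proof (rule ccontr)
      assume "?f \<noteq> 0"
      from joint_eigenvector_leading[OF hom this eig] obtain \<nu> where \<nu>: "length \<nu> = ?n"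
        "sum_list \<nu> = sum_list ?\<kappa>" "\<And>i. i \<in> {1..?n} \<Longrightarrow> y_eigenvalue ?\<kappa> i = y_eigenvalue \<nu> i"
        by metis
      have "\<nu> = \<eta>"
      proof (rule nth_equalityI)
        fix j assume "j < length \<nu>"
        thus "\<nu> ! j = \<eta> ! j"
          using \<nu>(3)[of "Suc j"] \<nu>(1) by (simp add: y_eigenvalue_eq_iff nth_append)
      qed (rule \<nu>(1))
      thus False using \<nu>(2) False by simp
    qed
    thus ?thesis using False by simp
  qed
qed

lemma restrict_var_comb:
  assumes "length a + size M = Suc n" and ne: "M \<noteq> {#}"
  shows "restrict_var (Suc n) (comb a M c) =
    (if 0 \<in># M then comb a (M - {#0#}) (\<lambda>\<nu>. c (\<nu> @ [0])) else 0)"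
proof -
  let ?P = "permutations_of_multiset M" and ?r = "restrict_var (Suc n)"
  have r: "?r (E_poly (a @ \<mu>)) = (if last \<mu> = 0 then E_poly (a @ butlast \<mu>) else 0)"
    if "\<mu> \<in> ?P" for \<mu>
  proof -
    have "\<mu> \<noteq> []" using that ne by (auto simp: permutations_of_multiset_def)
    then obtain \<nu> z where \<mu>: "\<mu> = \<nu> @ [z]" by (cases \<mu> rule: rev_cases) auto
    have "length (a @ \<nu>) = n"
      using length_permutations_of_multiset[OF that] assms by (simp add: \<mu>)
    thus ?thesis using restrict_var_E_poly[of "a @ \<nu>" z] by (simp add: \<mu>)
  qed
  have e: "?r (comb a M c) = (\<Sum>\<mu>\<in>?P. const (c \<mu>) * ?r (E_poly (a @ \<mu>)))"
    unfolding comb_def by (simp add: linear_op_sum[OF linear_op_restrict_var] linear_op_const_mult[OF linear_op_restrict_var])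
  show ?thesis
  proof (cases "0 \<in># M")
    case True
    let ?Q = "permutations_of_multiset (M - {#0#})"
    have "?r (comb a M c) = (\<Sum>\<mu>\<in>(\<lambda>\<nu>. \<nu> @ [0]) ` ?Q. const (c \<mu>) * ?r (E_poly (a @ \<mu>)))"
      unfolding e
    proof (rule sum.mono_neutral_right)
      show "(\<lambda>\<nu>. \<nu> @ [0]) ` ?Q \<subseteq> ?P" using True by (auto simp: permutations_of_multiset_def)
      show "\<forall>\<mu>\<in>?P - (\<lambda>\<nu>. \<nu> @ [0]) ` ?Q. const (c \<mu>) * ?r (E_poly (a @ \<mu>)) = 0"
      proof
        fix \<mu> assume \<mu>: "\<mu> \<in> ?P - (\<lambda>\<nu>. \<nu> @ [0]) ` ?Q"
        then obtain \<nu> z where z: "\<mu> = \<nu> @ [z]"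
          using ne by (cases \<mu> rule: rev_cases) (auto simp: permutations_of_multiset_def)
        have "z \<noteq> 0"
        proof
          assume "z = 0"
          hence "\<nu> \<in> ?Q" using \<mu> by (auto simp: z permutations_of_multiset_def)
          thus False using \<mu> z \<open>z = 0\<close> by auto
        qed
        thus "const (c \<mu>) * ?r (E_poly (a @ \<mu>)) = 0" using r[of \<mu>] \<mu> ne z by auto
      qed
    qed simp
    also have "\<dots> = (\<Sum>\<nu>\<in>?Q. const (c (\<nu> @ [0])) * ?r (E_poly (a @ \<nu> @ [0])))"
      by (subst sum.reindex) (auto simp: inj_on_def)
    also have "\<dots> = comb a (M - {#0#}) (\<lambda>\<nu>. c (\<nu> @ [0]))"
      unfolding comb_def
    proof (rule sum.cong[OF refl])
      fix \<nu> assume "\<nu> \<in> ?Q"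
      hence "\<nu> @ [0] \<in> ?P" using True by (auto simp: permutations_of_multiset_def)
      thus "const (c (\<nu> @ [0])) * ?r (E_poly (a @ \<nu> @ [0])) = const (c (\<nu> @ [0])) * E_poly (a @ \<nu>)"
        using r[of "\<nu> @ [0]"] ne by simp
    qed
    finally show ?thesis using True by simp
  next
    case False
      have "?r (E_poly (a @ \<mu>)) = 0" if "\<mu> \<in> ?P" for \<mu>
      proof -
        have "\<mu> \<noteq> []" using that ne by (auto simp: permutations_of_multiset_def)
        hence "last \<mu> \<in># M" using that last_in_set[of \<mu>] by (auto simp: permutations_of_multiset_def)
        thus ?thesis using r[OF that] False by auto
      qed
      thus ?thesis unfolding e using False by simp
  qed
qed

lemma P_fin_0: "N < length a + length lam \<Longrightarrow> P_fin (a, lam) N = 0"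
  by (simp add: P_fin_def)

text \<open>In the main case a trailing zero is stripped from the arrangements. The result is again
  symmetric, since the remaining T commute with the restriction, and its coefficient at the
  decreasing list is still \<open>1\<close>.\<close>

lemma restrict_var_P_fin:
  assumes lam: "sorted_wrt (\<ge>) lam" "0 \<notin> set lam" and N: "length a \<le> N"
  shows "restrict_var (Suc N) (P_fin (a, lam) (Suc N)) = P_fin (a, lam) N"
proof -
  let ?n = "N - length a"
  define L where "L = pad (Suc N - length a) lam"
  consider "length a + length lam \<le> N" | "length a + length lam = Suc N" | "length a + length lam > Suc N" by linarith
  thus ?thesis
  proof cases
    case 1
    obtain c where c: "P_fin (a, lam) (Suc N) = comb a (mset L) c" "sym_coeff a (mset L) c" "c L = 1"
      using P_fin_comb[of lam a "Suc N"] lam 1 by (auto simp: L_def)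
    define L' where "L' = pad ?n lam"
    have "Suc N - length a - length lam = Suc (?n - length lam)" using 1 by simp
    hence L: "L = L' @ [0]" by (simp add: L_def L'_def pad_def replicate_append_same)
    have len: "length L = Suc ?n" using 1 by (simp add: L_def length_pad)
    have r: "restrict_var (Suc N) (P_fin (a, lam) (Suc N)) = comb a (mset L') (\<lambda>\<nu>. c (\<nu> @ [0]))"
      unfolding c(1) using len N by (subst restrict_var_comb) (auto simp: L)
    have "sym_coeff a (mset L') (\<lambda>\<nu>. c (\<nu> @ [0]))"
    proof (rule sym_coeffI)
      fix p assume p: "1 \<le> p" "p < size (mset L')"
      have "p < size (mset L)" using p L by simp
      hence "T_op (length a + p) (P_fin (a, lam) (Suc N)) = const tvar * P_fin (a, lam) (Suc N)"
        unfolding c(1) using c(2) p by (intro T_op_comb_sym) auto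
      moreover have "Suc (length a + p) < Suc N" using p len N L by simp
      ultimately show "T_op (length a + p) (comb a (mset L') (\<lambda>\<nu>. c (\<nu> @ [0]))) =
          const tvar * comb a (mset L') (\<lambda>\<nu>. c (\<nu> @ [0]))"
        unfolding r[symmetric]
        by (simp add: restrict_var_T_op[symmetric] linear_op_const_mult[OF linear_op_restrict_var])
    qed
    hence "comb a (mset L') (\<lambda>\<nu>. c (\<nu> @ [0])) = const (c (L' @ [0])) * P_fin (a, lam) N"
      unfolding L'_def by (rule comb_eq_P_fin[OF lam(1) 1])
    thus ?thesis using r c(3) L by simp
  next
    \<comment> \<open>The partition fills all places, so no arrangement ends in zero and the
      restriction vanishes, in agreement with the convention for small \<open>N\<close> in
      \<open>P_fin\<close>.\<close>
    case 2
    obtain c where c: "P_fin (a, lam) (Suc N) = comb a (mset L) c"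
      using P_fin_comb[of lam a "Suc N"] lam 2 by (auto simp: L_def)
    have "Suc N - length a - length lam = 0" using 2 by simp
    hence L: "L = lam" by (simp add: L_def pad_def)
    have "lam \<noteq> []" using 2 N by auto
    hence "restrict_var (Suc N) (P_fin (a, lam) (Suc N)) = 0"
      unfolding c using 2 lam(2) by (subst restrict_var_comb) (auto simp: L)
    thus ?thesis using 2 by (simp add: P_fin_0)
  next
    case 3
    thus ?thesis by (simp add: P_fin_0 restrict_var_def)
  qed
qed

lemma lookup_P_fin_stable:
  assumes lam: "sorted_wrt (\<ge>) lam" "0 \<notin> set lam" and N: "length a \<le> N" "N \<le> N'"
    and \<alpha>: "Poly_Mapping.keys \<alpha> \<subseteq> {1..N}"
  shows "Poly_Mapping.lookup (P_fin (a, lam) N') \<alpha> = Poly_Mapping.lookup (P_fin (a, lam) N) \<alpha>"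
  using N(2)
proof (induction rule: dec_induct)
  case (step n)
  have "Suc n \<notin> Poly_Mapping.keys \<alpha>" using \<alpha> step by auto
  hence "Poly_Mapping.lookup (P_fin (a, lam) (Suc n)) \<alpha> =
      Poly_Mapping.lookup (restrict_var (Suc n) (P_fin (a, lam) (Suc n))) \<alpha>"
    by (simp add: lookup_restrict_var)
  also have "\<dots> = Poly_Mapping.lookup (P_fin (a, lam) n) \<alpha>"
    using N(1) step by (subst restrict_var_P_fin[OF lam]) auto
  finally show ?case using step by simp
qed simp

section \<open>Degree and symmetry in finitely many variables\<close>

lemma P_fin_hom_polys:
  assumes "sorted_wrt (\<ge>) lam"
  shows "P_fin (a, lam) N \<in> hom_polys N (sum_list a + sum_list lam)"
proof (cases "N < length a + length lam")
  case False
  define L where "L = pad (N - length a) lam"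
  obtain c where c: "P_fin (a, lam) N = comb a (mset L) c"
    using P_fin_comb[of lam a N] assms False by (auto simp: L_def)
  have "E_poly (a @ \<mu>) \<in> hom_polys N (sum_list a + sum_list lam)" if \<mu>: "\<mu> \<in> permutations_of_multiset (mset L)" for \<mu>
  proof -
    have "mset \<mu> = mset L" using \<mu> by (simp add: permutations_of_multiset_def)
    hence "length \<mu> = length L" "sum_list \<mu> = sum_list L" by (metis size_mset, metis sum_mset_sum_list)
    thus ?thesis using E_poly_hom_polys[of "a @ \<mu>"] False
      by (simp add: L_def length_pad) (simp add: pad_def sum_list_replicate)
  qed
  thus ?thesis unfolding c comb_def by (auto intro!: hom_polys_sum hom_polys_const_mult)
qed (simp add: P_fin_0)

lemma perm_op_transpose_P_fin:
  assumes lam: "sorted_wrt (\<ge>) lam" and ij: "length a < i" "i < j" "j \<le> N"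
  shows "perm_op (transpose i j) (P_fin (a, lam) N) = P_fin (a, lam) N"
proof (cases "N < length a + length lam")
  case False
  define L where "L = pad (N - length a) lam"
  obtain c where c: "P_fin (a, lam) N = comb a (mset L) c" "sym_coeff a (mset L) c"
    using P_fin_comb[of lam a N] lam False by (auto simp: L_def)
  have len: "length L = N - length a" using False by (simp add: L_def length_pad)
  have adj: "perm_op (transpose k (Suc k)) (P_fin (a, lam) N) = P_fin (a, lam) N"
    if k: "length a < k" "k < N" for k
  proof -
    obtain p where p: "k = length a + p" "1 \<le> p"
      using k by (metis add_diff_inverse_nat less_imp_le less_imp_not_less One_nat_def Suc_leI zero_less_diff not_less)
    have "T_op k (P_fin (a, lam) N) = const tvar * P_fin (a, lam) N"
      unfolding c(1) p(1) using p k len c(2) by (intro T_op_comb_sym) auto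
    thus ?thesis unfolding T_op_T_gen by (intro T_gen_eq_t_imp_symmetric) auto
  qed
  show ?thesis
    using Suc_leI[OF ij(2)] ij(3)
  proof (induction j rule: dec_induct)
    case base
    thus ?case using adj[of i] ij(1) by simp
  next
    case (step j)
    have "transpose i (Suc j) = transpose j (Suc j) \<circ> (transpose i j \<circ> transpose j (Suc j))"
      using step.hyps by (auto simp: fun_eq_iff transpose_def)
    hence "perm_op (transpose i (Suc j)) (P_fin (a, lam) N) =
        perm_op (transpose j (Suc j)) (perm_op (transpose i j) (perm_op (transpose j (Suc j)) (P_fin (a, lam) N)))"
      by (simp only: perm_op_comp)
    thus ?case using adj[of j] step ij(1) by simp
  qed
qed (simp add: P_fin_0)

lemma perm_op_P_fin:
  assumes lam: "sorted_wrt (\<ge>) lam" and \<sigma>: "\<sigma> permutes {Suc (length a)..N}"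
  shows "perm_op \<sigma> (P_fin (a, lam) N) = P_fin (a, lam) N"
  using \<sigma> finite_atLeastAtMost[of "Suc (length a)" N]
proof (induction rule: permutes_induct)
  case (swap i j \<sigma>)
  have "perm_op (transpose i j) (P_fin (a, lam) N) = P_fin (a, lam) N"
    using perm_op_transpose_P_fin[OF lam, of a i j N] perm_op_transpose_P_fin[OF lam, of a j i N] swap.hyps
    by (cases "i < j") (auto simp: transpose_commute[of i j])
  thus ?case unfolding perm_op_comp[symmetric] using swap by simp
qed simp_all

section \<open>Power series in infinitely many variables\<close>

lemma sum_lookup_mon:
  "(\<Sum>i\<in>Poly_Mapping.keys (mon \<nu>). Poly_Mapping.lookup (mon \<nu>) i) = sum_list \<nu>"
proof -
  have "(\<Sum>i\<in>Poly_Mapping.keys (mon \<nu>). Poly_Mapping.lookup (mon \<nu>) i) =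
      (\<Sum>i\<in>{1..length \<nu>}. Poly_Mapping.lookup (mon \<nu>) i)"
    by (rule sum.mono_neutral_left) (auto simp: in_keys_iff lookup_mon split: if_splits)
  also have "\<dots> = (\<Sum>i<length \<nu>. \<nu> ! i)"
    by (rule sum.reindex_bij_witness[of _ Suc "\<lambda>i. i - 1"]) (auto simp: lookup_mon)
  also have "\<dots> = sum_list \<nu>" by (simp add: sum_list_sum_nth atLeast0LessThan)
  finally show ?thesis .
qed

text \<open>\<open>R_ring\<close> asks for symmetry under all permutations of an infinite set, also
  those moving infinitely many points. One monomial sees only finitely many of them, and the partial
  bijection extends because the complements in \<open>{Suc m..N}\<close> have equal size.\<close>

lemma permutes_infinite_restrict:
  assumes \<sigma>: "\<sigma> permutes {m<..}" and A: "finite A" "A \<subseteq> {1..N}" "\<sigma> ` A \<subseteq> {1..N :: nat}"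
  obtains \<tau> where "\<tau> permutes {Suc m..N}" "\<And>x. x \<in> A \<Longrightarrow> \<tau> x = \<sigma> x"
proof -
  let ?S = "{Suc m..N}" and ?A = "A \<inter> {m<..}"
  have inj: "inj \<sigma>" using \<sigma> by (rule permutes_inj)
  have AS: "?A \<subseteq> ?S" using A by auto
  have BS: "\<sigma> ` ?A \<subseteq> ?S"
  proof
    fix y assume "y \<in> \<sigma> ` ?A"
    then obtain x where x: "y = \<sigma> x" "x \<in> A" "x \<in> {m<..}" by blast
    hence "y \<in> {m<..}" using permutes_in_image[OF \<sigma>] by simp
    thus "y \<in> ?S" using A(3) x by auto
  qed
  have fin: "finite ?A" using A by simp
  have "card (\<sigma> ` ?A) = card ?A" using inj by (intro card_image) (auto intro: inj_on_subset)
  hence "card (?S - ?A) = card (?S - \<sigma> ` ?A)"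
    using AS BS fin by (simp add: card_Diff_subset)
  then obtain g where g: "bij_betw g (?S - ?A) (?S - \<sigma> ` ?A)"
    using finite_same_card_bij[of "?S - ?A" "?S - \<sigma> ` ?A"] by auto
  define \<tau> where "\<tau> x = (if x \<in> ?A then \<sigma> x else if x \<in> ?S then g x else x)" for x
  have "bij_betw \<tau> (?A \<union> (?S - ?A)) (\<sigma> ` ?A \<union> (?S - \<sigma> ` ?A))"
  proof (rule bij_betw_combine)
    have "bij_betw \<sigma> ?A (\<sigma> ` ?A)" using inj by (auto simp: bij_betw_def intro: inj_on_subset)
    moreover have "bij_betw \<tau> ?A (\<sigma> ` ?A) \<longleftrightarrow> bij_betw \<sigma> ?A (\<sigma> ` ?A)"
      by (rule bij_betw_cong) (simp add: \<tau>_def)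
    ultimately show "bij_betw \<tau> ?A (\<sigma> ` ?A)" by blast
    have "bij_betw \<tau> (?S - ?A) (?S - \<sigma> ` ?A) \<longleftrightarrow> bij_betw g (?S - ?A) (?S - \<sigma> ` ?A)"
      by (rule bij_betw_cong) (auto simp: \<tau>_def)
    thus "bij_betw \<tau> (?S - ?A) (?S - \<sigma> ` ?A)" using g by blast
  qed auto
  moreover have "?A \<union> (?S - ?A) = ?S" "\<sigma> ` ?A \<union> (?S - \<sigma> ` ?A) = ?S" using AS BS by auto
  ultimately have "bij_betw \<tau> ?S ?S" by simp
  hence "\<tau> permutes ?S" using AS by (intro bij_imp_permutes) (auto simp: \<tau>_def)
  moreover have "\<tau> x = \<sigma> x" if "x \<in> A" for x
  proof (cases "x \<in> {m<..}")
    case False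
    thus ?thesis using permutes_not_in[OF \<sigma>, of x] by (auto simp: \<tau>_def)
  qed (use that in \<open>simp add: \<tau>_def\<close>)
  ultimately show ?thesis using that by blast
qed

lemma P_inf_lookup:
  assumes "m_partition m \<Lambda>"
  shows "\<And>N \<alpha>. m \<le> N \<Longrightarrow> Poly_Mapping.keys \<alpha> \<subseteq> {1..N} \<Longrightarrow> P_inf \<Lambda> \<alpha> = Poly_Mapping.lookup (P_fin \<Lambda> N) \<alpha>"
    "\<And>\<alpha>. 0 \<in> Poly_Mapping.keys \<alpha> \<Longrightarrow> P_inf \<Lambda> \<alpha> = 0"
proof -
  obtain a lam where \<Lambda>: "\<Lambda> = (a, lam)" by (cases \<Lambda>)
  have m: "length a = m" and lam: "sorted_wrt (\<ge>) lam" "0 \<notin> set lam"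
    using assms by (auto simp: \<Lambda> m_partition_def)
  let ?Q = "\<lambda>f. f \<in> R_ring m \<and> (\<forall>N \<ge> m. \<forall>\<alpha>. Poly_Mapping.keys \<alpha> \<subseteq> {1..N} \<longrightarrow>
        f \<alpha> = Poly_Mapping.lookup (P_fin \<Lambda> N) \<alpha>)"
  \<comment> \<open>The coefficient is read in the least number of variables, at least
    \<open>m\<close>, that contains the monomial; by stability any larger number gives the same.
    Monomials with the index \<open>0\<close> get \<open>0\<close>, as \<open>R_ring\<close>
    demands.\<close>
  define f where "f \<alpha> = (if 0 \<in> Poly_Mapping.keys \<alpha> then 0 else
    Poly_Mapping.lookup (P_fin \<Lambda> (Max (insert m (Poly_Mapping.keys \<alpha>)))) \<alpha>)" for \<alpha> :: monom
  have f: "f \<alpha> = Poly_Mapping.lookup (P_fin \<Lambda> N) \<alpha>" if N: "m \<le> N" "Poly_Mapping.keys \<alpha> \<subseteq> {1..N}" for N \<alpha>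
  proof -
    let ?M = "Max (insert m (Poly_Mapping.keys \<alpha>))"
    have "0 \<notin> Poly_Mapping.keys \<alpha>" using N by auto
    moreover have "Poly_Mapping.keys \<alpha> \<subseteq> {1..?M}"
    proof
      fix k assume k: "k \<in> Poly_Mapping.keys \<alpha>"
      hence "k \<le> ?M" by (intro Max_ge) auto
      thus "k \<in> {1..?M}" using N(2) k by auto
    qed
    moreover have "?M \<le> N" using N by (subst Max_le_iff) auto
    moreover have "m \<le> ?M" by (intro Max_ge) auto
    ultimately show ?thesis
      using lookup_P_fin_stable[OF lam, of a ?M N \<alpha>] m by (simp add: f_def \<Lambda>)
  qed
  have keys: "\<exists>N\<ge>m. Poly_Mapping.keys \<alpha> \<subseteq> {1..N} \<and> Poly_Mapping.keys \<beta> \<subseteq> {1..N}"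
    if "0 \<notin> Poly_Mapping.keys \<alpha>" "0 \<notin> Poly_Mapping.keys \<beta>" for \<alpha> \<beta> :: monom
  proof (intro exI[of _ "Max (insert m (Poly_Mapping.keys \<alpha> \<union> Poly_Mapping.keys \<beta>))"] conjI subsetI)
    show "m \<le> Max (insert m (Poly_Mapping.keys \<alpha> \<union> Poly_Mapping.keys \<beta>))" by (intro Max_ge) auto
    fix k assume k: "k \<in> Poly_Mapping.keys \<alpha>"
    hence "k \<le> Max (insert m (Poly_Mapping.keys \<alpha> \<union> Poly_Mapping.keys \<beta>))" by (intro Max_ge) auto
    moreover have "k \<noteq> 0" using k that by metis
    ultimately show "k \<in> {1..Max (insert m (Poly_Mapping.keys \<alpha> \<union> Poly_Mapping.keys \<beta>))}" by simp
  next
    fix k assume k: "k \<in> Poly_Mapping.keys \<beta>"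
    hence "k \<le> Max (insert m (Poly_Mapping.keys \<alpha> \<union> Poly_Mapping.keys \<beta>))" by (intro Max_ge) auto
    moreover have "k \<noteq> 0" using k that by metis
    ultimately show "k \<in> {1..Max (insert m (Poly_Mapping.keys \<alpha> \<union> Poly_Mapping.keys \<beta>))}" by simp
  qed
  have "f \<in> R_ring m"
    unfolding R_ring_def
  proof (intro CollectI conjI allI impI)
    fix \<alpha> :: monom assume "0 \<in> Poly_Mapping.keys \<alpha>"
    thus "f \<alpha> = 0" by (simp add: f_def)
  next
    have "(\<Sum>i\<in>Poly_Mapping.keys \<alpha>. Poly_Mapping.lookup \<alpha> i) = sum_list a + sum_list lam" if "f \<alpha> \<noteq> 0" for \<alpha>
    proof -
      have "\<alpha> \<in> Poly_Mapping.keys (P_fin (a, lam) (Max (insert m (Poly_Mapping.keys \<alpha>))))"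
        using that by (auto simp: f_def \<Lambda> in_keys_iff split: if_splits)
      then obtain \<nu> where "\<alpha> = mon \<nu>" "sum_list \<nu> = sum_list a + sum_list lam"
        using P_fin_hom_polys[OF lam(1)] unfolding hom_polys_def by blast
      thus ?thesis by (simp add: sum_lookup_mon)
    qed
    thus "\<exists>d. \<forall>\<alpha>. f \<alpha> \<noteq> 0 \<longrightarrow> (\<Sum>i\<in>Poly_Mapping.keys \<alpha>. Poly_Mapping.lookup \<alpha> i) \<le> d"
      by (intro exI[of _ "sum_list a + sum_list lam"]) auto
  next
    fix \<sigma> and \<alpha> :: monom assume \<sigma>: "\<sigma> permutes {m<..}"
    let ?\<beta> = "Poly_Mapping.map_key \<sigma> \<alpha>"
    have inj: "inj \<sigma>" using \<sigma> by (rule permutes_inj)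
    have kb: "k \<in> Poly_Mapping.keys ?\<beta> \<longleftrightarrow> \<sigma> k \<in> Poly_Mapping.keys \<alpha>" for k
      using keys_map_key[OF inj, of \<alpha>] by simp
    have "\<sigma> 0 = 0" using permutes_not_in[OF \<sigma>, of 0] by simp
    hence 0: "0 \<in> Poly_Mapping.keys ?\<beta> \<longleftrightarrow> 0 \<in> Poly_Mapping.keys \<alpha>" using kb[of 0] by simp
    show "f ?\<beta> = f \<alpha>"
    proof (cases "0 \<in> Poly_Mapping.keys \<alpha>")
      case True
      thus ?thesis using 0 by (simp add: f_def)
    next
      case False
      then obtain N where N: "m \<le> N" "Poly_Mapping.keys \<alpha> \<subseteq> {1..N}" "Poly_Mapping.keys ?\<beta> \<subseteq> {1..N}"
        using keys[of \<alpha> ?\<beta>] 0 by auto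
      have img: "\<sigma> ` Poly_Mapping.keys ?\<beta> = Poly_Mapping.keys \<alpha>"
      proof
        show "Poly_Mapping.keys \<alpha> \<subseteq> \<sigma> ` Poly_Mapping.keys ?\<beta>"
        proof
          fix k assume k: "k \<in> Poly_Mapping.keys \<alpha>"
          obtain l where "k = \<sigma> l" using permutes_surj[OF \<sigma>] by (metis surjD)
          thus "k \<in> \<sigma> ` Poly_Mapping.keys ?\<beta>" using kb k by blast
        qed
      qed (use kb in blast)
      obtain \<tau> where \<tau>: "\<tau> permutes {Suc m..N}" "\<And>x. x \<in> Poly_Mapping.keys ?\<beta> \<Longrightarrow> \<tau> x = \<sigma> x"
        using permutes_infinite_restrict[OF \<sigma>, of "Poly_Mapping.keys ?\<beta>" N] N img by auto
      have injt: "inj \<tau>" using \<tau>(1) by (rule permutes_inj)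
      have "Poly_Mapping.map_key \<tau> \<alpha> = ?\<beta>"
      proof (rule poly_mapping_eqI)
        fix k
        show "Poly_Mapping.lookup (Poly_Mapping.map_key \<tau> \<alpha>) k = Poly_Mapping.lookup ?\<beta> k"
        proof (cases "k \<in> Poly_Mapping.keys ?\<beta>")
          case True
          thus ?thesis using \<tau>(2)[OF True] by (simp add: map_key.rep_eq[OF inj] map_key.rep_eq[OF injt])
        next
          case False
          have "\<tau> k \<notin> Poly_Mapping.keys \<alpha>"
          proof
            assume "\<tau> k \<in> Poly_Mapping.keys \<alpha>"
            then obtain l where "\<tau> k = \<sigma> l" "l \<in> Poly_Mapping.keys ?\<beta>" using img by (metis imageE)
            hence "\<tau> k = \<tau> l" using \<tau>(2) by simp
            hence "k = l" using injt by (metis injD)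
            thus False using False \<open>l \<in> Poly_Mapping.keys ?\<beta>\<close> by simp
          qed
          thus ?thesis using False
            by (simp add: in_keys_iff map_key.rep_eq[OF injt])
        qed
      qed
      hence "f ?\<beta> = Poly_Mapping.lookup (perm_op \<tau> (P_fin \<Lambda> N)) \<alpha>"
        using f[OF N(1,3)] permutes_bij[OF \<tau>(1)] by (simp add: lookup_perm_op)
      also have "perm_op \<tau> (P_fin \<Lambda> N) = P_fin \<Lambda> N"
        using perm_op_P_fin[OF lam(1), of \<tau> a N] \<tau>(1) m by (simp add: \<Lambda>)
      finally show ?thesis using f[OF N(1,2)] by simp
    qed
  qed
  hence Qf: "?Q f" using f by blast
  have "P_inf \<Lambda> = f"
    unfolding P_inf_def
  proof (rule the_equality)
    show "f \<in> R_ring (length (fst \<Lambda>)) \<and> (\<forall>N\<ge>length (fst \<Lambda>). \<forall>\<alpha>. Poly_Mapping.keys \<alpha> \<subseteq> {1..N} \<longrightarrow>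
        f \<alpha> = Poly_Mapping.lookup (P_fin \<Lambda> N) \<alpha>)"
      using Qf m by (simp add: \<Lambda>)
  next
    fix g assume "g \<in> R_ring (length (fst \<Lambda>)) \<and> (\<forall>N\<ge>length (fst \<Lambda>). \<forall>\<alpha>. Poly_Mapping.keys \<alpha> \<subseteq> {1..N} \<longrightarrow>
        g \<alpha> = Poly_Mapping.lookup (P_fin \<Lambda> N) \<alpha>)"
    hence g: "g \<in> R_ring m" "\<And>N \<alpha>. m \<le> N \<Longrightarrow> Poly_Mapping.keys \<alpha> \<subseteq> {1..N} \<Longrightarrow> g \<alpha> = Poly_Mapping.lookup (P_fin \<Lambda> N) \<alpha>"
      using m by (auto simp: \<Lambda>)
    show "g = f"
    proof
      fix \<alpha>
      show "g \<alpha> = f \<alpha>"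
      proof (cases "0 \<in> Poly_Mapping.keys \<alpha>")
        case True
        thus ?thesis using g(1) by (auto simp: R_ring_def f_def)
      next
        case False
        then obtain N where "m \<le> N" "Poly_Mapping.keys \<alpha> \<subseteq> {1..N}" using keys[of \<alpha> \<alpha>] by auto
        thus ?thesis using g(2) f by metis
      qed
    qed
  qed
  thus "\<And>N \<alpha>. m \<le> N \<Longrightarrow> Poly_Mapping.keys \<alpha> \<subseteq> {1..N} \<Longrightarrow> P_inf \<Lambda> \<alpha> = Poly_Mapping.lookup (P_fin \<Lambda> N) \<alpha>"
    "\<And>\<alpha>. 0 \<in> Poly_Mapping.keys \<alpha> \<Longrightarrow> P_inf \<Lambda> \<alpha> = 0"
    using f by (auto simp: f_def)
qed

section \<open>The coefficients in terms of diagrams\<close>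

definition circled_rows :: "nat list \<Rightarrow> diagram" where
  "circled_rows a = map (\<lambda>i. (a ! (i - 1), Some i)) [1..<Suc (length a)]"

lemma diagram_eq:
  "diagram (a, lam) = sort_key (\<lambda>row. - int (fst row)) (circled_rows a @ map (\<lambda>b. (b, None)) lam)"
  by (simp add: diagram_def circled_rows_def)

lemma circled_rows_snoc: "circled_rows (a @ [b]) = circled_rows a @ [(b, Some (Suc (length a)))]"
  by (auto simp: circled_rows_def nth_append)

lemma map_fst_circled_rows: "map fst (circled_rows a) = a"
  by (rule nth_equalityI) (auto simp: circled_rows_def simp del: upt_Suc)

lemma circled_rows_not_None: "row \<in> set (circled_rows a) \<Longrightarrow> snd row \<noteq> None"
  by (auto simp: circled_rows_def)

lemma sorted_key_split:
  fixes c :: "'b :: linorder"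
  shows "sorted (map f D) \<Longrightarrow> D = filter (\<lambda>r. f r < c) D @ filter (\<lambda>r. \<not> f r < c) D"
proof (induction D)
  case (Cons r D)
  show ?case
  proof (cases "f r < c")
    case True
    thus ?thesis using Cons by simp
  next
    case False
    hence "\<forall>s\<in>set (r # D). \<not> f s < c" using Cons.prems by auto
    hence "filter (\<lambda>r. f r < c) (r # D) = []" "filter (\<lambda>r. \<not> f r < c) (r # D) = r # D"
      by (auto simp: filter_empty_conv filter_id_conv)
    thus ?thesis by simp
  qed
qed simp

text \<open>The rows with a square in column \<open>b\<close>. Adding a circle to a row of length
  \<open>b\<close> leaves them unchanged (\<open>long_rows_add_circle\<close>), so both diagrams
  begin with the same rows, numbered alike.\<close>

definition long_rows :: "nat \<Rightarrow> nat list \<Rightarrow> nat list \<Rightarrow> diagram" where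
  "long_rows b a lam = sort_key (\<lambda>row. - int (fst row))
     (filter (\<lambda>row. b < fst row) (circled_rows a @ map (\<lambda>b. (b, None)) lam))"

lemma diagram_split:
  obtains H where "diagram (a, lam) = long_rows b a lam @ H" "\<forall>row\<in>set H. fst row \<le> b"
    "\<forall>row\<in>set (long_rows b a lam). b < fst row"
proof -
  let ?f = "\<lambda>row :: nat \<times> nat option. - int (fst row)" and ?D = "diagram (a, lam)"
  have "sorted (map ?f ?D)" unfolding diagram_eq by (rule sorted_sort_key)
  hence split: "?D = filter (\<lambda>r. ?f r < - int b) ?D @ filter (\<lambda>r. \<not> ?f r < - int b) ?D"
    by (rule sorted_key_split)
  have long: "filter (\<lambda>r. ?f r < - int b) ?D = long_rows b a lam"
    unfolding diagram_eq long_rows_def filter_sort by simp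
  show ?thesis
  proof (rule that)
    show "?D = long_rows b a lam @ filter (\<lambda>r. \<not> ?f r < - int b) ?D"
      using split unfolding long .
  qed (auto simp: long_rows_def)
qed

lemma filter_remove1_idem: "\<not> P b \<Longrightarrow> filter P (remove1 b xs) = filter P xs"
  by (induction xs) auto

lemma long_rows_add_circle: "long_rows b (a @ [b]) (remove1 b lam) = long_rows b a lam"
  by (simp add: long_rows_def circled_rows_snoc filter_map o_def filter_remove1_idem)

text \<open>Below the square, column \<open>b\<close> contains one square for each later long row,
  and at its bottom the circles of the rows of length exactly \<open>b\<close>. The diagram with the
  new circle has one such circle more, which raises the modified leg by one.\<close>

lemma long_rows_leg_tilde:
  assumes r: "r < length (long_rows b a lam)" "snd (long_rows b a lam ! r) = None"
  shows "leg_tilde (diagram (a, lam)) (r, b) =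
      length (long_rows b a lam) - Suc r + length (filter (\<lambda>y. y = b) a)"
    "Suc (arm (diagram (a, lam)) (r, b)) = fst (long_rows b a lam ! r) - b"
proof -
  let ?G = "long_rows b a lam" and ?D = "diagram (a, lam)"
  obtain H where D: "?D = ?G @ H" and H: "\<forall>row\<in>set H. fst row \<le> b" and G: "\<forall>row\<in>set ?G. b < fst row"
    by (rule diagram_split)
  have nth: "?D ! r = ?G ! r" using r by (simp add: D nth_append)
  have long: "b < fst (?D ! s) \<longleftrightarrow> s < length ?G" if "s < length ?D" for s
  proof (cases "s < length ?G")
    case True
    thus ?thesis using G nth_mem by (auto simp: D nth_append)
  next
    case False
    hence "?D ! s \<in> set H" using that by (auto simp: D nth_append)
    thus ?thesis using H False by (auto simp: not_less)
  qed
  have "{s. r < s \<and> (s, b) \<in> squares ?D} = {Suc r..<length ?G}"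
    using long by (auto simp: squares_def row_len_def D)
  hence sq: "card {s. r < s \<and> (s, b) \<in> squares ?D} = length ?G - Suc r" by simp
  have "circles_below ?D (r, b) = {k. (b, Some k) \<in> set ?D}"
  proof (intro equalityI subsetI)
    fix k assume "k \<in> circles_below ?D (r, b)"
    then obtain s where "s < length ?D" "fst (?D ! s) = b" "snd (?D ! s) = Some k"
      by (auto simp: circles_below_def row_len_def row_circle_def)
    hence "?D ! s = (b, Some k)" "?D ! s \<in> set ?D" by (auto simp: prod_eq_iff)
    thus "k \<in> {k. (b, Some k) \<in> set ?D}" by simp
  next
    fix k assume "k \<in> {k. (b, Some k) \<in> set ?D}"
    then obtain s where s: "s < length ?D" "?D ! s = (b, Some k)" by (auto simp: in_set_conv_nth)
    hence "r < s" using long[of s] r by simp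
    thus "k \<in> circles_below ?D (r, b)" using s by (auto simp: circles_below_def row_len_def row_circle_def)
  qed
  also have "\<dots> = {i \<in> {1..length a}. a ! (i - 1) = b}"
    by (auto simp: diagram_eq circled_rows_def)
  also have "\<dots> = Suc ` {i. i < length a \<and> a ! i = b}"
    by (rule Collect_shift_Suc[where P = "\<lambda>i. a ! i = b"])
  finally have circ: "card (circles_below ?D (r, b)) = length (filter (\<lambda>y. y = b) a)"
    by (simp add: card_image length_filter_conv_card)
  show "leg_tilde ?D (r, b) = length ?G - Suc r + length (filter (\<lambda>y. y = b) a)"
    using r nth sq circ by (simp add: leg_tilde_def leg_def row_circle_def)
  have "b < fst (?G ! r)" using G r nth_mem by blast
  thus "Suc (arm ?D (r, b)) = fst (?G ! r) - b"
    using r nth by (simp add: arm_def row_len_def row_circle_def)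
qed

lemma col_squares_eq:
  "col_squares (a @ [b], lam) =
     (\<lambda>r. (r, b)) ` {r. r < length (long_rows b (a @ [b]) lam) \<and> snd (long_rows b (a @ [b]) lam ! r) = None}"
proof -
  let ?G = "long_rows b (a @ [b]) lam" and ?D = "diagram (a @ [b], lam)"
  obtain H where D: "?D = ?G @ H" and H: "\<forall>row\<in>set H. fst row \<le> b" and G: "\<forall>row\<in>set ?G. b < fst row"
    by (rule diagram_split)
  have ex: "(\<exists>s<length ?D. snd (?D ! s) = Some (Suc (length a)) \<and> fst (?D ! s) = c) \<longleftrightarrow> c = b" for c
  proof -
    have "(\<exists>s<length ?D. snd (?D ! s) = Some (Suc (length a)) \<and> fst (?D ! s) = c) \<longleftrightarrow>
        (c, Some (Suc (length a))) \<in> set ?D"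
    proof
      assume "\<exists>s<length ?D. snd (?D ! s) = Some (Suc (length a)) \<and> fst (?D ! s) = c"
      then obtain s where s: "s < length ?D" "?D ! s = (c, Some (Suc (length a)))" by (auto simp: prod_eq_iff)
      thus "(c, Some (Suc (length a))) \<in> set ?D" using nth_mem[OF s(1)] by simp
    next
      assume "(c, Some (Suc (length a))) \<in> set ?D"
      then obtain s where s: "s < length ?D" "?D ! s = (c, Some (Suc (length a)))"
        unfolding in_set_conv_nth by blast
      thus "\<exists>s<length ?D. snd (?D ! s) = Some (Suc (length a)) \<and> fst (?D ! s) = c"
        by (intro exI[of _ s]) simp
    qed
    also have "\<dots> \<longleftrightarrow> c = b" by (auto simp: diagram_eq circled_rows_snoc) (auto simp: circled_rows_def)
    finally show ?thesis .
  qed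
  have long: "s < length ?D \<and> b < fst (?D ! s) \<longleftrightarrow> s < length ?G" for s
  proof (cases "s < length ?G")
    case True
    thus ?thesis using G nth_mem by (auto simp: D nth_append)
  next
    case False
    have "\<not> (s < length ?D \<and> b < fst (?D ! s))"
    proof
      assume s: "s < length ?D \<and> b < fst (?D ! s)"
      hence "?D ! s \<in> set H" using False by (auto simp: D nth_append)
      thus False using H s by (metis not_less)
    qed
    thus ?thesis using False by blast
  qed
  have "col_squares (a @ [b], lam) = {(r, c). c = b \<and> r < length ?D \<and> b < fst (?D ! r) \<and> snd (?D ! r) = None}"
    using ex by (auto simp: col_squares_def squares_def row_len_def row_circle_def)
  also have "\<dots> = (\<lambda>r. (r, b)) ` {r. r < length ?D \<and> b < fst (?D ! r) \<and> snd (?D ! r) = None}"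
    by (auto simp: image_iff)
  also have "{r. r < length ?D \<and> b < fst (?D ! r) \<and> snd (?D ! r) = None} = {r. r < length ?G \<and> snd (?G ! r) = None}"
  proof -
    have nth: "?D ! r = ?G ! r" if "r < length ?G" for r using that by (simp add: D nth_append)
    have "r < length ?D \<and> b < fst (?D ! r) \<and> snd (?D ! r) = None \<longleftrightarrow> r < length ?G \<and> snd (?G ! r) = None" for r
      using long[of r] nth[of r] by metis
    thus ?thesis by (intro Collect_cong)
  qed
  finally show ?thesis .
qed

text \<open>The leg counts all long rows below, whereas \<open>branch_coeff\<close> runs over the
  parts of the partition alone. Here \<open>cnt x\<close> stands for the number of circled rows
  below a symmetric row of length \<open>x\<close>, and the two counts are matched row by
  row.\<close>

lemma prod_uncircled_rows:
  assumes "\<And>G1 x G2. G = G1 @ (x, None) # G2 \<Longrightarrow> length (filter (\<lambda>row. snd row \<noteq> None) G2) = cnt x"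
  defines "S \<equiv> map fst (filter (\<lambda>row. snd row = None) G)"
  shows "(\<Prod>r | r < length G \<and> snd (G ! r) = None. F (fst (G ! r)) (length G - Suc r)) =
    (\<Prod>k<length S. F (S ! k) (cnt (S ! k) + (length S - Suc k)))"
proof -
  have "(\<Prod>r | r < length G \<and> snd (G ! r) = None. F (fst (G ! r)) (length G - Suc r)) =
      (\<Prod>r<length G. if snd (G ! r) = None then F (fst (G ! r)) (length G - Suc r) else 1)"
    by (simp add: prod.If_cases) (rule prod.cong, auto)
  also have "\<dots> = (\<Prod>k<length S. F (S ! k) (cnt (S ! k) + (length S - Suc k)))"
    unfolding S_def using assms(1)
  proof (induction G)
    case (Cons row G)
    let ?S = "map fst (filter (\<lambda>row. snd row = None) G)"
    have IH: "(\<Prod>r<length G. if snd (G ! r) = None then F (fst (G ! r)) (length G - Suc r) else 1) =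
        (\<Prod>k<length ?S. F (?S ! k) (cnt (?S ! k) + (length ?S - Suc k)))"
    proof (rule Cons.IH)
      fix G1 x G2 assume "G = G1 @ (x, None) # G2"
      thus "length (filter (\<lambda>row. snd row \<noteq> None) G2) = cnt x"
        using Cons.prems[of "row # G1" x G2] by simp
    qed
    have l: "(\<Prod>r<length (row # G). if snd ((row # G) ! r) = None
          then F (fst ((row # G) ! r)) (length (row # G) - Suc r) else 1) =
        (if snd row = None then F (fst row) (length G) else 1) *
        (\<Prod>r<length G. if snd (G ! r) = None then F (fst (G ! r)) (length G - Suc r) else 1)"
      by (simp only: length_Cons prod.lessThan_Suc_shift nth_Cons_0 nth_Cons_Suc diff_Suc_Suc diff_zero)
    show ?case
    proof (cases "snd row = None")
      case True
      then obtain x where row: "row = (x, None)" by (cases row) auto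
      have "length (filter (\<lambda>row. snd row \<noteq> None) G) = cnt x"
        using Cons.prems[of "[]" x G] by (simp add: row)
      hence len: "length G = cnt x + length ?S"
        using sum_length_filter_compl[of "\<lambda>row. snd row \<noteq> None" G] by simp
      have S: "map fst (filter (\<lambda>row. snd row = None) (row # G)) = x # ?S" by (simp add: row)
      have r: "(\<Prod>k<length (x # ?S). F ((x # ?S) ! k) (cnt ((x # ?S) ! k) + (length (x # ?S) - Suc k))) =
          F x (cnt x + length ?S) * (\<Prod>k<length ?S. F (?S ! k) (cnt (?S ! k) + (length ?S - Suc k)))"
        by (simp only: length_Cons prod.lessThan_Suc_shift nth_Cons_0 nth_Cons_Suc diff_Suc_Suc diff_zero)
      have h: "(if snd row = None then F (fst row) (length G) else 1) = F x (cnt x + length ?S)"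
        using len by (simp add: row)
      show ?thesis unfolding l S r IH h ..
    next
      case False
      have S: "map fst (filter (\<lambda>row. snd row = None) (row # G)) = ?S" using False by simp
      have h: "(if snd row = None then F (fst row) (length G) else 1) = 1" using False by (rule if_not_P)
      show ?thesis unfolding l S IH h mult_1 ..
    qed
  qed simp
  finally show ?thesis .
qed

lemma append_split_suffix:
  assumes "Y @ e # Z = C @ S" "e \<notin> set C"
  shows "set Z \<subseteq> set S"
  using assms
proof (induction C arbitrary: Y)
  case Nil
  have "set Z \<subseteq> set (Y @ e # Z)" by auto
  thus ?case using Nil by simp
next
  case (Cons c C)
  thus ?case by (cases Y) auto
qed

text \<open>Among rows of equal length the stable sort keeps the circled ones on top, so the circled
  rows below a symmetric row are exactly the strictly shorter ones.\<close>

lemma circled_rows_after: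
  fixes C :: diagram
  assumes \<kappa>: "sorted_wrt (\<ge>) \<kappa>" and C: "\<forall>row\<in>set C. snd row \<noteq> None"
    and G: "sort_key (\<lambda>row. - int (fst row)) (C @ map (\<lambda>b. (b, None)) \<kappa>) = G1 @ (x, None) # G2"
  shows "length (filter (\<lambda>row. snd row \<noteq> None) G2) = length (filter (\<lambda>row. fst row < x) C)"
proof -
  let ?f = "\<lambda>row :: nat \<times> nat option. - int (fst row)" and ?S = "map (\<lambda>b. (b, None :: nat option)) \<kappa>"
  let ?G = "G1 @ (x, None) # G2"
  have "sorted (map ?f ?G)" unfolding G[symmetric] by (rule sorted_sort_key)
  hence G1: "\<forall>row\<in>set G1. x \<le> fst row" and G2: "\<forall>row\<in>set G2. fst row \<le> x"
    by (auto simp: sorted_append)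
  have "filter (\<lambda>row. ?f row = - int x) ?G = filter (\<lambda>row. ?f row = - int x) (C @ ?S)"
    unfolding G[symmetric] by (rule sort_key_stable)
  hence "filter (\<lambda>row. fst row = x) G1 @ (x, None) # filter (\<lambda>row. fst row = x) G2 =
      filter (\<lambda>row. fst row = x) C @ filter (\<lambda>row. fst row = x) ?S"
    by simp
  hence "set (filter (\<lambda>row. fst row = x) G2) \<subseteq> set (filter (\<lambda>row. fst row = x) ?S)"
    by (rule append_split_suffix) (use C in auto)
  hence eq: "snd row = None" if "row \<in> set G2" "fst row = x" for row
    using that by auto
  have "filter (\<lambda>row. snd row \<noteq> None) G2 = filter (\<lambda>row. snd row \<noteq> None \<and> fst row < x) G2"
  proof (rule filter_cong[OF refl])
    fix row assume "row \<in> set G2"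
    thus "snd row \<noteq> None \<longleftrightarrow> snd row \<noteq> None \<and> fst row < x"
      using eq[of row] G2 by (metis le_neq_implies_less)
  qed
  also have "\<dots> = filter (\<lambda>row. snd row \<noteq> None \<and> fst row < x) ?G"
  proof -
    have "filter (\<lambda>row. snd row \<noteq> None \<and> fst row < x) G1 = []"
      using G1 by (auto simp: filter_empty_conv not_less)
    thus ?thesis by simp
  qed
  finally have f: "filter (\<lambda>row. snd row \<noteq> None) G2 = filter (\<lambda>row. snd row \<noteq> None \<and> fst row < x) ?G" .
  have "length (filter (\<lambda>row. snd row \<noteq> None) G2) =
      size (filter_mset (\<lambda>row. snd row \<noteq> None \<and> fst row < x) (mset ?G))"
    unfolding f mset_filter[symmetric] size_mset ..
  also have "mset ?G = mset (C @ ?S)" unfolding G[symmetric] by simp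
  also have "size (filter_mset (\<lambda>row. snd row \<noteq> None \<and> fst row < x) (mset (C @ ?S))) =
      length (filter (\<lambda>row. snd row \<noteq> None \<and> fst row < x) (C @ ?S))"
    unfolding mset_filter[symmetric] size_mset ..
  also have "filter (\<lambda>row. snd row \<noteq> None \<and> fst row < x) (C @ ?S) = filter (\<lambda>row. fst row < x) C"
  proof -
    have "filter (\<lambda>row. snd row \<noteq> None \<and> fst row < x) ?S = []" by (auto simp: filter_empty_conv)
    moreover have "filter (\<lambda>row. snd row \<noteq> None \<and> fst row < x) C = filter (\<lambda>row. fst row < x) C"
      by (rule filter_cong[OF refl]) (use C in auto)
    ultimately show ?thesis by simp
  qed
  finally show ?thesis .
qed

text \<open>Circles enter the exponent of t in two ways: those ending rows of length
  \<open>b\<close> through the modified leg, those ending longer rows further down through the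
  squares of these rows in the column. Together they make up \<open>between\<close>.\<close>

lemma psi_eq_branch_coeff:
  assumes lam: "sorted_wrt (\<ge>) lam"
  shows "psi (a @ [b], remove1 b lam) (a, lam) = branch_coeff a lam b"
proof -
  let ?G = "long_rows b a lam"
  define \<kappa> where "\<kappa> = filter (\<lambda>y. b < y) lam"
  define n where "n = length (filter (\<lambda>y. y = b) a)"
  define F where "F x l = (1 - qvar ^ (x - b) * tvar ^ (n + l)) / (1 - qvar ^ (x - b) * tvar ^ (n + l + 1))" for x l :: nat
  define C where "C = filter (\<lambda>row. b < fst row) (circled_rows a)"
  define cnt where "cnt x = length (filter (\<lambda>y. b < y \<and> y < x) a)" for x
  have \<kappa>: "sorted_wrt (\<ge>) \<kappa>" unfolding \<kappa>_def using lam by (rule sorted_wrt_filter)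
  have G: "?G = sort_key (\<lambda>row. - int (fst row)) (C @ map (\<lambda>b. (b, None)) \<kappa>)"
    by (simp add: long_rows_def C_def \<kappa>_def filter_map o_def)
  have C: "\<forall>row\<in>set C. snd row \<noteq> None" using circled_rows_not_None by (auto simp: C_def)
  have "psi (a @ [b], remove1 b lam) (a, lam) =
      (\<Prod>r | r < length ?G \<and> snd (?G ! r) = None. F (fst (?G ! r)) (length ?G - Suc r))"
    unfolding psi_def col_squares_eq long_rows_add_circle
  proof (subst prod.reindex, force simp: inj_on_def, rule prod.cong[OF refl])
    fix r assume "r \<in> {r. r < length ?G \<and> snd (?G ! r) = None}"
    hence r: "r < length ?G" "snd (?G ! r) = None" by auto
    note l1 = long_rows_leg_tilde[OF r]
    note l2 = long_rows_leg_tilde[of r b "a @ [b]" "remove1 b lam", unfolded long_rows_add_circle, OF r]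
    show "((\<lambda>s. (1 - qvar ^ (arm (diagram (a, lam)) s + 1) * tvar ^ leg_tilde (diagram (a, lam)) s) /
        (1 - qvar ^ (arm (diagram (a @ [b], remove1 b lam)) s + 1) *
           tvar ^ leg_tilde (diagram (a @ [b], remove1 b lam)) s)) \<circ> (\<lambda>r. (r, b))) r =
        F (fst (?G ! r)) (length ?G - Suc r)"
      unfolding o_apply Suc_eq_plus1[symmetric] l1 l2 by (simp add: F_def n_def add_ac)
  qed
  also have "\<dots> = (\<Prod>k<length \<kappa>. F (\<kappa> ! k) (cnt (\<kappa> ! k) + (length \<kappa> - Suc k)))"
  proof -
    have S: "map fst (filter (\<lambda>row. snd row = None) ?G) = \<kappa>"
    proof -
      have "filter (\<lambda>row. snd row = None) ?G =
          sort_key (\<lambda>row. - int (fst row)) (filter (\<lambda>row. snd row = None) (C @ map (\<lambda>b. (b, None)) \<kappa>))"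
        unfolding G by (rule filter_sort)
      also have "filter (\<lambda>row. snd row = None) (C @ map (\<lambda>b. (b, None)) \<kappa>) = map (\<lambda>b. (b, None)) \<kappa>"
        using C by (auto simp: filter_empty_conv filter_map o_def)
      also have "sort_key (\<lambda>row. - int (fst row)) (map (\<lambda>b. (b, None :: nat option)) \<kappa>) = map (\<lambda>b. (b, None)) \<kappa>"
      proof (rule sort_key_id_if_sorted)
        show "sorted (map (\<lambda>row. - int (fst row)) (map (\<lambda>b. (b, None :: nat option)) \<kappa>))"
          using \<kappa> by (simp add: sorted_wrt_map o_def)
      qed
      finally show ?thesis by (simp add: o_def)
    qed
    have "length (filter (\<lambda>row. snd row \<noteq> None) G2) = cnt x" if "?G = G1 @ (x, None) # G2" for G1 x G2
    proof -
      have "length (filter (\<lambda>row. snd row \<noteq> None) G2) = length (filter (\<lambda>row. fst row < x) C)"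
        using circled_rows_after[OF \<kappa> C] that unfolding G by blast
      also have "\<dots> = length (filter (\<lambda>y. b < y \<and> y < x) (map fst (circled_rows a)))"
        by (simp add: C_def filter_map o_def)
      finally show ?thesis by (simp add: cnt_def map_fst_circled_rows)
    qed
    from prod_uncircled_rows[of ?G cnt F, OF this] show ?thesis unfolding S .
  qed
  also have "\<dots> = branch_coeff a lam b"
    unfolding branch_coeff_def Let_def \<kappa>_def[symmetric]
  proof (rule prod.cong[OF refl])
    fix k assume "k \<in> {..<length \<kappa>}"
    hence "\<kappa> ! k \<in> set \<kappa>" by simp
    hence "b < \<kappa> ! k" by (simp add: \<kappa>_def)
    hence "between a b (\<kappa> ! k) = n + cnt (\<kappa> ! k)"
      unfolding between_def n_def cnt_def by (induction a) auto
    thus "F (\<kappa> ! k) (cnt (\<kappa> ! k) + (length \<kappa> - Suc k)) = branch_factor a b (\<kappa> ! k) (length \<kappa> - Suc k)"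
      by (simp add: F_def branch_factor_def add.assoc)
  qed
  finally show ?thesis .
qed

theorem theorem6:
  fixes m :: nat and \<Lambda> :: mpart
  assumes "m_partition m \<Lambda>"
  shows "P_inf \<Lambda> = (\<lambda>\<alpha>. \<Sum>\<Omega>\<in>add_circle \<Lambda>. psi \<Omega> \<Lambda> * P_inf \<Omega> \<alpha>)"
proof
  fix \<alpha>
  obtain a lam where \<Lambda>: "\<Lambda> = (a, lam)" by (cases \<Lambda>)
  have m: "length a = m" and lam: "sorted_wrt (\<ge>) lam" "0 \<notin> set lam"
    using assms by (auto simp: \<Lambda> m_partition_def)
  let ?B = "insert 0 (set lam)" and ?\<Omega> = "\<lambda>b. (a @ [b], remove1 b lam)"
  have \<Omega>: "m_partition (Suc m) (?\<Omega> b)" for b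
    using lam m set_remove1_subset[of b lam] sorted_wrt_remove1[OF lam(1)] by (auto simp: m_partition_def)
  have "add_circle \<Lambda> = ?\<Omega> ` ?B" by (auto simp: \<Lambda> add_circle_def)
  hence "(\<Sum>\<Omega>\<in>add_circle \<Lambda>. psi \<Omega> \<Lambda> * P_inf \<Omega> \<alpha>) = (\<Sum>b\<in>?B. psi (?\<Omega> b) \<Lambda> * P_inf (?\<Omega> b) \<alpha>)"
    by (simp only:) (subst sum.reindex, auto simp: inj_on_def)
  also have "\<dots> = (\<Sum>b\<in>?B. branch_coeff a lam b * P_inf (?\<Omega> b) \<alpha>)"
    by (rule sum.cong[OF refl]) (simp only: \<Lambda> psi_eq_branch_coeff[OF lam(1)])
  also have "\<dots> = P_inf \<Lambda> \<alpha>"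
  proof (cases "0 \<in> Poly_Mapping.keys \<alpha>")
    case True
    thus ?thesis using P_inf_lookup(2)[OF assms True] P_inf_lookup(2)[OF \<Omega> True] by simp
  next
    case False
    \<comment> \<open>Large enough for all variables of \<open>\<alpha>\<close>, and beyond
      \<open>length a + length lam\<close> as \<open>P_fin_branch\<close> requires.\<close>
    define N where "N = Suc (length a + length lam) + Max (insert 0 (Poly_Mapping.keys \<alpha>))"
    have \<alpha>: "Poly_Mapping.keys \<alpha> \<subseteq> {1..N}"
    proof
      fix k assume k: "k \<in> Poly_Mapping.keys \<alpha>"
      hence "k \<le> Max (insert 0 (Poly_Mapping.keys \<alpha>))" by (intro Max_ge) auto
      moreover have "k \<noteq> 0" using k False by metis
      ultimately show "k \<in> {1..N}" by (simp add: N_def)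
    qed
    have "P_inf \<Lambda> \<alpha> = Poly_Mapping.lookup (P_fin (a, lam) N) \<alpha>"
      using P_inf_lookup(1)[OF assms _ \<alpha>] m by (simp add: \<Lambda> N_def)
    also have "\<dots> = (\<Sum>b\<in>?B. branch_coeff a lam b * Poly_Mapping.lookup (P_fin (?\<Omega> b) N) \<alpha>)"
    proof -
      have "length a + length lam < N" by (simp add: N_def)
      from P_fin_branch[OF lam this] show ?thesis by (simp only: lookup_sum lookup_const_mult)
    qed
    also have "\<dots> = (\<Sum>b\<in>?B. branch_coeff a lam b * P_inf (?\<Omega> b) \<alpha>)"
      using P_inf_lookup(1)[OF \<Omega> _ \<alpha>] m by (intro sum.cong refl) (simp add: N_def)
    finally show ?thesis by simp
  qed
  finally show "P_inf \<Lambda> \<alpha> = (\<Sum>\<Omega>\<in>add_circle \<Lambda>. psi \<Omega> \<Lambda> * P_inf \<Omega> \<alpha>)" by simp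
qed

end
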